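(* There is an algorithm (called IsOfFiniteIndex) which, given a number field $\mathbb{P}$, a positive integer $n$, and finite subsets $\mathcal{S}_1,\mathcal{S}_2$ of $\mathrm{GL}(n,\mathbb{P})$ such that $G=\langle\mathcal{S}_1\rangle$ is solvable-by-finite and $H=\langle\mathcal{S}_2\rangle\leq G$, returns true if $|G:H|$ is finite and returns false otherwise.
   Context: A group is solvable-by-finite if it has a solvable normal subgroup of finite index. The number field is given explicitly as $\mathbb{P}=\mathbb{Q}(\alpha)$ by the minimal polynomial of $\alpha$ over $\mathbb{Q}$, and the matrices in $\mathcal{S}_1,\mathcal{S}_2$ are given explicitly by their entries. *)

theory Defs
  imports
    "HOL-Library.Nat_Bijection"
    "HOL-Computational_Algebra.Polynomial"
    "HOL-Algebra.Generated_Groups"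
    "HOL-Algebra.Generated_Fields"
    "HOL-Algebra.Solvable_Groups"
    "Jordan_Normal_Form.Matrix"
    "Jordan_Normal_Form.VS_Connect"
begin

section \<open>Algorithms\<close>

text \<open>
  An algorithm is a program for a partial recursive (mu-recursive) function. Programs are finite
  syntactic objects; \<open>computes p xs y\<close> says that the program \<open>p\<close> halts on the argument list
  \<open>xs\<close> with output \<open>y\<close>. A program need not halt on every input.
\<close>

datatype prog =
    Zero
  | Succ
  | Proj nat
  | Comp prog "prog list"
  | PrimRec prog prog
  | Mu prog

inductive computes :: "prog \<Rightarrow> nat list \<Rightarrow> nat \<Rightarrow> bool" where
  zero: "computes Zero xs 0"
| succ: "computes Succ [x] (Suc x)"
| proj: "i < length xs \<Longrightarrow> computes (Proj i) xs (xs ! i)"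
| comp: "length ys = length gs \<Longrightarrow>
         \<forall>i<length gs. computes (gs ! i) xs (ys ! i) \<Longrightarrow>
         computes f ys z \<Longrightarrow> computes (Comp f gs) xs z"
| prim_0: "computes f xs y \<Longrightarrow> computes (PrimRec f g) (0 # xs) y"
| prim_Suc: "computes (PrimRec f g) (k # xs) r \<Longrightarrow> computes g (k # r # xs) y \<Longrightarrow>
             computes (PrimRec f g) (Suc k # xs) y"
| mu: "computes f (k # xs) 0 \<Longrightarrow>
       \<forall>i<k. \<exists>y>0. computes f (i # xs) y \<Longrightarrow> computes (Mu f) xs k"

lemma computes_deterministic:
  assumes "computes p xs y" "computes p xs z"
  shows "y = z"
  using assms
proof (induction arbitrary: z rule: computes.induct)
  case (zero xs)
  then show ?case by (auto elim: computes.cases)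
next
  case (succ x)
  then show ?case by (auto elim: computes.cases)
next
  case (proj i xs)
  from proj(2) show ?case by (cases rule: computes.cases) auto
next
  case (comp ys gs xs f z')
  from comp.prems obtain ys' where
    ys': "length ys' = length gs" "\<forall>i<length gs. computes (gs ! i) xs (ys' ! i)"
    "computes f ys' z"
    by (cases rule: computes.cases) auto
  have "ys = ys'"
    using comp.hyps(1) comp.IH(1) ys' by (intro nth_equalityI) auto
  with comp.IH(2) ys'(3) show ?case by simp
next
  case (prim_0 f xs y g)
  from prim_0.prems prim_0.IH show ?case by (cases rule: computes.cases) auto
next
  case (prim_Suc f g k xs r y)
  from prim_Suc.prems obtain r' where
    "computes (PrimRec f g) (k # xs) r'" "computes g (k # r' # xs) z"
    by (cases rule: computes.cases) auto
  with prim_Suc.IH show ?case by blast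
next
  case (mu f k xs)
  from mu.prems have z: "computes f (z # xs) 0" "\<forall>i<z. \<exists>y>0. computes f (i # xs) y"
    by (cases rule: computes.cases; auto)+
  show ?case
  proof (rule linorder_cases[of k z])
    assume "k < z"
    with z(2) obtain y where "y > 0" "computes f (k # xs) y" by blast
    with mu.IH(1) show ?thesis by auto
  next
    assume "z < k"
    with mu.IH(2) z(1) show ?thesis by blast
  qed
qed

section \<open>Number fields and matrix groups\<close>

definition eval_at :: "complex \<Rightarrow> rat poly \<Rightarrow> complex" where
  "eval_at \<alpha> g = poly (map_poly of_rat g) \<alpha>"

definition minimal_polynomial :: "rat poly \<Rightarrow> complex \<Rightarrow> bool" where
  "minimal_polynomial f \<alpha> \<longleftrightarrow>
     lead_coeff f = 1 \<and> eval_at \<alpha> f = 0 \<and>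
     (\<forall>g. g \<noteq> 0 \<and> eval_at \<alpha> g = 0 \<longrightarrow> degree f \<le> degree g)"

text \<open>
  Every number field embeds into the complex numbers, so number fields are taken to be the subfields
  \<open>\<rat>(\<alpha>)\<close> with \<open>\<alpha>\<close> algebraic. Since the prime field is contained in every subfield,
  \<open>\<rat>(\<alpha>)\<close> is the subfield generated by \<open>\<alpha>\<close> alone.
\<close>

definition rat_adjoin :: "complex \<Rightarrow> complex set" where
  "rat_adjoin \<alpha> = generate_field class_ring {\<alpha>}"

definition GL :: "nat \<Rightarrow> complex set \<Rightarrow> complex mat monoid" where
  "GL n P = units_of
     \<lparr>carrier = {A \<in> carrier_mat n n. elements_mat A \<subseteq> P}, mult = (*), one = 1\<^sub>m n\<rparr>"

definition finite_index :: "('a, 'b) monoid_scheme \<Rightarrow> 'a set \<Rightarrow> bool" where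
  "finite_index G H \<longleftrightarrow> finite (rcosets\<^bsub>G\<^esub> H)"

definition solvable_by_finite :: "('a, 'b) monoid_scheme \<Rightarrow> bool" where
  "solvable_by_finite G \<longleftrightarrow>
     (\<exists>N. N \<lhd> G \<and> solvable (G\<lparr>carrier := N\<rparr>) \<and> finite_index G N)"

section \<open>Encoding of the input\<close>

text \<open>
  An element of \<open>\<rat>(\<alpha>)\<close> is given by its coordinates with respect to the powers of \<open>\<alpha>\<close> below
  the degree of the minimal polynomial \<open>f\<close>, that is, by a rational polynomial of degree less than
  that of \<open>f\<close>. A finite set of matrices is given by a list enumerating it, in any order and
  possibly with repetitions.
\<close>

definition presents :: "complex \<Rightarrow> rat poly \<Rightarrow> rat poly mat list \<Rightarrow> complex mat set \<Rightarrow> bool" where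
  "presents \<alpha> f L S \<longleftrightarrow>
     (\<forall>A \<in> set L. \<forall>g \<in> elements_mat A. degree g < degree f) \<and>
     S = map_mat (eval_at \<alpha>) ` set L"

definition rat_code :: "rat \<Rightarrow> nat" where
  "rat_code q = prod_encode (map_prod int_encode int_encode (quotient_of q))"

definition poly_code :: "rat poly \<Rightarrow> nat" where
  "poly_code g = list_encode (map rat_code (coeffs g))"

definition mat_code :: "rat poly mat \<Rightarrow> nat" where
  "mat_code A = list_encode (map (list_encode \<circ> map poly_code) (mat_to_list A))"

definition mats_code :: "rat poly mat list \<Rightarrow> nat" where
  "mats_code L = list_encode (map mat_code L)"

end

(* Matrices over the number field act on a rational vector space, so G and H may be taken in GL(N,Q). It suffices
   that finiteness and infiniteness of |G:H| are both recursively enumerable. Finiteness is certified by a finite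
   list of coset representatives. Suppose that |G:H| is infinite. By Malcev's theorem a subgroup of finite index in
   G is triangular over the complex numbers. Either some g in G has eigenvalue characters multiplicatively
   independent of those of H, or, for the unipotent parts U of G and V of H, the index |U:V| is infinite and some
   polynomial vanishes on V but not on U. The first case has a finite certificate because a relation between
   eigenvalues of bounded height, if there is one, can be taken short: approximate its exponents by Dirichlet and
   use that there are only finitely many characteristic polynomials of bounded size. In the second case polynomials
   of bounded degree on a unipotent group are controlled by finitely many of its elements. *)

theory Submission
  imports Defs "HOL-Library.Function_Algebras" "HOL-Computational_Algebra.Fundamental_Theorem_Algebra"
    "Jordan_Normal_Form.Char_Poly"
begin


section \<open>Groups given by a type class\<close>

text \<open>The unipotent part of a finitely generated triangular group need not be finitely
  generated: diag(2, 1) and one elementary matrix already produce the dyadic rationals. So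
  generators of U and V cannot be computed and compared, and a certificate reaches V only through
  the normal closure of finitely many elements and through evaluations of polynomials, which span a
  space of finite dimension. Nor can the complex triangular basis be handed over as rational data; a
  certificate contains a nilpotent space of rational matrices from which such a basis follows, and
  relations between eigenvalues are tested by asking whether a word is unipotent. For finitely many
  such tests to exclude all relations, the height bound must be computable from the entries of the
  generators, namely from a common denominator d and a bound C on row sums. Modulo unipotents a
  finitely generated triangular group is abelian of finite rank, and the two cases compare these
  ranks for G and H. If they agree, infinite index comes from the unipotent parts, where nilpotency
  makes it visible modulo the commutator subgroup of U.\<close>

class grp = monoid_mult +
 fixes iv :: "'a => 'a"
 assumes iv_left [simp]: "iv a * a = 1"
begin

lemma iv_left_cancel [simp]: "iv a * (a * b) = b"
 by (metis iv_left mult_assoc mult_1_left)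

lemma iv_right [simp]: "a * iv a = 1"
 by (metis iv_left iv_left_cancel mult_1_right)

lemma iv_right_cancel [simp]: "a * (iv a * b) = b"
 by (metis iv_right mult_assoc mult_1_left)

lemma iv_unique: "a * b = 1 ==> iv a = b"
 by (metis iv_left_cancel mult_1_right)

lemma iv_iv [simp]: "iv (iv a) = a"
 by (simp add: iv_unique)

lemma iv_one [simp]: "iv 1 = 1"
 by (simp add: iv_unique)

lemma iv_mult [simp]: "iv (a * b) = iv b * iv a"
 by (rule iv_unique) (simp add: mult_assoc)

lemma iv_power: "iv (a ^ n) = iv a ^ n"
proof (induction n)
 case (Suc n)
 thus ?case by (metis iv_mult power_Suc power_Suc2)
qed simp

definition zp :: "'a => int => 'a" where
 "zp x n = (if n >= 0 then x ^ nat n else iv x ^ nat (- n))"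

lemma zp_0 [simp]: "zp x 0 = 1"
 and zp_1 [simp]: "zp x 1 = x"
 and zp_m1 [simp]: "zp x (- 1) = iv x"
 by (simp_all add: zp_def)

lemma zp_of_nat [simp]: "zp x (int n) = x ^ n"
 by (simp add: zp_def)

lemma zp_succ: "zp x (n + 1) = zp x n * x"
proof (cases "n >= 0")
 case True
 hence "nat (n + 1) = Suc (nat n)" by simp
 thus ?thesis using True by (simp add: zp_def power_Suc2 del: power_Suc)
next
 case False
 then obtain m where m: "n = - int (Suc m)" using negD[of n] by auto
 have neg: "zp x (- int k) = iv x ^ k" for k by (cases k) (auto simp: zp_def nat_add_distrib)
 show ?thesis
  using neg[of m] neg[of "Suc m"] by (simp only: m) (simp add: power_Suc2 mult_assoc del: power_Suc)
qed

lemma zp_pred: "zp x (n - 1) = zp x n * iv x"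
 using zp_succ[of x "n - 1"] by (simp add: mult_assoc)

lemma zp_add: "zp x (m + n) = zp x m * zp x n"
proof (induction n rule: int_induct[where k = 0])
 case (step1 i)
 thus ?case using zp_succ[of x "m + i"] zp_succ[of x i] by (simp add: mult_assoc add.assoc)
next
 case (step2 i)
 thus ?case using zp_pred[of x "m + i"] zp_pred[of x i]
  by (simp add: mult_assoc add_diff_eq)
qed simp

lemma zp_minus: "zp x (- n) = iv (zp x n)"
 using zp_add[of x n "- n"] by (metis iv_unique add.right_inverse zp_0)

section \<open>Subgroups and generation\<close>

definition sg :: "'a set => bool" where
 "sg H \<longleftrightarrow> 1 \<in> H & (\<forall>x\<in>H. \<forall>y\<in>H. x * y \<in> H) & (\<forall>x\<in>H. iv x \<in> H)"

lemma sg_one: "sg H ==> 1 \<in> H"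
 and sg_mult: "sg H ==> x \<in> H ==> y \<in> H ==> x * y \<in> H"
 and sg_iv: "sg H ==> x \<in> H ==> iv x \<in> H"
 by (auto simp: sg_def)

lemma sgI: "1 \<in> H ==> (!!x y. x \<in> H ==> y \<in> H ==> x * y \<in> H) ==> (!!x. x \<in> H ==> iv x \<in> H) ==> sg H"
 by (auto simp: sg_def)

lemma sg_iv_iff: "sg H ==> iv x \<in> H \<longleftrightarrow> x \<in> H"
 using sg_iv[of H x] sg_iv[of H "iv x"] by auto

lemma sg_mult_left_iff: "sg H ==> x \<in> H ==> x * y \<in> H \<longleftrightarrow> y \<in> H"
 by (metis sg_mult sg_iv iv_left_cancel)

lemma sg_mult_right_iff: "sg H ==> x \<in> H ==> y * x \<in> H \<longleftrightarrow> y \<in> H"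
 by (metis sg_mult sg_iv iv_right mult_assoc mult_1_right)

lemma sg_power: "sg H ==> x \<in> H ==> x ^ n \<in> H"
 by (induction n) (auto simp: sg_one sg_mult)

lemma sg_zp: "sg H ==> x \<in> H ==> zp x n \<in> H"
 by (auto simp: zp_def sg_power sg_iv)

lemma sg_Int: "sg H ==> sg K ==> sg (H \<inter> K)"
 by (auto simp: sg_def)

lemma sg_diff_sym: "sg H ==> x * iv y \<in> H ==> y * iv x \<in> H"
 using sg_iv[of H "x * iv y"] by simp

lemma sg_diff_trans: "sg H ==> x * iv y \<in> H ==> y * iv z \<in> H ==> x * iv z \<in> H"
 using sg_mult[of H "x * iv y" "y * iv z"] by (simp add: mult_assoc)

text \<open>Extending words on the right by one letter at a time makes every induction on
  \<open>gen\<close> a word induction; closure under products and inverses is derived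
  afterwards.\<close>

inductive_set gen :: "'a set => 'a set" for S where
 one: "1 \<in> gen S"
| mult: "x \<in> gen S ==> s \<in> S ==> x * s \<in> gen S"
| mult_iv: "x \<in> gen S ==> s \<in> S ==> x * iv s \<in> gen S"

lemma gen_least: "sg H ==> S \<subseteq> H ==> gen S \<subseteq> H"
proof
 fix x assume H: "sg H" "S \<subseteq> H" and x: "x \<in> gen S"
 from x show "x \<in> H"
  by induction (use H in \<open>auto simp: sg_one sg_mult sg_iv subset_iff\<close>)
qed

lemma gen_mult: "y \<in> gen S ==> x \<in> gen S ==> x * y \<in> gen S"
 by (induction y rule: gen.induct) (auto simp: mult_assoc[symmetric] intro: gen.intros)

lemma gen_incl: "s \<in> S ==> s \<in> gen S"
 using gen.mult[OF gen.one] by fastforce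

lemma gen_incl_iv: "s \<in> S ==> iv s \<in> gen S"
 using gen.mult_iv[OF gen.one] by fastforce

lemma sg_gen: "sg (gen S)"
proof (rule sgI)
 fix x assume "x \<in> gen S"
 thus "iv x \<in> gen S"
  by induction (auto intro: gen_mult gen_incl gen_incl_iv gen.one)
qed (auto intro: gen.one gen_mult)

lemma gen_mono: "S \<subseteq> T ==> gen S \<subseteq> gen T"
 by (rule gen_least[OF sg_gen]) (auto intro: gen_incl)

lemma gen_sg: "sg H ==> gen H = H"
 using gen_least[of H H] gen_incl[of _ H] by auto

section \<open>Finite index and Schreier's lemma\<close>

text \<open>Neither \<open>R\<close> nor \<open>H\<close> has to lie inside \<open>G\<close>. This
  makes the notion monotone in both arguments and transitive without side conditions;
  representatives inside the group are recovered in \<open>fidx_Int\<close>.\<close>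

definition fidx :: "'a set => 'a set => bool" where
 "fidx G H \<longleftrightarrow> (\<exists>R. finite R & (\<forall>g\<in>G. \<exists>r\<in>R. g * iv r \<in> H))"

lemma fidxI: "finite R ==> (!!g. g \<in> G ==> \<exists>r\<in>R. g * iv r \<in> H) ==> fidx G H"
 by (auto simp: fidx_def)

lemma fidx_refl: "sg G ==> fidx G G"
 by (rule fidxI[of "{1}"]) auto

lemma fidx_mono: "fidx G H ==> G' \<subseteq> G ==> H \<subseteq> H' ==> fidx G' H'"
 unfolding fidx_def by (meson subsetD)

text \<open>A representative \<open>r\<close> is replaced by an element \<open>c r\<close> of
  \<open>G'\<close> in the same coset of \<open>K\<close>; cosets that miss \<open>G'\<close> are
  dropped.\<close>

lemma fidx_Int:
 assumes "sg G'" "sg K" "fidx G K" "G' \<subseteq> G"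
 shows "\<exists>R. finite R & R \<subseteq> G' & (\<forall>g\<in>G'. \<exists>r\<in>R. g * iv r \<in> G' \<inter> K)"
proof -
 obtain R where R: "finite R" "!!g. g \<in> G ==> \<exists>r\<in>R. g * iv r \<in> K"
  using assms(3) by (auto simp: fidx_def)
 define c where "c r = (SOME g. g \<in> G' & g * iv r \<in> K)" for r
 define R' where "R' = c ` {r\<in>R. \<exists>g. g \<in> G' & g * iv r \<in> K}"
 have c: "c r \<in> G' & c r * iv r \<in> K" if "\<exists>g. g \<in> G' & g * iv r \<in> K" for r
  using someI_ex[OF that] by (simp add: c_def)
 have "\<exists>r\<in>R'. g * iv r \<in> G' \<inter> K" if g: "g \<in> G'" for g
 proof -
  obtain r where r: "r \<in> R" "g * iv r \<in> K" using R(2) g assms(4) by blast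
  hence cr: "c r \<in> G'" "c r * iv r \<in> K" using c[of r] g by blast+
  have "g * iv (c r) \<in> K"
   using sg_diff_trans[OF assms(2) r(2) sg_diff_sym[OF assms(2) cr(2)]] .
  thus ?thesis using r g cr assms(1) by (auto simp: R'_def sg_mult sg_iv)
 qed
 moreover have "R' \<subseteq> G'" using c by (auto simp: R'_def)
 moreover have "finite R'" using R(1) by (simp add: R'_def)
 ultimately show ?thesis by blast
qed

lemma fidx_Int': "sg G' ==> sg K ==> fidx G K ==> G' \<subseteq> G ==> fidx G' (G' \<inter> K)"
 by (drule (3) fidx_Int) (auto simp: fidx_def)

lemma fidx_trans:
 assumes "fidx G K" "fidx K H"
 shows "fidx G H"
proof -
 obtain R where R: "finite R" "!!g. g \<in> G ==> \<exists>r\<in>R. g * iv r \<in> K"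
  using assms(1) by (auto simp: fidx_def)
 obtain R' where R': "finite R'" "!!g. g \<in> K ==> \<exists>r\<in>R'. g * iv r \<in> H"
  using assms(2) by (auto simp: fidx_def)
 show ?thesis
 proof (rule fidxI[of "(%(a, b). b * a) ` (R \<times> R')"])
  fix g assume "g \<in> G"
  then obtain r where r: "r \<in> R" "g * iv r \<in> K" using R(2) by blast
  then obtain r' where r': "r' \<in> R'" "g * iv r * iv r' \<in> H" using R'(2) by blast
  thus "\<exists>r\<in>(%(a, b). b * a) ` (R \<times> R'). g * iv r \<in> H"
   using r by (intro bexI[of _ "r' * r"]) (auto simp: mult_assoc)
 qed (use R R' in auto)
qed

lemma fidx_inter:
 assumes "sg G" "sg K1" "sg K2" "K1 \<subseteq> G" "fidx G K1" "fidx G K2"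
 shows "fidx G (K1 \<inter> K2)"
 using fidx_trans[OF assms(5) fidx_Int'[OF assms(2,3,6,4)]] .

lemma fidx_image:
 assumes "finite (f ` G)" "!!g h. g \<in> G ==> h \<in> G ==> f g = f h ==> g * iv h \<in> K"
 shows "fidx G K"
proof (rule fidxI)
 define c where "c z = (SOME g. g \<in> G & f g = z)" for z
 show "finite (c ` f ` G)" using assms(1) by simp
 fix g assume g: "g \<in> G"
 have "c (f g) \<in> G & f (c (f g)) = f g"
  unfolding c_def by (rule someI[of _ g]) (use g in simp)
 thus "\<exists>r\<in>c ` f ` G. g * iv r \<in> K" using assms(2)[OF g] g by (intro bexI[of _ "c (f g)"]) auto
qed

lemma fidx_power:
 assumes "sg G" "sg H" "fidx G H" "g \<in> G"
 shows "\<exists>m\<ge>1. g ^ m \<in> H"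
proof -
 obtain R where R: "finite R" "!!g. g \<in> G ==> \<exists>r\<in>R. g * iv r \<in> H"
  using assms(3) by (auto simp: fidx_def)
 have "\<forall>n. \<exists>r\<in>R. g ^ n * iv r \<in> H" using R(2) sg_power[OF assms(1,4)] by blast
 then obtain f where f: "!!n. f n \<in> R" "!!n. g ^ n * iv (f n) \<in> H" by metis
 have "finite (range f)" using f(1) by (intro finite_subset[OF _ R(1)]) auto
 hence "~ inj f" using finite_imageD[of f UNIV] by auto
 then obtain i j where "i ~= j" "f i = f j" by (auto simp: inj_def)
 then obtain i j where ij: "i < j" "f i = f j" by (metis linorder_neq_iff)
 have "g ^ j * iv (g ^ i) \<in> H"
  using f(2)[of j] f(2)[of i] ij assms(2) by (metis sg_diff_sym sg_diff_trans)
 moreover have "g ^ j = g ^ (j - i) * g ^ i" using ij by (simp add: power_add[symmetric])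
 ultimately have "g ^ (j - i) \<in> H" by (simp add: mult_assoc)
 thus ?thesis using ij by (intro exI[of _ "j - i"]) auto
qed

text \<open>Rewriting a word letter by letter keeps it in the form t r, with t a product of Schreier
  generators r s r'^-1 and r a representative.\<close>

theorem schreier:
 assumes "finite S" "sg H" "H \<subseteq> gen S" "fidx (gen S) H"
 shows "\<exists>T. finite T & T \<subseteq> H & H = gen T"
proof -
 obtain R where R: "finite R" "R \<subseteq> gen S" "!!g. g \<in> gen S ==> \<exists>r\<in>R. g * iv r \<in> H"
  using fidx_Int[OF sg_gen assms(2,4) subset_refl] by (metis IntD2)
 \<comment> \<open>The added 1 starts the rewriting at the empty word; the letter 1 in
   \<open>S1\<close> puts those representatives into \<open>T\<close> that happen to lie in
   \<open>H\<close>.\<close>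
 define R1 where "R1 = insert 1 R"
 define S1 where "S1 = insert 1 (S \<union> iv ` S)"
 define T where "T = (%(r, s, r'). r * s * iv r') ` (R1 \<times> S1 \<times> R1) \<inter> H"
 have fin: "finite T" using R(1) assms(1) by (auto simp: T_def R1_def S1_def)
 have R1: "R1 \<subseteq> gen S" using R(2) by (auto simp: R1_def gen.one)
 have T: "r * s * iv r' \<in> T" if "r \<in> R1" "s \<in> S1" "r' \<in> R1" "r * s * iv r' \<in> H" for r s r'
  unfolding T_def using that by (intro IntI image_eqI[of _ _ "(r, s, r')"]) auto
 have step: "\<exists>t\<in>gen T. \<exists>r\<in>R1. x * s = t * r"
  if x: "\<exists>t\<in>gen T. \<exists>r\<in>R1. x = t * r" and s: "s \<in> S1" "s \<in> gen S" for x s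
 proof -
  obtain t r where tr: "t \<in> gen T" "r \<in> R1" "x = t * r" using x by auto
  have "r * s \<in> gen S" using tr(2) R1 s(2) by (auto intro: gen_mult)
  then obtain r' where r': "r' \<in> R1" "r * s * iv r' \<in> H" using R(3) by (auto simp: R1_def)
  hence "t * (r * s * iv r') \<in> gen T" using T[OF tr(2) s(1) r'] tr(1) by (auto intro: gen.mult)
  moreover have "x * s = t * (r * s * iv r') * r'" by (simp add: tr(3) mult_assoc)
  ultimately show ?thesis using r' by blast
 qed
 have all: "\<exists>t\<in>gen T. \<exists>r\<in>R1. x = t * r" if "x \<in> gen S" for x
  using that
 proof induction
  case one
  thus ?case by (intro bexI[of _ 1]) (auto simp: R1_def gen.one)
 next
  case (mult x s)
  thus ?case by (intro step) (auto simp: S1_def gen_incl)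
 next
  case (mult_iv x s)
  thus ?case by (intro step) (auto simp: S1_def gen_incl_iv)
 qed
 have TH: "gen T \<subseteq> H" by (rule gen_least[OF assms(2)]) (auto simp: T_def)
 have "H \<subseteq> gen T"
 proof
  fix h assume h: "h \<in> H"
  then obtain t r where tr: "t \<in> gen T" "r \<in> R1" "h = t * r" using all assms(3) by blast
  hence "r \<in> H" using TH h sg_mult_left_iff[OF assms(2)] by auto
  hence "r * 1 * iv 1 \<in> T" using T[OF tr(2), of 1 1] by (auto simp: S1_def R1_def)
  thus "h \<in> gen T" using tr by (auto intro: gen.mult)
 qed
 thus ?thesis using fin TH by (intro exI[of _ T]) (auto simp: T_def)
qed

section \<open>Commutators and normality\<close>

definition cm :: "'a => 'a => 'a" where "cm x y = x * y * iv x * iv y"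

lemma iv_cm [simp]: "iv (cm x y) = cm y x"
 by (simp add: cm_def mult_assoc)

definition nrm :: "'a set => 'a set => bool" where
 "nrm G N \<longleftrightarrow> (\<forall>g\<in>G. \<forall>n\<in>N. g * n * iv g \<in> N)"

lemma nrmD: "nrm G N ==> g \<in> G ==> n \<in> N ==> g * n * iv g \<in> N"
 by (auto simp: nrm_def)

lemma nrmD': "nrm G N ==> sg G ==> g \<in> G ==> n \<in> N ==> iv g * n * g \<in> N"
 using nrmD[of G N "iv g" n] by (auto simp: sg_iv)

lemma nrm_if_cm:
 assumes "sg N" "N \<subseteq> G" "!!x y. x \<in> G ==> y \<in> G ==> cm x y \<in> N"
 shows "nrm G N"
 unfolding nrm_def
proof (intro ballI)
 fix g n assume "g \<in> G" "n \<in> N"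
 hence "cm g n * n \<in> N" using assms by (auto intro: sg_mult)
 thus "g * n * iv g \<in> N" by (simp add: cm_def mult_assoc)
qed

lemma cm_mult_left: "cm (x * x') y = x * cm x' y * iv x * cm x y"
 by (simp add: cm_def mult_assoc)

lemma cm_iv_left: "cm (iv x) y = iv x * cm y x * x"
 by (simp add: cm_def mult_assoc)

lemma cm_mult_right: "cm x (y * y') = cm x y * (y * cm x y' * iv y)"
 by (simp add: cm_def mult_assoc)

text \<open>By \<open>cm_mult_left\<close>, [x x', y] is a conjugate of [x', y] times [x, y]. Hence
  a condition on generators extends to the whole group; \<open>cm_gen_mod\<close> uses this once in
  each argument.\<close>

lemma sg_centralizer_mod:
 assumes "sg G" "sg N" "nrm G N" "y \<in> G"
 shows "sg {x\<in>G. cm x y \<in> N}"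
proof (rule sgI)
 show "1 \<in> {x\<in>G. cm x y \<in> N}" using assms by (simp add: sg_one cm_def)
next
 fix x x' assume "x \<in> {x\<in>G. cm x y \<in> N}" "x' \<in> {x\<in>G. cm x y \<in> N}"
 thus "x * x' \<in> {x\<in>G. cm x y \<in> N}"
  using assms by (auto simp: sg_mult cm_mult_left nrmD)
next
 fix x assume x: "x \<in> {x\<in>G. cm x y \<in> N}"
 hence "cm y x \<in> N" using sg_iv[OF assms(2), of "cm x y"] by simp
 thus "iv x \<in> {x\<in>G. cm x y \<in> N}"
  using assms x by (auto simp: sg_iv cm_iv_left nrmD')
qed

lemma cm_gen_mod:
 assumes "sg N" "nrm (gen S) N" "!!a b. a \<in> S ==> b \<in> S ==> cm a b \<in> N"
  and "x \<in> gen S" "y \<in> gen S"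
 shows "cm x y \<in> N"
proof -
 have 1: "cm x b \<in> N" if "x \<in> gen S" "b \<in> S" for x b
  using gen_least[OF sg_centralizer_mod[OF sg_gen assms(1,2) gen_incl[OF that(2)]], of S]
   assms(3) that by (auto intro: gen_incl)
 have "S \<subseteq> {y\<in>gen S. cm y x \<in> N}"
  using 1[OF assms(4)] sg_iv[OF assms(1)] by (metis (mono_tags, lifting) gen_incl iv_cm mem_Collect_eq subsetI)
 hence "cm y x \<in> N"
  using gen_least[OF sg_centralizer_mod[OF sg_gen assms(1,2,4)]] assms(5) by blast
 thus ?thesis using sg_iv[OF assms(1)] by (metis iv_cm)
qed

lemma nrm_gen:
 assumes "sg N" "!!s n. s \<in> S ==> n \<in> N ==> s * n * iv s \<in> N"
  and "!!s n. s \<in> S ==> n \<in> N ==> iv s * n * s \<in> N"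
 shows "nrm (gen S) N"
proof -
 have "g \<in> gen S ==> \<forall>n\<in>N. g * n * iv g \<in> N" for g
 proof (induction g rule: gen.induct)
  case (mult x s)
  show ?case
  proof
   fix n assume "n \<in> N"
   hence "x * (s * n * iv s) * iv x \<in> N" using mult assms(2) by blast
   thus "x * s * n * iv (x * s) \<in> N" by (simp add: mult_assoc)
  qed
 next
  case (mult_iv x s)
  show ?case
  proof
   fix n assume "n \<in> N"
   hence "x * (iv s * n * s) * iv x \<in> N" using mult_iv assms(3) by blast
   thus "x * iv s * n * iv (x * iv s) \<in> N" by (simp add: mult_assoc)
  qed
 qed auto
 thus ?thesis by (auto simp: nrm_def)
qed

text \<open>Modulo \<open>P\<close>, which contains all commutators, \<open>t\<close> commutes with
  everything and its m-th power is trivial, so the powers \<open>t ^ j\<close> with j < m represent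
  all cosets.\<close>

lemma fidx_gen_insert:
 assumes "sg P" "P \<subseteq> G" "sg G" "!!x y. x \<in> G ==> y \<in> G ==> cm x y \<in> P"
  and "t \<in> G" "t ^ m \<in> P" "m >= 1"
 shows "fidx (gen (insert t P)) P"
proof (rule fidxI[of "(%j. t ^ j) ` {..<m}"])
 fix x assume "x \<in> gen (insert t P)"
 hence "\<exists>p\<in>P. \<exists>j<m. x = p * t ^ j"
 proof induction
  case one
  show ?case using assms(1,7) by (intro bexI[of _ 1] exI[of _ 0]) (auto simp: sg_one)
 next
  case (mult x s)
  then obtain p j where pj: "p \<in> P" "j < m" "x = p * t ^ j" by blast
  show ?case
  proof (cases "s = t")
   case True
   hence x: "x * s = p * t ^ Suc j" by (simp only: pj(3) power_Suc2 mult_assoc True)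
   show ?thesis
   proof (cases "Suc j = m")
    case True
    thus ?thesis using x pj assms by (intro bexI[of _ "x * s"] exI[of _ 0]) (auto intro: sg_mult)
   next
    case False
    thus ?thesis using x pj by (intro bexI[of _ p] exI[of _ "Suc j"]) auto
   qed
  next
   case False
   hence s: "s \<in> P" using mult by auto
   have "x * s = p * (cm (t ^ j) s * s) * t ^ j" by (simp add: pj(3) cm_def mult_assoc)
   moreover have "p * (cm (t ^ j) s * s) \<in> P"
    using pj s assms by (intro sg_mult) (auto intro: sg_power)
   ultimately show ?thesis using pj by blast
  qed
 next
  case (mult_iv x s)
  then obtain p j where pj: "p \<in> P" "j < m" "x = p * t ^ j" by blast
  show ?case
  proof (cases "s = t")
   case True
   show ?thesis
   proof (cases j)
    case 0
    \<comment> \<open>The exponent wraps around: t^-1 = t^-m t^(m-1).\<close>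
    obtain m' where m': "m = Suc m'" using assms(7) by (cases m) auto
    have "x * iv s = (p * iv (t ^ m)) * t ^ m'"
    proof -
     have "t ^ m = t ^ m' * t" by (simp only: m' power_Suc2)
     thus ?thesis by (simp only: pj(3) 0 True power_0 mult_1_right iv_mult mult_assoc iv_left)
    qed
    moreover have "p * iv (t ^ m) \<in> P" by (intro sg_mult sg_iv assms pj)
    ultimately show ?thesis using m' by blast
   next
    case (Suc j')
    hence "x * iv s = p * t ^ j'" by (simp add: pj(3) True power_Suc2 mult_assoc del: power_Suc)
    thus ?thesis using pj Suc by (intro bexI[of _ p] exI[of _ j']) auto
   qed
  next
   case False
   hence s: "s \<in> P" using mult_iv by auto
   have "x * iv s = p * (cm (t ^ j) (iv s) * iv s) * t ^ j" by (simp add: pj(3) cm_def mult_assoc)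
   moreover have "p * (cm (t ^ j) (iv s) * iv s) \<in> P"
    using pj s assms by (intro sg_mult) (auto intro: sg_power sg_iv)
   ultimately show ?thesis using pj by blast
  qed
 qed
 then obtain p j where "p \<in> P" "j < m" "x = p * t ^ j" by blast
 thus "\<exists>r\<in>(%j. t ^ j) ` {..<m}. x * iv r \<in> P"
  by (intro bexI[of _ "t ^ j"]) (auto simp: mult_assoc)
qed auto

text \<open>A finitely generated abelian torsion group is finite; here it is a quotient by
  \<open>K\<close>, and one generator is adjoined at a time.\<close>

lemma fidx_abelian_torsion:
 assumes "finite T" "T \<subseteq> G" "sg G" "sg K" "K \<subseteq> G"
  and "!!x y. x \<in> G ==> y \<in> G ==> cm x y \<in> K"
  and "!!t. t \<in> T ==> \<exists>m\<ge>1. t ^ m \<in> K"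
 shows "fidx (gen (T \<union> K)) K"
 using assms(1,2,7)
proof (induction T)
 case empty
 thus ?case using fidx_refl[OF assms(4)] by (simp add: gen_sg assms(4))
next
 case (insert t T)
 then obtain m where m: "m >= 1" "t ^ m \<in> K" by blast
 let ?P = "gen (T \<union> K)"
 have KP: "K \<subseteq> ?P" by (auto intro: gen_incl)
 have PG: "?P \<subseteq> G" by (rule gen_least[OF assms(3)]) (use insert.prems assms in auto)
 have "fidx (gen (insert t ?P)) ?P"
  by (rule fidx_gen_insert[OF sg_gen PG assms(3), where m = m])
   (use insert.prems assms m KP in auto)
 hence "fidx (gen (insert t T \<union> K)) ?P"
  by (rule fidx_mono) (auto intro!: gen_mono intro: gen_incl)
 thus ?case using insert by (meson fidx_trans insert_subset insertCI)
qed

section \<open>Power products of a list of elements\<close>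

fun pe :: "'a list => int list => 'a" where
 "pe (h # hs) (e # es) = zp h e * pe hs es"
| "pe _ _ = 1"

lemma pe_in: "sg G ==> set hs \<subseteq> G ==> pe hs es \<in> G"
 by (induction hs es rule: pe.induct) (auto simp: sg_mult sg_zp sg_one)

lemma pe_zero: "length es = length hs ==> \<forall>e\<in>set es. e = 0 ==> pe hs es = 1"
 by (induction hs es rule: pe.induct) auto

lemma pe_add_unit:
 assumes "sg G" "sg N" "nrm G N" "!!x y. x \<in> G ==> y \<in> G ==> cm x y \<in> N"
 shows "set hs \<subseteq> G ==> length es = length hs ==> i < length hs ==>
  pe hs es * zp (hs ! i) d * iv (pe hs (es[i := es ! i + d])) \<in> N"
proof (induction hs es arbitrary: i rule: pe.induct)
 case (1 h hs e es)
 show ?case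
 proof (cases i)
  case 0
  have "cm (pe hs es) (zp h d) \<in> N"
   using 1 assms(1,4) by (auto intro!: pe_in sg_zp)
  hence "zp h (e + d) * (iv (zp h d) * cm (pe hs es) (zp h d) * zp h d) * iv (zp h (e + d)) \<in> N"
   using 1 assms(1,3) by (auto intro!: nrmD nrmD' sg_zp)
  thus ?thesis using 0 by (simp add: zp_add cm_def mult_assoc)
 next
  case (Suc j)
  hence "pe hs es * zp (hs ! j) d * iv (pe hs (es[j := es ! j + d])) \<in> N"
   using 1 by auto
  hence "zp h e * (pe hs es * zp (hs ! j) d * iv (pe hs (es[j := es ! j + d]))) * iv (zp h e) \<in> N"
   using 1 assms by (auto intro!: nrmD sg_zp)
  thus ?thesis using Suc by (simp add: mult_assoc)
 qed
qed (auto)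

text \<open>Modulo \<open>N\<close> the elements of \<open>vs\<close> die and those of
  \<open>hs\<close> commute, so the group is abelian and generated by \<open>hs\<close>. The role of
  \<open>N\<close> is played by the kernel of the eigenvalue characters, by a normal closure, or by
  a group of elements of bounded exponent.\<close>

lemma gen_pe_mod:
 assumes "sg N" "nrm (gen (set hs \<union> vs)) N" "vs \<subseteq> N"
  and "!!a b. a \<in> set hs ==> b \<in> set hs ==> cm a b \<in> N"
  and "x \<in> gen (set hs \<union> vs)"
 shows "\<exists>es. length es = length hs & x * iv (pe hs es) \<in> N"
proof -
 let ?S = "set hs \<union> vs" let ?G = "gen ?S"
 have hsG: "set hs \<subseteq> ?G" by (auto intro: gen_incl)
 have vG: "v \<in> vs ==> v \<in> ?G" for v by (auto intro: gen_incl)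
 have cmv: "cm a v \<in> N" if "a \<in> ?G" "v \<in> N" for a v
 proof -
  have "(a * v * iv a) * iv v \<in> N"
   by (rule sg_mult) (use assms(1,2) that in \<open>auto intro: nrmD sg_iv\<close>)
  thus ?thesis by (simp add: cm_def mult_assoc)
 qed
 have cmS: "cm a b \<in> N" if "a \<in> ?S" "b \<in> ?S" for a b
 proof (cases "b \<in> vs")
  case True
  thus ?thesis using cmv[of a b] that assms(3) by (auto intro: gen_incl)
 next
  case False
  show ?thesis
  proof (cases "a \<in> vs")
   case True
   hence "cm b a \<in> N" using cmv[of b a] that assms(3) by (auto intro: gen_incl)
   thus ?thesis using sg_iv[OF assms(1), of "cm b a"] by simp
  next
   case False
   with \<open>b \<notin> vs\<close> show ?thesis using that assms(4) by auto
  qed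
 qed
 have cmG: "cm x y \<in> N" if "x \<in> ?G" "y \<in> ?G" for x y
  using cm_gen_mod[OF assms(1,2) cmS that] .
 have step: "\<exists>es. length es = length hs & x * zp s d * iv (pe hs es) \<in> N"
  if x: "x \<in> ?G" "\<exists>es. length es = length hs & x * iv (pe hs es) \<in> N" and s: "s \<in> ?S" for x s d
 proof -
  obtain es where es: "length es = length hs" "x * iv (pe hs es) \<in> N" using x by auto
  have pG: "pe hs es \<in> ?G" using pe_in[OF sg_gen hsG] .
  show ?thesis
  proof (cases "s \<in> set hs")
   case True
   then obtain i where i: "i < length hs" "hs ! i = s" by (auto simp: in_set_conv_nth)
   have 1: "pe hs es * zp s d * iv (pe hs (es[i := es ! i + d])) \<in> N"
    using pe_add_unit[OF sg_gen assms(1,2) cmG hsG es(1) i(1)] i(2) by simp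
   have "x * zp s d * iv (pe hs es * zp s d) \<in> N" using es(2) by (simp add: mult_assoc)
   hence "x * zp s d * iv (pe hs (es[i := es ! i + d])) \<in> N"
    using sg_diff_trans[OF assms(1) _ 1] by simp
   thus ?thesis using es(1) by (intro exI[of _ "es[i := es ! i + d]"]) auto
  next
   case False
   hence "zp s d \<in> N" using s assms(1,3) by (auto intro: sg_zp)
   hence "x * zp s d * iv x * (x * iv (pe hs es)) \<in> N"
    using x(1) assms(1,2) es(2) by (auto intro!: sg_mult nrmD)
   thus ?thesis using es by (intro exI[of _ es]) (auto simp: mult_assoc)
  qed
 qed
 show ?thesis using assms(5)
 proof induction
  case one
  show ?case by (rule exI[of _ "replicate (length hs) 0"]) (auto simp: pe_zero sg_one assms(1))
 next
  case (mult x s)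
  thus ?case using step[of x s 1] by auto
 next
  case (mult_iv x s)
  thus ?case using step[of x s "-1"] by auto
 qed
qed

section \<open>Powers and congruences modulo a normal subgroup\<close>

lemma power_mult_mod:
 assumes "sg P" "sg W" "W \<subseteq> P" "!!x y. x \<in> P ==> y \<in> P ==> cm x y \<in> W"
  and "x \<in> P" "y \<in> P"
 shows "(x * y) ^ n * iv (x ^ n * y ^ n) \<in> W"
proof (induction n)
 case 0
 thus ?case using assms by (simp add: sg_one)
next
 case (Suc n)
 have n: "nrm P W" using nrm_if_cm[OF assms(2-4)] .
 let ?a = "(x * y) ^ n * iv (x ^ n * y ^ n)"
 have "(x * y) ^ Suc n * iv (x ^ Suc n * y ^ Suc n) =
   (x * y) ^ n * (x * y) * iv (x ^ n * x * (y ^ n * y))"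
  by (simp only: power_Suc2)
 also have "\<dots> = ?a * (x ^ n * (y ^ n * x * y * iv (y ^ n * y) * iv x) * iv (x ^ n))"
  by (simp add: mult_assoc)
 also have "y ^ n * x * y * iv (y ^ n * y) * iv x = cm (y ^ n) x"
  by (simp add: cm_def mult_assoc)
 finally show ?case
  using Suc assms n by (auto intro!: sg_mult nrmD sg_power)
qed

text \<open>As (x y)^n and x^n y^n agree modulo \<open>W\<close>, an exponent valid for generators
  is valid for the group they generate.\<close>

lemma sg_exponent_mod:
 assumes "sg P" "sg W" "W \<subseteq> P" "!!x y. x \<in> P ==> y \<in> P ==> cm x y \<in> W"
 shows "sg {x\<in>P. x ^ n \<in> W}"
proof (rule sgI)
 fix x y assume "x \<in> {x\<in>P. x ^ n \<in> W}" "y \<in> {x\<in>P. x ^ n \<in> W}"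
 hence xy: "x \<in> P" "y \<in> P" "x ^ n \<in> W" "y ^ n \<in> W" by auto
 have "(x * y) ^ n * iv (x ^ n * y ^ n) * (x ^ n * y ^ n) \<in> W"
  by (intro sg_mult power_mult_mod[OF assms xy(1,2)] xy assms(2))
 hence "(x * y) ^ n \<in> W" by (simp add: mult_assoc)
 thus "x * y \<in> {x\<in>P. x ^ n \<in> W}" using xy assms by (auto intro: sg_mult)
qed (use assms in \<open>auto simp: sg_one sg_iv iv_power[symmetric]\<close>)

lemma cong_mult:
 assumes "sg N" "nrm U N" "x \<in> U" "x * iv x' \<in> N" "y * iv y' \<in> N"
 shows "x * y * iv (x' * y') \<in> N"
proof -
 have "x * (y * iv y') * iv x * (x * iv x') \<in> N"
  by (intro sg_mult nrmD[OF assms(2,3)] assms)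
 thus ?thesis by (simp add: mult_assoc)
qed

lemma cong_power:
 assumes "sg N" "nrm U N" "x \<in> U" "x * iv x' \<in> N"
 shows "x ^ n * iv (x' ^ n) \<in> N"
proof (induction n)
 case (Suc n)
 show ?case unfolding power_Suc by (rule cong_mult[OF assms Suc])
qed (simp add: assms sg_one)

lemma cong_zp:
 assumes "sg N" "nrm U N" "sg U" "x \<in> U" "x' \<in> U" "x * iv x' \<in> N"
 shows "zp x n * iv (zp x' n) \<in> N"
proof (cases "n >= 0")
 case True
 thus ?thesis using cong_power[OF assms(1,2,4,6)] by (simp add: zp_def)
next
 case False
 have "iv x' * (x' * iv x) * iv (iv x') \<in> N"
  by (rule nrmD[OF assms(2)]) (use assms sg_diff_sym in \<open>auto intro: sg_iv\<close>)
 hence "iv x * iv (iv x') \<in> N" by simp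
 thus ?thesis
  using cong_power[OF assms(1,2) sg_iv[OF assms(3,4)]] False by (simp add: zp_def)
qed

text \<open>A central filtration \<open>\<Gamma>\<^sub>i\<close> with \<open>[\<Gamma>\<^sub>i, \<Gamma>\<^sub>j] \<subseteq> \<Gamma>\<^bsub>i+j\<^esub>\<close> by construction, which spares the three subgroups
 lemma needed for the lower central series.\<close>

inductive Gam :: "'a set => nat => 'a => bool" for U where
 Gam_base: "u \<in> U ==> Gam U 1 u"
| Gam_cm: "Gam U i a ==> Gam U j b ==> Gam U (i + j) (cm a b)"
| Gam_one: "i >= 1 ==> Gam U i 1"
| Gam_mult: "Gam U i a ==> Gam U i b ==> Gam U i (a * b)"
| Gam_iv: "Gam U i a ==> Gam U i (iv a)"
| Gam_weaken: "Gam U (Suc i) a ==> i >= 1 ==> Gam U i a"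

lemma Gam_pos: "Gam U i a ==> i >= 1"
 by (induction rule: Gam.induct) auto

lemma Gam_sub:
 assumes "sg U" shows "Gam U i a ==> a \<in> U"
 by (induction rule: Gam.induct) (use assms in \<open>auto simp: sg_mult sg_iv sg_one cm_def\<close>)

lemma Gam_le:
 assumes "Gam U j a" "1 <= i" "i <= j" shows "Gam U i a"
 using assms(3,2,1) by (induction rule: inc_induct) (auto intro: Gam_weaken)

lemma sg_Gam: "i >= 1 ==> sg {a. Gam U i a}"
 by (rule sgI) (auto intro: Gam.intros)

lemma nrm_Gam: "nrm U {a. Gam U i a}"
 unfolding nrm_def
proof safe
 fix g n assume g: "g \<in> U" and n: "Gam U i n"
 have "Gam U (1 + i) (cm g n)" by (intro Gam_cm Gam_base g n)
 hence "Gam U i (cm g n)" using Gam_pos[OF n] by (auto intro: Gam_le)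
 hence "Gam U i (cm g n * n)" using n by (rule Gam_mult)
 thus "Gam U i (g * n * iv g)" by (simp add: cm_def mult_assoc)
qed

text \<open>The image of V \<inter> \<Gamma>_i in the graded piece \<Gamma>_i / \<Gamma>_(i+1),
  pulled back to \<Gamma>_i. For \<open>i = 1\<close> this is V [U, U].\<close>

definition GamV :: "'a set => 'a set => nat => 'a set" where
 "GamV U V i = {v * g |v g. v \<in> V & Gam U i v & Gam U (Suc i) g}"

lemma sg_prod_normal:
 assumes "sg V" "sg N" "nrm V N"
 shows "sg {v * g |v g. v \<in> V & g \<in> N}"
proof (rule sgI)
 show "1 \<in> {v * g |v g. v \<in> V & g \<in> N}"
  using assms by (auto intro!: exI[of _ 1] simp: sg_one)
next
 fix x y assume "x \<in> {v * g |v g. v \<in> V & g \<in> N}" "y \<in> {v * g |v g. v \<in> V & g \<in> N}"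
 then obtain v g w h where *: "x = v * g" "y = w * h" "v \<in> V" "g \<in> N" "w \<in> V" "h \<in> N" by auto
 hence "x * y = (v * w) * (iv w * g * w * h)" by (simp add: mult_assoc)
 moreover have "iv w * g * w * h \<in> N" using * assms by (intro sg_mult nrmD') auto
 moreover have "v * w \<in> V" using * assms by (auto intro: sg_mult)
 ultimately show "x * y \<in> {v * g |v g. v \<in> V & g \<in> N}" by blast
next
 fix x assume "x \<in> {v * g |v g. v \<in> V & g \<in> N}"
 then obtain v g where *: "x = v * g" "v \<in> V" "g \<in> N" by auto
 hence "iv x = iv v * (v * iv g * iv v)" by (simp add: mult_assoc)
 moreover have "v * iv g * iv v \<in> N" "iv v \<in> V" using * assms by (auto intro!: nrmD sg_iv)
 ultimately show "iv x \<in> {v * g |v g. v \<in> V & g \<in> N}" by blast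
qed

lemma nrm_mono: "nrm U N ==> V \<subseteq> U ==> nrm V N"
 by (auto simp: nrm_def)

lemma sg_GamV:
 assumes "sg U" "sg V" "V \<subseteq> U" "i >= 1"
 shows "sg (GamV U V i)"
proof -
 have "sg {v * g |v g. v \<in> V \<inter> {a. Gam U i a} & g \<in> {a. Gam U (Suc i) a}}"
  using assms by (intro sg_prod_normal sg_Int sg_Gam nrm_mono[OF nrm_Gam]) auto
 thus ?thesis by (simp add: GamV_def conj_assoc)
qed

lemma Gam_GamV: "sg V ==> i >= 1 ==> Gam U (Suc i) a ==> a \<in> GamV U V i"
 unfolding GamV_def by (rule CollectI, rule exI[of _ 1], rule exI[of _ a]) (auto simp: sg_one Gam_one)

lemma GamV_Gam: "a \<in> GamV U V i ==> Gam U i a"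
 unfolding GamV_def using Gam_pos by (auto intro!: Gam_mult intro: Gam_weaken)

lemma cm_GamV:
 assumes "sg U" "sg V" "V \<subseteq> U" "Gam U i a" "Gam U i b"
 shows "cm a b \<in> GamV U V i"
proof -
 have "Gam U (i + i) (cm a b)" by (intro Gam_cm assms)
 hence "Gam U (Suc i) (cm a b)" using Gam_pos[OF assms(4)] by (auto intro: Gam_le)
 thus ?thesis using Gam_GamV[OF assms(2)] Gam_pos[OF assms(4)] by auto
qed

text \<open>The commutator is bilinear on graded pieces: the correction term [a, [a^n, b]] has
  weight 2 j + k and disappears modulo weight j + k + 1.\<close>

lemma cm_power_left_Gam:
 assumes "sg U" "Gam U j a" "Gam U k b"
 shows "Gam U (Suc (j + k)) (cm a b ^ n * iv (cm (a ^ n) b))"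
proof (induction n)
 case 0
 show ?case by (simp add: cm_def Gam_one)
next
 case (Suc n)
 let ?L = "{x. Gam U (Suc (j + k)) x}" and ?c = "cm (a ^ n) b"
 have L: "sg ?L" "nrm U ?L" by (auto intro: sg_Gam nrm_Gam)
 have j: "j >= 1" "k >= 1" using Gam_pos assms by auto
 have an: "Gam U j (a ^ n)" using sg_power[OF sg_Gam, of j a U] j assms by auto
 have c: "Gam U (j + k) ?c" by (intro Gam_cm an assms)
 have U: "a \<in> U" "b \<in> U" "?c \<in> U" "cm a b \<in> U"
  using Gam_sub[OF assms(1)] assms c by (auto intro!: Gam_cm)
 have "Gam U (j + (j + k)) (cm a ?c)" by (intro Gam_cm assms c)
 hence "Gam U (Suc (j + k)) (cm a ?c)" using j by (auto intro: Gam_le)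
 hence "a * ?c * iv a * iv ?c \<in> ?L" by (simp add: cm_def)
 hence "?c * iv (a * ?c * iv a) \<in> ?L" using sg_diff_sym[OF L(1)] by blast
 hence "cm a b ^ n * iv (a * ?c * iv a) \<in> ?L" using sg_diff_trans[OF L(1)] Suc by blast
 hence "cm a b ^ n * cm a b * iv ((a * ?c * iv a) * cm a b) \<in> ?L"
  using U sg_power[OF assms(1)] by (intro cong_mult[OF L]) (auto simp del: iv_cm intro: Gam_one)
 moreover have "cm (a ^ Suc n) b = (a * ?c * iv a) * cm a b" by (simp add: cm_mult_left)
 ultimately show ?case by (simp only: power_Suc2) simp
qed

text \<open>Inverting the left version suffices, because
  \<open>iv (cm a b) = cm b a\<close>.\<close>

lemma cm_power_right_Gam:
 assumes "sg U" "Gam U j a" "Gam U k b"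
 shows "Gam U (Suc (j + k)) (cm a b ^ n * iv (cm a (b ^ n)))"
proof -
 let ?L = "{x. Gam U (Suc (j + k)) x}"
 have L: "sg ?L" "nrm U ?L" by (auto intro: sg_Gam nrm_Gam)
 have j: "j >= 1" "k >= 1" using Gam_pos assms by auto
 let ?x = "cm b a ^ n" and ?y = "cm (b ^ n) a"
 have "?x * iv ?y \<in> ?L" using cm_power_left_Gam[OF assms(1,3,2), of n] by (simp add: add.commute)
 moreover have "?x \<in> U" "?y \<in> U"
  using Gam_sub[OF assms(1)] assms by (auto intro!: sg_power sg_mult sg_iv simp: cm_def)
 ultimately have "zp ?x (- 1) * iv (zp ?y (- 1)) \<in> ?L"
  by (intro cong_zp[OF L assms(1)])
 thus ?thesis by (simp add: iv_power)
qed

text \<open>By bilinearity [a, b]^(m n) agrees with [a^m, b^n] up to weight j + k + 1. Replacing a^m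
  and b^n by elements of \<open>V\<close> of the same weight again costs only terms of weight j + k
  + 1.\<close>

lemma GamV_exponent_step:
 assumes U: "sg U" "sg V" "V \<subseteq> U"
  and a: "Gam U j a" "a ^ m \<in> GamV U V j"
  and b: "Gam U k b" "b ^ n \<in> GamV U V k"
 shows "cm a b ^ (m * n) \<in> GamV U V (j + k)"
proof -
 let ?L = "{x. Gam U (Suc (j + k)) x}" and ?W = "GamV U V (j + k)"
 have jk: "j >= 1" "k >= 1" using Gam_pos a b by auto
 have L: "sg ?L" "nrm U ?L" by (auto intro: sg_Gam nrm_Gam)
 have W: "sg ?W" using sg_GamV[OF U] jk by auto
 have LW: "?L \<subseteq> ?W" using Gam_GamV[OF U(2)] jk by auto
 have am: "Gam U j (a ^ m)" using GamV_Gam[OF a(2)] .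
 have inU: "a \<in> U" "b \<in> U" "a ^ m \<in> U" "b ^ n \<in> U"
  using Gam_sub[OF U(1) a(1)] Gam_sub[OF U(1) b(1)] sg_power[OF U(1)] by blast+
 have cU: "cm x y \<in> U" if "x \<in> U" "y \<in> U" for x y
  unfolding cm_def using that U by (intro sg_mult sg_iv) auto
 have "cm a b ^ m * iv (cm (a ^ m) b) \<in> ?L" using cm_power_left_Gam[OF U(1) a(1) b(1)] by simp
 hence "(cm a b ^ m) ^ n * iv (cm (a ^ m) b ^ n) \<in> ?L"
  using inU cU U(1) by (intro cong_power[OF L]) (auto intro: sg_power)
 moreover have "cm (a ^ m) b ^ n * iv (cm (a ^ m) (b ^ n)) \<in> ?L"
  using cm_power_right_Gam[OF U(1) am b(1)] by simp
 ultimately have "cm a b ^ (m * n) * iv (cm (a ^ m) (b ^ n)) \<in> ?L"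
  unfolding power_mult by (rule sg_diff_trans[OF L(1)])
 hence 1: "cm a b ^ (m * n) * iv (cm (a ^ m) (b ^ n)) \<in> ?W" by (rule subsetD[OF LW])
 obtain v t where v: "a ^ m = v * t" "v \<in> V" "Gam U j v" "Gam U (Suc j) t"
  using a(2) by (auto simp: GamV_def)
 obtain w s where w: "b ^ n = w * s" "w \<in> V" "Gam U k w" "Gam U (Suc k) s"
  using b(2) by (auto simp: GamV_def)
 have vw: "v \<in> U" "w \<in> U" using v w U by auto
 have "Gam U (Suc j + k) (cm t (b ^ n))" by (intro Gam_cm v GamV_Gam[OF b(2)])
 hence "v * cm t (b ^ n) * iv v \<in> ?L" using vw by (intro nrmD[OF L(2)]) auto
 moreover have "Gam U (j + Suc k) (cm v s)" by (intro Gam_cm v w)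
 hence "w * cm v s * iv w \<in> ?L" using vw by (intro nrmD[OF L(2)]) auto
 moreover have "cm v w \<in> V" unfolding cm_def using v w U by (intro sg_mult sg_iv) auto
 moreover have "Gam U (j + k) (cm v w)" by (intro Gam_cm v w)
 ultimately have "v * cm t (b ^ n) * iv v \<in> ?W" "cm v w * (w * cm v s * iv w) \<in> ?W"
  using LW by (auto simp: GamV_def)
 hence "(v * cm t (b ^ n) * iv v) * (cm v w * (w * cm v s * iv w)) \<in> ?W"
  by (rule sg_mult[OF W])
 hence "cm (a ^ m) (b ^ n) \<in> ?W" by (simp only: v(1) w(1) cm_mult_left[of v] cm_mult_right[of v])
 from sg_mult[OF W 1 this]
 have "cm a b ^ (m * n) * iv (cm (a ^ m) (b ^ n)) * cm (a ^ m) (b ^ n) \<in> ?W" .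
 thus ?thesis by (simp add: mult_assoc del: iv_cm)
qed

text \<open>A graded piece of weight i > 1 is generated by commutators of lower weights, so a finite
  exponent of U modulo V [U, U] propagates to every weight.\<close>

lemma GamV_exponent:
 assumes U: "sg U" "sg V" "V \<subseteq> U"
  and m1: "m1 >= 1" "!!u. u \<in> U ==> u ^ m1 \<in> GamV U V 1"
 shows "i >= 1 ==> \<exists>m\<ge>1. \<forall>z. Gam U i z --> z ^ m \<in> GamV U V i"
proof (induction i rule: less_induct)
 case (less i)
 show ?case
 proof (cases "i = 1")
  case True
  thus ?thesis using m1 Gam_sub[OF U(1)] by blast
 next
  case False
  have "\<forall>j\<in>{1..<i}. \<exists>m::nat. m >= 1 & (\<forall>z. Gam U j z --> z ^ m \<in> GamV U V j)"
   using less.IH by simp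
  hence "\<exists>m. \<forall>j\<in>{1..<i}. m j >= (1::nat) & (\<forall>z. Gam U j z --> z ^ m j \<in> GamV U V j)"
   by (rule bchoice)
  then obtain m where m: "!!j. j \<in> {1..<i} ==> m j >= (1::nat) & (\<forall>z. Gam U j z --> z ^ m j \<in> GamV U V j)"
   by (elim exE) (metis atLeastLessThan_iff)
  define p where "p = (\<Prod>j\<in>{1..<i}. m j)"
  \<comment> \<open>A commutator of weights j and k costs the exponent m_j m_k, and j = k may occur;
    the square is divisible by all these products.\<close>
  define M where "M = p * p"
  have "M >= 1" unfolding M_def p_def using m by (auto simp: Suc_le_eq intro!: prod_pos)
  have W: "sg (GamV U V i)" using sg_GamV[OF U] less by auto
  let ?E = "{x\<in>{a. Gam U i a}. x ^ M \<in> GamV U V i}"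
  have E: "sg ?E"
   by (rule sg_exponent_mod[OF sg_Gam W]) (use less GamV_Gam cm_GamV[OF U] in auto)
  \<comment> \<open>The weight stays a variable so that induction over the generation of the
    filtration applies; elements of weight i + 1 lie in \<open>GamV U V i\<close> anyway.\<close>
  have "k = i --> z ^ M \<in> GamV U V i" if "Gam U k z" for k z
   using that
  proof induction
   case (Gam_base u)
   thus ?case using False by auto
  next
   case (Gam_cm j a k b)
   show ?case
   proof
    assume jk: "j + k = i"
    hence jk': "j \<in> {1..<i}" "k \<in> {1..<i}"
     using Gam_pos[OF Gam_cm(1)] Gam_pos[OF Gam_cm(2)] by auto
    have "cm a b ^ (m j * m k) \<in> GamV U V (j + k)"
     using jk' m Gam_cm by (intro GamV_exponent_step[OF U]) auto
    moreover have "m j dvd p" "m k dvd p" unfolding p_def using jk' by (auto intro!: dvd_prodI)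
    hence "m j * m k dvd M" unfolding M_def by (rule mult_dvd_mono)
    then obtain q where "M = m j * m k * q" by (auto simp: dvd_def)
    ultimately show "cm a b ^ M \<in> GamV U V i"
     using sg_power[OF W] by (simp add: jk power_mult)
   qed
  next
   case (Gam_one k)
   thus ?case using W by (auto simp: sg_one)
  next
   case (Gam_mult k a b)
   thus ?case using sg_mult[OF E, of a b] by auto
  next
   case (Gam_iv k a)
   thus ?case using sg_iv[OF E, of a] by auto
  next
   case (Gam_weaken k a)
   thus ?case using sg_power[OF sg_Gam, of "Suc k" a U M] Gam_GamV[OF U(2)] by auto
  qed
  thus ?thesis using \<open>M >= 1\<close> by blast
 qed
qed

text \<open>The chain U = V \<Gamma>_1, V \<Gamma>_2, ..., V \<Gamma>_n = V has steps of bounded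
  exponent by \<open>GamV_exponent\<close>. For groups that are not finitely generated this does not
  yet give finite index; the hypothesis \<open>bnd\<close> supplies that and is later discharged by
  \<open>fidx_unipotent\<close>.\<close>

theorem fidx_nilpotent:
 assumes U: "sg U" "sg V" "V \<subseteq> U"
  and m1: "m1 >= 1" "!!u. u \<in> U ==> u ^ m1 \<in> GamV U V 1"
  and nil: "n >= 1" "!!z. Gam U n z ==> z = 1"
  and bnd: "!!P X k. sg P ==> sg X ==> X \<subseteq> P ==> P \<subseteq> U ==> k >= 1 ==>
   (!!u. u \<in> P ==> u ^ k \<in> X) ==> fidx P X"
 shows "fidx U V"
proof -
 define Y where "Y i = {v * g |v g. v \<in> V & Gam U i g}" for i
 have step: "fidx (Y i) (Y (Suc i))" if i: "i >= 1" for i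
 proof -
  obtain m where m: "m >= 1" "!!z. Gam U i z ==> z ^ m \<in> GamV U V i"
   using GamV_exponent[OF U m1 i] by auto
  have "fidx {z. Gam U i z} (GamV U V i)"
   using m i by (intro bnd[of _ _ m] sg_Gam sg_GamV U) (auto intro: GamV_Gam Gam_sub[OF U(1)])
  then obtain R where R: "finite R" "!!g. Gam U i g ==> \<exists>r\<in>R. g * iv r \<in> GamV U V i"
   by (auto simp: fidx_def)
  show ?thesis
  proof (rule fidxI[OF R(1)])
   fix y assume "y \<in> Y i"
   then obtain v g where y: "y = v * g" "v \<in> V" "Gam U i g" by (auto simp: Y_def)
   then obtain r where r: "r \<in> R" "g * iv r \<in> GamV U V i" using R by blast
   then obtain w h where wh: "g * iv r = w * h" "w \<in> V" "Gam U (Suc i) h" by (auto simp: GamV_def)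
   have "y * iv r = (v * w) * h" by (simp only: y mult_assoc wh)
   hence "y * iv r \<in> Y (Suc i)" using wh y U by (auto simp: Y_def intro: sg_mult)
   thus "\<exists>r\<in>R. y * iv r \<in> Y (Suc i)" using r by blast
  qed
 qed
 have "fidx (Y 1) (Y (Suc k))" for k
 proof (induction k)
  case 0
  have "sg (Y 1)"
   using sg_prod_normal[OF U(2) sg_Gam[of 1 U]] nrm_mono[OF nrm_Gam U(3)] by (simp add: Y_def)
  thus ?case using fidx_refl by simp
 next
  case (Suc k)
  thus ?case using fidx_trans step[of "Suc k"] by auto
 qed
 hence "fidx (Y 1) (Y n)" using nil(1) by (metis Suc_diff_1 less_eq_Suc_le One_nat_def)
 thus ?thesis
 proof (rule fidx_mono)
  show "U \<subseteq> Y 1"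
  proof
   fix u assume "u \<in> U"
   thus "u \<in> Y 1" unfolding Y_def using U
    by (intro CollectI, rule_tac exI[of _ 1], rule_tac exI[of _ u])
     (use Gam_base in \<open>auto simp: sg_one\<close>)
  qed
  show "Y n \<subseteq> V"
  proof
   fix y assume "y \<in> Y n"
   then obtain v g where "y = v * g" "v \<in> V" "Gam U n g" by (auto simp: Y_def)
   thus "y \<in> V" using nil(2)[of g] by simp
  qed
 qed
qed

end

section \<open>Flags of invariant subspaces\<close>

lemma sum_fun_app: "(\<Sum>a\<in>A. f a) x = (\<Sum>a\<in>A. f a x :: 'b::comm_monoid_add)"
 by (induction A rule: infinite_finite_induct) auto

locale vspace = vector_space scale
 for scale :: "'a::field => 'b::ab_group_add => 'b"
begin

text \<open>The ambient space may have infinite dimension; finiteness enters only through the span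
  of \<open>F\<close>.\<close>

lemma dim_strict:
 assumes "finite F" "Y \<subseteq> span F" "subspace X" "subspace Y" "X \<subset> Y"
 shows "dim X < dim Y"
proof -
 obtain B where B: "B \<subseteq> X" "independent B" "X \<subseteq> span B" "card B = dim X"
  using basis_exists[of X] by blast
 obtain C where C: "C \<subseteq> Y" "independent C" "Y \<subseteq> span C" "card C = dim Y"
  using basis_exists[of Y] by blast
 have fC: "finite C" using independent_span_bound[OF assms(1) C(2)] C(1) assms(2) by blast
 obtain y where y: "y \<in> Y" "y \<notin> X" using assms(5) by auto
 have "span B \<subseteq> X" using B(1) assms(3) by (rule span_minimal)
 hence "y \<notin> span B" using y by auto
 hence ind: "independent (insert y B)" "y \<notin> B"
  using B(2) by (auto simp: independent_insert span_base)
 have "insert y B \<subseteq> span C" using y B(1) assms(5) C(3) by auto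
 hence "finite (insert y B) & card (insert y B) <= card C"
  by (rule independent_span_bound[OF fC ind(1)])
 thus ?thesis using ind(2) B(4) C(4) by auto
qed

definition lin :: "('b => 'b) => bool" where
 "lin T \<longleftrightarrow> (\<forall>x y. T (x + y) = T x + T y) & (\<forall>c x. T (scale c x) = scale c (T x))"

lemma lin_add: "lin T ==> T (x + y) = T x + T y"
 by (auto simp: lin_def)

lemma lin_scale: "lin T ==> T (scale c x) = scale c (T x)"
 by (auto simp: lin_def)

lemma lin_zero: "lin T ==> T 0 = 0"
 using lin_scale[of T 0 0] by simp

lemma lin_diff: "lin T ==> T (x - y) = T x - T y"
 using lin_add[of T "x - y" y] by simp

lemma lin_sum: "lin T ==> T (sum f A) = (\<Sum>a\<in>A. T (f a))"
 by (induction A rule: infinite_finite_induct) (auto simp: lin_zero lin_add)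

lemma lin_span:
 assumes "lin T" "!!b. b \<in> B ==> T b \<in> Z" "subspace Z" "x \<in> span B"
 shows "T x \<in> Z"
 using assms(4)
proof (induction rule: span_induct_alt)
 case base
 thus ?case using assms by (simp add: lin_zero subspace_0)
next
 case (step c x y)
 thus ?case using assms by (simp add: lin_add lin_scale subspace_add subspace_scale)
qed

text \<open>The vector p(T) v, by Horner's scheme.\<close>

definition op :: "('b => 'b) => 'a poly => 'b => 'b" where
 "op T p v = fold_coeffs (%a r. scale a v + T r) p 0"

lemma op_0 [simp]: "op T 0 v = 0"
 by (simp add: op_def)

lemma op_pCons: "lin T ==> op T (pCons a p) v = scale a v + T (op T p v)"
 by (cases "p = 0 & a = 0") (auto simp: op_def lin_zero)

lemma op_add: "lin T ==> op T (p + q) v = op T p v + op T q v"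
 by (induction p q rule: poly_induct2) (auto simp: op_pCons lin_add scale_left_distrib)

lemma op_smult: "lin T ==> op T (smult c p) v = scale c (op T p v)"
 by (induction p) (auto simp: op_pCons lin_scale scale_right_distrib)

lemma op_sum: "lin T ==> op T (sum f A) v = (\<Sum>a\<in>A. op T (f a) v)"
 by (induction A rule: infinite_finite_induct) (auto simp: op_add)

lemma op_monom: "lin T ==> op T (monom c i) v = scale c ((T ^^ i) v)"
 by (induction i) (auto simp: monom_0 monom_Suc op_pCons lin_zero lin_scale)

lemma op_in:
 assumes "lin T" "subspace Y" "!!x. x \<in> Y ==> T x \<in> Y" "v \<in> Y"
 shows "op T p v \<in> Y"
 by (induction p) (use assms in \<open>auto simp: op_pCons subspace_0 subspace_add subspace_scale\<close>)

lemma annihilating_poly: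
 assumes "lin T" "finite F" "!!i. (T ^^ i) y \<in> span F"
 shows "\<exists>p. p ~= 0 & op T p y = 0"
proof -
 define m where "m = card F"
 let ?f = "%i. (T ^^ i) y"
 show ?thesis
 \<comment> \<open>Linear dependence is a property of sets, so a repetition among the vectors T^i y
   is treated separately and gives the polynomial x^i - x^j.\<close>
 proof (cases "inj_on ?f {..m}")
  case False
  then obtain i j where ij: "i ~= j" "?f i = ?f j" by (auto simp: inj_on_def)
  have "coeff (monom 1 i + monom (- 1) j :: 'a poly) i = 1" using ij by simp
  hence "monom 1 i + monom (- 1) j ~= (0 :: 'a poly)" by (metis coeff_0 zero_neq_one)
  moreover have "op T (monom 1 i + monom (- 1) j) y = 0"
   using ij by (simp add: op_add op_monom assms(1))
  ultimately show ?thesis by blast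
 next
  case True
  hence "card (?f ` {..m}) = Suc m" by (simp add: card_image)
  hence "dependent (?f ` {..m})"
   using independent_span_bound[OF assms(2), of "?f ` {..m}"] assms(3) by (auto simp: m_def)
  then obtain u where u: "\<exists>v\<in>?f ` {..m}. u v ~= 0" "(\<Sum>v\<in>?f ` {..m}. scale (u v) v) = 0"
   by (auto simp: dependent_finite)
  define p where "p = (\<Sum>i\<le>m. monom (u (?f i)) i)"
  have "op T p y = (\<Sum>i\<le>m. scale (u (?f i)) (?f i))"
   by (simp add: p_def op_sum op_monom assms(1))
  also have "\<dots> = 0" using u(2) by (simp add: sum.reindex[OF True])
  finally have "op T p y = 0" .
  moreover obtain i where i: "i <= m" "u (?f i) ~= 0" using u(1) by auto
  have "coeff p i = (\<Sum>j\<le>m. if j = i then u (?f j) else 0)"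
   by (simp add: p_def coeff_sum if_distrib cong: if_cong)
  hence "coeff p i ~= 0" using i by simp
  hence "p ~= 0" by auto
  ultimately show ?thesis by blast
 qed
qed

lemma subspace_eigen:
 assumes "lin T" "subspace X" "subspace Y"
 shows "subspace {y\<in>Y. T y - scale c y \<in> X}"
proof -
 have "T (x + y) - scale c (x + y) = (T x - scale c x) + (T y - scale c y)" for x y
  using assms by (simp add: lin_add scale_right_distrib)
 moreover have "T (scale d x) - scale c (scale d x) = scale d (T x - scale c x)" for d x
  using assms by (simp add: lin_scale scale_right_diff_distrib mult.commute)
 ultimately show ?thesis
  using assms by (auto simp: subspace_def lin_zero)
qed

lemma subspace_Inter_eigen:
 assumes "!!a. a \<in> A ==> lin (T a)" "subspace X" "subspace Y"
 shows "subspace {y\<in>Y. \<forall>a\<in>A. T a y - scale (\<chi> a) y \<in> X}"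
proof -
 have "{y\<in>Y. \<forall>a\<in>A. T a y - scale (\<chi> a) y \<in> X} = Y \<inter> (\<Inter>a\<in>A. {y\<in>Y. T a y - scale (\<chi> a) y \<in> X})"
  by auto
 moreover have "subspace (\<Inter>a\<in>A. {y\<in>Y. T a y - scale (\<chi> a) y \<in> X})"
  using subspace_eigen[OF assms(1) assms(2,3)] by (intro subspace_Int) auto
 ultimately show ?thesis using assms(3) by (simp add: subspace_inter)
qed

text \<open>Applying T_a - \<psi>(a) kills the component of \<psi> and rescales the others: the
  usual proof that eigenvectors for distinct weights are independent, here modulo
  \<open>X\<close>.\<close>

lemma weights_independent:
 assumes X: "subspace X" and T: "!!a. a \<in> A ==> lin (T a)" "!!a x. a \<in> A ==> x \<in> X ==> T a x \<in> X"
 shows "finite S ==> (!!\<chi> \<psi>. \<chi> \<in> S ==> \<psi> \<in> S ==> \<chi> ~= \<psi> ==> \<exists>a\<in>A. \<chi> a ~= \<psi> a) ==>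
  (!!\<chi> a. \<chi> \<in> S ==> a \<in> A ==> T a (w \<chi>) - scale (\<chi> a) (w \<chi>) \<in> X) ==>
  (\<Sum>\<chi>\<in>S. w \<chi>) \<in> X ==> \<chi> \<in> S ==> w \<chi> \<in> X"
proof (induction S arbitrary: w \<chi> rule: finite_induct)
 case empty
 thus ?case by simp
next
 case (insert \<psi> S)
 have *: "w \<chi> \<in> X" if \<chi>: "\<chi> \<in> S" for \<chi>
 proof -
  have "\<chi> ~= \<psi>" using \<chi> insert(2) by auto
  then obtain a where a: "a \<in> A" "\<chi> a ~= \<psi> a" using insert.prems(1)[of \<chi> \<psi>] \<chi> by auto
  define w' where "w' \<phi> = scale (\<phi> a - \<psi> a) (w \<phi>)" for \<phi>
  have w: "T b (w \<phi>) - scale (\<phi> b) (w \<phi>) \<in> X" if "\<phi> \<in> insert \<psi> S" "b \<in> A" for \<phi> b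
   using insert.prems(2)[OF that] .
  have "w' \<chi> \<in> X"
  proof (rule insert.IH[of w' \<chi>])
   fix \<phi> b assume \<phi>: "\<phi> \<in> S" "b \<in> A"
   have "T b (w' \<phi>) - scale (\<phi> b) (w' \<phi>) = scale (\<phi> a - \<psi> a) (T b (w \<phi>) - scale (\<phi> b) (w \<phi>))"
    using T(1)[OF \<phi>(2)] by (simp add: w'_def lin_scale scale_right_diff_distrib mult.commute)
   thus "T b (w' \<phi>) - scale (\<phi> b) (w' \<phi>) \<in> X"
    using w[of \<phi> b] \<phi> X by (simp add: subspace_scale)
  next
   let ?s = "\<Sum>\<phi>\<in>insert \<psi> S. w \<phi>"
   have "T a ?s - scale (\<psi> a) ?s \<in> X"
    using insert.prems(3) T(2)[OF a(1)] X by (intro subspace_diff subspace_scale) auto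
   moreover have "T a ?s - scale (\<psi> a) ?s = (\<Sum>\<phi>\<in>insert \<psi> S. T a (w \<phi>) - scale (\<psi> a) (w \<phi>))"
    using T(1)[OF a(1)] by (simp add: lin_sum scale_sum_right sum_subtractf del: sum.insert)
   ultimately have "(\<Sum>\<phi>\<in>insert \<psi> S. T a (w \<phi>) - scale (\<psi> a) (w \<phi>)) \<in> X" by simp
   moreover have "(\<Sum>\<phi>\<in>insert \<psi> S. T a (w \<phi>) - scale (\<phi> a) (w \<phi>)) \<in> X"
    by (rule subspace_sum[OF X w]) (use a in auto)
   ultimately have "(\<Sum>\<phi>\<in>insert \<psi> S. T a (w \<phi>) - scale (\<psi> a) (w \<phi>))
     - (\<Sum>\<phi>\<in>insert \<psi> S. T a (w \<phi>) - scale (\<phi> a) (w \<phi>)) \<in> X"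
    by (rule subspace_diff[OF X])
   also have "(\<Sum>\<phi>\<in>insert \<psi> S. T a (w \<phi>) - scale (\<psi> a) (w \<phi>))
     - (\<Sum>\<phi>\<in>insert \<psi> S. T a (w \<phi>) - scale (\<phi> a) (w \<phi>)) = (\<Sum>\<phi>\<in>insert \<psi> S. w' \<phi>)"
    unfolding sum_subtractf[symmetric]
    by (intro sum.cong) (auto simp: w'_def scale_left_diff_distrib)
   also have "\<dots> = sum w' S" using insert(1,2) by (simp add: w'_def)
   finally show "sum w' S \<in> X" .
  qed (use insert.prems(1) \<chi> in auto)
  hence "scale (inverse (\<chi> a - \<psi> a)) (w' \<chi>) \<in> X" using X by (simp add: subspace_scale)
  thus ?thesis using a(2) by (simp add: w'_def)
 qed
 have "w \<psi> = (\<Sum>\<phi>\<in>insert \<psi> S. w \<phi>) - (\<Sum>\<phi>\<in>S. w \<phi>)" using insert(1,2) by simp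
 also have "\<dots> \<in> X" by (rule subspace_diff[OF X insert.prems(3) subspace_sum[OF X *]])
 finally show ?case using * insert.prems(4) by auto
qed

lemma independent_if_independent_mod:
 assumes "finite S" "!!c s. (\<Sum>s\<in>S. scale (c s) (w s)) = 0 ==> s \<in> S ==> c s = (0::'a)"
 shows "inj_on w S & independent (w ` S)"
proof
 show inj: "inj_on w S"
 proof (rule inj_onI, rule ccontr)
  fix s t assume st: "s \<in> S" "t \<in> S" "w s = w t" "s ~= t"
  define c where "c r = (if r = s then 1 else if r = t then - 1 else (0::'a))" for r
  have "(\<Sum>r\<in>S. scale (c r) (w r)) = (\<Sum>r\<in>{s, t}. scale (c r) (w r))"
   using st assms(1) by (intro sum.mono_neutral_right) (auto simp: c_def)
  also have "\<dots> = 0" using st by (simp add: c_def)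
  finally have "c s = 0" using assms(2) st by blast
  thus False by (simp add: c_def)
 qed
 show "independent (w ` S)"
 proof
  assume "dependent (w ` S)"
  then obtain u where u: "\<exists>v\<in>w ` S. u v ~= 0" "(\<Sum>v\<in>w ` S. scale (u v) v) = 0"
   using assms(1) by (auto simp: dependent_finite)
  hence "(\<Sum>s\<in>S. scale (u (w s)) (w s)) = 0" by (simp add: sum.reindex[OF inj])
  thus False using assms(2)[of "%s. u (w s)"] u(1) by auto
 qed
qed

text \<open>More than \<open>card F\<close> weights would yield too many independent vectors.
  Restricting to \<open>extensional A\<close> ensures that different weights differ at a point of
  \<open>A\<close>.\<close>

lemma finite_weights:
 assumes X: "subspace X" and F: "finite F" and
  T: "!!a. a \<in> A ==> lin (T a)" "!!a x. a \<in> A ==> x \<in> X ==> T a x \<in> X"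
 shows "finite {\<chi> \<in> extensional A. \<exists>w\<in>span F - X. \<forall>a\<in>A. T a w - scale (\<chi> a) w \<in> X}"
proof (rule ccontr)
 assume "infinite {\<chi> \<in> extensional A. \<exists>w\<in>span F - X. \<forall>a\<in>A. T a w - scale (\<chi> a) w \<in> X}"
 then obtain S where S: "finite S" "card S = Suc (card F)"
  "S \<subseteq> {\<chi> \<in> extensional A. \<exists>w\<in>span F - X. \<forall>a\<in>A. T a w - scale (\<chi> a) w \<in> X}"
  using infinite_arbitrarily_large by blast
 hence "\<forall>\<chi>\<in>S. \<exists>w. w \<in> span F - X & (\<forall>a\<in>A. T a w - scale (\<chi> a) w \<in> X)" by auto
 then obtain w where w: "!!\<chi>. \<chi> \<in> S ==> w \<chi> \<in> span F - X & (\<forall>a\<in>A. T a (w \<chi>) - scale (\<chi> a) (w \<chi>) \<in> X)"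
  by metis
 have "inj_on w S & independent (w ` S)"
 proof (rule independent_if_independent_mod[OF S(1)])
  fix c \<psi> assume c: "(\<Sum>s\<in>S. scale (c s) (w s)) = 0" "\<psi> \<in> S"
  have "scale (c \<psi>) (w \<psi>) \<in> X"
  proof (rule weights_independent[OF X T S(1), where w = "%\<chi>. scale (c \<chi>) (w \<chi>)"])
   fix \<chi> \<phi> assume "\<chi> \<in> S" "\<phi> \<in> S" "\<chi> ~= \<phi>"
   thus "\<exists>a\<in>A. \<chi> a ~= \<phi> a" using S(3) by (metis (mono_tags, lifting) extensionalityI mem_Collect_eq subsetD)
  next
   fix \<chi> a assume "\<chi> \<in> S" "a \<in> A"
   hence "scale (c \<chi>) (T a (w \<chi>) - scale (\<chi> a) (w \<chi>)) \<in> X"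
    using w X by (auto intro: subspace_scale)
   thus "T a (scale (c \<chi>) (w \<chi>)) - scale (\<chi> a) (scale (c \<chi>) (w \<chi>)) \<in> X"
    using T(1)[OF \<open>a \<in> A\<close>] by (simp add: lin_scale scale_right_diff_distrib mult.commute)
  qed (use c X in \<open>auto simp: subspace_0\<close>)
  show "c \<psi> = 0"
  proof (rule ccontr)
   assume "c \<psi> ~= 0"
   hence "scale (inverse (c \<psi>)) (scale (c \<psi>) (w \<psi>)) = w \<psi>" by simp
   hence "w \<psi> \<in> X" using \<open>scale (c \<psi>) (w \<psi>) \<in> X\<close> X by (metis subspace_scale)
   thus False using w c by auto
  qed
 qed
 moreover have "w ` S \<subseteq> span F" using w by auto
 ultimately have "card (w ` S) <= card F" "card (w ` S) = card S"
  using independent_span_bound[OF F, of "w ` S"] by (simp_all add: card_image)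
 thus False using S(2) by simp
qed

definition flag :: "('i => 'b => 'b) => 'i set => 'b list => bool" where
 "flag act G ws \<longleftrightarrow> (\<forall>i<length ws. ws ! i \<notin> span (set (take i ws)) &
   (\<forall>g\<in>G. \<exists>c. act g (ws ! i) - scale c (ws ! i) \<in> span (set (take i ws))))"

lemma flag_snoc:
 assumes "flag act G ws" "w \<notin> span (set ws)"
  "!!g. g \<in> G ==> \<exists>c. act g w - scale c w \<in> span (set ws)"
 shows "flag act G (ws @ [w])"
 using assms by (auto simp: flag_def nth_append less_Suc_eq)

lemma flag_mono: "flag act G ws ==> H \<subseteq> G ==> flag act H ws"
 unfolding flag_def by blast

lemma flag_inv:
 assumes "flag act G ws" "!!g. g \<in> G ==> lin (act g)" "g \<in> G" "k <= length ws" "x \<in> span (set (take k ws))"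
 shows "act g x \<in> span (set (take k ws))"
proof (rule lin_span[OF assms(2)[OF assms(3)] _ _ assms(5)])
 fix b assume "b \<in> set (take k ws)"
 then obtain i where i: "i < k" "i < length ws" "b = ws ! i" by (auto simp: in_set_conv_nth)
 then obtain c where "act g b - scale c b \<in> span (set (take i ws))"
  using assms(1,3) by (auto simp: flag_def)
 moreover have "set (take i ws) \<subseteq> set (take k ws)" using i by (intro set_take_subset_set_take) simp
 ultimately have "act g b - scale c b \<in> span (set (take k ws))"
  using span_mono by blast
 moreover have "scale c b \<in> span (set (take k ws))"
  using \<open>b \<in> set (take k ws)\<close> by (auto intro: span_scale span_base)
 ultimately have "act g b - scale c b + scale c b \<in> span (set (take k ws))" by (rule span_add)
 thus "act g b \<in> span (set (take k ws))" by simp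
qed simp

text \<open>The acting set may shrink at each extension of the flag as long as \<open>Q\<close>
  persists. \<open>malcev\<close> passes to subgroups of finite index in this way, while
  \<open>flag_of_ideal_cert\<close> keeps the set constant.\<close>

lemma flag_exists:
 assumes F: "finite F"
  and lin: "!!G g. Q G ==> g \<in> G ==> lin (act g)"
  and step: "!!G X. Q G ==> subspace X ==> X \<subset> span F ==> (!!g x. g \<in> G ==> x \<in> X ==> act g x \<in> X) ==>
   \<exists>G1 w. Q G1 & G1 \<subseteq> G & w \<in> span F - X & (\<forall>g\<in>G1. \<exists>c. act g w - scale c w \<in> X)"
  and Q: "Q G"
 shows "\<exists>G1 ws. Q G1 & G1 \<subseteq> G & flag act G1 ws & span (set ws) = span F"
proof -
 have "\<exists>G1 ws. Q G1 & G1 \<subseteq> G & flag act G1 ws & span (set ws) = span F"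
  if "Q G" "flag act G us" "set us \<subseteq> span F" for G us
  using that
 proof (induction "dim (span F) - dim (span (set us))" arbitrary: G us rule: less_induct)
  case less
  let ?X = "span (set us)"
  have XF: "?X \<subseteq> span F" using less.prems(3) by (simp add: span_minimal)
  show ?case
  proof (cases "?X = span F")
   case True
   thus ?thesis using less.prems by blast
  next
   case False
   hence X: "?X \<subset> span F" using XF by auto
   have inv: "act g x \<in> ?X" if "g \<in> G" "x \<in> ?X" for g x
    using flag_inv[OF less.prems(2) lin[OF less.prems(1)] that(1), of "length us"] that(2) by auto
   obtain G1 w where w: "Q G1" "G1 \<subseteq> G" "w \<in> span F - ?X" "\<forall>g\<in>G1. \<exists>c. act g w - scale c w \<in> ?X"
    using step[OF less.prems(1) subspace_span X inv] by blast
   have fl: "flag act G1 (us @ [w])"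
    by (rule flag_snoc[OF flag_mono[OF less.prems(2) w(2)]]) (use w in auto)
   have us: "set (us @ [w]) \<subseteq> span F" using less.prems(3) w by auto
   have "?X \<subset> span (set (us @ [w]))"
    using w(3) span_mono[of "set us" "set (us @ [w])"] span_base[of w "set (us @ [w])"] by auto
   hence "dim ?X < dim (span (set (us @ [w])))"
    using us by (intro dim_strict[OF F]) (auto simp: span_minimal)
   moreover have "dim ?X < dim (span F)" using X by (intro dim_strict[OF F]) auto
   ultimately have "dim (span F) - dim (span (set (us @ [w]))) < dim (span F) - dim ?X" by simp
   from less.hyps[OF this w(1) fl us] show ?thesis using w(2) by blast
  qed
 qed
 from this[of G "[]"] Q show ?thesis by (simp add: flag_def)
qed

end

section \<open>Eigenvectors over the complex numbers\<close>

locale complex_space = vspace scale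
 for scale :: "complex => 'v::ab_group_add => 'v"
begin

text \<open>Let p have minimal degree with p(T) y in X. If c is a root of p and p = (x - c) q, then
  q(T) y is an eigenvector modulo X.\<close>

lemma eigenvector_mod:
 assumes T: "lin T" and F: "finite F" and X: "subspace X" and Y: "subspace Y" "X \<subset> Y" "Y \<subseteq> span F"
  and inv: "!!x. x \<in> X ==> T x \<in> X" "!!y. y \<in> Y ==> T y \<in> Y"
 shows "\<exists>w\<in>Y - X. \<exists>c. T w - scale c w \<in> X"
proof -
 obtain y where y: "y \<in> Y" "y \<notin> X" using Y by auto
 have "(T ^^ i) y \<in> Y" for i by (induction i) (use y inv in auto)
 hence "\<exists>p. p ~= 0 & op T p y = 0" using Y(3) by (intro annihilating_poly[OF T F]) auto
 hence ex: "\<exists>p. p ~= 0 & op T p y \<in> X" using X by (metis subspace_0)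
 define p where "p = arg_min degree (%p. p ~= 0 & op T p y \<in> X)"
 have p: "p ~= 0" "op T p y \<in> X"
  using arg_min_natI[of "%p. p ~= 0 & op T p y \<in> X" _ degree] ex by (auto simp: p_def)
 have min: "degree p <= degree q" if "q ~= 0" "op T q y \<in> X" for q
  unfolding p_def by (rule arg_min_nat_le) (use that in auto)
 have "degree p ~= 0"
 proof
  assume "degree p = 0"
  then obtain a where a: "p = [:a:]" by (rule degree_eq_zeroE)
  hence "scale a y \<in> X" using p by (simp add: op_pCons T lin_zero)
  hence "scale (inverse a) (scale a y) \<in> X" using X by (metis subspace_scale)
  thus False using a p y by simp
 qed
 hence "~ constant (poly p)" by (simp add: constant_degree)
 then obtain c where c: "poly p c = 0" using fundamental_theorem_of_algebra by blast
 then obtain q where q: "p = [:- c, 1:] * q" by (metis poly_eq_0_iff_dvd dvd_def)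
 have "q ~= 0" using q p by auto
 hence "degree p = Suc (degree q)" unfolding q by (subst degree_mult_eq) auto
 hence "op T q y \<notin> X" using min[of q] \<open>q ~= 0\<close> by auto
 moreover have "op T q y \<in> Y" by (rule op_in[OF T Y(1) inv(2) y(1)])
 moreover have "op T p y = T (op T q y) - scale c (op T q y)"
  unfolding q using op_add[OF T, of "smult (- c) q" "pCons 0 q" y]
  by (simp add: op_smult op_pCons T del: smult_minus_left)
 ultimately show ?thesis using p by auto
qed

text \<open>On an invariant \<open>Z\<close> of minimal dimension above \<open>X\<close> every
  operator is scalar modulo \<open>X\<close>, since its eigenspaces are invariant under the
  operators commuting with it.\<close>

lemma common_eigenvector_mod:
 assumes T: "!!a. a \<in> A ==> lin (T a)" and F: "finite F"
  and X: "subspace X" and Y: "subspace Y" "X \<subset> Y" "Y \<subseteq> span F"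
  and inv: "!!a x. a \<in> A ==> x \<in> X ==> T a x \<in> X" "!!a y. a \<in> A ==> y \<in> Y ==> T a y \<in> Y"
  and comm: "!!a b y. a \<in> A ==> b \<in> A ==> y \<in> Y ==> T a (T b y) - T b (T a y) \<in> X"
 shows "\<exists>w\<in>Y - X. \<forall>a\<in>A. \<exists>c. T a w - scale c w \<in> X"
proof -
 define P where "P Z \<longleftrightarrow> subspace Z & X \<subset> Z & Z \<subseteq> Y & (\<forall>a\<in>A. \<forall>z\<in>Z. T a z \<in> Z)" for Z
 have "P Y" using Y inv by (auto simp: P_def)
 define Z where "Z = arg_min dim P"
 have Z: "P Z" unfolding Z_def by (rule arg_min_natI) fact
 have min: "dim Z <= dim Z'" if "P Z'" for Z' unfolding Z_def by (rule arg_min_nat_le) fact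
 have Z': "subspace Z" "X \<subset> Z" "Z \<subseteq> Y" "!!a z. a \<in> A ==> z \<in> Z ==> T a z \<in> Z"
  using Z by (auto simp: P_def)
 have ZF: "Z \<subseteq> span F" using Z' Y by auto
 have "\<exists>c. \<forall>z\<in>Z. T a z - scale c z \<in> X" if a: "a \<in> A" for a
 proof -
  obtain w c where w: "w \<in> Z - X" "T a w - scale c w \<in> X"
   using eigenvector_mod[OF T[OF a] F X Z'(1,2) ZF inv(1)[OF a] Z'(4)[OF a]] by blast
  define E where "E = {z\<in>Z. T a z - scale c z \<in> X}"
  have sE: "subspace E" unfolding E_def by (rule subspace_eigen[OF T[OF a] X Z'(1)])
  have XE: "X \<subseteq> E" unfolding E_def
   using Z' inv(1)[OF a] X by (auto intro!: subspace_diff subspace_scale)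
  moreover have "w \<in> E" using w by (auto simp: E_def)
  ultimately have XE': "X \<subset> E" using w by auto
  have "T b z \<in> E" if b: "b \<in> A" and z: "z \<in> E" for b z
  proof -
   have zZ: "z \<in> Z" "T a z - scale c z \<in> X" using z by (auto simp: E_def)
   have "T b (T a z - scale c z) \<in> X" by (rule inv(1)[OF b zZ(2)])
   hence "T b (T a z) - scale c (T b z) \<in> X"
    using T[OF b] by (simp add: lin_diff lin_scale)
   moreover have "T a (T b z) - T b (T a z) \<in> X" using comm[OF a b] zZ Z' by auto
   ultimately have "(T a (T b z) - T b (T a z)) + (T b (T a z) - scale c (T b z)) \<in> X"
    using X by (intro subspace_add)
   thus ?thesis using Z'(4)[OF b zZ(1)] by (simp add: E_def)
  qed
  hence "P E" using sE XE' Z'(3) by (auto simp: P_def E_def)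
  hence "dim Z <= dim E" by (rule min)
  moreover have "E \<subseteq> Z" by (auto simp: E_def)
  ultimately have "E = Z" using dim_strict[OF F ZF sE Z'(1)] by auto
  thus ?thesis by (auto simp: E_def)
 qed
 moreover obtain w where "w \<in> Z" "w \<notin> X" using Z' by auto
 ultimately show ?thesis using Z'(3) by (meson DiffI subsetD)
qed

end

section \<open>Derived subgroups and stabilizers\<close>

definition der :: "'a::grp set => 'a set" where
 "der N = gen {cm a b |a b. a \<in> N & b \<in> N}"

lemma der_mono: "M \<subseteq> N ==> der M \<subseteq> der N"
 unfolding der_def by (rule gen_mono) auto

lemma funpow_der_mono: "M \<subseteq> N ==> (der ^^ k) M \<subseteq> (der ^^ k) N"
 by (induction k) (auto intro: der_mono[THEN subsetD])

lemma sg_der: "sg (der N)"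
 by (simp add: der_def sg_gen)

lemma sg_funpow_der: "sg N ==> sg ((der ^^ k) N)"
 by (cases k) (auto simp: sg_der)

lemma der_subset: "sg N ==> der N \<subseteq> N"
 unfolding der_def by (rule gen_least) (auto simp: cm_def intro!: sg_mult sg_iv)

lemma cm_conj: "cm (g * a * iv g) (g * b * iv g) = g * cm a b * iv (g::'a::grp)"
 by (simp add: cm_def mult.assoc)

lemma gen_conj: "x \<in> gen S ==> (!!s. s \<in> S ==> g * s * iv g \<in> S) ==> g * x * iv (g::'a::grp) \<in> gen S"
proof (induction rule: gen.induct)
 case one
 thus ?case by (simp add: gen.one)
next
 case (mult x s)
 hence "(g * x * iv g) * (g * s * iv g) \<in> gen S" by (blast intro: gen.mult)
 thus ?case by (simp add: mult.assoc)
next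
 case (mult_iv x s)
 hence "(g * x * iv g) * iv (g * s * iv g) \<in> gen S" by (blast intro: gen.mult_iv)
 thus ?case by (simp add: mult.assoc)
qed

lemma nrm_der: "nrm G N ==> nrm G (der N)"
 unfolding nrm_def der_def by (auto intro!: gen_conj) (metis cm_conj)

text \<open>Elements that produce the same translate of \<chi> on \<open>A\<close> differ by an
  element of the stabilizer, so a finite orbit means finite index.\<close>

lemma stabilizer_of_finite_orbit:
 fixes G :: "'g::grp set"
 assumes G: "sg G" and A: "nrm G A" and fin: "finite ((%g. restrict (%a. \<chi> (g * a * iv g)) A) ` G)"
  and H: "H = {g\<in>G. \<forall>a\<in>A. \<chi> (g * a * iv g) = \<chi> a}"
 shows "sg H" "fidx G H"
proof -
 have conj: "g * a * iv g \<in> A" "iv g * a * g \<in> A" if "g \<in> G" "a \<in> A" for g a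
  using nrmD[OF A that] nrmD'[OF A G that] by auto
 show "sg H"
 proof (rule sgI)
  show "1 \<in> H" using G by (simp add: H sg_one)
 next
  fix x y assume xy: "x \<in> H" "y \<in> H"
  have "\<chi> (x * y * a * iv (x * y)) = \<chi> a" if a: "a \<in> A" for a
  proof -
   have "\<chi> (x * (y * a * iv y) * iv x) = \<chi> (y * a * iv y)" using xy conj(1)[of y a] a by (auto simp: H)
   thus ?thesis using xy a by (simp add: H mult.assoc)
  qed
  thus "x * y \<in> H" using xy G by (auto simp: H sg_mult)
 next
  fix x assume x: "x \<in> H"
  have "\<chi> (iv x * a * iv (iv x)) = \<chi> a" if a: "a \<in> A" for a
  proof -
   have "\<chi> (x * (iv x * a * x) * iv x) = \<chi> (iv x * a * x)" using x conj(2)[of x a] a by (auto simp: H)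
   thus ?thesis by (simp add: mult.assoc)
  qed
  thus "iv x \<in> H" using x G by (auto simp: H sg_iv)
 qed
 show "fidx G H"
 proof (rule fidx_image[OF fin])
  fix g h assume gh: "g \<in> G" "h \<in> G" "restrict (%a. \<chi> (g * a * iv g)) A = restrict (%a. \<chi> (h * a * iv h)) A"
  have "\<chi> (g * iv h * a * iv (g * iv h)) = \<chi> a" if a: "a \<in> A" for a
   using fun_cong[OF gh(3), of "iv h * a * h"] conj(2)[OF gh(2) a] by (simp add: mult.assoc)
  thus "g * iv h \<in> H" using gh G by (simp add: H sg_mult sg_iv)
 qed
qed

locale complex_rep = complex_space scale
 for scale :: "complex => 'v::ab_group_add => 'v" +
 fixes act :: "'g::grp => 'v => 'v"
 assumes lin_act: "lin (act g)"
  and act_one [simp]: "act 1 v = v"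
  and act_mult: "act (g * h) v = act g (act h v)"
begin

lemma act_iv [simp]: "act g (act (iv g) v) = v" "act (iv g) (act g v) = v"
 by (simp_all add: act_mult[symmetric])

lemma act_diff: "act g (x - y) = act g x - act g y"
 by (rule lin_diff[OF lin_act])

lemma act_scale: "act g (scale c x) = scale c (act g x)"
 by (rule lin_scale[OF lin_act])

end

text \<open>\<open>Y / X\<close> is irreducible under every subgroup of finite index of \<open>G\<close>. Then normal solvable
 subgroups act by scalars.\<close>

locale irred = complex_rep scale act
 for scale :: "complex => 'v::ab_group_add => 'v" and act :: "'g::grp => 'v => 'v" +
 fixes F X Y G
 assumes F: "finite F" and X: "subspace X" and Y: "subspace Y" and XY: "X \<subset> Y" and YF: "Y \<subseteq> span F"
  and G: "sg G"
  and invX: "!!g x. g \<in> G ==> x \<in> X ==> act g x \<in> X"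
  and invY: "!!g y. g \<in> G ==> y \<in> Y ==> act g y \<in> Y"
  and irr: "!!H Z. sg H ==> H \<subseteq> G ==> fidx G H ==> subspace Z ==> X \<subset> Z ==> Z \<subseteq> Y ==>
   (!!g z. g \<in> H ==> z \<in> Z ==> act g z \<in> Z) ==> Z = Y"
begin

definition eqX (infix "\<approx>" 50) where "x \<approx> y \<longleftrightarrow> x - y \<in> X"

lemma eqX_refl [simp]: "x \<approx> x"
 using X by (simp add: eqX_def subspace_0)

lemma eqX_sym: "x \<approx> y ==> y \<approx> x"
 using subspace_neg[OF X, of "x - y"] by (simp add: eqX_def)

lemma eqX_trans [trans]: "x \<approx> y ==> y \<approx> z ==> x \<approx> z"
 using subspace_add[OF X, of "x - y" "y - z"] by (simp add: eqX_def)

lemma eqX_eq_trans [trans]: "x \<approx> y ==> y = z ==> x \<approx> z" "x = y ==> y \<approx> z ==> x \<approx> z"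
 by simp_all

lemma eqX_scale: "x \<approx> y ==> scale c x \<approx> scale c y"
 using subspace_scale[OF X, of "x - y" c] by (simp add: eqX_def scale_right_diff_distrib)

lemma eqX_scale_cancel: "c ~= 0 ==> scale c x \<approx> scale c y ==> x \<approx> y"
 using eqX_scale[of "scale c x" "scale c y" "inverse c"] by simp

lemma eqX_act: "g \<in> G ==> x \<approx> y ==> act g x \<approx> act g y"
 using invX[of g "x - y"] by (simp add: eqX_def act_diff)

lemma eqX_act_cancel: "g \<in> G ==> act g x \<approx> act g y ==> x \<approx> y"
 using eqX_act[of "iv g" "act g x" "act g y"] G by (simp add: sg_iv)

lemma YX: "X \<subseteq> Y" using XY by auto

lemma act_notin: "g \<in> G ==> w \<notin> X ==> act g w \<notin> X"
 using invX[of "iv g" "act g w"] G by (auto simp: sg_iv)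

definition sc :: "'g set => bool" where
 "sc B \<longleftrightarrow> (\<forall>b\<in>B. \<exists>c. \<forall>y\<in>Y. act b y \<approx> scale c y)"

lemma scalar_unique:
 assumes "!!y. y \<in> Y ==> scale c y \<approx> scale d y"
 shows "c = d"
proof (rule ccontr)
 assume "c ~= d"
 obtain y where y: "y \<in> Y" "y \<notin> X" using XY by auto
 have "scale (c - d) y \<in> X" using assms[OF y(1)] by (simp add: eqX_def scale_left_diff_distrib)
 hence "scale (inverse (c - d)) (scale (c - d) y) \<in> X" by (rule subspace_scale[OF X])
 thus False using y \<open>c ~= d\<close> by simp
qed

text \<open>Conjugation by G permutes the finitely many weights of \<open>A\<close> on Y/X. The
  stabilizer of one weight has finite index and preserves its eigenspace, which by irreducibility is
  all of \<open>Y\<close>.\<close>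

lemma commuting_scalar:
 assumes A: "A \<subseteq> G" "nrm G A"
  and comm: "!!a b y. a \<in> A ==> b \<in> A ==> y \<in> Y ==> act a (act b y) \<approx> act b (act a y)"
 shows "sc A"
proof -
 have "\<exists>w\<in>Y - X. \<forall>a\<in>A. \<exists>c. act a w - scale c w \<in> X"
  by (rule common_eigenvector_mod[OF lin_act F X Y XY YF])
   (use A comm invX invY in \<open>auto simp: eqX_def\<close>)
 then obtain w where w: "w \<in> Y" "w \<notin> X" "\<forall>a\<in>A. \<exists>c. act a w \<approx> scale c w"
  by (auto simp: eqX_def)
 then obtain \<chi> where \<chi>: "!!a. a \<in> A ==> act a w \<approx> scale (\<chi> a) w" by metis
 define E where "E = {y\<in>Y. \<forall>a\<in>A. act a y - scale (\<chi> a) y \<in> X}"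
 define tw where "tw g = restrict (%a. \<chi> (g * a * iv g)) A" for g
 have conj: "g * a * iv g \<in> A" "iv g * a * g \<in> A" if "g \<in> G" "a \<in> A" for g a
  using nrmD[OF A(2) that] nrmD'[OF A(2) G that] by auto
 have "tw ` G \<subseteq> {\<chi> \<in> extensional A. \<exists>w\<in>span F - X. \<forall>a\<in>A. act a w - scale (\<chi> a) w \<in> X}"
 proof safe
  fix g assume g: "g \<in> G"
  hence g': "iv g \<in> G" using G by (simp add: sg_iv)
  show "tw g \<in> extensional A" by (simp add: tw_def)
  show "\<exists>w\<in>span F - X. \<forall>a\<in>A. act a w - scale (tw g a) w \<in> X"
  proof (intro bexI[of _ "act (iv g) w"] ballI)
   show "act (iv g) w \<in> span F - X" using invY[OF g' w(1)] YF act_notin[OF g' w(2)] by auto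
   fix a assume a: "a \<in> A"
   have "act a (act (iv g) w) = act (iv g) (act (g * a * iv g) w)" by (simp add: act_mult)
   also have "\<dots> \<approx> act (iv g) (scale (\<chi> (g * a * iv g)) w)"
    by (rule eqX_act[OF g' \<chi>[OF conj(1)[OF g a]]])
   also have "\<dots> = scale (tw g a) (act (iv g) w)" using a by (simp add: tw_def act_scale)
   finally show "act a (act (iv g) w) - scale (tw g a) (act (iv g) w) \<in> X" by (simp add: eqX_def)
  qed
 qed
 moreover have "finite {\<chi> \<in> extensional A. \<exists>w\<in>span F - X. \<forall>a\<in>A. act a w - scale (\<chi> a) w \<in> X}"
  by (rule finite_weights[OF X F lin_act]) (use A invX in auto)
 ultimately have fin: "finite (tw ` G)" by (rule finite_subset)
 define H where "H = {g\<in>G. \<forall>a\<in>A. \<chi> (g * a * iv g) = \<chi> a}"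
 note H = stabilizer_of_finite_orbit[OF G A(2) fin[unfolded tw_def] H_def]
 have "E = Y"
 proof (rule irr[OF H(1) _ H(2)])
  show "H \<subseteq> G" by (auto simp: H_def)
  show "subspace E" unfolding E_def by (rule subspace_Inter_eigen[OF lin_act X Y])
  have "X \<subseteq> E" unfolding E_def
   using YX A(1) invX X by (auto intro!: subspace_diff subspace_scale)
  moreover have "w \<in> E" using w \<chi> by (auto simp: E_def eqX_def)
  ultimately show "X \<subset> E" using w by auto
  show "E \<subseteq> Y" by (auto simp: E_def)
  fix g z assume g: "g \<in> H" and z: "z \<in> E"
  have gG: "g \<in> G" using g by (auto simp: H_def)
  have "act a (act g z) \<approx> scale (\<chi> a) (act g z)" if a: "a \<in> A" for a
  proof -
   have "act a (act g z) = act g (act (iv g * a * g) z)" by (simp add: act_mult)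
   also have "\<dots> \<approx> act g (scale (\<chi> (iv g * a * g)) z)"
    by (rule eqX_act[OF gG]) (use z conj(2)[OF gG a] in \<open>auto simp: E_def eqX_def\<close>)
   also have "\<dots> = scale (\<chi> a) (act g z)"
   proof -
    have "\<chi> (g * (iv g * a * g) * iv g) = \<chi> (iv g * a * g)"
     using g conj(2)[OF gG a] by (auto simp: H_def)
    thus ?thesis by (simp add: mult.assoc act_scale)
   qed
   finally show ?thesis .
  qed
  thus "act g z \<in> E" using invY[OF gG] z by (auto simp: E_def eqX_def)
 qed
 thus ?thesis by (auto simp: sc_def E_def eqX_def)
qed

text \<open>Since a b a^-1 = [a, b] b, the operator b is a weight vector for conjugation by
  \<open>B\<close> on End(Y/X), with weight lam(., b). This space has finite dimension, so only
  finitely many weights occur.\<close>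

lemma finite_commutator_weights:
 assumes B: "sg B" "B \<subseteq> G"
  and lam: "!!a b y. a \<in> B ==> b \<in> B ==> y \<in> Y ==> act (cm a b) y \<approx> scale (lam a b) y"
 shows "finite ((%b. restrict (%a. lam a b) B) ` B)"
proof (rule ccontr)
 interpret fs: vspace "%c (f :: 'v => 'v) x. scale c (f x)"
  by unfold_locales (simp_all only: fun_eq_iff plus_fun_apply scale_right_distrib scale_left_distrib scale_scale scale_one simp_thms)
 let ?W = "(%b. restrict (%a. lam a b) B) ` B"
 assume "infinite ?W"
 obtain E where E: "E \<subseteq> Y" "independent E" "Y \<subseteq> span E" "card E = dim Y"
  by (rule basis_exists)
 have "E \<subseteq> span F" using E(1) YF by auto
 hence fE: "finite E" using independent_span_bound[OF F E(2)] by simp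
 \<comment> \<open>Operators are restricted to a basis \<open>E\<close> of \<open>Y\<close> and
   extended by zero, which places them in a function space of finite dimension: \<open>D\<close>
   spans the functions from \<open>E\<close> to the span of \<open>F\<close>.\<close>
 define D where "D = (%(e, f) x. if x = e then f else 0) ` (E \<times> F)"
 have fD: "finite D" using fE F by (simp add: D_def)
 obtain S where S: "finite S" "card S = Suc (card D)" "S \<subseteq> ?W"
  using infinite_arbitrarily_large[OF \<open>infinite ?W\<close>] by blast
 hence "\<forall>\<chi>\<in>S. \<exists>b. b \<in> B & \<chi> = restrict (%a. lam a b) B" by auto
 then obtain b where b: "!!\<chi>. \<chi> \<in> S ==> b \<chi> \<in> B & \<chi> = restrict (%a. lam a (b \<chi>)) B" by metis
 have BG: "x \<in> B ==> x \<in> G" "x \<in> B ==> iv x \<in> G" for x using B G by (auto simp: sg_iv)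
 define X' where "X' = {M. \<forall>y\<in>Y. M y \<in> X}"
 have X': "fs.subspace X'"
  using X by (auto simp: X'_def fs.subspace_def subspace_0 subspace_add subspace_scale)
 define T where "T a M = (%v. act a (M (act (iv a) v)))" for a and M :: "'v => 'v"
 have T: "fs.lin (T a)" for a
  by (auto simp: fs.lin_def T_def lin_add[OF lin_act] act_scale)
 have TX: "T a M \<in> X'" if "a \<in> B" "M \<in> X'" for a M
  using that BG by (auto simp: X'_def T_def invX invY)
 define r where "r \<chi> = (%e. if e \<in> E then act (b \<chi>) e else 0)" for \<chi>
 have "inj_on r S & fs.independent (r ` S)"
 proof (rule fs.independent_if_independent_mod[OF S(1)])
  fix c \<psi> assume c: "(\<Sum>\<chi>\<in>S. (%x. scale (c \<chi>) (r \<chi> x))) = 0" and \<psi>: "\<psi> \<in> S"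
  \<comment> \<open>A relation on the basis extends to \<open>Y\<close> by linearity. The weight
    argument needs it on all of \<open>Y\<close>, because conjugation moves the basis.\<close>
  have zero: "(\<Sum>\<chi>\<in>S. scale (c \<chi>) (act (b \<chi>) y)) = 0" if "y \<in> Y" for y
  proof -
   have "(\<Sum>\<chi>\<in>S. scale (c \<chi>) (act (b \<chi>) y)) \<in> {0}"
   proof (rule lin_span[where T = "%y. \<Sum>\<chi>\<in>S. scale (c \<chi>) (act (b \<chi>) y)"])
    show "lin (%y. \<Sum>\<chi>\<in>S. scale (c \<chi>) (act (b \<chi>) y))"
     by (auto simp: lin_def lin_add[OF lin_act] act_scale scale_right_distrib sum.distrib
       scale_sum_right mult.commute)
    show "y \<in> span E" using that E by auto
    fix e assume "e \<in> E"
    thus "(\<Sum>\<chi>\<in>S. scale (c \<chi>) (act (b \<chi>) e)) \<in> {0}"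
     using fun_cong[OF c, of e] by (simp add: r_def sum_fun_app)
   qed (simp add: subspace_single_0)
   thus ?thesis by simp
  qed
  have "(%y. scale (c \<psi>) (act (b \<psi>) y)) \<in> X'"
  proof (rule fs.weights_independent[OF X' T TX S(1), where w = "%\<chi> y. scale (c \<chi>) (act (b \<chi>) y)"])
   fix \<chi> \<phi> assume "\<chi> \<in> S" "\<phi> \<in> S" "\<chi> ~= \<phi>"
   hence "\<chi> \<in> extensional B" "\<phi> \<in> extensional B" using S(3) by auto
   thus "\<exists>a\<in>B. \<chi> a ~= \<phi> a" using \<open>\<chi> ~= \<phi>\<close> by (metis extensionalityI)
  next
   fix \<chi> a assume \<chi>: "\<chi> \<in> S" and a: "a \<in> B"
   have "act a (scale (c \<chi>) (act (b \<chi>) (act (iv a) y))) \<approx> scale (\<chi> a) (scale (c \<chi>) (act (b \<chi>) y))"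
    if y: "y \<in> Y" for y
   proof -
    have "act a (act (b \<chi>) (act (iv a) y)) = act (cm a (b \<chi>)) (act (b \<chi>) y)"
     by (simp add: cm_def act_mult)
    also have "\<dots> \<approx> scale (lam a (b \<chi>)) (act (b \<chi>) y)"
     using lam[OF a] b[OF \<chi>] y BG invY by blast
    also have "lam a (b \<chi>) = \<chi> a" using b[OF \<chi>] a by (metis restrict_apply')
    finally have "scale (c \<chi>) (act a (act (b \<chi>) (act (iv a) y))) \<approx> scale (c \<chi>) (scale (\<chi> a) (act (b \<chi>) y))"
     by (rule eqX_scale)
    thus ?thesis by (simp add: act_scale mult.commute)
   qed
   thus "T a (%y. scale (c \<chi>) (act (b \<chi>) y)) - (%y. scale (\<chi> a) (scale (c \<chi>) (act (b \<chi>) y))) \<in> X'"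
    by (simp add: X'_def T_def eqX_def)
  next
   have "(\<Sum>\<chi>\<in>S. (%y. scale (c \<chi>) (act (b \<chi>) y))) y = 0" if "y \<in> Y" for y
    using zero[OF that] by (simp add: sum_fun_app)
   thus "(\<Sum>\<chi>\<in>S. (%y. scale (c \<chi>) (act (b \<chi>) y))) \<in> X'"
    using X by (auto simp: X'_def subspace_0)
  qed (use \<psi> in auto)
  moreover obtain y where y: "y \<in> Y" "y \<notin> X" using XY by auto
  ultimately have in_X: "scale (c \<psi>) (act (b \<psi>) y) \<in> X" by (auto simp: X'_def)
  show "c \<psi> = 0"
  proof (rule ccontr)
   assume "c \<psi> ~= 0"
   hence "scale (inverse (c \<psi>)) (scale (c \<psi>) (act (b \<psi>) y)) = act (b \<psi>) y" by simp
   hence "act (b \<psi>) y \<in> X" using in_X X by (metis subspace_scale)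
   thus False using act_notin y b[OF \<psi>] BG by blast
  qed
 qed
 moreover have "r \<chi> \<in> fs.span D" if "\<chi> \<in> S" for \<chi>
 proof -
  have "(%x. if x = e then v else 0) \<in> fs.span D" if "e \<in> E" "v \<in> span F" for e v
   using that(2)
  proof (induction rule: span_induct_alt)
   case base
   thus ?case using fs.span_zero[of D] by (simp add: zero_fun_def)
  next
   case (step c x y)
   have "(%z. if z = e then x else 0) \<in> fs.span D"
    by (rule fs.span_base) (use step that(1) in \<open>force simp: D_def\<close>)
   from fs.span_add[OF fs.span_scale[OF this, of c] step(2)]
   show ?case by (rule back_subst[of "%f. f \<in> fs.span D"]) (auto simp: fun_eq_iff)
  qed
  moreover have "act (b \<chi>) e \<in> span F" if "e \<in> E" for e
   using E that b[OF \<open>\<chi> \<in> S\<close>] BG invY YF by blast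
  ultimately have "(\<Sum>e\<in>E. (%x. if x = e then act (b \<chi>) e else 0)) \<in> fs.span D"
   by (intro fs.span_sum) auto
  moreover have "(\<Sum>e\<in>E. (%x. if x = e then act (b \<chi>) e else 0)) = r \<chi>"
   using fE by (auto simp: fun_eq_iff r_def sum_fun_app)
  ultimately show ?thesis by simp
 qed
 ultimately have "card (r ` S) <= card D" "card (r ` S) = card S"
  using fs.independent_span_bound[OF fD, of "r ` S"] by (auto simp: card_image)
 thus False using S(2) by simp
qed

text \<open>For g in a subgroup of finite index, b^-1 (g b g^-1) is central in \<open>B\<close>
  modulo X, and the centre acts by scalars by \<open>commuting_scalar\<close>. So such g multiply b
  by scalars, which permute its finitely many eigenvalues; a smaller subgroup of finite index
  preserves an eigenspace of b, and irreducibility applies.\<close>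

lemma class_two_scalar:
 assumes B: "sg B" "B \<subseteq> G" "nrm G B"
  and c: "!!a b. a \<in> B ==> b \<in> B ==> \<exists>c. \<forall>y\<in>Y. act (cm a b) y \<approx> scale c y"
 shows "sc B"
proof -
 obtain lam where lam: "!!a b y. a \<in> B ==> b \<in> B ==> y \<in> Y ==> act (cm a b) y \<approx> scale (lam a b) y"
  using c by metis
 have BG: "x \<in> B ==> x \<in> G" "x \<in> B ==> iv x \<in> G" for x using B G by (auto simp: sg_iv)
 have GI: "x \<in> G ==> iv x \<in> G" for x using G by (simp add: sg_iv)
 have conj: "g * a * iv g \<in> B" "iv g * a * g \<in> B" if "g \<in> G" "a \<in> B" for g a
  using nrmD[OF B(3) that] nrmD'[OF B(3) G that] by auto
 have lam': "act (a * b * iv a) y \<approx> scale (lam a b) (act b y)" if "a \<in> B" "b \<in> B" "y \<in> Y" for a b y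
 proof -
  have "act (a * b * iv a) y = act (cm a b) (act b y)" by (simp add: cm_def act_mult)
  also have "\<dots> \<approx> scale (lam a b) (act b y)" using lam that BG invY by blast
  finally show ?thesis .
 qed
 have lam_conj: "lam a (g * b * iv g) = lam (iv g * a * g) b" if "g \<in> G" "a \<in> B" "b \<in> B" for g a b
 proof (rule scalar_unique)
  fix y assume y: "y \<in> Y"
  have "scale (lam a (g * b * iv g)) y \<approx> act (cm a (g * b * iv g)) y"
   by (rule eqX_sym[OF lam]) (use that y conj in auto)
  also have "cm a (g * b * iv g) = g * cm (iv g * a * g) b * iv g"
   by (simp add: cm_conj[symmetric] mult.assoc) (simp add: cm_def mult.assoc)
  also have "act (g * cm (iv g * a * g) b * iv g) y = act g (act (cm (iv g * a * g) b) (act (iv g) y))"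
   by (simp add: act_mult)
  also have "\<dots> \<approx> act g (scale (lam (iv g * a * g) b) (act (iv g) y))"
   by (intro eqX_act lam invY GI that conj y)
  also have "\<dots> = scale (lam (iv g * a * g) b) y" by (simp add: act_scale)
  finally show "scale (lam a (g * b * iv g)) y \<approx> scale (lam (iv g * a * g) b) y" .
 qed
 define Z where "Z = {z\<in>B. \<forall>b\<in>B. \<forall>y\<in>Y. act b (act z y) \<approx> act z (act b y)}"
 have "nrm G Z"
  unfolding nrm_def
 proof (intro ballI)
  fix g z assume g: "g \<in> G" and z: "z \<in> Z"
  have zB: "z \<in> B" using z by (simp add: Z_def)
  have "act b (act (g * z * iv g) y) \<approx> act (g * z * iv g) (act b y)" if b: "b \<in> B" and y: "y \<in> Y" for b y
  proof -
   have "act b (act (g * z * iv g) y) = act g (act (iv g * b * g) (act z (act (iv g) y)))"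
    by (simp add: act_mult)
   also have "\<dots> \<approx> act g (act z (act (iv g * b * g) (act (iv g) y)))"
    using z conj(2)[OF g b] invY[OF GI[OF g] y] by (intro eqX_act g) (auto simp: Z_def)
   also have "\<dots> = act (g * z * iv g) (act b y)" by (simp add: act_mult)
   finally show ?thesis .
  qed
  thus "g * z * iv g \<in> Z" using conj(1)[OF g zB] by (simp add: Z_def)
 qed
 hence scZ: "sc Z" by (rule commuting_scalar[rotated]) (use BG in \<open>auto simp: Z_def\<close>)
 have "\<exists>c. \<forall>y\<in>Y. act b y \<approx> scale c y" if b: "b \<in> B" for b
 proof -
  have bG: "b \<in> G" by (rule BG[OF b])
  define f where "f g = restrict (%a. lam a (iv g * b * g)) B" for g
  have "f ` G \<subseteq> (%b. restrict (%a. lam a b) B) ` B" using conj(2)[OF _ b] by (auto simp: f_def)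
  hence finf: "finite (f ` G)" by (rule finite_subset[OF _ finite_commutator_weights[OF B(1,2) lam]])
  have "f g = restrict (%a. lam (g * a * iv g) b) B" if "g \<in> G" for g
   using lam_conj[OF GI[OF that] _ b] by (auto simp: f_def restrict_def fun_eq_iff)
  hence "(%g. restrict (%a. lam (g * a * iv g) b) B) ` G = f ` G" by (intro image_cong) auto
  hence fin: "finite ((%g. restrict (%a. lam (g * a * iv g) b) B) ` G)" using finf by simp
  define S where "S = {g\<in>G. \<forall>a\<in>B. lam (g * a * iv g) b = lam a b}"
  have SG: "S \<subseteq> G" by (auto simp: S_def)
  have sS: "sg S" and fS: "fidx G S"
   using stabilizer_of_finite_orbit[of G B "%a. lam a b" S, OF G B(3) fin] by (auto simp: S_def)
  have "\<exists>\<mu>. \<forall>y\<in>Y. act (g * b * iv g) y \<approx> scale \<mu> (act b y)" if g: "g \<in> S" for g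
  proof -
   have gG: "g \<in> G" using g SG by auto
   define d where "d = g * b * iv g"
   have d: "d \<in> B" unfolding d_def by (rule conj(1)[OF gG b])
   define z where "z = iv b * d"
   have zB: "z \<in> B" unfolding z_def using b d B by (auto intro!: sg_mult sg_iv)
   have "act a (act z y) \<approx> act z (act a y)" if a: "a \<in> B" and y: "y \<in> Y" for a y
   proof -
    have aY: "act a y \<in> Y" using BG a y invY by blast
    have zY: "act z (act a y) \<in> Y" using BG zB aY invY by blast
    have pG: "a * b * iv a \<in> G" using a b BG G by (auto intro!: sg_mult)
    have lamd: "lam a d = lam a b"
     using lam_conj[OF gG a b] sg_iv[OF sS g] a by (simp add: d_def S_def)
    have "act (a * b * iv a) (act a (act z y)) = act (a * d * iv a) (act a y)"
     by (simp add: z_def act_mult)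
    also have "\<dots> \<approx> scale (lam a b) (act d (act a y))"
     using lam'[OF a d aY] lamd by simp
    also have "\<dots> = scale (lam a b) (act b (act z (act a y)))" by (simp add: z_def act_mult)
    also have "\<dots> \<approx> act (a * b * iv a) (act z (act a y))" by (rule eqX_sym[OF lam'[OF a b zY]])
    finally show ?thesis by (rule eqX_act_cancel[OF pG])
   qed
   hence "z \<in> Z" using zB by (simp add: Z_def)
   then obtain \<mu> where \<mu>: "!!y. y \<in> Y ==> act z y \<approx> scale \<mu> y" using scZ unfolding sc_def by blast
   have "act d y \<approx> scale \<mu> (act b y)" if "y \<in> Y" for y
    using eqX_act[OF bG \<mu>[OF that]] by (simp add: z_def act_mult act_scale)
   thus ?thesis unfolding d_def by blast
  qed
  then obtain \<mu> where \<mu>: "!!g y. g \<in> S ==> y \<in> Y ==> act (g * b * iv g) y \<approx> scale (\<mu> g) (act b y)"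
   by metis
  have \<mu>0: "\<mu> g ~= 0" if g: "g \<in> S" for g
  proof
   assume "\<mu> g = 0"
   obtain y where y: "y \<in> Y" "y \<notin> X" using XY by auto
   have "act (g * b * iv g) y \<in> X" using \<mu>[OF g y(1)] \<open>\<mu> g = 0\<close> by (simp add: eqX_def)
   moreover have "g * b * iv g \<in> G" using g SG conj(1)[OF _ b] BG by blast
   ultimately show False using act_notin y by blast
  qed
  obtain w c where w: "w \<in> Y - X" "act b w - scale c w \<in> X"
   using eigenvector_mod[OF lin_act F X Y XY YF invX[OF bG] invY[OF bG]] by blast
  define E where "E d = {y\<in>Y. act b y - scale d y \<in> X}" for d
  have to: "act (iv g) y \<in> E (\<mu> g * c)" if g: "g \<in> S" and y: "y \<in> E c" for g y
  proof -
   have gG: "g \<in> G" "iv g \<in> G" using g SG GI by auto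
   have yY: "y \<in> Y" "act b y \<approx> scale c y" using y by (auto simp: E_def eqX_def)
   have "act b (act (iv g) y) = act (iv g) (act (g * b * iv g) y)" by (simp add: act_mult)
   also have "\<dots> \<approx> act (iv g) (scale (\<mu> g) (act b y))" by (rule eqX_act[OF gG(2) \<mu>[OF g yY(1)]])
   also have "\<dots> \<approx> act (iv g) (scale (\<mu> g) (scale c y))" by (intro eqX_act gG eqX_scale yY)
   also have "\<dots> = scale (\<mu> g * c) (act (iv g) y)" by (simp add: act_scale)
   finally show ?thesis using invY[OF gG(2) yY(1)] by (simp add: E_def eqX_def)
  qed
  have fro: "act g y \<in> E c" if g: "g \<in> S" and y: "y \<in> E (\<mu> g * c)" for g y
  proof -
   have gG: "g \<in> G" using g SG by auto
   have yY: "y \<in> Y" "act b y \<approx> scale (\<mu> g * c) y" using y by (auto simp: E_def eqX_def)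
   have gY: "act g y \<in> Y" by (rule invY[OF gG yY(1)])
   have "scale (\<mu> g) (act b (act g y)) \<approx> act (g * b * iv g) (act g y)" by (rule eqX_sym[OF \<mu>[OF g gY]])
   also have "\<dots> = act g (act b y)" by (simp add: act_mult)
   also have "\<dots> \<approx> act g (scale (\<mu> g * c) y)" by (rule eqX_act[OF gG yY(2)])
   also have "\<dots> = scale (\<mu> g) (scale c (act g y))" by (simp add: act_scale)
   finally have "act b (act g y) \<approx> scale c (act g y)" by (rule eqX_scale_cancel[OF \<mu>0[OF g]])
   thus ?thesis using gY by (simp add: E_def eqX_def)
  qed
  define H where "H = {g\<in>S. \<forall>y\<in>E c. act g y \<in> E c & act (iv g) y \<in> E c}"
  have sH: "sg H"
   by (rule sgI) (use sS in \<open>auto simp: H_def sg_one sg_mult sg_iv act_mult\<close>)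
  have wE: "w \<in> E c" using w by (simp add: E_def)
  have fin: "finite ((%g. \<mu> g * c) ` S)"
  proof -
   let ?D = "{\<chi> \<in> extensional {b}. \<exists>w\<in>span F - X. \<forall>a\<in>{b}. act a w - scale (\<chi> a) w \<in> X}"
   have "finite ?D" by (rule finite_weights[OF X F lin_act]) (use invX bG in auto)
   hence "finite ((%\<chi>. \<chi> b) ` ?D)" by simp
   moreover have "(%g. \<mu> g * c) ` S \<subseteq> (%\<chi>. \<chi> b) ` ?D"
   proof safe
    fix g assume g: "g \<in> S"
    have "act (iv g) w \<in> span F - X" "act b (act (iv g) w) - scale (\<mu> g * c) (act (iv g) w) \<in> X"
     using to[OF g wE] YF act_notin[of "iv g" w] g SG GI w by (auto simp: E_def)
    thus "\<mu> g * c \<in> (%\<chi>. \<chi> b) ` ?D"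
     by (intro image_eqI[of _ _ "restrict (%_. \<mu> g * c) {b}"]) auto
   qed
   ultimately show ?thesis by (rule rev_finite_subset)
  qed
  have "fidx S H"
  proof (rule fidx_image[OF fin])
   fix g h assume gh: "g \<in> S" "h \<in> S" "\<mu> g * c = \<mu> h * c"
   have "act (g * iv h) y \<in> E c" "act (iv (g * iv h)) y \<in> E c" if y: "y \<in> E c" for y
    using fro[OF gh(1), of "act (iv h) y"] fro[OF gh(2), of "act (iv g) y"]
     to[OF gh(1) y] to[OF gh(2) y] gh(3) by (auto simp: act_mult)
   thus "g * iv h \<in> H" using gh sS by (simp add: H_def sg_mult sg_iv)
  qed
  hence fH: "fidx G H" by (rule fidx_trans[OF fS])
  have "E c = Y"
  proof (rule irr[OF sH _ fH])
   show "H \<subseteq> G" using SG by (auto simp: H_def)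
   show "subspace (E c)" unfolding E_def by (rule subspace_eigen[OF lin_act X Y])
   have "X \<subseteq> E c" unfolding E_def
    using YX invX[OF bG] X by (auto intro!: subspace_diff subspace_scale)
   thus "X \<subset> E c" using w wE by auto
   show "E c \<subseteq> Y" by (auto simp: E_def)
  qed (auto simp: H_def)
  thus ?thesis by (intro exI[of _ c]) (auto simp: E_def eqX_def)
 qed
 thus ?thesis by (simp add: sc_def)
qed

text \<open>Induction on the derived length: when the derived subgroup acts by scalars,
  \<open>class_two_scalar\<close> applies to \<open>N\<close>.\<close>

lemma solvable_scalar:
 "sg N ==> N \<subseteq> G ==> nrm G N ==> (der ^^ k) N = {1} ==> sc N"
proof (induction k arbitrary: N)
 case 0
 thus ?case by (auto simp: sc_def intro: exI[of _ 1])
next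
 case (Suc k)
 have "sc (der N)"
 proof (rule Suc.IH)
  show "sg (der N)" by (rule sg_der)
  show "der N \<subseteq> G" using der_subset[OF Suc.prems(1)] Suc.prems(2) by auto
  show "nrm G (der N)" by (rule nrm_der[OF Suc.prems(3)])
  show "(der ^^ k) (der N) = {1}" using Suc.prems(4) by (simp only: funpow_Suc_right o_def)
 qed
 moreover have "cm a b \<in> der N" if "a \<in> N" "b \<in> N" for a b
  unfolding der_def using that by (intro gen_incl) auto
 ultimately show ?case using Suc.prems by (intro class_two_scalar) (auto simp: sc_def)
qed

end

context complex_rep
begin

text \<open>\<open>Y\<close> has minimal dimension among all subspaces above \<open>X\<close> that
  are invariant under some subgroup of finite index. Then Y/X is irreducible for every smaller
  subgroup of finite index, so N \<inter> H acts on it by scalars, and any vector of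
  \<open>Y\<close> outside \<open>X\<close> extends the flag.\<close>

theorem malcev:
 assumes F: "finite F" and sG: "sg G" and inv: "!!g x. g \<in> G ==> x \<in> span F ==> act g x \<in> span F"
  and N: "sg N" "N \<subseteq> G" "nrm G N" "fidx G N" "(der ^^ k) N = {1}"
 shows "\<exists>G1 ws. sg G1 & G1 \<subseteq> G & fidx G G1 & flag act G1 ws & span (set ws) = span F"
proof -
 define Q where "Q G1 \<longleftrightarrow> sg G1 & G1 \<subseteq> G & fidx G G1" for G1
 have "\<exists>G1 ws. Q G1 & G1 \<subseteq> G & flag act G1 ws & span (set ws) = span F"
 proof (rule flag_exists[OF F])
  show "Q G" using sG fidx_refl by (simp add: Q_def)
  fix G' X assume G': "Q G'" and X: "subspace X" "X \<subset> span F"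
   and invX: "!!g x. g \<in> G' ==> x \<in> X ==> act g x \<in> X"
  define P where "P Y \<longleftrightarrow> subspace Y & X \<subset> Y & Y \<subseteq> span F &
   (\<exists>H. Q H & H \<subseteq> G' & (\<forall>g\<in>H. \<forall>y\<in>Y. act g y \<in> Y))" for Y
  have "P (span F)" unfolding P_def
   by (intro conjI X exI[of _ G'] G') (use G' inv in \<open>auto simp: Q_def\<close>)
  define Y where "Y = arg_min dim P"
  have Y: "P Y" unfolding Y_def by (rule arg_min_natI) fact
  have min: "dim Y <= dim Z" if "P Z" for Z unfolding Y_def by (rule arg_min_nat_le) fact
  obtain H where H: "Q H" "H \<subseteq> G'" "\<forall>g\<in>H. \<forall>y\<in>Y. act g y \<in> Y" using Y by (auto simp: P_def)
  interpret irred scale act F X Y H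
  proof
   fix K Z assume K: "sg K" "K \<subseteq> H" "fidx H K" and Z: "subspace Z" "X \<subset> Z" "Z \<subseteq> Y"
    "!!g z. g \<in> K ==> z \<in> Z ==> act g z \<in> Z"
   have "Q K" using K H fidx_trans[of G H K] by (auto simp: Q_def)
   hence "P Z" unfolding P_def
    by (intro conjI exI[of _ K]) (use K Z H Y in \<open>auto simp: P_def\<close>)
   hence "dim Y <= dim Z" by (rule min)
   thus "Z = Y" using dim_strict[OF F _ Z(1), of Y] Z(3) Y by (auto simp: P_def)
  qed (use F X Y H invX in \<open>auto simp: P_def Q_def\<close>)
  have scNH: "sc (N \<inter> H)"
  proof (rule solvable_scalar)
   show "sg (N \<inter> H)" using N H by (auto simp: Q_def intro: sg_Int)
   show "nrm H (N \<inter> H)"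
    unfolding nrm_def
   proof (intro ballI IntI)
    fix g n assume gn: "g \<in> H" "n \<in> N \<inter> H"
    thus "g * n * iv g \<in> N" using H by (intro nrmD[OF N(3)]) (auto simp: Q_def)
    show "g * n * iv g \<in> H" using gn H by (intro sg_mult sg_iv) (auto simp: Q_def)
   qed
   have "(der ^^ k) (N \<inter> H) \<subseteq> {1}" using funpow_der_mono[of "N \<inter> H" N k] N(5) by auto
   thus "(der ^^ k) (N \<inter> H) = {1}"
    using sg_one[OF sg_funpow_der[OF \<open>sg (N \<inter> H)\<close>]] by auto
  qed auto
  have "Q (N \<inter> H)"
   using fidx_inter[OF sG N(1) _ N(2) N(4), of H] H N by (auto simp: Q_def intro: sg_Int)
  moreover obtain w where w: "w \<in> Y" "w \<notin> X" using XY by auto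
  moreover have "\<exists>c. act g w - scale c w \<in> X" if "g \<in> N \<inter> H" for g
   using scNH that w(1) unfolding sc_def eqX_def by blast
  ultimately show "\<exists>G1 w. Q G1 & G1 \<subseteq> G' & w \<in> span F - X & (\<forall>g\<in>G1. \<exists>c. act g w - scale c w \<in> X)"
   using H(2) YF by (intro exI[of _ "N \<inter> H"] exI[of _ w]) auto
 qed (rule lin_act)
 thus ?thesis by (auto simp: Q_def)
qed

end

section \<open>Row-finite rational matrices and their units\<close>

text \<open>One ring for all sizes: a matrix of size N occupies the upper left corner, and an
  invertible one is continued by the identity. Finite rows keep products finite sums while admitting
  the identity.\<close>

typedef fmat = "{A :: nat => nat => rat. \<forall>i. finite {j. A i j ~= 0}}"
 morphisms ent Fmat
 by (rule exI[of _ "%_ _. 0"]) auto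

setup_lifting type_definition_fmat

lemma finite_row: "finite {j. ent A i j ~= 0}"
 using ent[of A] by auto

lemma fmat_eqI: "(!!i j. ent A i j = ent B i j) ==> A = B"
 by (simp add: ent_inject[symmetric] fun_eq_iff)

lemma ent_Fmat: "(!!i. finite {j. f i j ~= 0}) ==> ent (Fmat f) = f"
 by (rule Fmat_inverse) auto

instantiation fmat :: ring_1
begin

lift_definition zero_fmat :: fmat is "%_ _. 0" by simp
lift_definition one_fmat :: fmat is "%i j. if i = j then 1 else 0" by simp
lift_definition plus_fmat :: "fmat => fmat => fmat" is "%A B i j. A i j + B i j"
proof -
 fix f g :: "nat => nat => rat" and i
 assume "!!i. finite {j. f i j ~= 0}" "!!i. finite {j. g i j ~= 0}"
 hence "finite ({j. f i j ~= 0} \<union> {j. g i j ~= 0})" by simp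
 thus "finite {j. f i j + g i j ~= 0}" by (rule rev_finite_subset) auto
qed
lift_definition uminus_fmat :: "fmat => fmat" is "%A i j. - A i j" by simp
lift_definition minus_fmat :: "fmat => fmat => fmat" is "%A B i j. A i j - B i j"
proof -
 fix f g :: "nat => nat => rat" and i
 assume "!!i. finite {j. f i j ~= 0}" "!!i. finite {j. g i j ~= 0}"
 hence "finite ({j. f i j ~= 0} \<union> {j. g i j ~= 0})" by simp
 thus "finite {j. f i j - g i j ~= 0}" by (rule rev_finite_subset) auto
qed
lift_definition times_fmat :: "fmat => fmat => fmat" is
 "%A B i j. \<Sum>k\<in>{k. A i k ~= 0}. A i k * B k j"
proof -
 fix f g :: "nat => nat => rat" and i
 assume fg: "!!i. finite {j. f i j ~= 0}" "!!i. finite {j. g i j ~= 0}"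
 have "{j. (\<Sum>k\<in>{k. f i k ~= 0}. f i k * g k j) ~= 0} \<subseteq> (\<Union>k\<in>{k. f i k ~= 0}. {j. g k j ~= 0})"
 proof
  fix j assume "j \<in> {j. (\<Sum>k\<in>{k. f i k ~= 0}. f i k * g k j) ~= 0}"
  hence "(\<Sum>k\<in>{k. f i k ~= 0}. f i k * g k j) ~= 0" by simp
  then obtain k where "k \<in> {k. f i k ~= 0}" "f i k * g k j ~= 0"
   by (rule sum.not_neutral_contains_not_neutral)
  thus "j \<in> (\<Union>k\<in>{k. f i k ~= 0}. {j. g k j ~= 0})" by auto
 qed
 thus "finite {j. (\<Sum>k\<in>{k. f i k ~= 0}. f i k * g k j) ~= 0}"
  by (rule finite_subset) (use fg in auto)
qed

lemma ent_times:
 assumes "finite S" "!!k. k \<notin> S ==> ent A i k = 0"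
 shows "ent (A * B) i j = (\<Sum>k\<in>S. ent A i k * ent B k j)"
 unfolding times_fmat.rep_eq using assms by (intro sum.mono_neutral_left) auto

instance
proof
 fix A B C :: fmat
 show "A * B * C = A * (B * C)"
 proof (rule fmat_eqI)
  fix i j
  let ?S = "{k. ent A i k ~= 0}"
  let ?T = "\<Union>k\<in>?S. {l. ent B k l ~= 0}"
  have fin: "finite ?S" "finite ?T" using finite_row by auto
  have 1: "ent (A * B) i l = (\<Sum>k\<in>?S. ent A i k * ent B k l)" for l
   using fin by (intro ent_times) auto
  have "ent (A * B * C) i j = (\<Sum>l\<in>?T. ent (A * B) i l * ent C l j)"
  proof (rule ent_times[OF fin(2)])
   fix l assume "l \<notin> ?T"
   thus "ent (A * B) i l = 0" unfolding 1 by (intro sum.neutral) auto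
  qed
  also have "\<dots> = (\<Sum>k\<in>?S. \<Sum>l\<in>?T. ent A i k * ent B k l * ent C l j)"
   unfolding 1 sum_distrib_right by (rule sum.swap)
  also have "\<dots> = (\<Sum>k\<in>?S. ent A i k * ent (B * C) k j)"
  proof (rule sum.cong[OF refl])
   fix k assume "k \<in> ?S"
   hence "ent (B * C) k j = (\<Sum>l\<in>?T. ent B k l * ent C l j)"
    using fin by (intro ent_times) auto
   thus "(\<Sum>l\<in>?T. ent A i k * ent B k l * ent C l j) = ent A i k * ent (B * C) k j"
    by (simp add: sum_distrib_left mult.assoc)
  qed
  also have "\<dots> = ent (A * (B * C)) i j" using fin by (intro ent_times[symmetric]) auto
  finally show "ent (A * B * C) i j = ent (A * (B * C)) i j" .
 qed
 show "1 * A = A"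
  by (rule fmat_eqI, subst ent_times[of "{_}"]) (auto simp: one_fmat.rep_eq)
 show "A * 1 = A"
  by (rule fmat_eqI) (simp add: times_fmat.rep_eq one_fmat.rep_eq if_distrib finite_row cong: if_cong)
 show "(A + B) * C = A * C + B * C"
 proof (rule fmat_eqI)
  fix i j
  let ?S = "{k. ent A i k ~= 0} \<union> {k. ent B i k ~= 0}"
  have fin: "finite ?S" using finite_row by auto
  have "ent ((A + B) * C) i j = (\<Sum>k\<in>?S. ent (A + B) i k * ent C k j)"
   "ent (A * C) i j = (\<Sum>k\<in>?S. ent A i k * ent C k j)"
   "ent (B * C) i j = (\<Sum>k\<in>?S. ent B i k * ent C k j)"
   by (intro ent_times[OF fin]; simp add: plus_fmat.rep_eq)+
  thus "ent ((A + B) * C) i j = ent (A * C + B * C) i j"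
   by (simp add: plus_fmat.rep_eq distrib_right sum.distrib)
 qed
 show "A * (B + C) = A * B + A * C"
  by (rule fmat_eqI) (simp add: times_fmat.rep_eq plus_fmat.rep_eq distrib_left sum.distrib)
 show "(0::fmat) ~= 1"
  by (metis one_fmat.rep_eq zero_fmat.rep_eq zero_neq_one)
qed (rule fmat_eqI; simp add: plus_fmat.rep_eq zero_fmat.rep_eq uminus_fmat.rep_eq minus_fmat.rep_eq)+

end

lemmas ent_simps = plus_fmat.rep_eq zero_fmat.rep_eq uminus_fmat.rep_eq minus_fmat.rep_eq one_fmat.rep_eq

lift_definition sm :: "rat => fmat => fmat" is "%c A i j. c * A i j"
proof -
 fix c :: rat and f :: "nat => nat => rat" and i
 assume "!!i. finite {j. f i j ~= 0}"
 thus "finite {j. c * f i j ~= 0}" by (rule rev_finite_subset[of "{j. f i j ~= 0}"]) auto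
qed

interpretation fm: vspace sm
 by unfold_locales (rule fmat_eqI; simp add: sm.rep_eq ent_simps algebra_simps)+

lemma sm_mult_left [simp]: "sm c A * B = sm c (A * B)"
proof (cases "c = 0")
 case False
 show ?thesis
  by (rule fmat_eqI) (simp add: times_fmat.rep_eq sm.rep_eq False sum_distrib_left mult.assoc)
qed simp

lemma sm_mult_right [simp]: "A * sm c B = sm c (A * B)"
 by (rule fmat_eqI) (simp add: times_fmat.rep_eq sm.rep_eq sum_distrib_left mult_ac)

lemma ent_sum: "ent (sum f A) i j = (\<Sum>a\<in>A. ent (f a) i j)"
 by (induction A rule: infinite_finite_induct) (auto simp: ent_simps)

text \<open>Pairs of an element and its two-sided inverse, so that the units of a monoid become an
  instance of \<open>grp\<close> with a total inverse.\<close>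

typedef (overloaded) 'a un = "{(a, b). a * b = (1 :: 'a :: monoid_mult) & b * a = 1}"
 by (rule exI[of _ "(1, 1)"]) simp

setup_lifting type_definition_un

lift_definition val :: "'a::monoid_mult un => 'a" is fst .

instantiation un :: (monoid_mult) grp
begin

lift_definition one_un :: "'a un" is "(1, 1)" by simp
lift_definition times_un :: "'a un => 'a un => 'a un" is "%(a, b) (c, d). (a * c, d * b)"
proof clarify
 fix a b c d :: 'a
 assume *: "a * b = 1" "b * a = 1" "c * d = 1" "d * c = 1"
 have "a * c * (d * b) = a * (c * d) * b" "d * b * (a * c) = d * (b * a) * c" by (simp_all add: mult.assoc)
 with * show "a * c * (d * b) = 1 & d * b * (a * c) = 1" by simp
qed
lift_definition iv_un :: "'a un => 'a un" is "%(a, b). (b, a)" by auto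

instance
 by standard (transfer; auto simp: mult.assoc)+

end

lemma val_one [simp]: "val 1 = 1"
 by transfer simp

lemma val_mult [simp]: "val (x * y) = val x * val y"
 by transfer auto

lemma val_iv_left [simp]: "val (iv x) * val x = 1"
 by (metis iv_left val_mult val_one)

lemma val_iv_right [simp]: "val x * val (iv x) = 1"
 by (metis iv_right val_mult val_one)

lemma val_iv_left' [simp]: "val (iv x) * (val x * a) = a"
 by (simp add: mult.assoc[symmetric])

lemma val_iv_right' [simp]: "val x * (val (iv x) * a) = a"
 by (simp add: mult.assoc[symmetric])

lemma val_power [simp]: "val (x ^ n) = val x ^ n"
 by (induction n) auto

lemma val_inj: "val x = val y ==> x = y"
proof transfer
 fix x y :: "'a \<times> 'a"
 assume x: "x \<in> {(a, b). a * b = 1 & b * a = 1}" and y: "y \<in> {(a, b). a * b = 1 & b * a = 1}"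
  and eq: "fst x = fst y"
 obtain a b c d where *: "x = (a, b)" "y = (c, d)" by force
 have "b = b * (c * d)" using x y * by simp
 also have "\<dots> = (b * a) * d" using eq * by (simp add: mult.assoc)
 also have "\<dots> = d" using x * by simp
 finally show "x = y" using eq * by simp
qed

lemma ex_un: "a * b = 1 ==> b * a = 1 ==> \<exists>x. val x = a & val (iv x) = b"
 by (rule exI[of _ "Abs_un (a, b)"]) (simp add: val.rep_eq iv_un.rep_eq Abs_un_inverse)

definition MN :: "nat => fmat set" where
 "MN N = {A. \<forall>i j. ent A i j ~= 0 --> i < N & j < N}"

lemma MN_subspace: "fm.subspace (MN N)"
 unfolding fm.subspace_def
proof (intro conjI ballI allI)
 fix x y assume "x \<in> MN N" "y \<in> MN N"
 hence "ent x i j = 0" "ent y i j = 0" if "~ (i < N & j < N)" for i j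
  using that unfolding MN_def by blast+
 hence "ent (x + y) i j = 0" if "~ (i < N & j < N)" for i j
  using that by (simp add: ent_simps)
 thus "x + y \<in> MN N" unfolding MN_def by blast
qed (auto simp: MN_def ent_simps sm.rep_eq)

lemma ent_times_MN: "A \<in> MN N ==> ent (A * B) i j = (\<Sum>k<N. ent A i k * ent B k j)"
 by (rule ent_times) (auto simp: MN_def)

lemma MN_mult: "A \<in> MN N ==> B \<in> MN N ==> A * B \<in> MN N"
 unfolding MN_def mem_Collect_eq
proof (intro allI impI)
 fix i j assume A: "\<forall>i j. ent A i j ~= 0 --> i < N & j < N" and B: "\<forall>i j. ent B i j ~= 0 --> i < N & j < N"
  and nz: "ent (A * B) i j ~= 0"
 have "ent (A * B) i j = (\<Sum>k<N. ent A i k * ent B k j)"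
  using A by (intro ent_times) auto
 hence "(\<Sum>k<N. ent A i k * ent B k j) ~= 0" using nz by simp
 then obtain k where "ent A i k * ent B k j ~= 0"
  by (rule sum.not_neutral_contains_not_neutral)
 thus "i < N & j < N" using A B by auto
qed

definition unitmat :: "nat => nat => fmat" where
 "unitmat a b = Fmat (%i j. if i = a & j = b then 1 else 0)"

lemma ent_unitmat: "ent (unitmat a b) i j = (if i = a & j = b then 1 else 0)"
 unfolding unitmat_def by (subst ent_Fmat) (auto intro: rev_finite_subset[of "{b}"])

lemma MN_sum: "A \<in> MN N ==> A = (\<Sum>i<N. \<Sum>j<N. sm (ent A i j) (unitmat i j))"
proof (rule fmat_eqI)
 fix a b assume A: "A \<in> MN N"
 have in0: "(\<Sum>j<N. ent A i j * (if a = i & b = j then 1 else 0)) = (if a = i then ent A a b else 0)" for i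
 proof (cases "a = i")
  case True
  have "(\<Sum>j<N. ent A i j * (if a = i & b = j then 1 else 0)) = (\<Sum>j<N. if b = j then ent A i j else 0)"
   using True by (intro sum.cong) auto
  also have "\<dots> = ent A a b" using A True by (auto simp: MN_def)
  finally show ?thesis using True by simp
 qed simp
 have "(\<Sum>i<N. \<Sum>j<N. ent A i j * (if a = i & b = j then 1 else 0)) = ent A a b"
  unfolding in0 using A by (auto simp: MN_def)
 thus "ent A a b = ent (\<Sum>i<N. \<Sum>j<N. sm (ent A i j) (unitmat i j)) a b"
  by (simp add: ent_sum sm.rep_eq ent_unitmat)
qed

definition EN :: "nat => fmat set" where "EN N = (%(i, j). unitmat i j) ` ({..<N} \<times> {..<N})"

lemma finite_EN: "finite (EN N)"
 by (simp add: EN_def)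

lemma MN_span: "MN N \<subseteq> fm.span (EN N)"
proof
 fix A assume "A \<in> MN N"
 hence "A = (\<Sum>i<N. \<Sum>j<N. sm (ent A i j) (unitmat i j))" by (rule MN_sum)
 also have "\<dots> \<in> fm.span (EN N)"
  by (intro fm.span_sum fm.span_scale fm.span_base) (auto simp: EN_def)
 finally show "A \<in> fm.span (EN N)" .
qed

definition GLN :: "nat => fmat un set" where
 "GLN N = {x. val x - 1 \<in> MN N & val (iv x) - 1 \<in> MN N}"

lemma one_plus_mult: "(x * y - 1 :: 'a::ring_1) = (x - 1) + (y - 1) + (x - 1) * (y - 1)"
 by (simp add: algebra_simps)

lemma sg_GLN: "sg (GLN N)"
proof (rule sgI)
 show "1 \<in> GLN N" using MN_subspace by (simp add: GLN_def fm.subspace_0)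
next
 fix x y assume "x \<in> GLN N" "y \<in> GLN N"
 thus "x * y \<in> GLN N"
  using MN_subspace[of N]
  by (auto simp: GLN_def one_plus_mult[of "val x"] one_plus_mult[of "val (iv y)"] intro!: fm.subspace_add MN_mult)
qed (auto simp: GLN_def)

lemma GLN_MN: "g \<in> GLN N ==> A \<in> MN N ==> val g * A \<in> MN N" "g \<in> GLN N ==> A \<in> MN N ==> A * val g \<in> MN N"
proof -
 assume *: "g \<in> GLN N" "A \<in> MN N"
 hence "(val g - 1) * A + A \<in> MN N" "A * (val g - 1) + A \<in> MN N"
  using MN_subspace[of N] by (auto simp: GLN_def intro!: fm.subspace_add MN_mult)
 thus "val g * A \<in> MN N" "A * val g \<in> MN N" by (simp_all add: algebra_simps)
qed

lemma ent_times_GLN: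
 assumes "A - 1 \<in> MN N" "i < N"
 shows "ent (A * B) i j = (\<Sum>k<N. ent A i k * ent B k j)"
proof (rule ent_times)
 fix k assume "k \<notin> {..<N}"
 hence "ent (A - 1) i k = 0" using assms by (auto simp: MN_def)
 thus "ent A i k = 0" using \<open>k \<notin> {..<N}\<close> assms(2) by (auto simp: ent_simps)
qed simp

section \<open>Polynomial functions on matrices\<close>

inductive pol :: "nat => (fmat => rat) => bool" for N where
 pol_const: "pol N (%_. c)"
| pol_ent: "i < N ==> j < N ==> pol N (%x. ent x i j)"
| pol_add: "pol N f ==> pol N g ==> pol N (%x. f x + g x)"
| pol_mult: "pol N f ==> pol N g ==> pol N (%x. f x * g x)"

lemma pol_sum: "finite A ==> (!!a. a \<in> A ==> pol N (f a)) ==> pol N (%x. \<Sum>a\<in>A. f a x)"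
 by (induction A rule: finite_induct) (auto intro: pol.intros)

lemma pol_prod: "finite A ==> (!!a. a \<in> A ==> pol N (f a)) ==> pol N (%x. \<Prod>a\<in>A. f a x)"
 by (induction A rule: finite_induct) (auto intro: pol.intros)

lemma pol_diff: "pol N f ==> pol N g ==> pol N (%x. f x - g x)"
 using pol_add[of N f, OF _ pol_mult[OF pol_const[of N "- 1"], of g]] by simp

lemma pol_compose: "pol N f ==> (!!i j. i < N ==> j < N ==> pol N (%x. ent (A x) i j)) ==> pol N (%x. f (A x))"
 by (induction rule: pol.induct) (auto intro: pol.intros)

text \<open>Binomial coefficients are polynomials in the upper argument; hence a power
  \<open>binp\<close> whose exponent depends polynomially on x is itself polynomial in x.\<close>

lemma pol_gchoose: "pol N f ==> pol N (%x. f x gchoose k)"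
 unfolding gbinomial_prod_rev divide_inverse
 by (intro pol_mult pol_prod pol_diff pol_const) auto

definition ispoly :: "(rat => rat) => bool" where
 "ispoly f \<longleftrightarrow> (\<exists>q. \<forall>s. f s = poly q s)"

lemma ispoly_const: "ispoly (%_. c)"
 unfolding ispoly_def by (rule exI[of _ "[:c:]"]) simp

lemma ispoly_id: "ispoly (%s. s)"
 unfolding ispoly_def by (rule exI[of _ "[:0, 1:]"]) simp

lemma ispoly_add: "ispoly f ==> ispoly g ==> ispoly (%s. f s + g s)"
 unfolding ispoly_def by (metis poly_add)

lemma ispoly_diff: "ispoly f ==> ispoly g ==> ispoly (%s. f s - g s)"
 unfolding ispoly_def by (metis poly_diff)

lemma ispoly_mult: "ispoly f ==> ispoly g ==> ispoly (%s. f s * g s)"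
 unfolding ispoly_def by (metis poly_mult)

lemma ispoly_sum: "finite A ==> (!!a. a \<in> A ==> ispoly (f a)) ==> ispoly (%x. \<Sum>a\<in>A. f a x)"
 by (induction A rule: finite_induct) (auto intro: ispoly_const ispoly_add)

lemma ispoly_prod: "finite A ==> (!!a. a \<in> A ==> ispoly (f a)) ==> ispoly (%x. \<Prod>a\<in>A. f a x)"
 by (induction A rule: finite_induct) (auto intro: ispoly_const ispoly_mult)

lemma ispoly_gchoose: "ispoly (%s. s gchoose k)"
 unfolding gbinomial_prod_rev divide_inverse
 by (intro ispoly_mult ispoly_prod ispoly_diff ispoly_const ispoly_id) auto

lemma ispoly_pol: "pol N f ==> (!!i j. ispoly (%s. ent (A s) i j)) ==> ispoly (%s. f (A s))"
 by (induction rule: pol.induct) (auto intro: ispoly_const ispoly_add ispoly_mult)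

lemma ispoly_zero:
 assumes "ispoly f" "m >= 1" "!!j::nat. f (of_nat (m * j)) = 0"
 shows "f s = 0"
proof -
 obtain q where q: "!!s. f s = poly q s" using assms(1) by (auto simp: ispoly_def)
 have "q = 0"
 proof (rule ccontr)
  assume "q ~= 0"
  hence "finite {x. poly q x = 0}" by (rule poly_roots_finite)
  moreover have "range (%j::nat. rat_of_nat (m * j)) \<subseteq> {x. poly q x = 0}"
   using assms(3) q by auto
  ultimately have "finite (range (%j::nat. rat_of_nat (m * j)))" by (rule rev_finite_subset)
  moreover have "inj (%j::nat. rat_of_nat (m * j))" using assms(2) by (auto simp: inj_def)
  ultimately show False by (metis finite_imageD infinite_UNIV_nat)
 qed
 thus ?thesis using q by simp
qed

text \<open>\<open>(1 + x)\<^sup>s\<close> for nilpotent \<open>x\<close> and arbitrary rational exponent \<open>s\<close>.\<close>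

definition binp :: "nat => fmat => rat => fmat" where
 "binp n x s = (\<Sum>i<n. sm (s gchoose i) (x ^ i))"

text \<open>Pascal's rule; the condition \<open>x ^ n = 0\<close> removes the top term of the
  product.\<close>

lemma binp_Suc:
 assumes "x ^ n = 0" "n >= 1"
 shows "binp n x (s + 1) = binp n x s * (1 + x)"
proof -
 obtain m where m: "n = Suc m" using assms(2) by (cases n) auto
 have "binp n x s * x = (\<Sum>i<m. sm (s gchoose i) (x ^ Suc i)) + sm (s gchoose m) (x ^ n)"
  by (simp add: binp_def m sum_distrib_right power_Suc2 distrib_right del: power_Suc)
 also have "\<dots> = (\<Sum>i<m. sm (s gchoose i) (x ^ Suc i))" using assms(1) by simp
 finally have *: "binp n x s * x = (\<Sum>i<m. sm (s gchoose i) (x ^ Suc i))" .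
 have "binp n x (s + 1) = 1 + (\<Sum>i<m. sm ((s + 1) gchoose Suc i) (x ^ Suc i))"
  unfolding binp_def m by (subst sum.lessThan_Suc_shift) simp
 also have "\<dots> = (1 + (\<Sum>i<m. sm (s gchoose Suc i) (x ^ Suc i))) + (\<Sum>i<m. sm (s gchoose i) (x ^ Suc i))"
  by (simp only: gbinomial_Suc_Suc fm.scale_left_distrib sum.distrib add.assoc add.commute[of "\<Sum>i<m. sm (s gchoose i) (x ^ Suc i)"])
 also have "1 + (\<Sum>i<m. sm (s gchoose Suc i) (x ^ Suc i)) = binp n x s"
  unfolding binp_def m by (subst sum.lessThan_Suc_shift) simp
 finally show ?thesis by (simp add: * distrib_left)
qed

lemma binp_0: "n >= 1 ==> binp n x 0 = 1"
 unfolding binp_def by (cases n) (auto simp: sum.lessThan_Suc_shift simp del: sum.lessThan_Suc)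

lemma val_zp_binp:
 assumes "(val v - 1) ^ n = 0" "n >= 1"
 shows "val (zp v k) = binp n (val v - 1) (of_int k)"
proof (induction k rule: int_induct[where k = 0])
 case base
 thus ?case using binp_0[OF assms(2)] by simp
next
 case (step1 i)
 thus ?case using binp_Suc[OF assms, of "of_int i"] by (simp add: zp_succ)
next
 case (step2 i)
 have "binp n (val v - 1) (of_int i) = binp n (val v - 1) (of_int (i - 1)) * val v"
  using binp_Suc[OF assms, of "of_int (i - 1)"] by simp
 hence "binp n (val v - 1) (of_int i) * val (iv v) = binp n (val v - 1) (of_int (i - 1))"
  by (simp add: mult.assoc)
 thus ?case using step2 by (simp add: zp_pred)
qed

lemma val_power_binp:
 "(val v - 1) ^ n = 0 ==> n >= 1 ==> val (v ^ k) = binp n (val v - 1) (of_nat k)"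
 using val_zp_binp[of v n "int k"] by simp

lemma ispoly_binp: "ispoly (%s. ent (binp n x s) i j)"
 unfolding binp_def ent_sum sm.rep_eq
 by (intro ispoly_sum ispoly_mult ispoly_gchoose ispoly_const) auto

text \<open>The curve (1 + x)^s is polynomial in s, so vanishing at the exponents m j forces
  vanishing along the whole curve, in particular at s = 1. This is how statements about powers of a
  unipotent element return to the element itself.\<close>

lemma pol_vanish_power:
 assumes "pol N f" "(val v - 1) ^ n = 0" "m >= 1" "!!j. f (val (v ^ (m * j))) = 0"
 shows "f (val v) = 0"
proof -
 have n: "(val v - 1) ^ Suc n = 0" using assms(2) by simp
 have "f (binp (Suc n) (val v - 1) 1) = 0"
  by (rule ispoly_zero[OF ispoly_pol[OF assms(1) ispoly_binp] assms(3)])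
   (use assms(4) val_power_binp[OF n] in \<open>simp del: val_power of_nat_mult\<close>)
 thus ?thesis using val_power_binp[OF n, of 1] by simp
qed

section \<open>Unipotent groups\<close>

lemma (in vspace) functional_exists:
 assumes "subspace Z" "b \<notin> Z"
 shows "\<exists>l. (\<forall>x y. l (x + y) = l x + l y) & (\<forall>c x. l (scale c x) = c * l x) & (\<forall>z\<in>Z. l z = 0) & l b = 1"
proof -
 obtain B where B: "B \<subseteq> Z" "independent B" "Z \<subseteq> span B" "card B = dim Z"
  by (rule basis_exists)
 have "span B \<subseteq> Z" using B(1) assms(1) by (rule span_minimal)
 hence b: "b \<notin> span B" using assms(2) by auto
 hence ind: "independent (insert b B)" using B(2) by (simp add: independent_insert span_base)
 have bB: "b \<notin> B" using b span_base by auto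
 define C where "C = extend_basis (insert b B)"
 have C: "independent C" "insert b B \<subseteq> C" "span C = UNIV"
  using independent_extend_basis[OF ind] extend_basis_superset[OF ind] span_extend_basis[OF ind]
  by (auto simp: C_def)
 define l where "l x = representation C x b" for x
 have add: "l (x + y) = l x + l y" for x y
  using C by (simp add: l_def representation_add)
 have sc: "l (scale c x) = c * l x" for c x
  using C by (simp add: l_def representation_scale)
 have "l e = (if e = b then 1 else 0)" if "e \<in> C" for e
  using C that by (auto simp: l_def representation_basis)
 hence lb: "l b = 1" "!!e. e \<in> B ==> l e = 0" using C(2) bB by auto
 have "l z = 0" if "z \<in> span B" for z
  using that
 proof (induction rule: span_induct_alt)
  case base
  show ?case using sc[of 0 0] by simp
 next
  case (step c x y)
  thus ?case by (simp add: add sc lb)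
 qed
 thus ?thesis using add sc lb B(3) by (intro exI[of _ l]) auto
qed

locale nilalg =
 fixes J :: "fmat set" and N n :: nat
 assumes J: "fm.subspace J" "J \<subseteq> MN N"
  and J_mult: "!!a b. a \<in> J ==> b \<in> J ==> a * b \<in> J"
  and nil: "!!js. length js = n ==> set js \<subseteq> J ==> prod_list js = 0"
begin

definition idl :: "fmat set => bool" where
 "idl I \<longleftrightarrow> fm.subspace I & I \<subseteq> J & (\<forall>a\<in>J. \<forall>b\<in>I. a * b \<in> I & b * a \<in> I)"

lemma J_span: "J \<subseteq> fm.span (EN N)"
 using J MN_span by blast

lemma idl_J: "idl J"
 using J J_mult by (auto simp: idl_def)

definition pr :: "fmat set => fmat set" where
 "pr I = {a * b |a b. a \<in> J & b \<in> I} \<union> {b * a |a b. a \<in> J & b \<in> I}"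

lemma idl_pr_subset: "idl I ==> fm.span (pr I) \<subseteq> I"
 by (rule fm.span_minimal) (auto simp: idl_def pr_def)

text \<open>Otherwise I = JI + IJ could be iterated to place I in every power of J, and J is
  nilpotent.\<close>

lemma pr_proper:
 assumes "idl I" "I ~= {0}"
 shows "fm.span (pr I) ~= I"
proof
 assume eq: "fm.span (pr I) = I"
 define P where "P k = {prod_list js |js. length js = k & set js \<subseteq> J}" for k :: nat
 have step: "x * a \<in> fm.span (P (Suc k))" "a * x \<in> fm.span (P (Suc k))"
  if x: "x \<in> fm.span (P k)" and a: "a \<in> J" for x a k
 proof -
  show "x * a \<in> fm.span (P (Suc k))"
   using x
  proof (induction rule: fm.span_induct_alt)
   case (step c y z)
   then obtain js where js: "y = prod_list js" "length js = k" "set js \<subseteq> J" by (auto simp: P_def)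
   have "y * a \<in> P (Suc k)" unfolding P_def using js a by (intro CollectI exI[of _ "js @ [a]"]) auto
   from fm.span_add[OF fm.span_scale[OF fm.span_base[OF this]] step(2)]
   show ?case by (simp add: distrib_right)
  qed (simp add: fm.span_zero)
  show "a * x \<in> fm.span (P (Suc k))"
   using x
  proof (induction rule: fm.span_induct_alt)
   case (step c y z)
   then obtain js where js: "y = prod_list js" "length js = k" "set js \<subseteq> J" by (auto simp: P_def)
   have "a * y \<in> P (Suc k)" unfolding P_def using js a by (intro CollectI exI[of _ "a # js"]) auto
   from fm.span_add[OF fm.span_scale[OF fm.span_base[OF this]] step(2)]
   show ?case by (simp add: distrib_left)
  qed (simp add: fm.span_zero)
 qed
 have "I \<subseteq> fm.span (P (Suc k))" for k
 proof (induction k)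
  case 0
  have "J \<subseteq> P (Suc 0)" unfolding P_def by (auto intro!: exI[of _ "[_]"])
  thus ?case using assms(1) fm.span_superset by (fastforce simp: idl_def)
 next
  case (Suc k)
  have "pr I \<subseteq> fm.span (P (Suc (Suc k)))" using step Suc by (auto simp: pr_def)
  hence "fm.span (pr I) \<subseteq> fm.span (P (Suc (Suc k)))" by (rule fm.span_minimal) simp
  thus ?case using eq by simp
 qed
 hence "I \<subseteq> fm.span (P (Suc n))" .
 moreover have "P (Suc n) \<subseteq> {0}"
 proof
  fix x assume "x \<in> P (Suc n)"
  then obtain js where js: "x = prod_list js" "length js = Suc n" "set js \<subseteq> J" by (auto simp: P_def)
  then obtain a as where "js = a # as" by (cases js) auto
  thus "x \<in> {0}" using js nil[of as] by auto
 qed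
 hence "fm.span (P (Suc n)) \<subseteq> {0}" by (rule fm.span_minimal) (simp add: fm.subspace_single_0)
 ultimately have "I \<subseteq> {0}" by blast
 thus False using assms fm.subspace_0[of I] by (auto simp: idl_def)
qed

text \<open>A functional killing JI makes x -> l(x - 1) additive on 1 + I; killing IJ as well makes
  its kernel an ideal of smaller dimension. Inductions on unipotent groups peel off such
  homomorphisms into the rationals.\<close>

lemma idl_functional:
 assumes "idl I" "I ~= {0}"
 obtains l where "\<forall>x y. l (x + y) = l x + l y" "\<forall>c x. l (sm c x) = c * l x"
  "\<forall>a\<in>J. \<forall>b\<in>I. l (a * b) = (0::rat)" "idl {b\<in>I. l b = 0}" "fm.dim {b\<in>I. l b = 0} < fm.dim I"
proof -
 have I: "fm.subspace I" "I \<subseteq> J" "!!a b. a \<in> J ==> b \<in> I ==> a * b \<in> I & b * a \<in> I"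
  using assms(1) by (auto simp: idl_def)
 obtain v where v: "v \<in> I" "v \<notin> fm.span (pr I)"
  using pr_proper[OF assms] idl_pr_subset[OF assms(1)] by auto
 obtain l where l: "\<forall>x y. l (x + y) = l x + l y" "\<forall>c x. l (sm c x) = c * l x"
  "\<forall>z\<in>fm.span (pr I). l z = 0" "l v = 1"
  using fm.functional_exists[OF fm.subspace_span v(2)] by auto
 have l0: "l (a * b) = 0" "l (b * a) = 0" if "a \<in> J" "b \<in> I" for a b
 proof -
  have "a * b \<in> fm.span (pr I)" "b * a \<in> fm.span (pr I)"
   by (rule fm.span_base, use that in \<open>auto simp: pr_def\<close>)+
  thus "l (a * b) = 0" "l (b * a) = 0" using l(3) by auto
 qed
 have "l 0 = 0" using l(1) by (metis add_0 add_cancel_right_left)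
 hence sub: "fm.subspace {b\<in>I. l b = 0}"
  using I(1) l by (auto simp: fm.subspace_def)
 moreover have "fm.dim {b\<in>I. l b = 0} < fm.dim I"
 proof (rule fm.dim_strict[OF finite_EN _ sub I(1)])
  show "I \<subseteq> fm.span (EN N)" using I(2) J_span by auto
  have "v \<notin> {b\<in>I. l b = 0}" using l(4) by simp
  thus "{b\<in>I. l b = 0} \<subset> I" using v(1) by blast
 qed
 moreover have "idl {b\<in>I. l b = 0}" using sub I l0 by (auto simp: idl_def)
 ultimately show ?thesis using l l0 by (intro that[of l]) auto
qed

definition ug :: "fmat set => fmat un set => bool" where
 "ug I U \<longleftrightarrow> sg U & (\<forall>x\<in>U. val x - 1 \<in> I)"

lemma theta_hom:
 assumes "\<forall>x y. l (x + y) = l x + l y" "\<forall>a\<in>J. \<forall>b\<in>I. l (a * b) = (0::rat)" "I \<subseteq> J"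
  and "val x - 1 \<in> I" "val y - 1 \<in> I"
 shows "l (val (x * y) - 1) = l (val x - 1) + l (val y - 1)"
proof -
 have "l ((val x - 1) * (val y - 1)) = 0" using assms by auto
 thus ?thesis by (simp add: one_plus_mult[of "val x" "val y"] assms(1))
qed

lemma hom_props:
 fixes th :: "'g::grp => rat"
 assumes "sg U" "\<forall>x\<in>U. \<forall>y\<in>U. th (x * y) = th x + th y"
 shows "th 1 = 0" "!!x. x \<in> U ==> th (iv x) = - th x" "!!x k. x \<in> U ==> th (x ^ k) = of_nat k * th x"
  "!!x k. x \<in> U ==> th (zp x k) = of_int k * th x"
proof -
 show 1: "th 1 = 0"
 proof -
  have "th (1 * 1) = th 1 + th 1" using assms(2) sg_one[OF assms(1)] by blast
  thus ?thesis by simp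
 qed
 show 2: "th (iv x) = - th x" if "x \<in> U" for x
 proof -
  have "th (x * iv x) = th x + th (iv x)" using assms(2) that sg_iv[OF assms(1)] by blast
  thus ?thesis using 1 by simp
 qed
 show 3: "th (x ^ k) = of_nat k * th x" if "x \<in> U" for x k
  by (induction k) (use 1 that assms sg_power[OF assms(1)] in \<open>auto simp: algebra_simps\<close>)
 show "th (zp x k) = of_int k * th x" if "x \<in> U" for x k
  using 3[OF that] 3[of "iv x"] 2[OF that] that sg_iv[OF assms(1)] by (auto simp: zp_def)
qed

end

section \<open>Additive groups of rationals\<close>

lemma rat_int_multiple:
 fixes L :: "rat set"
 assumes "0 \<in> L" "!!x y. x \<in> L ==> y \<in> L ==> x + y \<in> L" "!!x. x \<in> L ==> - x \<in> L" "x \<in> L"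
 shows "of_int a * x \<in> L"
proof (induction a rule: int_induct[where k = 0])
 case (step1 i)
 thus ?case using assms(2)[OF step1(2) assms(4)] by (simp add: algebra_simps)
next
 case (step2 i)
 thus ?case using assms(2)[OF step2(2) assms(3)[OF assms(4)]] by (simp add: algebra_simps)
qed (use assms(1) in simp)

text \<open>Finitely generated groups of rationals are cyclic: over a common denominator, Bezout's
  identity exhibits the gcd of two elements inside \<open>L\<close>.\<close>

lemma rat_common_multiple:
 fixes L :: "rat set"
 assumes "0 \<in> L" "!!x y. x \<in> L ==> y \<in> L ==> x + y \<in> L" "!!x. x \<in> L ==> - x \<in> L"
 shows "finite F ==> F \<subseteq> L ==> \<exists>c\<in>L. \<forall>f\<in>F. \<exists>a. f = of_int a * c"
proof (induction F rule: finite_induct)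
 case empty
 thus ?case using assms(1) by auto
next
 case (insert l F)
 have int_mult: "of_int a * x \<in> L" if "x \<in> L" for a x
  by (rule rat_int_multiple) (use assms that in auto)
 obtain c where c: "c \<in> L" "!!f. f \<in> F ==> \<exists>a. f = of_int a * c" using insert by auto
 obtain a d where ad: "c = of_int a / of_int d" "d ~= 0"
  by (metis Fract_of_int_quotient less_irrefl quotient_of_denom_pos quotient_of_div surj_pair)
 obtain b e where be: "l = of_int b / of_int e" "e ~= 0"
  by (metis Fract_of_int_quotient less_irrefl quotient_of_denom_pos quotient_of_div surj_pair)
 define A where "A = a * e"
 define B where "B = b * d"
 define D where "D = d * e"
 have D: "D ~= 0" "c = of_int A / of_int D" "l = of_int B / of_int D"
  using ad be by (auto simp: A_def B_def D_def)
 obtain u v where uv: "u * A + v * B = gcd A B" using bezout_int by blast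
 define c' where "c' = rat_of_int (gcd A B) / of_int D"
 have "c' = of_int u * c + of_int v * l"
  unfolding c'_def uv[symmetric] D(2,3) by (simp add: add_divide_distrib)
 hence "c' \<in> L" using int_mult[OF c(1)] int_mult[of l] insert.prems assms(2) by simp
 moreover have cl: "\<exists>z. c = of_int z * c'" "\<exists>z. l = of_int z * c'"
 proof -
  obtain z where "A = gcd A B * z" using dvd_def gcd_dvd1 by blast
  hence "rat_of_int A = of_int z * of_int (gcd A B)" by (metis mult.commute of_int_mult)
  thus "\<exists>z. c = of_int z * c'" by (auto simp: D c'_def)
  obtain z where "B = gcd A B * z" using dvd_def gcd_dvd2 by blast
  hence "rat_of_int B = of_int z * of_int (gcd A B)" by (metis mult.commute of_int_mult)
  thus "\<exists>z. l = of_int z * c'" by (auto simp: D c'_def)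
 qed
 moreover have "\<exists>z. f = of_int z * c'" if "f \<in> F" for f
 proof -
  obtain z where z: "f = of_int z * c" using c(2)[OF \<open>f \<in> F\<close>] by auto
  obtain y where "c = of_int y * c'" using cl(1) by auto
  hence "f = of_int (z * y) * c'" using z by simp
  thus ?thesis by blast
 qed
 ultimately show ?case by (intro bexI[of _ c']) auto
qed

text \<open>A finite set of rationals lies in a cyclic subgroup, so \<open>L / kL\<close> has at most \<open>k\<close> elements.\<close>

lemma rat_quotient_finite:
 fixes L :: "rat set"
 assumes L: "0 \<in> L" "!!x y. x \<in> L ==> y \<in> L ==> x + y \<in> L" "!!x. x \<in> L ==> - x \<in> L" and k: "k >= 1"
 shows "\<exists>R. finite R & R \<subseteq> L & (\<forall>l\<in>L. \<exists>r\<in>R. \<exists>m\<in>L. l - r = of_nat k * m)"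
proof -
 define cl where "cl l = {m\<in>L. \<exists>x\<in>L. m - l = of_nat k * x}" for l
 have self: "l \<in> cl l" if "l \<in> L" for l using that L(1) by (auto simp: cl_def intro: bexI[of _ 0])
 have "finite (cl ` L)"
 proof (rule ccontr)
  assume "infinite (cl ` L)"
  then obtain Q where Q: "finite Q" "card Q = Suc k" "Q \<subseteq> cl ` L"
   using infinite_arbitrarily_large by blast
  hence "\<forall>q\<in>Q. \<exists>l. l \<in> L & q = cl l" by auto
  then obtain r where r: "!!q. q \<in> Q ==> r q \<in> L & q = cl (r q)" by metis
  obtain c where c: "c \<in> L" "\<forall>f\<in>r ` Q. \<exists>a. f = of_int a * c"
   using rat_common_multiple[OF L, of "r ` Q"] Q(1) r by auto
  hence "\<forall>q\<in>Q. \<exists>a. r q = of_int a * c" by simp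
  then obtain a where a: "!!q. q \<in> Q ==> r q = of_int (a q) * c" by metis
  have "(%q. a q mod int k) ` Q \<subseteq> {0..<int k}" using k by auto
  hence "card ((%q. a q mod int k) ` Q) <= k"
   using card_mono[of "{0..<int k}"] by fastforce
  hence "~ inj_on (%q. a q mod int k) Q" using Q(2) by (auto dest: card_image)
  then obtain p q where pq: "p \<in> Q" "q \<in> Q" "p ~= q" "a p mod int k = a q mod int k"
   by (auto simp: inj_on_def)
  have int_mult: "of_int z * c \<in> L" for z by (rule rat_int_multiple) (use L c(1) in auto)
  have "cl (r p) = cl (r q)"
  proof -
   obtain z where z: "a p - a q = int k * z"
    using pq(4) by (metis dvd_def mod_eq_dvd_iff)
   have "r p - r q = of_int (a p - a q) * c" using a pq by (simp add: algebra_simps)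
   hence rpq: "r p - r q = of_nat k * (of_int z * c)" by (simp add: z)
   have sub: "x - y \<in> L" if "x \<in> L" "y \<in> L" for x y using L(2)[OF that(1) L(3)[OF that(2)]] by simp
   have "\<exists>x\<in>L. m - r q = of_nat k * x" if "x \<in> L" "m - r p = of_nat k * x" for m x
    using that rpq L(2)[OF that(1) int_mult[of z]]
    by (intro bexI[of _ "x + of_int z * c"]) (auto simp: algebra_simps)
   moreover have "\<exists>x\<in>L. m - r p = of_nat k * x" if "x \<in> L" "m - r q = of_nat k * x" for m x
    using that rpq sub[OF that(1) int_mult[of z]]
    by (intro bexI[of _ "x - of_int z * c"]) (auto simp: algebra_simps)
   ultimately show ?thesis unfolding cl_def by blast
  qed
  thus False using pq r by metis
 qed
 define c where "c q = (SOME l. l \<in> L & cl l = q)" for q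
 have c: "c (cl l) \<in> L & cl (c (cl l)) = cl l" if "l \<in> L" for l
  unfolding c_def by (rule someI[of _ l]) (use that in simp)
 show ?thesis
 proof (intro exI[of _ "c ` cl ` L"] conjI ballI)
  fix l assume l: "l \<in> L"
  hence "l \<in> cl (c (cl l))" using self c by auto
  thus "\<exists>r\<in>c ` cl ` L. \<exists>m\<in>L. l - r = of_nat k * m" using l by (auto simp: cl_def)
 qed (use \<open>finite (cl ` L)\<close> c in auto)
qed

context nilalg
begin

text \<open>The group \<open>U\<close> may fail to be finitely generated, but \<theta>(U) / k
  \<theta>(U) is finite for a homomorphism \<theta> into the rationals, and k-th powers lie in
  \<open>X\<close>. The kernel of \<theta> is handled by induction on the dimension of the
  ideal.\<close>

theorem fidx_unipotent:
 "idl I ==> ug I U ==> sg X ==> X \<subseteq> U ==> k >= 1 ==> (!!u. u \<in> U ==> u ^ k \<in> X) ==> fidx U X"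
proof (induction "fm.dim I" arbitrary: I U X rule: less_induct)
 case less
 have sU: "sg U" and UI: "!!x. x \<in> U ==> val x - 1 \<in> I" using less.prems(2) by (auto simp: ug_def)
 have IJ: "I \<subseteq> J" using less.prems(1) by (auto simp: idl_def)
 show ?case
 proof (cases "I = {0}")
  case True
  have "u = 1" if "u \<in> U" for u using UI[OF that] True by (intro val_inj) simp
  hence "U \<subseteq> X" using sg_one[OF less.prems(3)] by auto
  thus ?thesis by (intro fidxI[of "{1}"]) auto
 next
  case False
  obtain l where l: "\<forall>x y. l (x + y) = l x + l y" "\<forall>a\<in>J. \<forall>b\<in>I. l (a * b) = (0::rat)"
   "idl {b\<in>I. l b = 0}" "fm.dim {b\<in>I. l b = 0} < fm.dim I"
   by (rule idl_functional[OF less.prems(1) False])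
  define th where "th x = l (val x - 1)" for x
  have th: "th (x * y) = th x + th y" if "x \<in> U" "y \<in> U" for x y
   unfolding th_def by (rule theta_hom[OF l(1,2) IJ]) (use UI that in auto)
  hence "\<forall>x\<in>U. \<forall>y\<in>U. th (x * y) = th x + th y" by blast
  note thp = hom_props[OF sU this]
  define U1 where "U1 = {x\<in>U. th x = 0}"
  have sU1: "sg U1" by (rule sgI) (use sU thp th in \<open>auto simp: U1_def sg_one sg_mult sg_iv\<close>)
  have "fidx U1 (U1 \<inter> X)"
  proof (rule less.hyps[OF l(4,3)])
   show "ug {b\<in>I. l b = 0} U1" using sU1 UI by (auto simp: ug_def U1_def th_def)
   show "sg (U1 \<inter> X)" by (rule sg_Int[OF sU1 less.prems(3)])
   show "u ^ k \<in> U1 \<inter> X" if "u \<in> U1" for u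
    using that less.prems(6) sg_power[OF sU1 that] by (auto simp: U1_def)
  qed (use less.prems in auto)
  then obtain R1 where R1: "finite R1" "!!u. u \<in> U1 ==> \<exists>r\<in>R1. u * iv r \<in> X"
   by (auto simp: fidx_def) (metis)
  have "\<exists>R. finite R & R \<subseteq> th ` U & (\<forall>l\<in>th ` U. \<exists>r\<in>R. \<exists>m\<in>th ` U. l - r = of_nat k * m)"
  proof (rule rat_quotient_finite[OF _ _ _ less.prems(5)])
   show "0 \<in> th ` U" using thp(1) sg_one[OF sU] by force
   show "x + y \<in> th ` U" if "x \<in> th ` U" "y \<in> th ` U" for x y
    using that th sg_mult[OF sU] by (auto simp: image_iff) metis
   show "- x \<in> th ` U" if "x \<in> th ` U" for x
    using that thp(2) sg_iv[OF sU] by (auto simp: image_iff) metis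
  qed
  then obtain R where R: "finite R" "R \<subseteq> th ` U" "!!u. u \<in> U ==> \<exists>r\<in>R. \<exists>m\<in>U. th u - r = of_nat k * th m"
   by auto
  obtain R2 where R2: "finite R2" "R2 \<subseteq> U" "R = th ` R2"
   using finite_subset_image[OF R(1,2)] by auto
  show ?thesis
  proof (rule fidxI[of "(%(r, s). r * s) ` (R1 \<times> R2)"])
   fix u assume u: "u \<in> U"
   obtain s m where sm: "s \<in> R2" "m \<in> U" "th u - th s = of_nat k * th m"
    using R(3)[OF u] R2(3) by auto
   have s: "s \<in> U" using sm R2 by auto
   \<comment> \<open>This k-th power corrects the value of \<theta> without leaving
     \<open>X\<close>.\<close>
   define x where "x = m ^ k"
   have x: "x \<in> X" "x \<in> U" using less.prems(4,6) sm(2) by (auto simp: x_def)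
   have "th (iv x * (u * iv s)) = 0"
    using sm s u x thp sU by (simp add: th sg_mult sg_iv x_def)
   hence "iv x * (u * iv s) \<in> U1" using u s x sU by (simp add: U1_def sg_mult sg_iv)
   then obtain r where r: "r \<in> R1" "iv x * (u * iv s) * iv r \<in> X" using R1 by blast
   have "x * (iv x * (u * iv s) * iv r) \<in> X" by (rule sg_mult[OF less.prems(3) x(1) r(2)])
   hence "u * iv (r * s) \<in> X" by (simp add: mult.assoc)
   thus "\<exists>r\<in>(%(r, s). r * s) ` (R1 \<times> R2). u * iv r \<in> X" using r sm by force
  qed (use R1 R2 in auto)
 qed
qed

lemma J_nilpotent: "x \<in> J ==> x ^ Suc n = 0"
 using nil[of "replicate n x"] by (simp add: prod_list_replicate set_replicate_conv_if split: if_splits)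

text \<open>Divide off the power \<open>v\<^sup>t\<close> with \<open>t = th y / th v\<close>, where \<open>v \<in> W\<close>. The resulting polynomial vanishes on those
 \<open>y \<in> W\<close> for which \<open>t\<close> is an integer, and therefore on \<open>W\<close>, since it is polynomial along every one-parameter
 group.\<close>

theorem separating_polynomial:
 "idl I ==> ug I U ==> sg W ==> W \<subseteq> U ==> (!!x y. x \<in> U ==> y \<in> U ==> cm x y \<in> W) ==> u \<in> U ==>
  (!!m. m >= 1 ==> u ^ m \<notin> W) ==> \<exists>p. pol N p & (\<forall>w\<in>W. p (val w) = 0) & (\<exists>x\<in>U. p (val x) ~= 0)"
proof (induction "fm.dim I" arbitrary: I U W u rule: less_induct)
 case less
 note W = less.prems(3,4) and u = less.prems(6,7)
 have sU: "sg U" and UI: "!!x. x \<in> U ==> val x - 1 \<in> I" using less.prems(2) by (auto simp: ug_def)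
 have IJ: "I \<subseteq> J" using less.prems(1) by (auto simp: idl_def)
 have UM: "val x - 1 \<in> MN N" if "x \<in> U" for x using UI[OF that] IJ J(2) by blast
 have "I ~= {0}"
 proof
  assume "I = {0}"
  hence "u = 1" using UI[OF u(1)] by (intro val_inj) simp
  thus False using u(2)[of 1] sg_one[OF W(1)] by simp
 qed
 then obtain l where l: "\<forall>x y. l (x + y) = l x + l y" "\<forall>c x. l (sm c x) = c * l x"
  "\<forall>a\<in>J. \<forall>b\<in>I. l (a * b) = (0::rat)" "idl {b\<in>I. l b = 0}" "fm.dim {b\<in>I. l b = 0} < fm.dim I"
  by (rule idl_functional[OF less.prems(1)])
 define th where "th x = l (val x - 1)" for x
 have th: "th (x * y) = th x + th y" if "x \<in> U" "y \<in> U" for x y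
  unfolding th_def by (rule theta_hom[OF l(1,3) IJ]) (use UI that in auto)
 hence "\<forall>x\<in>U. \<forall>y\<in>U. th (x * y) = th x + th y" by blast
 note thp = hom_props[OF sU this]
 define U1 where "U1 = {x\<in>U. th x = 0}"
 have sU1: "sg U1" by (rule sgI) (use sU thp th in \<open>auto simp: U1_def sg_one sg_mult sg_iv\<close>)
 have ug1: "ug {b\<in>I. l b = 0} U1" using sU1 UI by (auto simp: ug_def U1_def th_def)
 have cm0: "cm x y \<in> U1" if "x \<in> U" "y \<in> U" for x y
  using that sU by (simp add: U1_def cm_def th thp(2) sg_mult sg_iv)
 \<comment> \<open>A polynomial in the entries that agrees with \<theta> on
   \<open>U\<close>.\<close>
 define t where "t y = (\<Sum>i<N. \<Sum>j<N. (ent y i j - ent 1 i j) * l (unitmat i j))" for y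
 have l_sum: "l (sum f A) = (\<Sum>a\<in>A. l (f a))" for f and A :: "nat set"
 proof -
  have "l 0 = 0" using l(1) by (metis add_0 add_cancel_right_right)
  thus ?thesis by (induction A rule: infinite_finite_induct) (use l(1) in auto)
 qed
 have t: "t (val y) = th y" if "y \<in> U" for y
 proof -
  have "l (val y - 1) = l (\<Sum>i<N. \<Sum>j<N. sm (ent (val y - 1) i j) (unitmat i j))"
   using MN_sum[OF UM[OF that]] by simp
  also have "\<dots> = t (val y)" using l(2) by (simp add: l_sum minus_fmat.rep_eq t_def)
  finally show ?thesis by (simp add: th_def)
 qed
 have pol_t: "pol N t"
  unfolding t_def by (intro pol_mult pol_sum pol_diff pol_const pol_ent) auto
 show ?case
 proof (cases "\<exists>v\<in>W. th v ~= 0")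
  case False
  hence WU1: "W \<subseteq> U1" using W by (auto simp: U1_def)
  show ?thesis
  proof (cases "th u = 0")
   case True
   have "\<exists>p. pol N p & (\<forall>w\<in>W. p (val w) = 0) & (\<exists>x\<in>U1. p (val x) ~= 0)"
    by (rule less.hyps[OF l(5,4) ug1 W(1) WU1, of u]) (use less.prems True in \<open>auto simp: U1_def\<close>)
   thus ?thesis by (auto simp: U1_def)
  \<comment> \<open>When \<theta> vanishes on \<open>W\<close> but not at \<open>u\<close>, it
    separates by itself.\<close>
  qed (use pol_t t W u False in \<open>intro exI[of _ t], auto\<close>)
 next
  case True
  then obtain v where vW: "v \<in> W" "th v ~= 0" by auto
  hence v: "v \<in> U" using W by auto
  have common: "\<exists>m\<ge>1. \<exists>a. of_nat m * th y = of_int a * th v" for y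
  proof -
   obtain a d where ad: "th y / th v = of_int a / of_int d" "d > 0"
    by (metis quotient_of_denom_pos quotient_of_div surj_pair)
   hence "of_nat (nat d) * th y = of_int a * th v" using vW(2) by (simp add: field_simps)
   thus ?thesis using ad(2) by (intro exI[of _ "nat d"]) auto
  qed
  define W1 where "W1 = {w\<in>W. th w = 0}"
  have sW1: "sg W1" by (rule sgI) (use W(2) sg_one sg_mult sg_iv W(1) thp th in \<open>auto simp: W1_def subset_iff\<close>)
  obtain m a where ma: "m >= 1" "of_nat m * th u = of_int a * th v" using common by blast
  \<comment> \<open>The exponents are chosen to make \<theta>(u1) = 0. A power of \<open>u1\<close>
    in \<open>W\<close> would give a power of \<open>u\<close> in \<open>W\<close>, since
    \<open>W\<close> contains \<open>v\<close> and the commutators of \<open>U\<close>.\<close>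
  define u1 where "u1 = u ^ m * zp v (- a)"
  have vp: "zp v k \<in> W" for k by (rule sg_zp[OF W(1) vW(1)])
  have u1: "u1 \<in> U1"
   using u(1) v sU ma(2) by (simp add: u1_def U1_def th thp sg_mult sg_zp sg_power)
  have "\<exists>p. pol N p & (\<forall>w\<in>W1. p (val w) = 0) & (\<exists>x\<in>U1. p (val x) ~= 0)"
  proof (rule less.hyps[OF l(5,4) ug1 sW1 _ _ u1])
   show "W1 \<subseteq> U1" using W by (auto simp: W1_def U1_def)
   show "cm x y \<in> W1" if "x \<in> U1" "y \<in> U1" for x y
    using that less.prems(5) cm0 by (auto simp: W1_def U1_def)
   show "u1 ^ k \<notin> W1" if k: "k >= 1" for k
   proof
    assume "u1 ^ k \<in> W1"
    hence "u1 ^ k \<in> W" by (simp add: W1_def)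
    moreover have "u1 ^ k * iv ((u ^ m) ^ k * zp v (- a) ^ k) \<in> W"
     unfolding u1_def by (rule power_mult_mod[OF sU W less.prems(5)]) (use u(1) v sU in \<open>auto intro: sg_power sg_zp\<close>)
    ultimately have "(u ^ m) ^ k * zp v (- a) ^ k \<in> W"
     using sg_mult_left_iff[OF W(1)] sg_iv_iff[OF W(1)] by blast
    hence "u ^ (m * k) \<in> W" using sg_mult_right_iff[OF W(1) sg_power[OF W(1) vp]] by (simp add: power_mult)
    thus False using u(2)[of "m * k"] ma(1) k by simp
   qed
  qed
  then obtain p1 x where p1: "pol N p1" "\<forall>w\<in>W1. p1 (val w) = 0" "x \<in> U1" "p1 (val x) ~= 0" by auto
  have nilp: "(val y - 1) ^ Suc n = 0" if "y \<in> U" for y using UI[OF that] IJ by (blast intro: J_nilpotent)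
  define B where "B s = binp (Suc n) (val v - 1) s" for s
  define p where "p y = p1 (B (- (t y / th v)) * y)" for y
  have B1: "B s - 1 \<in> MN N" for s
  proof -
   have "(val v - 1) ^ Suc i \<in> MN N" for i
    by (induction i) (use UM[OF v] MN_mult in auto)
   hence "(\<Sum>i<n. sm (s gchoose Suc i) ((val v - 1) ^ Suc i)) \<in> MN N"
    using MN_subspace by (intro fm.subspace_sum fm.subspace_scale) auto
   moreover have "B s = 1 + (\<Sum>i<n. sm (s gchoose Suc i) ((val v - 1) ^ Suc i))"
    unfolding B_def binp_def by (subst sum.lessThan_Suc_shift) simp
   ultimately show ?thesis by simp
  qed
  have polp: "pol N p"
   unfolding p_def
  proof (rule pol_compose[OF p1(1)])
   fix i j assume ij: "i < N" "j < N"
   have "pol N (%x. t x * (- inverse (th v)))" by (intro pol_mult pol_const pol_t)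
   hence mt: "pol N (%x. - (t x / th v))" by (simp add: divide_inverse)
   have "pol N (%x. ent (B (- (t x / th v))) i k)" for k
    unfolding B_def binp_def ent_sum sm.rep_eq
    by (intro pol_sum pol_mult pol_const pol_gchoose mt) auto
   hence "pol N (%x. \<Sum>k<N. ent (B (- (t x / th v))) i k * ent x k j)"
    by (intro pol_sum pol_mult pol_ent) (use ij in auto)
   thus "pol N (%x. ent (B (- (t x / th v)) * x) i j)"
    using ent_times_GLN[OF B1 ij(1)] by simp
  qed
  have int: "p (val y) = 0" if y: "y \<in> W" "th y = of_int b * th v" for y b
  proof -
   have yU: "y \<in> U" using y W by auto
   have "B (- of_int b) = val (zp v (- b))"
    using val_zp_binp[OF nilp[OF v], of "- b"] by (simp add: B_def)
   moreover have "zp v (- b) * y \<in> W1"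
    using y yU v sU vp by (simp add: W1_def th thp(4) sg_mult[OF W(1)] sg_zp)
   ultimately show ?thesis using p1(2) y(2) vW(2) by (simp add: p_def t[OF yU] flip: val_mult)
  qed
  have "p (val y) = 0" if y: "y \<in> W" for y
  proof -
   have yU: "y \<in> U" using y W by auto
   obtain m b where m: "m >= 1" "of_nat m * th y = of_int b * th v" using common by blast
   show ?thesis
   proof (rule pol_vanish_power[OF polp nilp[OF yU] m(1)])
    fix j
    have "th (y ^ (m * j)) = of_nat j * (of_nat m * th y)" by (simp add: thp(3)[OF yU])
    also have "\<dots> = of_int (int j * b) * th v" by (simp add: m(2))
    finally show "p (val (y ^ (m * j))) = 0" by (intro int sg_power W(1) y)
   qed
  qed
  moreover have "p (val x) = p1 (val x)"
   using p1(3) t[of x] binp_0 by (simp add: p_def U1_def B_def)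
  ultimately have "p (val x) ~= 0" "\<forall>w\<in>W. p (val w) = 0" "x \<in> U" using p1(3,4) by (simp_all add: U1_def)
  thus ?thesis using polp by blast
 qed
qed

end

section \<open>Monomials of bounded degree\<close>

definition mnm :: "(nat \<times> nat) list => fmat => rat" where
 "mnm l x = prod_list (map (%(i, j). ent x i j) l)"

text \<open>Monomials are words in the index pairs. A commutative monomial has several such words,
  which does no harm to spanning.\<close>

definition mons :: "nat => nat => (nat \<times> nat) list set" where
 "mons N D = {l. length l <= D & set l \<subseteq> {..<N} \<times> {..<N}}"

lemma finite_mons: "finite (mons N D)"
proof -
 have "mons N D = (\<Union>d\<le>D. {l. set l \<subseteq> {..<N} \<times> {..<N} & length l = d})" by (auto simp: mons_def)
 thus ?thesis by (simp add: finite_lists_length_eq)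
qed

inductive pd :: "nat => nat => (fmat => rat) => bool" for N D where
 pd_mnm: "l \<in> mons N D ==> pd N D (mnm l)"
| pd_add: "pd N D f ==> pd N D g ==> pd N D (%x. f x + g x)"
| pd_scale: "pd N D f ==> pd N D (%x. c * f x)"

lemma pd_le: "pd N D f ==> D <= E ==> pd N E f"
 by (induction rule: pd.induct) (auto intro: pd.intros simp: mons_def)

lemma pd_const: "pd N D (%_. c)"
 using pd_scale[OF pd_mnm[of "[]" N D], of c] by (simp add: mons_def mnm_def)

lemma pd_sum: "finite A ==> (!!a. a \<in> A ==> pd N D (f a)) ==> pd N D (%x. \<Sum>a\<in>A. f a x)"
 by (induction A rule: finite_induct) (auto intro: pd_const pd_add)

lemma pd_mult_mnm: "pd N E g ==> l \<in> mons N D ==> pd N (D + E) (%x. mnm l x * g x)"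
proof (induction rule: pd.induct)
 case (pd_mnm l')
 have "(%x. mnm l x * mnm l' x) = mnm (l @ l')" by (simp add: mnm_def fun_eq_iff)
 thus ?case using pd_mnm by (auto intro!: pd.pd_mnm simp: mons_def)
next
 case (pd_add f g)
 thus ?case using pd.pd_add[of N "D + E" "%x. mnm l x * f x" "%x. mnm l x * g x"]
  by (simp add: distrib_left)
next
 case (pd_scale f c)
 thus ?case using pd.pd_scale[of N "D + E" "%x. mnm l x * f x" c] by (simp add: mult.left_commute)
qed

lemma pd_mult: "pd N D f ==> pd N E g ==> pd N (D + E) (%x. f x * g x)"
proof (induction rule: pd.induct)
 case (pd_mnm l)
 thus ?case by (intro pd_mult_mnm)
next
 case (pd_add f f')
 thus ?case using pd.pd_add[of N "D + E" "%x. f x * g x" "%x. f' x * g x"]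
  by (simp add: distrib_right)
next
 case (pd_scale f c)
 thus ?case using pd.pd_scale[of N "D + E" "%x. f x * g x" c] by (simp add: mult.assoc)
qed

lemma pd_ent: "i < N ==> j < N ==> pd N 1 (%x. ent x i j)"
 using pd_mnm[of "[(i, j)]" N 1] by (simp add: mons_def mnm_def[abs_def])

lemma pol_pd: "pol N f ==> \<exists>D. pd N D f"
proof (induction rule: pol.induct)
 case (pol_add f g)
 then obtain D E where "pd N D f" "pd N E g" by auto
 hence "pd N (max D E) (%x. f x + g x)" by (intro pd_add) (auto intro: pd_le)
 thus ?case by blast
qed (auto intro: pd_const pd_mult pd_ent)

lemma pd_sum_mnm: "pd N D f ==> \<exists>a. \<forall>x. f x = (\<Sum>l\<in>mons N D. a l * mnm l x)"
proof (induction rule: pd.induct)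
 case (pd_mnm l)
 have "(\<Sum>l'\<in>mons N D. (if l' = l then 1 else 0) * mnm l' x) = mnm l x" for x
  using pd_mnm finite_mons[of N D] by (simp add: if_distrib[of "%c. c * _"] cong: if_cong)
 thus ?case by (intro exI[of _ "%l'. if l' = l then 1 else 0"]) simp
next
 case (pd_add f g)
 then obtain a b where "\<forall>x. f x = (\<Sum>l\<in>mons N D. a l * mnm l x)" "\<forall>x. g x = (\<Sum>l\<in>mons N D. b l * mnm l x)"
  by auto
 thus ?case by (intro exI[of _ "%l. a l + b l"]) (simp add: distrib_right sum.distrib)
next
 case (pd_scale f c)
 then obtain a where "\<forall>x. f x = (\<Sum>l\<in>mons N D. a l * mnm l x)" by auto
 thus ?case by (intro exI[of _ "%l. c * a l"]) (simp add: sum_distrib_left mult.assoc)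
qed

lemma pd_pol: "pd N D f ==> pol N f"
proof (induction rule: pd.induct)
 case (pd_mnm l)
 hence "set l \<subseteq> {..<N} \<times> {..<N}" by (simp add: mons_def)
 hence "pol N (%x. prod_list (map (%(i, j). ent x i j) l))"
  by (induction l) (auto intro: pol.intros)
 thus ?case by (simp add: mnm_def[abs_def])
qed (auto intro: pol.intros)

text \<open>Translations are linear in the entries and so keep the degree bound; therefore one
  \<open>D\<close> can serve a whole normal closure.\<close>

lemma pd_translate:
 assumes a: "a - 1 \<in> MN N" and b: "b - 1 \<in> MN N"
 shows "pd N D f ==> \<exists>g. pd N D g & (\<forall>x. x - 1 \<in> MN N --> f (a * x * b) = g x)"
proof (induction rule: pd.induct)
 case (pd_mnm l)
 have "length l <= D ==> set l \<subseteq> {..<N} \<times> {..<N} ==>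
  \<exists>g. pd N D g & (\<forall>x. x - 1 \<in> MN N --> mnm l (a * x * b) = g x)" for D
 proof (induction l arbitrary: D)
  case Nil
  thus ?case using pd_const[of N D 1] by (auto simp: mnm_def)
 next
  case (Cons ij l)
  obtain D' where D': "D = Suc D'" using Cons.prems(1) by (cases D) auto
  obtain i j where "ij = (i, j)" "i < N" "j < N" using Cons.prems(2) by (cases ij) auto
  note ij = this D'
  obtain g where g: "pd N D' g" "!!x. x - 1 \<in> MN N ==> mnm l (a * x * b) = g x"
  proof -
   have "\<exists>g. pd N D' g & (\<forall>x. x - 1 \<in> MN N --> mnm l (a * x * b) = g x)"
    by (rule Cons.IH) (use Cons.prems D' in auto)
   thus ?thesis using that by blast
  qed
  define h where "h x = (\<Sum>k<N. \<Sum>m<N. (ent a i k * ent b m j) * ent x k m)" for x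
  have "pd N 1 h" unfolding h_def by (intro pd_sum pd_scale pd_ent) auto
  hence "pd N (1 + D') (%x. h x * g x)" by (rule pd_mult[OF _ g(1)])
  moreover have "mnm (ij # l) (a * x * b) = h x * g x" if x: "x - 1 \<in> MN N" for x
  proof -
   have "ent (a * (x * b)) i j = (\<Sum>k<N. ent a i k * ent (x * b) k j)"
    by (rule ent_times_GLN[OF a ij(2)])
   also have "\<dots> = (\<Sum>k<N. ent a i k * (\<Sum>m<N. ent x k m * ent b m j))"
    by (intro sum.cong refl arg_cong2[of _ _ _ _ "(*)"] ent_times_GLN[OF x]) auto
   also have "\<dots> = h x" by (simp add: h_def sum_distrib_left mult_ac)
   finally show ?thesis using g(2)[OF x] by (simp add: mnm_def ij mult.assoc)
  qed
  ultimately show ?case using ij by (intro exI[of _ "%x. h x * g x"]) auto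
 qed
 thus ?case using pd_mnm by (auto simp: mons_def)
next
 case (pd_add f f')
 then obtain g g' where "pd N D g" "\<forall>x. x - 1 \<in> MN N --> f (a * x * b) = g x"
  "pd N D g'" "\<forall>x. x - 1 \<in> MN N --> f' (a * x * b) = g' x" by auto
 thus ?case by (intro exI[of _ "%x. g x + g' x"]) (auto intro: pd.pd_add)
next
 case (pd_scale f c)
 then obtain g where "pd N D g" "\<forall>x. x - 1 \<in> MN N --> f (a * x * b) = g x" by auto
 thus ?case by (intro exI[of _ "%x. c * g x"]) (auto intro: pd.pd_scale)
qed

section \<open>Rational matrices acting on complex vectors\<close>

definition csc :: "complex => (nat => complex) => nat => complex" where
 "csc c v = (%i. c * v i)"

interpretation cv: complex_space csc
 by unfold_locales (auto simp: csc_def fun_eq_iff algebra_simps)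

definition Act :: "fmat => (nat => complex) => nat => complex" where
 "Act A v = (%i. \<Sum>k\<in>{k. ent A i k ~= 0}. of_rat (ent A i k) * v k)"

lemma Act_eq:
 assumes "finite S" "!!k. k \<notin> S ==> ent A i k = 0"
 shows "Act A v i = (\<Sum>k\<in>S. of_rat (ent A i k) * v k)"
 unfolding Act_def using assms by (intro sum.mono_neutral_left) auto

lemma Act_one [simp]: "Act 1 v = v"
 by (rule ext, subst Act_eq[of "{_}"]) (auto simp: ent_simps)

lemma Act_add: "Act (A + B) v = Act A v + Act B v"
proof
 fix i
 let ?S = "{k. ent A i k ~= 0} \<union> {k. ent B i k ~= 0}"
 have fin: "finite ?S" using finite_row by auto
 have "Act (A + B) v i = (\<Sum>k\<in>?S. of_rat (ent (A + B) i k) * v k)"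
  "Act A v i = (\<Sum>k\<in>?S. of_rat (ent A i k) * v k)" "Act B v i = (\<Sum>k\<in>?S. of_rat (ent B i k) * v k)"
  by (intro Act_eq[OF fin]; simp add: ent_simps)+
 thus "Act (A + B) v i = (Act A v + Act B v) i"
  by (simp add: ent_simps of_rat_add distrib_right sum.distrib)
qed

lemma Act_sm: "Act (sm c A) v = csc (of_rat c) (Act A v)"
proof
 fix i
 have "Act (sm c A) v i = (\<Sum>k\<in>{k. ent A i k ~= 0}. of_rat (ent (sm c A) i k) * v k)"
  by (rule Act_eq) (auto simp: sm.rep_eq finite_row)
 thus "Act (sm c A) v i = csc (of_rat c) (Act A v) i"
  by (simp add: sm.rep_eq of_rat_mult csc_def Act_def sum_distrib_left mult.assoc)
qed

lemma Act_mult: "Act (A * B) v = Act A (Act B v)"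
proof
 fix i
 let ?S = "{k. ent A i k ~= 0}"
 let ?T = "\<Union>k\<in>?S. {l. ent B k l ~= 0}"
 have fin: "finite ?S" "finite ?T" using finite_row by auto
 have 1: "ent (A * B) i l = (\<Sum>k\<in>?S. ent A i k * ent B k l)" for l
  using fin by (intro ent_times) auto
 have "Act (A * B) v i = (\<Sum>l\<in>?T. of_rat (ent (A * B) i l) * v l)"
 proof (rule Act_eq[OF fin(2)])
  fix l assume "l \<notin> ?T"
  thus "ent (A * B) i l = 0" unfolding 1 by (intro sum.neutral) auto
 qed
 also have "\<dots> = (\<Sum>k\<in>?S. \<Sum>l\<in>?T. of_rat (ent A i k) * of_rat (ent B k l) * v l)"
  unfolding 1 of_rat_sum of_rat_mult sum_distrib_right by (rule sum.swap)
 also have "\<dots> = (\<Sum>k\<in>?S. of_rat (ent A i k) * Act B v k)"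
 proof (rule sum.cong[OF refl])
  fix k assume "k \<in> ?S"
  hence "Act B v k = (\<Sum>l\<in>?T. of_rat (ent B k l) * v l)"
   using fin by (intro Act_eq) auto
  thus "(\<Sum>l\<in>?T. of_rat (ent A i k) * of_rat (ent B k l) * v l) = of_rat (ent A i k) * Act B v k"
   by (simp add: sum_distrib_left mult.assoc)
 qed
 also have "\<dots> = Act A (Act B v) i" using fin by (intro Act_eq[symmetric]) auto
 finally show "Act (A * B) v i = Act A (Act B v) i" .
qed

lemma lin_Act: "cv.lin (Act A)"
 by (auto simp: cv.lin_def Act_def csc_def fun_eq_iff distrib_left sum.distrib sum_distrib_left mult.left_commute)

lemma Act_diff: "Act (A - B) v = Act A v - Act B v"
 using Act_add[of "A - B" B v] by simp

interpretation cr: complex_rep csc "%g. Act (val g)"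
 by unfold_locales (auto simp: lin_Act Act_mult)

definition dl :: "nat => nat => complex" where "dl k = (%i. if i = k then 1 else 0)"

definition FN :: "nat => (nat => complex) set" where "FN N = dl ` {..<N}"

lemma finite_FN: "finite (FN N)"
 by (simp add: FN_def)

lemma span_FN: "cv.span (FN N) = {v. \<forall>i\<ge>N. v i = 0}"
proof
 show "cv.span (FN N) \<subseteq> {v. \<forall>i\<ge>N. v i = 0}"
  by (rule cv.span_minimal) (auto simp: FN_def dl_def cv.subspace_def csc_def)
 show "{v. \<forall>i\<ge>N. v i = 0} \<subseteq> cv.span (FN N)"
 proof safe
  fix v :: "nat => complex" assume v: "\<forall>i\<ge>N. v i = 0"
  have "v = (\<Sum>k<N. csc (v k) (dl k))"
  proof
   fix i
   have "(\<Sum>k<N. csc (v k) (dl k)) i = (\<Sum>k<N. if k = i then v k else 0)"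
    unfolding sum_fun_app by (intro sum.cong) (auto simp: csc_def dl_def)
   thus "v i = (\<Sum>k<N. csc (v k) (dl k)) i" using v by auto
  qed
  also have "\<dots> \<in> cv.span (FN N)" by (intro cv.span_sum cv.span_scale cv.span_base) (auto simp: FN_def)
  finally show "v \<in> cv.span (FN N)" .
 qed
qed

lemma independent_FN: "cv.independent (FN N)" "card (FN N) = N"
proof -
 have "inj_on dl {..<N} & cv.independent (dl ` {..<N})"
 proof (rule cv.independent_if_independent_mod)
  fix c s assume c: "(\<Sum>s<N. csc (c s) (dl s)) = 0" and s: "s \<in> {..<N}"
  have "(\<Sum>k<N. csc (c k) (dl k)) s = (\<Sum>k<N. if k = s then c k else 0)"
   unfolding sum_fun_app by (intro sum.cong) (auto simp: csc_def dl_def)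
  thus "c s = 0" using c s by simp
 qed simp
 thus "cv.independent (FN N)" "card (FN N) = N" by (auto simp: FN_def card_image)
qed

text \<open>The common shape of the blocks in \<open>MN N\<close> and of the elements of
  \<open>GLN N\<close>. It is closed under products and suffices for reading off the N x N
  block.\<close>

definition rb :: "nat => fmat set" where
 "rb N = {A. \<forall>i<N. \<forall>j\<ge>N. ent A i j = 0}"

lemma Act_rb: "A \<in> rb N ==> i < N ==> Act A v i = (\<Sum>k<N. of_rat (ent A i k) * v k)"
 by (rule Act_eq) (auto simp: rb_def not_less)

lemma ent_times_rb: "A \<in> rb N ==> i < N ==> ent (A * B) i j = (\<Sum>k<N. ent A i k * ent B k j)"
 by (rule ent_times) (auto simp: rb_def not_less)

lemma rb_mult: "A \<in> rb N ==> B \<in> rb N ==> A * B \<in> rb N"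
 by (auto simp: rb_def ent_times_rb[of A N, unfolded rb_def])

lemma rb_one: "1 \<in> rb N"
 by (auto simp: rb_def ent_simps)

lemma rb_power: "A \<in> rb N ==> A ^ k \<in> rb N"
 by (induction k) (auto simp: rb_one rb_mult)

lemma rb_sm: "A \<in> rb N ==> sm c A \<in> rb N"
 by (auto simp: rb_def sm.rep_eq)

lemma rb_MN: "A \<in> MN N ==> A \<in> rb N"
 by (force simp: rb_def MN_def)

lemma rb_GLN: "g \<in> GLN N ==> val g \<in> rb N"
proof -
 assume "g \<in> GLN N"
 hence "val g - 1 \<in> rb N" by (auto simp: GLN_def intro: rb_MN)
 thus ?thesis by (auto simp: rb_def ent_simps)
qed

lemma Act_MN_in: "A \<in> MN N ==> Act A v \<in> cv.span (FN N)"
 by (force simp: span_FN Act_def MN_def intro!: sum.neutral)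

lemma Act_GLN_in: "g \<in> GLN N ==> v \<in> cv.span (FN N) ==> Act (val g) v \<in> cv.span (FN N)"
proof -
 assume *: "g \<in> GLN N" "v \<in> cv.span (FN N)"
 have "Act (val g) v = Act (val g - 1) v + v" by (simp add: Act_diff)
 also have "\<dots> \<in> cv.span (FN N)" using * by (intro cv.span_add Act_MN_in) (auto simp: GLN_def)
 finally show ?thesis .
qed

lemma MN_zeroI:
 assumes "A \<in> MN N" "!!v. v \<in> cv.span (FN N) ==> Act A v = 0"
 shows "A = 0"
proof (rule fmat_eqI)
 fix i j
 show "ent A i j = ent 0 i j"
 proof (cases "i < N & j < N")
  case True
  have "dl j \<in> cv.span (FN N)" using True by (auto simp: FN_def intro: cv.span_base)
  hence "Act A (dl j) i = 0" using assms(2) by simp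
  moreover have "Act A (dl j) i = (\<Sum>k<N. if k = j then of_rat (ent A i k) else 0)"
   unfolding Act_rb[OF rb_MN[OF assms(1)] conjunct1[OF True]] by (intro sum.cong) (auto simp: dl_def)
  ultimately have "of_rat (ent A i j) = (0::complex)" using True by simp
  thus ?thesis by (simp add: ent_simps)
 qed (use assms(1) in \<open>auto simp: MN_def ent_simps\<close>)
qed

section \<open>Matrices triangular with respect to a flag\<close>

locale full_flag =
 fixes ws :: "(nat => complex) list" and N :: nat
 assumes indep: "!!i. i < length ws ==> ws ! i \<notin> cv.span (set (take i ws))"
  and full: "cv.span (set ws) = cv.span (FN N)"
begin

abbreviation W :: "nat => (nat => complex) set" where
 "W i \<equiv> cv.span (set (take i ws))"

lemma independent_take: "i <= length ws ==> cv.independent (set (take i ws)) & card (set (take i ws)) = i"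
proof (induction i)
 case 0
 show ?case using cv.independent_empty by simp
next
 case (Suc i)
 have "set (take (Suc i) ws) = insert (ws ! i) (set (take i ws))"
  using Suc.prems by (auto simp: take_Suc_conv_app_nth)
 moreover have "ws ! i \<notin> set (take i ws)" using indep[of i] Suc.prems cv.span_base by auto
 ultimately show ?case using Suc indep[of i] by (auto simp: cv.independent_insert)
qed

lemma length_ws: "length ws = N"
proof -
 have "cv.independent (set ws)" "card (set ws) = length ws"
  using independent_take[of "length ws"] by auto
 moreover have "set ws \<subseteq> cv.span (FN N)" using full cv.span_superset by blast
 moreover have "FN N \<subseteq> cv.span (set ws)" using full cv.span_superset by blast
 ultimately show ?thesis
  using cv.independent_span_bound[OF finite_FN, of "set ws" N]
   cv.independent_span_bound[OF finite_set independent_FN(1), of N ws] independent_FN(2)[of N] by auto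
qed

lemma W_mono: "i <= j ==> W i \<subseteq> W j"
 by (intro cv.span_mono set_take_subset_set_take)

lemma ws_in: "i < j ==> i < N ==> ws ! i \<in> W j"
 by (rule cv.span_base) (auto simp: in_set_conv_nth length_ws intro!: exI[of _ i])

definition ut :: "fmat set" where
 "ut = {A. \<forall>i<N. \<exists>c. Act A (ws ! i) - csc c (ws ! i) \<in> W i}"

text \<open>The i-th diagonal entry with respect to the flag; for triangular matrices these are the
  eigenvalues, by \<open>char_poly_flag\<close>.\<close>

definition ch :: "nat => fmat => complex" where
 "ch i A = (SOME c. Act A (ws ! i) - csc c (ws ! i) \<in> W i)"

definition sut :: "fmat set" where
 "sut = {A. \<forall>i<N. Act A (ws ! i) \<in> W i}"

lemma ch: "A \<in> ut ==> i < N ==> Act A (ws ! i) - csc (ch i A) (ws ! i) \<in> W i"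
 unfolding ch_def by (rule someI_ex) (simp only: ut_def mem_Collect_eq)

lemma ch_unique:
 assumes "i < N" "Act A (ws ! i) - csc c (ws ! i) \<in> W i"
 shows "ch i A = c"
proof (rule ccontr)
 assume neq: "ch i A ~= c"
 have "Act A (ws ! i) - csc (ch i A) (ws ! i) \<in> W i"
  unfolding ch_def by (rule someI) (rule assms)
 hence "(Act A (ws ! i) - csc c (ws ! i)) - (Act A (ws ! i) - csc (ch i A) (ws ! i)) \<in> W i"
  by (rule cv.span_diff[OF assms(2)])
 hence "csc (ch i A - c) (ws ! i) \<in> W i" by (simp add: cv.scale_left_diff_distrib)
 hence "csc (inverse (ch i A - c)) (csc (ch i A - c) (ws ! i)) \<in> W i" by (rule cv.span_scale)
 hence "ws ! i \<in> W i" using neq by simp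
 thus False using indep assms(1) length_ws by auto
qed

lemma ut_inv: "A \<in> ut ==> i <= N ==> x \<in> W i ==> Act A x \<in> W i"
 by (rule cv.flag_inv[of Act "{A}" ws])
  (use indep in \<open>auto simp: cv.flag_def ut_def length_ws intro: lin_Act\<close>)

lemma sut_down: "A \<in> sut ==> i < N ==> x \<in> W (Suc i) ==> Act A x \<in> W i"
proof (rule cv.lin_span[OF lin_Act])
 fix b assume A: "A \<in> sut" and i: "i < N" and "b \<in> set (take (Suc i) ws)"
 then obtain j where "j < Suc i" "b = ws ! j" by (auto simp: in_set_conv_nth)
 thus "Act A b \<in> W i" using A i W_mono[of j i] by (auto simp: sut_def)
qed auto

lemma sut_ut: "sut \<subseteq> ut"
 unfolding sut_def ut_def by (auto intro!: exI[of _ 0])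

lemma ch_mult:
 assumes A: "A \<in> ut" and B: "B \<in> ut" and i: "i < N"
 shows "Act (A * B) (ws ! i) - csc (ch i A * ch i B) (ws ! i) \<in> W i"
proof -
 have "Act A (Act B (ws ! i) - csc (ch i B) (ws ! i)) \<in> W i"
  by (rule ut_inv[OF A _ ch[OF B i]]) (use i in simp)
 moreover have "csc (ch i B) (Act A (ws ! i) - csc (ch i A) (ws ! i)) \<in> W i"
  by (rule cv.span_scale[OF ch[OF A i]])
 ultimately have "Act A (Act B (ws ! i) - csc (ch i B) (ws ! i)) + csc (ch i B) (Act A (ws ! i) - csc (ch i A) (ws ! i)) \<in> W i"
  by (rule cv.span_add)
 moreover have "Act A (Act B (ws ! i) - csc (ch i B) (ws ! i)) + csc (ch i B) (Act A (ws ! i) - csc (ch i A) (ws ! i))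
   = Act (A * B) (ws ! i) - csc (ch i A * ch i B) (ws ! i)"
  by (simp add: Act_mult cv.lin_diff[OF lin_Act] cv.lin_scale[OF lin_Act] cv.scale_right_diff_distrib mult.commute)
 ultimately show ?thesis by simp
qed

lemma ut_mult: "A \<in> ut ==> B \<in> ut ==> A * B \<in> ut"
 using ch_mult[of A B] by (subst ut_def) blast

lemma ch_mult_eq: "A \<in> ut ==> B \<in> ut ==> i < N ==> ch i (A * B) = ch i A * ch i B"
 by (rule ch_unique[OF _ ch_mult])

lemma ut_one: "1 \<in> ut" and ch_one [simp]: "i < N ==> ch i 1 = 1"
proof -
 have "Act 1 (ws ! i) - csc 1 (ws ! i) \<in> W i" for i by (simp add: cv.span_zero)
 thus "1 \<in> ut" "i < N ==> ch i 1 = 1" by (auto simp: ut_def intro!: ch_unique exI[of _ 1])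
qed

lemma ut_power: "A \<in> ut ==> A ^ k \<in> ut"
 by (induction k) (auto simp: ut_one ut_mult)

lemma ch_power: "A \<in> ut ==> i < N ==> ch i (A ^ k) = ch i A ^ k"
 by (induction k) (auto simp: ch_mult_eq ut_power)

lemma ut_add: "A \<in> ut ==> B \<in> ut ==> A + B \<in> ut"
 and ch_add: "A \<in> ut ==> B \<in> ut ==> i < N ==> ch i (A + B) = ch i A + ch i B"
proof -
 assume A: "A \<in> ut" and B: "B \<in> ut"
 have *: "Act (A + B) (ws ! i) - csc (ch i A + ch i B) (ws ! i) \<in> W i" if "i < N" for i
  using cv.span_add[OF ch[OF A that] ch[OF B that]]
  by (simp add: Act_add cv.scale_left_distrib algebra_simps)
 thus "A + B \<in> ut" by (auto simp: ut_def)
 show "ch i (A + B) = ch i A + ch i B" if "i < N" by (rule ch_unique[OF that *[OF that]])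
qed

lemma ut_sm: "A \<in> ut ==> sm c A \<in> ut"
 and ch_sm: "A \<in> ut ==> i < N ==> ch i (sm c A) = of_rat c * ch i A"
proof -
 assume A: "A \<in> ut"
 have *: "Act (sm c A) (ws ! i) - csc (of_rat c * ch i A) (ws ! i) \<in> W i" if "i < N" for i
  using cv.span_scale[OF ch[OF A that], of "of_rat c"]
  by (simp add: Act_sm cv.scale_right_diff_distrib)
 thus "sm c A \<in> ut" by (auto simp: ut_def)
 show "ch i (sm c A) = of_rat c * ch i A" if "i < N" by (rule ch_unique[OF that *[OF that]])
qed

lemma ut_diff: "A \<in> ut ==> B \<in> ut ==> A - B \<in> ut"
 and ch_diff: "A \<in> ut ==> B \<in> ut ==> i < N ==> ch i (A - B) = ch i A - ch i B"
proof -
 assume A: "A \<in> ut" and B: "B \<in> ut"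
 have "A - B = A + sm (- 1) B" by (rule fmat_eqI) (simp add: ent_simps sm.rep_eq)
 thus "A - B \<in> ut" "i < N ==> ch i (A - B) = ch i A - ch i B"
  using ut_add[OF A ut_sm[OF B, of "- 1"]] ch_add[OF A ut_sm[OF B, of "- 1"]] ch_sm[OF B, of i "- 1"]
  by simp_all
qed

lemma sut_iff: "A \<in> sut \<longleftrightarrow> A \<in> ut & (\<forall>i<N. ch i A = 0)"
proof
 assume A: "A \<in> sut"
 hence "ch i A = 0" if "i < N" for i
  using that by (intro ch_unique) (auto simp: sut_def)
 thus "A \<in> ut & (\<forall>i<N. ch i A = 0)" using A sut_ut by auto
next
 assume "A \<in> ut & (\<forall>i<N. ch i A = 0)"
 thus "A \<in> sut" unfolding sut_def using ch[of A] by fastforce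
qed

lemma subspace_sut: "fm.subspace sut"
 unfolding fm.subspace_def
proof (intro conjI ballI allI)
 show "0 \<in> sut" by (simp add: sut_def Act_def cv.span_zero[unfolded zero_fun_def] ent_simps)
qed (auto simp: sut_def Act_add Act_sm intro: cv.span_add cv.span_scale)

lemma sut_mult: "A \<in> sut ==> B \<in> ut ==> A * B \<in> sut" "A \<in> ut ==> B \<in> sut ==> A * B \<in> sut"
 by (auto simp: sut_iff ut_mult ch_mult_eq)

text \<open>Each factor lowers a vector by one step of the flag, which has N steps.\<close>

lemma sut_prod_zero:
 assumes "length js = N" "set js \<subseteq> sut" "prod_list js \<in> MN N"
 shows "prod_list js = 0"
proof (rule MN_zeroI[OF assms(3)])
 fix v assume v: "v \<in> cv.span (FN N)"
 have "length js <= N ==> set js \<subseteq> sut ==> Act (prod_list js) v \<in> W (N - length js)" for js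
 proof (induction js)
  case Nil
  thus ?case using v full by (simp add: length_ws)
 next
  case (Cons j js)
  hence "Act (prod_list js) v \<in> W (Suc (N - length (j # js)))"
   by (simp add: Suc_diff_Suc)
  thus ?case using Cons.prems by (auto simp: Act_mult intro: sut_down)
 qed
 from this[OF _ assms(2)] show "Act (prod_list js) v = 0" using assms(1) by simp
qed

text \<open>The flag is complex, yet the rational matrices that are strictly triangular for it form
  a nilpotent algebra over the rationals, so the theory of unipotent groups applies without
  extending scalars. The bound on \<open>N\<close> excludes the empty product 1.\<close>

lemma nilalg_sut: assumes "N >= 1" shows "nilalg (sut \<inter> MN N) N N"
proof
 show "fm.subspace (sut \<inter> MN N)" by (intro fm.subspace_inter subspace_sut MN_subspace)
 show "a * b \<in> sut \<inter> MN N" if "a \<in> sut \<inter> MN N" "b \<in> sut \<inter> MN N" for a b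
  using that sut_mult sut_ut MN_mult by blast
 fix js :: "fmat list" assume js: "length js = N" "set js \<subseteq> sut \<inter> MN N"
 have pr: "us ~= [] ==> set us \<subseteq> MN N ==> prod_list us \<in> MN N" for us
  by (induction us rule: list_nonempty_induct) (auto intro: MN_mult)
 have "js ~= []" "set js \<subseteq> MN N" "set js \<subseteq> sut" using js assms by auto
 thus "prod_list js = 0" using sut_prod_zero[OF js(1) _ pr] by simp
qed auto

end

section \<open>Bounding multiplicative relations between eigenvalues\<close>

lemma clear_denominators: "\<exists>a F. a > 0 & map_poly rat_of_int F = smult (of_int a) f"
proof (induction f)
 case 0
 show ?case by (rule exI[of _ 1], rule exI[of _ 0]) simp
next
 case (pCons c f)
 then obtain a F where aF: "a > 0" "map_poly rat_of_int F = smult (of_int a) f" by auto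
 obtain x y where xy: "quotient_of c = (x, y)" by force
 have y: "y > 0" "c = of_int x / of_int y"
  using quotient_of_denom_pos[OF xy] quotient_of_div[OF xy] by auto
 have "map_poly rat_of_int (pCons (x * a) (smult y F)) = smult (of_int (a * y)) (pCons c f)"
  using y aF(2) by (simp add: of_int_hom.map_poly_pCons_hom of_int_hom.map_poly_hom_smult mult_ac)
 thus ?case using aF(1) y(1) by (intro exI[of _ "a * y"] exI[of _ "pCons (x * a) (smult y F)"]) auto
qed

lemma content_nonneg: "content (F :: int poly) >= 0"
proof -
 have "\<bar>content F\<bar> = content F" using normalize_content[of F] by (simp only: normalize_int_def)
 thus ?thesis by linarith
qed

lemma monic_primitive_multiple:
 assumes "lead_coeff f = 1"
 shows "\<exists>a F. a > 0 & map_poly rat_of_int F = smult (of_int a) f & content F = 1"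
proof -
 obtain a F where aF: "a > 0" "map_poly rat_of_int F = smult (of_int a) f"
  using clear_denominators by blast
 have "rat_of_int (lead_coeff F) = lead_coeff (map_poly rat_of_int F)" by simp
 also have "\<dots> = of_int a" using assms by (simp add: aF(2))
 finally have lF: "lead_coeff F = a" by simp
 define c where "c = content F"
 have "c dvd a" unfolding c_def lF[symmetric] by (rule content_dvd_coeff)
 then obtain b where b: "a = c * b" by (auto simp: dvd_def)
 have "c >= 0" unfolding c_def by (rule content_nonneg)
 moreover have "c ~= 0" using aF(1) b by auto
 ultimately have c: "c > 0" by simp
 have "F ~= 0" using lF aF(1) by auto
 have "smult (rat_of_int c) (map_poly rat_of_int (primitive_part F)) = map_poly rat_of_int F"
  using content_times_primitive_part[of F]
  by (metis c_def of_int_hom.map_poly_hom_smult)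
 also have "\<dots> = smult (of_int c) (smult (of_int b) f)" by (simp add: aF(2) b)
 finally have "map_poly rat_of_int (primitive_part F) = smult (of_int b) f"
  using c by (metis of_int_0_eq_iff smult_cancel less_irrefl)
 moreover have "b > 0" using aF(1) b c by (simp add: zero_less_mult_iff)
 ultimately show ?thesis using \<open>F ~= 0\<close> by (intro exI[of _ b] exI[of _ "primitive_part F"]) simp
qed

text \<open>Let F and H be primitive integer multiples, by a and b, of f and its cofactor. Then F H
  = a b g, and comparing contents gives a b = 1.\<close>

lemma gauss_monic:
 assumes f: "lead_coeff f = 1" and g: "lead_coeff g = 1" and dvd: "f dvd map_poly rat_of_int g"
 shows "\<exists>F. f = map_poly rat_of_int F"
proof -
 obtain h where h: "map_poly rat_of_int g = f * h" using dvd by (auto simp: dvd_def)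
 have "lead_coeff (map_poly rat_of_int g) = 1" using g by simp
 hence lh: "lead_coeff h = 1" using f unfolding h by (simp add: lead_coeff_mult)
 obtain a F where F: "a > 0" "map_poly rat_of_int F = smult (of_int a) f" "content F = 1"
  using monic_primitive_multiple[OF f] by blast
 obtain b H where H: "b > 0" "map_poly rat_of_int H = smult (of_int b) h" "content H = 1"
  using monic_primitive_multiple[OF lh] by blast
 have "map_poly rat_of_int (F * H) = map_poly rat_of_int (smult (a * b) g)"
  by (simp add: of_int_poly_hom.hom_mult F(2) H(2) of_int_hom.map_poly_hom_smult h mult_ac)
 hence eq: "F * H = smult (a * b) g" by (simp only: of_int_poly_hom.eq_iff)
 have "content g dvd 1" using content_dvd_coeff[of g "degree g"] g by simp
 moreover have "content g >= 0" by (rule content_nonneg)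
 ultimately have "content g = 1" by simp
 hence "a * b = 1"
  using arg_cong[OF eq, of content] F(1,3) H(1,3) by (simp add: content_mult)
 hence "a = 1" using F(1) H(1) by (auto simp: zmult_eq_1_iff)
 thus ?thesis using F(2) by (intro exI[of _ F]) simp
qed

section \<open>Bounded polynomials, roots of unity and simultaneous approximation\<close>

lemma coeff_prod_linear_bound:
 fixes a :: "nat => complex"
 assumes "R >= 0" "!!j. j < n ==> cmod (a j) <= R"
 shows "cmod (coeff (\<Prod>j<n. [:- a j, 1:]) i) <= (1 + R) ^ n"
 using assms(2)
proof (induction n arbitrary: i)
 case 0
 thus ?case by (simp add: coeff_1)
next
 case (Suc n)
 let ?p = "\<Prod>j<n. [:- a j, 1:]"
 have IH: "cmod (coeff ?p i) <= (1 + R) ^ n" for i using Suc by simp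
 have "(\<Prod>j<Suc n. [:- a j, 1:]) = smult (- a n) ?p + pCons 0 ?p" by simp
 hence "coeff (\<Prod>j<Suc n. [:- a j, 1:]) i = - a n * coeff ?p i + (if i = 0 then 0 else coeff ?p (i - 1))"
  by (simp add: coeff_pCons split: nat.split)
 also have "cmod \<dots> <= cmod (a n) * cmod (coeff ?p i) + (1 + R) ^ n"
  using IH[of "i - 1"] assms(1) by (intro norm_triangle_le add_mono) (auto simp: norm_mult)
 also have "\<dots> <= R * (1 + R) ^ n + (1 + R) ^ n"
  using Suc.prems[of n] IH[of i] assms(1) by (intro add_right_mono mult_mono) auto
 finally show ?case by (simp add: algebra_simps)
qed

lemma card_bounded_polys:
 "finite {F :: int poly. degree F <= n & (\<forall>i. \<bar>coeff F i\<bar> <= int T)} &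
  card {F :: int poly. degree F <= n & (\<forall>i. \<bar>coeff F i\<bar> <= int T)} <= (2 * T + 1) ^ (n + 1)"
proof -
 let ?P = "{F :: int poly. degree F <= n & (\<forall>i. \<bar>coeff F i\<bar> <= int T)}"
 let ?f = "%F :: int poly. map (coeff F) [0..<n + 1]"
 let ?L = "{xs. set xs \<subseteq> {- int T..int T} & length xs = n + 1}"
 have inj: "inj_on ?f ?P"
 proof (rule inj_onI)
  fix F G assume FG: "F \<in> ?P" "G \<in> ?P" "?f F = ?f G"
  have "coeff F i = coeff G i" for i
  proof (cases "i <= n")
   case True
   thus ?thesis using FG(3) by auto
  next
   case False
   thus ?thesis using FG by (auto simp: coeff_eq_0)
  qed
  thus "F = G" by (rule poly_eqI)
 qed
 have "- int T <= coeff F i & coeff F i <= int T" if "F \<in> ?P" for F i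
 proof -
  have "\<bar>coeff F i\<bar> <= int T" using that by blast
  thus ?thesis by linarith
 qed
 hence sub: "?f ` ?P \<subseteq> ?L" by auto
 have cT: "card {- int T..int T} = 2 * T + 1" by (simp add: nat_add_distrib nat_mult_distrib)
 have L: "finite ?L" "card ?L = (2 * T + 1) ^ (n + 1)"
  using finite_lists_length_eq[of "{- int T..int T}" "n + 1"] card_lists_length_eq[of "{- int T..int T}" "n + 1"]
  unfolding cT by simp_all
 show ?thesis
  using card_inj_on_le[OF inj sub L(1)] inj_on_finite[OF inj sub L(1)] L(2) by simp
qed

text \<open>Following s^l = t^k from element to element must repeat within n steps. This gives s^m =
  1 for m = l^b - l^a k^(b-a), which is positive and at most K^n; the factorial is a common multiple
  of all candidates m.\<close>

lemma root_of_unity_if_powers_permute: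
 fixes S :: "complex set"
 assumes S: "finite S" "card S <= n" "0 \<notin> S" and kl: "k < l" "l <= K" and n: "n >= 1"
  and perm: "!!s. s \<in> S ==> \<exists>t\<in>S. s ^ l = t ^ k" and s: "s \<in> S"
 shows "s ^ fact (K ^ n) = 1"
proof -
 obtain nx where nx: "!!s. s \<in> S ==> nx s \<in> S & s ^ l = nx s ^ k" using perm by metis
 define f where "f i = (nx ^^ i) s" for i
 have f: "f i \<in> S" for i by (induction i) (use s nx in \<open>auto simp: f_def\<close>)
 have step: "f i ^ l = f (Suc i) ^ k" for i using nx[OF f[of i]] by (simp add: f_def)
 have pow: "f i ^ (l ^ j) = f (i + j) ^ (k ^ j)" for i j
 proof (induction j)
  case (Suc j)
  have "f i ^ (l ^ Suc j) = (f (i + j) ^ (k ^ j)) ^ l"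
   by (simp add: Suc[symmetric] power_mult[symmetric] mult.commute)
  also have "\<dots> = (f (i + j) ^ l) ^ (k ^ j)" by (simp add: power_mult[symmetric] mult.commute)
  also have "\<dots> = f (i + Suc j) ^ (k ^ Suc j)" by (simp add: step power_mult[symmetric])
  finally show ?case .
 qed simp
 have "~ inj_on f {..n}"
 proof
  assume "inj_on f {..n}"
  hence "card {..n} <= card S" using f S(1) by (intro card_inj_on_le[of f]) auto
  thus False using S(2) by simp
 qed
 then obtain a b where ab: "a < b" "b <= n" "f a = f b"
  unfolding inj_on_def by (metis atMost_iff linorder_neq_iff)
 define m where "m = l ^ b - l ^ a * k ^ (b - a)"
 have lt: "l ^ a * k ^ (b - a) < l ^ b"
 proof -
  have "l ^ a * k ^ (b - a) < l ^ a * l ^ (b - a)"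
   using kl ab by (intro mult_strict_left_mono power_strict_mono) auto
  also have "\<dots> = l ^ b" using ab by (simp add: power_add[symmetric])
  finally show ?thesis .
 qed
 have "s ^ (l ^ b) = s ^ (l ^ a * k ^ (b - a))"
 proof -
  have f0: "f 0 = s" by (simp add: f_def)
  have "s ^ (l ^ b) = f b ^ (k ^ b)" using pow[of 0 b] f0 by simp
  also have "\<dots> = (f a ^ (k ^ a)) ^ (k ^ (b - a))"
   using ab by (simp add: power_mult[symmetric] power_add[symmetric])
  also have "\<dots> = (s ^ (l ^ a)) ^ (k ^ (b - a))" using pow[of 0 a] f0 by simp
  finally show ?thesis by (simp add: power_mult)
 qed
 moreover have "s ^ (l ^ b) = s ^ (l ^ a * k ^ (b - a)) * s ^ m"
  using lt by (simp add: m_def power_add[symmetric])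
 ultimately have "s ^ m = 1" using S(3) s by auto
 moreover have "1 <= m" using lt by (simp add: m_def)
 moreover have "m <= K ^ n"
 proof -
  have "m <= l ^ b" by (simp add: m_def)
  also have "\<dots> <= K ^ b" using kl(2) by (rule power_mono) simp
  also have "\<dots> <= K ^ n" using ab kl by (intro power_increasing) auto
  finally show ?thesis .
 qed
 ultimately show ?thesis
 proof -
  assume m: "s ^ m = 1" "1 <= m" "m <= K ^ n"
  hence "m dvd fact (K ^ n)" by (intro dvd_fact) auto
  then obtain q where "fact (K ^ n) = m * q" by (auto simp: dvd_def)
  thus ?thesis using m(1) by (metis power_mult power_one)
 qed
qed

text \<open>Pigeonhole: the fractional parts of q e_i / E, for q from 0 to Q^r, fall into Q^r boxes
  of side 1/Q. Everything is multiplied by E to stay with integers.\<close>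

lemma dirichlet_simultaneous:
 fixes e :: "nat => int"
 assumes "E >= 1" "Q >= 1"
 obtains q p where "0 < q" "q <= int (Q ^ r)" "\<forall>i<r. \<bar>p i * int E - q * e i\<bar> * int Q < int E"
proof -
 define f where "f q = (\<lambda>i\<in>{..<r}. nat ((int q * e i mod int E) * int Q div int E))" for q :: nat
 have "f q \<in> {..<r} \<rightarrow>\<^sub>E {..<Q}" for q
 proof -
  have "nat ((int q * e i mod int E) * int Q div int E) < Q" for i
  proof -
   have "(int q * e i mod int E) * int Q < int E * int Q"
    using assms by (intro mult_strict_right_mono) auto
   moreover have "(int q * e i mod int E) * int Q div int E * int E <= (int q * e i mod int E) * int Q"
    using assms by (simp add: minus_mod_eq_div_mult[symmetric])
   ultimately have "(int q * e i mod int E) * int Q div int E * int E < int Q * int E"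
    by (simp add: mult.commute)
   hence "(int q * e i mod int E) * int Q div int E < int Q"
    using assms by (simp add: mult_less_cancel_right)
   thus ?thesis using assms by (simp add: nat_less_iff pos_imp_zdiv_nonneg_iff)
  qed
  thus ?thesis by (auto simp: f_def)
 qed
 hence "f ` {..Q ^ r} \<subseteq> {..<r} \<rightarrow>\<^sub>E {..<Q}" by auto
 hence "card (f ` {..Q ^ r}) <= Q ^ r"
  using card_mono[of "{..<r} \<rightarrow>\<^sub>E {..<Q}"] by (simp add: finite_PiE card_PiE)
 hence "~ inj_on f {..Q ^ r}" by (auto dest: card_image)
 then obtain a b where ab: "a < b" "b <= Q ^ r" "f a = f b"
  unfolding inj_on_def by (metis atMost_iff linorder_neq_iff)
 show ?thesis
 proof (rule that[of "int (b - a)" "%i. (int b * e i div int E) - (int a * e i div int E)"])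
  show "int (b - a) <= int (Q ^ r)" using ab by linarith
  show "\<forall>i<r. \<bar>((int b * e i div int E) - (int a * e i div int E)) * int E - int (b - a) * e i\<bar> * int Q < int E"
  proof (intro allI impI)
  fix i assume i: "i < r"
  define u where "u = int a * e i mod int E"
  define v where "v = int b * e i mod int E"
  have uv: "int a * e i = (int a * e i div int E) * int E + u" "int b * e i = (int b * e i div int E) * int E + v"
   by (simp_all add: u_def v_def)
  have "((int b * e i div int E) - (int a * e i div int E)) * int E - int (b - a) * e i = u - v"
   using uv ab(1) by (simp add: of_nat_diff algebra_simps)
  moreover have "u * int Q div int E = v * int Q div int E"
  proof -
   have "u * int Q div int E >= 0" "v * int Q div int E >= 0"
    using assms by (auto simp: u_def v_def pos_imp_zdiv_nonneg_iff)
   thus ?thesis using fun_cong[OF ab(3), of i] i by (simp add: f_def u_def v_def)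
  qed
  hence "\<bar>u * int Q - v * int Q\<bar> < int E"
  proof -
   define z where "z = u * int Q div int E"
   assume eq: "u * int Q div int E = v * int Q div int E"
   have "u * int Q = z * int E + u * int Q mod int E" "v * int Q = z * int E + v * int Q mod int E"
    unfolding z_def by simp (simp add: eq)
   moreover have "0 <= u * int Q mod int E" "u * int Q mod int E < int E"
    "0 <= v * int Q mod int E" "v * int Q mod int E < int E" using assms by auto
   ultimately show ?thesis by linarith
  qed
  ultimately show "\<bar>((int b * e i div int E) - (int a * e i div int E)) * int E - int (b - a) * e i\<bar> * int Q < int E"
   by (metis abs_mult abs_of_nat left_diff_distrib)
  qed
 qed (use ab in auto)
qed

lemma cmod_of_rat: "cmod (of_rat q) = real_of_rat \<bar>q\<bar>"
proof -
 obtain a b where ab: "quotient_of q = (a, b)" by force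
 have "q = of_int a / of_int b" "b > 0" using quotient_of_div[OF ab] quotient_of_denom_pos[OF ab] by auto
 moreover have "real_of_rat \<bar>rat_of_int a\<bar> = \<bar>real_of_int a\<bar>"
  by (metis of_int_abs of_rat_of_int_eq)
 ultimately show ?thesis by (simp add: of_rat_divide norm_divide abs_divide)
qed

definition qmat :: "nat => fmat => rat mat" where
 "qmat N A = mat N N (%(i, j). ent A i j)"

lemma qmat_carrier [simp]: "qmat N A \<in> carrier_mat N N"
 by (simp add: qmat_def)

lemma char_poly_integral:
 assumes "!!i j. i < N ==> j < N ==> ent A i j \<in> \<int>"
 shows "\<exists>G. char_poly (qmat N A) = map_poly rat_of_int G & lead_coeff G = 1"
proof -
 define M where "M = mat N N (%(i, j). \<lfloor>ent A i j\<rfloor>)"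
 have M: "M \<in> carrier_mat N N" by (simp add: M_def)
 have "qmat N A = map_mat rat_of_int M"
  using assms by (intro eq_matI) (auto simp: qmat_def M_def elim!: Ints_cases)
 hence "char_poly (qmat N A) = map_poly rat_of_int (char_poly M)"
  by (simp add: of_int_hom.char_poly_hom[OF M])
 moreover have "lead_coeff (char_poly M) = 1" using degree_monic_char_poly[OF M] by auto
 ultimately show ?thesis by blast
qed

context full_flag
begin

lemma span_take_sum: "j <= N ==> x \<in> W j ==> \<exists>c. x = (\<Sum>l<j. csc (c l) (ws ! l))"
proof -
 assume j: "j <= N" and "x \<in> W j"
 from this(2) show "\<exists>c. x = (\<Sum>l<j. csc (c l) (ws ! l))"
 proof (induction rule: cv.span_induct_alt)
  case base
  show ?case by (rule exI[of _ "%_. 0"]) simp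
 next
  case (step a b y)
  then obtain c where c: "y = (\<Sum>l<j. csc (c l) (ws ! l))" by auto
  obtain k where k: "k < j" "b = ws ! k" using step(1) by (auto simp: in_set_conv_nth)
  have "(\<Sum>l<j. csc ((c(k := c k + a)) l) (ws ! l)) = (\<Sum>l<j. csc (c l) (ws ! l) + (if l = k then csc a (ws ! l) else 0))"
   by (intro sum.cong) (auto simp: cv.scale_left_distrib)
  also have "\<dots> = y + csc a b" using k by (simp add: sum.distrib c)
  finally show ?case by (intro exI[of _ "c(k := c k + a)"]) (simp add: add.commute)
 qed
qed

lemma ws_zero: "j < N ==> i >= N ==> (ws ! j) i = 0"
proof -
 assume "j < N" "i >= N"
 hence "ws ! j \<in> cv.span (set ws)" by (intro cv.span_base) (simp add: length_ws)
 thus "(ws ! j) i = 0" using \<open>i >= N\<close> full by (auto simp: span_FN)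
qed

text \<open>The flag vectors are the columns of a matrix \<open>P\<close> that conjugates the matrix
  into the upper triangular \<open>T\<close>.\<close>

theorem char_poly_flag:
 assumes A: "A \<in> ut" "A \<in> rb N"
 shows "char_poly (map_mat complex_of_rat (qmat N A)) = (\<Prod>i<N. [:- ch i A, 1:])"
proof -
 define Ac where "Ac = map_mat complex_of_rat (qmat N A)"
 define P where "P = mat N N (%(i, j). (ws ! j) i)"
 have "\<exists>c. Act A (ws ! j) - csc (ch j A) (ws ! j) = (\<Sum>l<j. csc (c l) (ws ! l))" if "j < N" for j
  using span_take_sum[OF _ ch[OF A(1) that]] that by simp
 then obtain c where c: "!!j. j < N ==> Act A (ws ! j) - csc (ch j A) (ws ! j) = (\<Sum>l<j. csc (c j l) (ws ! l))"
  by metis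
 define t where "t l j = (if l < j then c j l else if l = j then ch j A else 0)" for l j
 have t: "Act A (ws ! j) = (\<Sum>l<N. csc (t l j) (ws ! l))" if j: "j < N" for j
 proof -
  have "(\<Sum>l<N. csc (t l j) (ws ! l)) = (\<Sum>l<Suc j. csc (t l j) (ws ! l))"
   using j by (intro sum.mono_neutral_right) (auto simp: t_def csc_def fun_eq_iff)
  also have "\<dots> = (\<Sum>l<j. csc (c j l) (ws ! l)) + csc (ch j A) (ws ! j)"
   by (simp add: t_def)
  also have "\<dots> = Act A (ws ! j)" by (simp add: c[OF j, symmetric])
  finally show ?thesis by simp
 qed
 define T where "T = mat N N (%(l, j). t l j)"
 have car: "Ac \<in> carrier_mat N N" "P \<in> carrier_mat N N" "T \<in> carrier_mat N N"
  by (auto simp: Ac_def P_def T_def)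
 have comm: "Ac * P = P * T"
 proof (rule eq_matI)
  fix i j assume ij: "i < dim_row (P * T)" "j < dim_col (P * T)"
  hence ij': "i < N" "j < N" by (auto simp: P_def T_def)
  have "(Ac * P) $$ (i, j) = (\<Sum>k<N. of_rat (ent A i k) * (ws ! j) k)"
   using ij' by (simp add: Ac_def P_def qmat_def scalar_prod_def lessThan_atLeast0)
  also have "\<dots> = Act A (ws ! j) i" by (rule Act_rb[OF A(2) ij'(1), symmetric])
  also have "\<dots> = (\<Sum>l<N. (ws ! l) i * t l j)"
   unfolding t[OF ij'(2)] sum_fun_app by (simp add: csc_def mult.commute)
  also have "\<dots> = (P * T) $$ (i, j)"
   using ij' by (simp add: T_def P_def scalar_prod_def lessThan_atLeast0)
  finally show "(Ac * P) $$ (i, j) = (P * T) $$ (i, j)" .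
 qed (auto simp: Ac_def P_def T_def qmat_def)
 \<comment> \<open>The last nonzero coordinate of a kernel vector would put a flag vector into the
   span of its predecessors.\<close>
 have "det P ~= 0"
 proof
  assume "det P = 0"
  then obtain v where v: "v \<in> carrier_vec N" "v ~= 0\<^sub>v N" "P *\<^sub>v v = 0\<^sub>v N"
   using det_0_iff_vec_prod_zero[OF car(2)] by auto
  define I where "I = {j. j < N & v $ j ~= 0}"
  have "finite I" by (simp add: I_def)
  moreover have "I ~= {}"
  proof
   assume "I = {}"
   hence "v = 0\<^sub>v N" using v(1) by (intro eq_vecI) (auto simp: I_def)
   thus False using v(2) by simp
  qed
  ultimately have m: "Max I \<in> I" "!!j. j \<in> I ==> j <= Max I" by auto
  define m where "m = Max I"
  have mN: "m < N" "v $ m ~= 0" using m(1) by (auto simp: I_def m_def)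
  have "(\<Sum>j<N. csc (v $ j) (ws ! j)) = 0"
  proof
   fix i
   show "(\<Sum>j<N. csc (v $ j) (ws ! j)) i = 0 i"
   proof (cases "i < N")
    case True
    have "(P *\<^sub>v v) $ i = (\<Sum>j<N. (ws ! j) i * v $ j)"
     using True v(1) by (auto simp: P_def scalar_prod_def lessThan_atLeast0)
    thus ?thesis using v(3) True by (simp add: sum_fun_app csc_def mult.commute)
   next
    case False
    thus ?thesis by (simp add: sum_fun_app csc_def ws_zero)
   qed
  qed
  moreover have "(\<Sum>j<N. csc (v $ j) (ws ! j)) = (\<Sum>j<Suc m. csc (v $ j) (ws ! j))"
  proof (rule sum.mono_neutral_right)
   show "\<forall>j\<in>{..<N} - {..<Suc m}. csc (v $ j) (ws ! j) = 0"
   proof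
    fix j assume "j \<in> {..<N} - {..<Suc m}"
    hence "~ j <= m" "j < N" by auto
    hence "v $ j = 0" using m(2)[of j] unfolding m_def[symmetric] by (auto simp: I_def)
    thus "csc (v $ j) (ws ! j) = 0" by simp
   qed
  qed (use mN in auto)
  ultimately have "csc (v $ m) (ws ! m) = - (\<Sum>j<m. csc (v $ j) (ws ! j))"
   by (simp add: eq_neg_iff_add_eq_0 add.commute)
  also have "\<dots> \<in> W m"
   by (intro cv.span_neg cv.span_sum cv.span_scale ws_in) (use mN in auto)
  finally have "csc (inverse (v $ m)) (csc (v $ m) (ws ! m)) \<in> W m" by (rule cv.span_scale)
  thus False using indep[of m] mN by (simp add: length_ws)
 qed
 hence "P \<in> Units (ring_mat TYPE(complex) N ())" by (rule det_non_zero_imp_unit[OF car(2)])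
 then obtain Q where Q: "Q \<in> carrier_mat N N" "Q * P = 1\<^sub>m N" "P * Q = 1\<^sub>m N"
  by (auto simp: Units_def ring_mat_def)
 note dQ = Q(1)
 have "similar_mat Ac T"
 proof (rule similar_matI)
  show "{Ac, T, P, Q} \<subseteq> carrier_mat N N" using car dQ by auto
  have "P * T * Q = Ac * P * Q" by (simp add: comm)
  also have "\<dots> = Ac" using car dQ Q by (simp add: assoc_mult_mat[of _ N N _ N _ N])
  finally show "Ac = P * T * Q" by simp
 qed (use Q dQ in auto)
 hence "char_poly Ac = char_poly T" by (rule char_poly_similar)
 also have "\<dots> = (\<Prod>a\<leftarrow>diag_mat T. [:- a, 1:])"
  by (rule char_poly_upper_triangular[OF car(3)]) (auto simp: T_def t_def)
 also have "\<dots> = (\<Prod>i\<leftarrow>[0..<N]. [:- ch i A, 1:])"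
  by (rule arg_cong[of _ _ prod_list]) (auto simp: diag_mat_def T_def t_def)
 also have "\<dots> = (\<Prod>i<N. [:- ch i A, 1:])"
  by (simp add: prod.distinct_set_conv_list[symmetric] lessThan_atLeast0)
 finally show ?thesis by (simp add: Ac_def)
qed

lemma char_poly_qmat:
 assumes A: "A \<in> ut" "A \<in> rb N"
 shows "map_poly complex_of_rat (char_poly (qmat N A)) = (\<Prod>i<N. [:- ch i A, 1:])"
 using char_poly_flag[OF assms] by (simp add: of_rat_hom.char_poly_hom[OF qmat_carrier])

text \<open>The row sum bound for eigenvalues: compare both sides of the eigenvector equation at a
  coordinate of largest modulus.\<close>

lemma ch_bound:
 assumes A: "A \<in> ut" "A \<in> rb N" and j: "j < N"
  and C: "!!i. i < N ==> (\<Sum>k<N. \<bar>ent A i k\<bar>) <= of_nat C"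
 shows "cmod (ch j A) <= of_nat C"
proof -
 define Ac where "Ac = map_mat complex_of_rat (qmat N A)"
 have car: "Ac \<in> carrier_mat N N" by (auto simp: Ac_def)
 have "poly (char_poly Ac) (ch j A) = (\<Prod>i<N. poly [:- ch i A, 1:] (ch j A))"
  unfolding Ac_def char_poly_flag[OF A] by (rule poly_prod)
 also have "\<dots> = 0" using j by (intro prod_zero) auto
 finally have "eigenvalue Ac (ch j A)" by (simp add: eigenvalue_root_char_poly[OF car])
 then obtain v where v: "v \<in> carrier_vec N" "v ~= 0\<^sub>v N" "Ac *\<^sub>v v = ch j A \<cdot>\<^sub>v v"
  using car by (auto simp: eigenvalue_def eigenvector_def)
 have "\<exists>i<N. v $ i ~= 0"
 proof (rule ccontr)
  assume "~ (\<exists>i<N. v $ i ~= 0)"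
  hence "v = 0\<^sub>v N" using v(1) by (intro eq_vecI) auto
  thus False using v(2) by simp
 qed
 then obtain i0 where i0: "i0 < N" "v $ i0 ~= 0" by auto
 define M where "M = Max ((%i. cmod (v $ i)) ` {..<N})"
 have "M \<in> (%i. cmod (v $ i)) ` {..<N}" unfolding M_def by (rule Max_in) (use i0 in auto)
 then obtain i where i: "i < N" "cmod (v $ i) = M" by auto
 have le: "cmod (v $ k) <= M" if "k < N" for k
  unfolding M_def by (rule Max_ge) (use that in auto)
 have M: "M > 0" using le[OF i0(1)] i0(2) by (meson less_le_trans zero_less_norm_iff)
 have "ch j A * v $ i = (Ac *\<^sub>v v) $ i" using v(1,3) i(1) by simp
 also have "\<dots> = (\<Sum>k<N. of_rat (ent A i k) * v $ k)"
  using i(1) v(1) by (auto simp: Ac_def qmat_def scalar_prod_def lessThan_atLeast0)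
 finally have "cmod (ch j A) * M = cmod (\<Sum>k<N. of_rat (ent A i k) * v $ k)"
  by (metis i(2) norm_mult)
 also have "\<dots> <= (\<Sum>k<N. of_rat \<bar>ent A i k\<bar> * M)"
 proof (rule sum_norm_le)
  fix k assume "k \<in> {..<N}"
  show "cmod (of_rat (ent A i k) * v $ k) <= of_rat \<bar>ent A i k\<bar> * M"
   using le[of k] \<open>k \<in> {..<N}\<close> by (auto simp: norm_mult cmod_of_rat intro!: mult_left_mono)
 qed
 also have "\<dots> = of_rat (\<Sum>k<N. \<bar>ent A i k\<bar>) * M" by (simp add: of_rat_sum sum_distrib_right)
 also have "\<dots> <= of_nat C * M"
 proof (rule mult_right_mono)
  show "real_of_rat (\<Sum>k<N. \<bar>ent A i k\<bar>) <= of_nat C"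
   using C[OF i(1)] by (metis of_rat_less_eq of_rat_of_nat_eq)
 qed (use M in simp)
 finally show ?thesis using M by simp
qed

text \<open>The eigenvalues of \<open>A\<close> are E-th roots of those of an integral matrix, hence
  algebraic integers. Concretely, the characteristic polynomial of \<open>A\<close> divides G(x^E),
  which is monic and integral, and \<open>gauss_monic\<close> applies.\<close>

lemma char_poly_integral_root:
 assumes A: "A \<in> ut" "A \<in> rb N" and X: "X \<in> ut" "X \<in> rb N"
  and int: "!!i j. i < N ==> j < N ==> ent X i j \<in> \<int>"
  and E: "E >= 1" and pow: "!!j. j < N ==> ch j X = ch j A ^ E"
 shows "\<exists>F. char_poly (qmat N A) = map_poly rat_of_int F"
proof -
 obtain G where G: "char_poly (qmat N X) = map_poly rat_of_int G" "lead_coeff G = 1"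
  using char_poly_integral[OF int] by blast
 let ?m = "monom 1 E :: int poly" and ?mc = "monom 1 E :: complex poly"
 have "(\<Prod>i<N. [:- ch i A, 1:]) dvd (\<Prod>i<N. [:- ch i X, 1:] \<circ>\<^sub>p ?mc)"
 proof (rule prod_dvd_prod)
  fix i assume "i \<in> {..<N}"
  hence "poly ([:- ch i X, 1:] \<circ>\<^sub>p ?mc) (ch i A) = 0"
   using pow[of i] by (simp add: poly_pcompose poly_monom)
  thus "[:- ch i A, 1:] dvd [:- ch i X, 1:] \<circ>\<^sub>p ?mc" by (rule poly_eq_0_iff_dvd[THEN iffD1])
 qed
 also have "(\<Prod>i<N. [:- ch i X, 1:] \<circ>\<^sub>p ?mc) = (\<Prod>i<N. [:- ch i X, 1:]) \<circ>\<^sub>p ?mc"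
  by (simp add: pcompose_prod)
 also have "(\<Prod>i<N. [:- ch i X, 1:]) = map_poly complex_of_rat (map_poly rat_of_int G)"
  by (simp only: char_poly_qmat[OF X, symmetric] G(1))
 also have "map_poly complex_of_rat (map_poly rat_of_int G) \<circ>\<^sub>p ?mc
  = map_poly complex_of_rat (map_poly rat_of_int (G \<circ>\<^sub>p ?m))"
  by (simp add: of_rat_hom.map_poly_pcompose of_int_hom.map_poly_pcompose map_poly_monom)
 finally have "map_poly complex_of_rat (char_poly (qmat N A)) dvd map_poly complex_of_rat (map_poly rat_of_int (G \<circ>\<^sub>p ?m))"
  by (simp only: char_poly_qmat[OF A])
 hence "char_poly (qmat N A) dvd map_poly rat_of_int (G \<circ>\<^sub>p ?m)"
  by (rule of_rat_hom.dvd_map_poly_hom_imp_dvd)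
 moreover have "lead_coeff (char_poly (qmat N A)) = 1"
  using degree_monic_char_poly[OF qmat_carrier] by metis
 moreover have "lead_coeff (G \<circ>\<^sub>p ?m) = 1"
  using G(2) E by (subst lead_coeff_comp) (auto simp: degree_monom_eq)
 ultimately show ?thesis by (intro gauss_monic)
qed

section \<open>Characters of the triangular group\<close>

definition TG :: "fmat un set" where
 "TG = {g \<in> GLN N. val g \<in> ut & val (iv g) \<in> ut}"

lemma sg_TG: "sg TG"
 by (rule sgI) (use sg_GLN[of N] in \<open>auto simp: TG_def ut_one ut_mult sg_one sg_mult sg_iv\<close>)

lemma TG_rb: "g \<in> TG ==> val g \<in> rb N"
 by (auto simp: TG_def rb_GLN)

lemma TG_ut: "g \<in> TG ==> val g \<in> ut"
 by (simp add: TG_def)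

lemma ch_TG_mult: "g \<in> TG ==> h \<in> TG ==> j < N ==> ch j (val (g * h)) = ch j (val g) * ch j (val h)"
 by (simp add: TG_def ch_mult_eq)

lemma ch_TG_iv: "g \<in> TG ==> j < N ==> ch j (val (iv g)) = inverse (ch j (val g))"
proof -
 assume g: "g \<in> TG" and j: "j < N"
 have "ch j (val (iv g)) * ch j (val g) = ch j (val (iv g * g))"
  using ch_TG_mult[OF sg_iv[OF sg_TG g] g j] by simp
 hence "ch j (val (iv g)) * ch j (val g) = 1" using j by simp
 thus ?thesis by (metis inverse_unique mult.commute)
qed

lemma ch_TG_nz: "g \<in> TG ==> j < N ==> ch j (val g) ~= 0"
 using ch_TG_mult[of "iv g" g j] sg_iv[OF sg_TG, of g] by auto

lemma ch_TG_zp: "g \<in> TG ==> j < N ==> ch j (val (zp g k)) = ch j (val g) powi k"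
 by (auto simp: zp_def power_int_def ch_power TG_ut ch_TG_iv sg_iv[OF sg_TG] power_inverse)

lemma ch_TG_pe:
 "set hs \<subseteq> TG ==> length es = length hs ==> j < N ==>
  ch j (val (pe hs es)) = (\<Prod>i<length hs. ch j (val (hs ! i)) powi (es ! i))"
proof (induction hs es rule: pe.induct)
 case (1 h hs e es)
 thus ?case
  by (simp add: ch_TG_mult sg_zp[OF sg_TG] pe_in[OF sg_TG] ch_TG_zp prod.lessThan_Suc_shift del: val_mult prod.lessThan_Suc)
qed auto

text \<open>Measures denominators by powers of \<open>d\<close>, so that the length of a word bounds
  the power needed (\<open>ints_pe\<close>).\<close>

definition ints :: "nat => nat => fmat => bool" where
 "ints d k A \<longleftrightarrow> (\<forall>i<N. \<forall>j<N. of_nat d ^ k * ent A i j \<in> \<int>)"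

lemma ints_mult:
 assumes "A \<in> rb N" "ints d k A" "ints d l B"
 shows "ints d (k + l) (A * B)"
 unfolding ints_def
proof (intro allI impI)
 fix i j assume ij: "i < N" "j < N"
 have "of_nat d ^ (k + l) * ent (A * B) i j = (\<Sum>m<N. (of_nat d ^ k * ent A i m) * (of_nat d ^ l * ent B m j))"
  unfolding ent_times_rb[OF assms(1) ij(1)] sum_distrib_left
  by (intro sum.cong refl) (simp add: power_add mult_ac)
 also have "\<dots> \<in> \<int>"
  by (rule Ints_sum, rule Ints_mult) (use assms ij in \<open>auto simp: ints_def\<close>)
 finally show "of_nat d ^ (k + l) * ent (A * B) i j \<in> \<int>" .
qed

lemma ints_one: "ints d 0 1"
 by (auto simp: ints_def ent_simps)

lemma ints_le: "ints d k A ==> k <= l ==> ints d l A"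
 unfolding ints_def
proof (intro allI impI)
 fix i j assume *: "\<forall>i<N. \<forall>j<N. of_nat d ^ k * ent A i j \<in> \<int>" "k <= l" "i < N" "j < N"
 have "rat_of_nat d ^ l * ent A i j = of_nat d ^ (l - k) * (of_nat d ^ k * ent A i j)"
  using *(2) by (simp add: mult.assoc[symmetric] power_add[symmetric])
 also have "\<dots> \<in> \<int>" by (rule Ints_mult) (use * in auto)
 finally show "rat_of_nat d ^ l * ent A i j \<in> \<int>" .
qed

lemma ints_pe:
 "set hs \<subseteq> TG ==> length es = length hs ==> (!!h. h \<in> set hs ==> ints d 1 (val h) & ints d 1 (val (iv h))) ==>
  ints d (\<Sum>e\<leftarrow>es. nat \<bar>e\<bar>) (val (pe hs es))"
proof (induction hs es rule: pe.induct)
 case (1 h hs e es)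
 have pow: "ints d k (val (g ^ k))" if "g \<in> TG" "ints d 1 (val g)" for g k
 proof (induction k)
  case 0
  thus ?case by (simp add: ints_one)
 next
  case (Suc k)
  thus ?case using ints_mult[OF TG_rb[OF that(1)] that(2) Suc] by simp
 qed
 have h: "h \<in> TG" "iv h \<in> TG" using 1 sg_iv[OF sg_TG] by auto
 have "ints d (nat \<bar>e\<bar>) (val (zp h e))"
  using pow[OF h(1)] pow[OF h(2)] 1(4)[of h] by (auto simp: zp_def abs_if simp del: val_power)
 thus ?case
  using 1 ints_mult[OF TG_rb[OF sg_zp[OF sg_TG h(1)]]] by simp
qed (auto simp: ints_one)

text \<open>If the eigenvalue characters of \<open>hs\<close> satisfy a nontrivial relation, Dirichlet approximation of its
 exponent vector produces a short vector \<open>p\<close> for which the powers of \<open>h\<^sup>p\<close> have characteristic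
 polynomials in a fixed finite set, so that the eigenvalues of \<open>h\<^sup>p\<close> are roots of unity.\<close>

theorem relation_bound:
 assumes N: "N >= 1" and hs: "set hs \<subseteq> TG"
  and d: "d >= 1" "!!h. h \<in> set hs ==> ints d 1 (val h) & ints d 1 (val (iv h))"
  and C: "!!h i. h \<in> set hs ==> i < N ==>
   (\<Sum>k<N. \<bar>ent (val h) i k\<bar>) <= of_nat C & (\<Sum>k<N. \<bar>ent (val (iv h)) i k\<bar>) <= of_nat C"
  and K: "(2 * (1 + d * C) ^ N + 1) ^ (N + 1) <= K"
  and B: "fact (K ^ N) * ((K * length hs) ^ length hs + 1) <= B"
  and es: "length es0 = length hs" "\<exists>e\<in>set es0. e ~= 0" "!!j. j < N ==> ch j (val (pe hs es0)) = 1"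
 shows "\<exists>es. length es = length hs & (\<exists>e\<in>set es. e ~= 0) & (\<forall>e\<in>set es. \<bar>e\<bar> <= int B) &
  (\<forall>j<N. ch j (val (pe hs es)) = 1)"
proof -
 define r where "r = length hs"
 obtain i1 where i1: "i1 < r" "es0 ! i1 ~= 0" using es(1,2) by (auto simp: in_set_conv_nth r_def)
 have "(1::nat) <= (2 * (1 + d * C) ^ N + 1) ^ (N + 1)" by (rule one_le_power) simp
 hence K1: "K >= 1" using K by (rule le_trans)
 \<comment> \<open>The factor K permits multiplying the approximation errors by any k up to K, and
   the factor r permits summing them over the generators, with a total of at most E.\<close>
 define Q where "Q = K * r"
 have Q: "Q > 0" using K1 i1 by (auto simp: Q_def)
 \<comment> \<open>C = 0 would bound a nonzero eigenvalue by 0; positivity makes powers of C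
   increasing.\<close>
 have C1: "C >= 1"
 proof -
  have h: "hs ! i1 \<in> set hs" using i1 by (simp add: r_def)
  have g: "hs ! i1 \<in> TG" using hs h by auto
  have "cmod (ch 0 (val (hs ! i1))) <= of_nat C" "cmod (ch 0 (val (iv (hs ! i1)))) <= of_nat C"
   using N C[OF h] g sg_iv[OF sg_TG g] by (auto intro!: ch_bound TG_ut TG_rb)
  moreover have "cmod (ch 0 (val (hs ! i1))) ~= 0" using ch_TG_nz[OF g, of 0] N by simp
  ultimately show ?thesis by (cases C) auto
 qed
 define E where "E = Max ((%i. nat \<bar>es0 ! i\<bar>) ` {..<r})"
 have "E \<in> (%i. nat \<bar>es0 ! i\<bar>) ` {..<r}" unfolding E_def by (rule Max_in) (use i1 in auto)
 then obtain i0 where i0: "i0 < r" "nat \<bar>es0 ! i0\<bar> = E" by auto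
 have Ele: "\<bar>es0 ! i\<bar> <= int E" if "i < r" for i
 proof -
  have "nat \<bar>es0 ! i\<bar> <= E" unfolding E_def by (rule Max_ge) (use that in auto)
  thus ?thesis by simp
 qed
 have E: "E >= 1" using Ele[OF i1(1)] i1(2) by (cases E) auto
 have Q1: "Q >= 1" using Q by simp
 obtain q p where q: "0 < q" "q <= int (Q ^ r)"
  and p: "\<forall>i<r. \<bar>p i * int E - q * es0 ! i\<bar> * int Q < int E"
  by (rule dirichlet_simultaneous[OF E Q1, of r "%i. es0 ! i"])
 \<comment> \<open>The approximation errors. Because \<open>es0\<close> is a relation, the power k E
   of \<open>lam j\<close> equals the character at the exponents k s, whose total is at most E
   (\<open>lam_pow\<close>, \<open>s_sum\<close>).\<close>
 define s where "s i = p i * int E - q * es0 ! i" for i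
 have s: "\<bar>s i\<bar> * int Q < int E" if "i < r" for i
  using p that by (simp add: s_def)
 \<comment> \<open>At the largest exponent the approximation cannot be 0, so the new relation is
   nontrivial.\<close>
 have p_nz: "p i0 ~= 0"
 proof
  assume "p i0 = 0"
  moreover have "\<bar>es0 ! i0\<bar> = int E" using i0(2) by simp
  ultimately have "q * int E * int Q < int E" using s[OF i0(1)] q(1) by (simp add: s_def abs_mult)
  moreover have "int E <= q * int E * int Q"
  proof -
   have "1 * int E * 1 <= q * int E * int Q" using q Q by (intro mult_mono) auto
   thus ?thesis by simp
  qed
  ultimately show False by simp
 qed
 have p_le: "\<bar>p i\<bar> <= int (Q ^ r) + 1" if "i < r" for i
 proof -
  have "\<bar>p i\<bar> * int E = \<bar>s i + q * es0 ! i\<bar>" by (simp add: s_def abs_mult)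
  also have "\<dots> <= \<bar>s i\<bar> + \<bar>q * es0 ! i\<bar>" by (rule abs_triangle_ineq)
  also have "\<bar>s i\<bar> <= int E"
  proof -
   have "\<bar>s i\<bar> * 1 <= \<bar>s i\<bar> * int Q" using Q by (intro mult_left_mono) auto
   thus ?thesis using s[OF that] by simp
  qed
  also have "\<bar>q * es0 ! i\<bar> <= int (Q ^ r) * int E"
   unfolding abs_mult using q Ele[OF that] by (intro mult_mono) auto
  finally have "\<bar>p i\<bar> * int E <= (int (Q ^ r) + 1) * int E" by (simp add: algebra_simps)
  thus ?thesis using E by simp
 qed
 define \<Lambda> where "\<Lambda> j e = (\<Prod>i<r. ch j (val (hs ! i)) powi (e i))" for j and e :: "nat => int"
 have hsTG: "hs ! i \<in> TG" if "i < r" for i using hs that by (auto simp: r_def)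
 have nz: "ch j (val (hs ! i)) ~= 0" if "i < r" "j < N" for i j using ch_TG_nz[OF hsTG] that by auto
 have \<Lambda>_add: "\<Lambda> j (%i. a i + b i) = \<Lambda> j a * \<Lambda> j b" if "j < N" for j a b
  unfolding \<Lambda>_def prod.distrib[symmetric] using nz that
  by (intro prod.cong refl) (simp add: power_int_add)
 have prod_powi: "(\<Prod>i\<in>S. f i powi b) = (\<Prod>i\<in>S. f i) powi b" for f :: "nat => complex" and S b
  by (induction S rule: infinite_finite_induct) (auto simp: power_int_mult_distrib)
 have \<Lambda>_mult: "\<Lambda> j (%i. a i * b) = \<Lambda> j a powi b" for j a b
  unfolding \<Lambda>_def by (simp add: power_int_mult prod_powi)
 have \<Lambda>_pe: "ch j (val (pe hs (map e [0..<r]))) = \<Lambda> j e" if "j < N" for j e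
  unfolding \<Lambda>_def using ch_TG_pe[OF hs _ that, of "map e [0..<r]"] by (simp add: r_def)
 have \<Lambda>0: "\<Lambda> j (%i. es0 ! i) = 1" if "j < N" for j
  using ch_TG_pe[OF hs es(1) that] es(3)[OF that] by (simp add: \<Lambda>_def r_def)
 have \<Lambda>_bound: "cmod (\<Lambda> j e) <= real C ^ (\<Sum>i<r. nat \<bar>e i\<bar>)" if j: "j < N" for j e
 proof -
  have "cmod (\<Lambda> j e) = (\<Prod>i<r. cmod (ch j (val (hs ! i)) powi (e i)))" by (simp add: \<Lambda>_def prod_norm)
  also have "\<dots> <= (\<Prod>i<r. real C ^ nat \<bar>e i\<bar>)"
  proof (rule prod_mono)
   fix i assume "i \<in> {..<r}"
   hence i: "i < r" "hs ! i \<in> set hs" by (auto simp: r_def)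
   have b: "cmod (ch j (val (hs ! i))) <= real C"
    by (rule ch_bound[OF TG_ut TG_rb j]) (use hsTG[OF i(1)] C[OF i(2)] in auto)
   have "cmod (ch j (val (iv (hs ! i)))) <= real C"
    by (rule ch_bound[OF TG_ut TG_rb j]) (use sg_iv[OF sg_TG hsTG[OF i(1)]] C[OF i(2)] in auto)
   hence b': "cmod (inverse (ch j (val (hs ! i)))) <= real C"
    by (simp add: ch_TG_iv[OF hsTG[OF i(1)] j])
   show "0 <= cmod (ch j (val (hs ! i)) powi (e i)) & cmod (ch j (val (hs ! i)) powi (e i)) <= real C ^ nat \<bar>e i\<bar>"
    using b b' by (auto simp: power_int_def norm_power abs_if intro!: power_mono)
  qed
  finally show ?thesis by (simp add: power_sum)
 qed
 define lam where "lam j = \<Lambda> j p" for j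
 have lam_pow: "lam j ^ (k * E) = \<Lambda> j (%i. s i * int k)" if j: "j < N" for j k
 proof -
  have "lam j ^ (k * E) = \<Lambda> j (%i. p i * int (k * E))"
   unfolding \<Lambda>_mult lam_def by (simp only: power_int_of_nat)
  also have "(%i. p i * int (k * E)) = (%i. s i * int k + (es0 ! i) * (q * int k))"
   by (auto simp: s_def fun_eq_iff algebra_simps)
  also have "\<Lambda> j \<dots> = \<Lambda> j (%i. s i * int k) * \<Lambda> j (%i. es0 ! i) powi (q * int k)"
   unfolding \<Lambda>_add[OF j] \<Lambda>_mult[symmetric] ..
  finally show ?thesis by (simp add: \<Lambda>0[OF j])
 qed
 have s_sum: "(\<Sum>i<r. nat \<bar>s i * int k\<bar>) <= E" if k: "k <= K" for k
 proof -
  have "(\<Sum>i<r. \<bar>s i\<bar> * int Q) <= (\<Sum>i<r. int E)" using s by (intro sum_mono) (auto intro: less_imp_le)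
  hence "(\<Sum>i<r. \<bar>s i\<bar>) * (int K * int r) <= int r * int E"
   by (simp add: sum_distrib_right Q_def)
  hence "(int K * (\<Sum>i<r. \<bar>s i\<bar>)) * int r <= int E * int r" by (simp add: mult_ac)
  hence le: "int K * (\<Sum>i<r. \<bar>s i\<bar>) <= int E" using i1 by (subst (asm) mult_le_cancel_right) auto
  have "int (\<Sum>i<r. nat \<bar>s i * int k\<bar>) = int k * (\<Sum>i<r. \<bar>s i\<bar>)"
   by (simp add: sum_distrib_left abs_mult mult.commute)
  also have "\<dots> <= int K * (\<Sum>i<r. \<bar>s i\<bar>)" using k by (intro mult_right_mono sum_nonneg) auto
  finally show ?thesis using le by linarith
 qed
 define g where "g = pe hs (map p [0..<r])"
 have g: "g \<in> TG" unfolding g_def by (rule pe_in[OF sg_TG hs])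
 have chg: "ch j (val g) = lam j" if "j < N" for j using \<Lambda>_pe[OF that] by (simp add: g_def lam_def)
 \<comment> \<open>One factor d is enough: in E-th powers it becomes d^E, which clears the
   denominators of a word of length at most E.\<close>
 define A where "A k = sm (of_nat d) (val g ^ k)" for k
 have A: "A k \<in> ut" "A k \<in> rb N" for k
  unfolding A_def using g by (auto intro!: ut_sm rb_sm ut_power rb_power TG_ut TG_rb)
 have chA: "ch j (A k) = of_nat d * lam j ^ k" if "j < N" for j k
  unfolding A_def using that g chg[OF that] by (simp add: ch_sm ut_power TG_ut ch_power)
 have intF: "\<exists>F. char_poly (qmat N (A k)) = map_poly rat_of_int F" if k: "k <= K" for k
 proof -
  define x where "x = pe hs (map (%i. s i * int k) [0..<r])"
  have x: "x \<in> TG" unfolding x_def by (rule pe_in[OF sg_TG hs])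
  define X where "X = sm (of_nat d ^ E) (val x)"
  have "ints d (\<Sum>e\<leftarrow>map (%i. s i * int k) [0..<r]. nat \<bar>e\<bar>) (val x)"
   unfolding x_def by (rule ints_pe[OF hs]) (use d in \<open>auto simp: r_def\<close>)
  moreover have "(\<Sum>e\<leftarrow>map (%i. s i * int k) [0..<r]. nat \<bar>e\<bar>) = (\<Sum>i<r. nat \<bar>s i * int k\<bar>)"
   by (simp add: o_def sum_list_distinct_conv_sum_set lessThan_atLeast0)
  ultimately have "ints d E (val x)" using s_sum[OF k] ints_le by metis
  hence "ent X i j \<in> \<int>" if "i < N" "j < N" for i j
   using that by (simp add: X_def sm.rep_eq ints_def)
  moreover have "ch j X = ch j (A k) ^ E" if j: "j < N" for j
  proof -
   have "ch j X = of_nat d ^ E * \<Lambda> j (%i. s i * int k)"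
    using \<Lambda>_pe[OF j] x by (simp add: X_def ch_sm[OF TG_ut j] x_def of_rat_power)
   also have "\<dots> = ch j (A k) ^ E"
    by (simp add: chA[OF j] lam_pow[OF j, symmetric] power_mult_distrib power_mult)
   finally show ?thesis .
  qed
  ultimately show ?thesis
   using x E by (intro char_poly_integral_root[OF A, of X E]) (auto simp: X_def intro!: ut_sm rb_sm TG_ut TG_rb)
 qed
 then obtain F where F: "!!k. k <= K ==> char_poly (qmat N (A k)) = map_poly rat_of_int (F k)" by metis
 have Fc: "map_poly complex_of_int (F k) = (\<Prod>j<N. [:- (of_nat d * lam j ^ k), 1:])" if k: "k <= K" for k
 proof -
  have "map_poly complex_of_int (F k) = map_poly complex_of_rat (map_poly rat_of_int (F k))"
   by (subst map_poly_map_poly) (auto simp: o_def)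
  also have "\<dots> = (\<Prod>j<N. [:- ch j (A k), 1:])" by (simp only: F[OF k, symmetric] char_poly_qmat[OF A])
  also have "\<dots> = (\<Prod>j<N. [:- (of_nat d * lam j ^ k), 1:])" by (intro prod.cong refl) (simp add: chA)
  finally show ?thesis .
 qed
 have lam_le: "cmod (lam j ^ k) <= real C" if j: "j < N" and k: "k <= K" for j k
 proof -
  have "cmod (lam j ^ k) ^ E = cmod (\<Lambda> j (%i. s i * int k))"
   by (simp add: lam_pow[OF j, symmetric] norm_power power_mult)
  also have "\<dots> <= real C ^ (\<Sum>i<r. nat \<bar>s i * int k\<bar>)" by (rule \<Lambda>_bound[OF j])
  also have "\<dots> <= real C ^ E" using s_sum[OF k] C1 by (intro power_increasing) auto
  finally have le: "cmod (lam j ^ k) ^ E <= real C ^ E" .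
  obtain E' where E': "E = Suc E'" using E by (cases E) auto
  show ?thesis by (rule power_le_imp_le_base[OF le[unfolded E']]) simp
 qed
 define T where "T = (1 + d * C) ^ N"
 have FP: "F k \<in> {F. degree F <= N & (\<forall>i. \<bar>coeff F i\<bar> <= int T)}" if k: "k <= K" for k
 proof -
  have "degree (map_poly complex_of_int (F k)) = degree (F k)" by simp
  moreover have "degree (map_poly rat_of_int (F k)) = N"
   using F[OF k] degree_monic_char_poly[OF qmat_carrier] by metis
  ultimately have "degree (F k) = N" by simp
  moreover have "\<bar>coeff (F k) i\<bar> <= int T" for i
  proof -
   have "cmod (coeff (\<Prod>j<N. [:- (of_nat d * lam j ^ k), 1:]) i) <= (1 + real d * real C) ^ N"
    using lam_le[OF _ k] by (intro coeff_prod_linear_bound) (auto simp: norm_mult intro!: mult_left_mono)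
   hence "real_of_int \<bar>coeff (F k) i\<bar> <= (1 + real d * real C) ^ N"
    unfolding Fc[OF k, symmetric] by simp
   also have "\<dots> = real_of_int (int T)" by (simp add: T_def)
   finally show ?thesis by (simp only: of_int_le_iff)
  qed
  ultimately show ?thesis by simp
 qed
 \<comment> \<open>There are K + 1 exponents but at most K polynomials within the coefficient
   bound.\<close>
 have "~ inj_on F {..K}"
 proof
  assume "inj_on F {..K}"
  hence "card {..K} <= card {F :: int poly. degree F <= N & (\<forall>i. \<bar>coeff F i\<bar> <= int T)}"
   using FP card_bounded_polys[of N T] by (intro card_inj_on_le[of F]) auto
  also have "\<dots> <= K" using card_bounded_polys[of N T] K by (simp add: T_def)
  finally show False by simp
 qed
 then obtain k l where kl: "k < l" "l <= K" "F k = F l"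
  unfolding inj_on_def by (metis atMost_iff linorder_neq_iff)
 have "lam j ^ fact (K ^ N) = 1" if j: "j < N" for j
 proof (rule root_of_unity_if_powers_permute[of "lam ` {..<N}" N k l])
  show "card (lam ` {..<N}) <= N" using card_image_le[of "{..<N}" lam] by simp
  show "0 \<notin> lam ` {..<N}" using ch_TG_nz[OF g] chg by auto
  fix z assume "z \<in> lam ` {..<N}"
  then obtain i where i: "i < N" "z = lam i" by auto
  have "poly (\<Prod>j<N. [:- (of_nat d * lam j ^ l), 1:]) (of_nat d * lam i ^ l) = 0"
   unfolding poly_prod using i by (intro prod_zero) auto
  hence "poly (\<Prod>j<N. [:- (of_nat d * lam j ^ k), 1:]) (of_nat d * lam i ^ l) = 0"
   using Fc[of k] Fc[of l] kl by simp
  then obtain j where j: "j < N" "of_nat d * lam i ^ l = of_nat d * lam j ^ k"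
   unfolding poly_prod by (auto simp: prod_zero_iff)
  hence "lam i ^ l = lam j ^ k" using d(1) by simp
  thus "\<exists>t\<in>lam ` {..<N}. z ^ l = t ^ k" using i j by auto
 qed (use kl N j in auto)
 hence one: "\<Lambda> j (%i. p i * int (fact (K ^ N))) = 1" if "j < N" for j
  unfolding \<Lambda>_mult using that by (simp only: lam_def[symmetric] power_int_of_nat)
 show ?thesis
 proof (intro exI[of _ "map (%i. p i * int (fact (K ^ N))) [0..<r]"] conjI)
  show "\<exists>e\<in>set (map (%i. p i * int (fact (K ^ N))) [0..<r]). e ~= 0"
   using i0 p_nz by (intro bexI[of _ "p i0 * int (fact (K ^ N))"]) auto
  show "\<forall>e\<in>set (map (%i. p i * int (fact (K ^ N))) [0..<r]). \<bar>e\<bar> <= int B"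
  proof
   fix e assume "e \<in> set (map (%i. p i * int (fact (K ^ N))) [0..<r])"
   then obtain i where i: "i < r" "e = p i * int (fact (K ^ N))" by auto
   have "\<bar>e\<bar> = \<bar>p i\<bar> * int (fact (K ^ N))" by (simp add: i abs_mult)
   also have "\<dots> <= (int (Q ^ r) + 1) * int (fact (K ^ N))" using p_le[OF i(1)] by (intro mult_right_mono) auto
   also have "\<dots> = int (fact (K ^ N) * ((K * length hs) ^ length hs + 1))"
    by (simp add: Q_def r_def algebra_simps)
   also have "\<dots> <= int B" using B by (simp only: of_nat_le_iff)
   finally show "\<bar>e\<bar> <= int B" .
  qed
  show "\<forall>j<N. ch j (val (pe hs (map (%i. p i * int (fact (K ^ N))) [0..<r]))) = 1"
   using one \<Lambda>_pe by simp
 qed (simp add: r_def)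
qed

end

section \<open>Certificates of infinite index\<close>

definition unip :: "nat => fmat un => bool" where
 "unip N g \<longleftrightarrow> (val g - 1) ^ N = 0"

definition symm :: "'a::grp set => 'a set" where "symm S = S \<union> iv ` S"

lemma symm_subset: "sg G ==> S \<subseteq> G ==> symm S \<subseteq> G"
 by (auto simp: symm_def sg_iv)

lemma symm_induct [consumes 1, case_names one mult]:
 assumes "x \<in> gen S" "P 1" "!!x s. x \<in> gen S ==> P x ==> s \<in> symm S ==> P (x * s)"
 shows "P x"
 using assms(1) by induction (auto intro: assms(2,3) simp: symm_def)

text \<open>The matrices \<open>Js\<close> span a nilpotent space that is stable under \<open>S\<close> and contains the commutators of
 \<open>S\<close> and all \<open>v - 1\<close>. This makes \<open>S\<close> simultaneously triangular over the complex numbers, with the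
 \<open>v \<in> vs\<close> unipotent.\<close>

definition ideal_cert :: "nat => fmat un set => fmat un set => fmat list => bool" where
 "ideal_cert N S vs Js \<longleftrightarrow> set Js \<subseteq> MN N &
  (\<forall>js. length js = N & set js \<subseteq> set Js --> prod_list js = 0) &
  (\<forall>a\<in>set Js. \<forall>g\<in>symm S. a * val g \<in> fm.span (set Js)) &
  (\<forall>g\<in>symm S. \<forall>h\<in>symm S. val g * val h - val h * val g \<in> fm.span (set Js)) &
  (\<forall>v\<in>vs. val v - 1 \<in> fm.span (set Js))"

text \<open>The bound \<open>B\<close> of \<open>relation_bound\<close> for m elements, at the
  smallest admissible \<open>K\<close>.\<close>

definition bnd :: "nat => nat => nat => nat => nat" where
 "bnd N d C m = fact (((2 * (1 + d * C) ^ N + 1) ^ (N + 1)) ^ N) * (((2 * (1 + d * C) ^ N + 1) ^ (N + 1) * m) ^ m + 1)"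

text \<open>By \<open>relation_bound\<close>, excluding relations up to the height
  \<open>bnd\<close> excludes all relations, and each exponent vector requires only a test for
  unipotency.\<close>

definition indep_cert :: "nat => fmat un list => bool" where
 "indep_cert N hs \<longleftrightarrow> (\<exists>d C. d >= 1 &
  (\<forall>h\<in>symm (set hs). \<forall>i<N. (\<forall>j<N. of_nat d * ent (val h) i j \<in> \<int>) & (\<Sum>k<N. \<bar>ent (val h) i k\<bar>) <= of_nat C) &
  (\<forall>es. length es = length hs & (\<forall>e\<in>set es. \<bar>e\<bar> <= int (bnd N d C (length hs))) & (\<exists>e\<in>set es. e ~= 0) -->
   ~ unip N (pe hs es)))"

text \<open>Here \<open>hs\<close> carries the eigenvalues and \<open>vs\<close> consists of
  unipotent elements. The list \<open>ls\<close>, whose characters are tested for independence, is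
  \<open>hs\<close> itself or \<open>hs\<close> with one more element.\<close>

definition triang :: "nat => fmat un set => fmat un list => fmat un list => fmat un list => bool" where
 "triang N H hs vs ls \<longleftrightarrow> set hs \<union> set vs \<subseteq> H & fidx H (gen (set hs \<union> set vs)) &
  (\<exists>Js. ideal_cert N (set ls \<union> set hs \<union> set vs) (set vs) Js) & indep_cert N ls"

definition cert_torus :: "nat => fmat un set => fmat un set => bool" where
 "cert_torus N G H \<longleftrightarrow> (\<exists>g hs vs. g \<in> G & triang N H hs vs (g # hs))"

text \<open>Evaluation at \<open>x\<close>, as a functional on polynomials of degree at most
  \<open>D\<close>, lies in the span of the evaluations at \<open>ys\<close>.\<close>

definition sp :: "nat => nat => fmat un list => fmat un => bool" where
 "sp N D ys x \<longleftrightarrow> (\<exists>c. length c = length ys &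
  (\<forall>l\<in>mons N D. mnm l (val x) = (\<Sum>i<length ys. c ! i * mnm l (val (ys ! i)))))"

text \<open>The span of the evaluations at \<open>ys\<close> contains evaluation at 1 and is stable
  under right multiplication by \<open>vs\<close> and conjugation by \<open>S\<close>; hence it
  contains the evaluations at the normal closure of \<open>vs\<close>. The coefficients
  \<open>a\<close> give the separating polynomial.\<close>

definition poly_cert :: "nat => nat => fmat un set => fmat un set => fmat un list => fmat un => bool" where
 "poly_cert N D S vs ys u \<longleftrightarrow> set ys \<subseteq> GLN N & sp N D ys 1 &
  (\<forall>y\<in>set ys. \<forall>v\<in>symm vs. sp N D ys (y * v)) &
  (\<forall>y\<in>set ys. \<forall>g\<in>symm S. sp N D ys (g * y * iv g)) &
  (\<exists>a. (\<forall>y\<in>set ys. (\<Sum>l\<in>mons N D. a l * mnm l (val y)) = 0) &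
     (\<Sum>l\<in>mons N D. a l * mnm l (val u)) ~= 0)"
definition cert_unip :: "nat => fmat un set => fmat un set => bool" where
 "cert_unip N G H \<longleftrightarrow> (\<exists>u hs vs D ys. u \<in> G & unip N u & triang N H hs vs hs &
  (\<forall>a\<in>set hs. \<forall>b\<in>set hs. cm a b \<in> set vs) & poly_cert N D (set hs \<union> set vs) (set vs) ys u)"

subsection \<open>Soundness\<close>

lemma Act_span:
 assumes "cv.subspace X" "!!j. j \<in> B ==> Act j w \<in> X" "a \<in> fm.span B"
 shows "Act a w \<in> X"
 using assms(3)
proof (induction rule: fm.span_induct_alt)
 case base
 have "Act 0 w = 0" by (auto simp: Act_def ent_simps)
 thus ?case using cv.subspace_0[OF assms(1)] by argo
next
 case (step c x y)
 show ?case unfolding Act_add Act_sm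
  by (intro cv.subspace_add cv.subspace_scale assms(1,2) step)
qed

text \<open>For an invariant \<open>X\<close>, let \<open>Y\<close> be the vectors that
  \<open>Js\<close> sends into \<open>X\<close>; nilpotency makes it larger than \<open>X\<close>.
  It is stable under \<open>S\<close> because the span of \<open>Js\<close> absorbs right
  multiplication, and \<open>S\<close> commutes on it modulo \<open>X\<close> because the span
  contains the additive commutators. A common eigenvector in \<open>Y\<close> extends the
  flag.\<close>

lemma flag_of_ideal_cert:
 assumes S: "S \<subseteq> GLN N" and cert: "ideal_cert N S vs Js"
 shows "\<exists>ws. full_flag ws N & S \<subseteq> full_flag.TG ws N & (\<forall>a\<in>set Js. a \<in> full_flag.sut ws N)"
proof -
 have J: "set Js \<subseteq> MN N" "!!js. length js = N ==> set js \<subseteq> set Js ==> prod_list js = 0"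
  "!!a g. a \<in> set Js ==> g \<in> symm S ==> a * val g \<in> fm.span (set Js)"
  "!!g h. g \<in> symm S ==> h \<in> symm S ==> val g * val h - val h * val g \<in> fm.span (set Js)"
  using cert by (auto simp: ideal_cert_def)
 have symS: "symm S \<subseteq> GLN N" by (rule symm_subset[OF sg_GLN S])
 \<comment> \<open>With \<open>Js\<close> among the operators, \<open>X\<close> is invariant under
   them too, so \<open>X\<close> lies in \<open>Y\<close>; moreover they become triangular, and
   being nilpotent they are strictly so.\<close>
 define G0 where "G0 = val ` symm S \<union> set Js"
 have "\<exists>G1 ws. G1 = G0 & G1 \<subseteq> G0 & cv.flag Act G1 ws & cv.span (set ws) = cv.span (FN N)"
 proof (rule cv.flag_exists[where Q = "%G. G = G0", OF finite_FN])
  fix G X assume G: "G = G0" and X: "cv.subspace X" "X \<subset> cv.span (FN N)"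
   and inv: "!!g x. g \<in> G ==> x \<in> X ==> Act g x \<in> X"
  define Y where "Y = {w \<in> cv.span (FN N). \<forall>j\<in>set Js. Act j w \<in> X}"
  have Y: "cv.subspace Y"
   using cv.subspace_Inter_eigen[of "set Js" Act X "cv.span (FN N)" "%_. 0"] X(1) lin_Act by (simp add: Y_def)
  have XY: "X \<subseteq> Y" using X inv G by (auto simp: Y_def G0_def)
  have YX: "Y - X ~= {}"
  proof
   assume empty: "Y - X = {}"
   obtain w where w: "w \<in> cv.span (FN N)" "w \<notin> X" using X(2) by auto
   have "\<exists>js. length js = k & set js \<subseteq> set Js & Act (prod_list js) w \<in> cv.span (FN N) - X" for k
   proof (induction k)
    case 0
    thus ?case using w by (intro exI[of _ "[]"]) auto
   next
    case (Suc k)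
    then obtain js where js: "length js = k" "set js \<subseteq> set Js" "Act (prod_list js) w \<in> cv.span (FN N) - X" by auto
    then obtain j where "j \<in> set Js" "Act j (Act (prod_list js) w) \<notin> X" using empty by (auto simp: Y_def)
    thus ?case using js J(1) by (intro exI[of _ "j # js"]) (auto simp: Act_mult intro: Act_MN_in)
   qed
   then obtain js where "length js = N" "set js \<subseteq> set Js" "Act (prod_list js) w \<notin> X" by blast
   hence "Act 0 w \<notin> X" using J(2) by metis
   moreover have "Act 0 w = 0" by (auto simp: Act_def ent_simps)
   ultimately show False using X(1) by (simp add: cv.subspace_0)
  qed
  have actY: "Act (val g) y \<in> Y" if g: "g \<in> symm S" and y: "y \<in> Y" for g y
   unfolding Y_def
  proof (intro CollectI conjI ballI)
   show "Act (val g) y \<in> cv.span (FN N)" using g y symS by (auto simp: Y_def intro: Act_GLN_in)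
   fix j assume "j \<in> set Js"
   hence "Act (j * val g) y \<in> X"
    using y by (intro Act_span[of X "set Js" y "j * val g"] X(1) J(3) g) (auto simp: Y_def)
   thus "Act j (Act (val g) y) \<in> X" by (simp add: Act_mult)
  qed
  have "\<exists>w\<in>Y - X. \<forall>a\<in>val ` symm S. \<exists>c. Act a w - csc c w \<in> X"
  proof (rule cv.common_eigenvector_mod[OF lin_Act finite_FN X(1) Y])
   show "X \<subset> Y" using XY YX by auto
   show "Y \<subseteq> cv.span (FN N)" by (auto simp: Y_def)
   fix a b y assume ab: "a \<in> val ` symm S" "b \<in> val ` symm S" and y: "y \<in> Y"
   hence "a * b - b * a \<in> fm.span (set Js)" using J(4) by auto
   hence "Act (a * b - b * a) y \<in> X"
    using y by (intro Act_span[of X "set Js" y "a * b - b * a"] X(1)) (auto simp: Y_def)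
   thus "Act a (Act b y) - Act b (Act a y) \<in> X" by (simp add: Act_diff Act_mult)
  qed (use inv G actY in \<open>auto simp: G0_def\<close>)
  then obtain w where w: "w \<in> Y" "w \<notin> X" "\<forall>a\<in>val ` symm S. \<exists>c. Act a w - csc c w \<in> X" by auto
  have "\<exists>c. Act a w - csc c w \<in> X" if "a \<in> G" for a
  proof (cases "a \<in> set Js")
   case True
   thus ?thesis using w(1) by (intro exI[of _ 0]) (auto simp: Y_def)
  next
   case False
   thus ?thesis using w(3) that G by (auto simp: G0_def)
  qed
  thus "\<exists>G1 w. G1 = G0 & G1 \<subseteq> G & w \<in> cv.span (FN N) - X & (\<forall>g\<in>G1. \<exists>c. Act g w - csc c w \<in> X)"
   using w G by (intro exI[of _ G] exI[of _ w]) (auto simp: Y_def)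
 qed (auto simp: lin_Act)
 then obtain ws where ws: "cv.flag Act G0 ws" "cv.span (set ws) = cv.span (FN N)" by auto
 interpret full_flag ws N
  by unfold_locales (use ws in \<open>auto simp: cv.flag_def\<close>)
 have ut: "a \<in> ut" if "a \<in> G0" for a
  using ws(1) that length_ws unfolding cv.flag_def ut_def by blast
 have "a \<in> sut" if a: "a \<in> set Js" for a
 proof -
  have au: "a \<in> ut" using ut a by (simp add: G0_def)
  have "a ^ N = 0" using J(2)[of "replicate N a"] a by (simp add: prod_list_replicate set_replicate_conv_if)
  moreover have "ch j (0::fmat) = 0" if "j < N" for j
   using sut_iff[of 0] subspace_sut fm.subspace_0 that by blast
  ultimately have "ch j a ^ N = 0" if "j < N" for j using ch_power[OF au that, of N] that by simp
  thus ?thesis using au by (auto simp: sut_iff)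
 qed
 moreover have "S \<subseteq> TG"
  using ut S by (auto simp: TG_def G0_def symm_def)
 ultimately show ?thesis using full_flag_axioms by blast
qed

context full_flag
begin

lemma ch_one_iff_sut: "g \<in> TG ==> (\<forall>j<N. ch j (val g) = 1) \<longleftrightarrow> val g - 1 \<in> sut"
 by (auto simp: sut_iff ut_diff TG_ut ut_one ch_diff)

text \<open>Translates between a condition that can be checked on the matrix and the characters,
  which depend on an unknown complex flag.\<close>

lemma unip_iff:
 assumes N: "N >= 1" and g: "g \<in> TG"
 shows "unip N g \<longleftrightarrow> (\<forall>j<N. ch j (val g) = 1)"
proof
 assume "unip N g"
 have ut: "val g - 1 \<in> ut" using g by (simp add: ut_diff TG_ut ut_one)
 show "\<forall>j<N. ch j (val g) = 1"
 proof (intro allI impI)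
  fix j assume j: "j < N"
  have "ch j (0::fmat) = 0" using sut_iff[of 0] subspace_sut fm.subspace_0 j by blast
  hence "ch j (val g - 1) ^ N = 0" using \<open>unip N g\<close> ch_power[OF ut j, of N] by (simp add: unip_def)
  thus "ch j (val g) = 1" using j g by (simp add: ch_diff TG_ut ut_one)
 qed
next
 assume "\<forall>j<N. ch j (val g) = 1"
 hence "val g - 1 \<in> sut \<inter> MN N" using ch_one_iff_sut[OF g] g by (auto simp: TG_def GLN_def)
 thus "unip N g"
  using nilalg.nil[OF nilalg_sut[OF N], of "replicate N (val g - 1)"]
  by (simp add: unip_def prod_list_replicate set_replicate_conv_if split: if_splits)
qed

text \<open>The unipotent elements of the triangular group, presented as a common kernel of
  characters so that normality and commutators are immediate.\<close>

definition kerch :: "fmat un set" where "kerch = {x \<in> TG. \<forall>j<N. ch j (val x) = 1}"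

lemma sg_kerch: "sg kerch"
 by (rule sgI) (use sg_TG in \<open>auto simp: kerch_def sg_one sg_mult sg_iv ch_TG_mult ch_TG_iv simp del: val_mult\<close>)

lemma nrm_kerch: "nrm TG kerch"
 unfolding nrm_def kerch_def
 by (auto simp: sg_mult[OF sg_TG] sg_iv[OF sg_TG] ch_TG_mult ch_TG_iv ch_TG_nz simp del: val_mult)

lemma cm_kerch: "x \<in> TG ==> y \<in> TG ==> cm x y \<in> kerch"
 unfolding cm_def kerch_def
 by (auto simp: sg_mult[OF sg_TG] sg_iv[OF sg_TG] ch_TG_mult ch_TG_iv ch_TG_nz divide_simps
   simp flip: divide_inverse simp del: val_mult)

lemma kerch_eq: "x \<in> TG ==> y \<in> TG ==> x * iv y \<in> kerch \<longleftrightarrow> (\<forall>j<N. ch j (val x) = ch j (val y))"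
 unfolding kerch_def
 by (auto simp: sg_mult[OF sg_TG] sg_iv[OF sg_TG] ch_TG_mult ch_TG_iv ch_TG_nz divide_simps
   simp flip: divide_inverse simp del: val_mult)

definition indep :: "fmat un list => bool" where
 "indep hs \<longleftrightarrow> (\<forall>es. length es = length hs & pe hs es \<in> kerch --> (\<forall>e\<in>set es. e = 0))"

lemma indep_if_cert:
 assumes N: "N >= 1" and hs: "set hs \<subseteq> TG" and ic: "indep_cert N hs"
 shows "indep hs"
 unfolding indep_def
proof (intro allI impI, rule ccontr)
 fix es assume es: "length es = length hs & pe hs es \<in> kerch" and nz: "~ (\<forall>e\<in>set es. e = 0)"
 obtain d C where c: "d >= 1" "\<forall>h\<in>symm (set hs). \<forall>i<N. (\<forall>j<N. of_nat d * ent (val h) i j \<in> \<int>) &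
   (\<Sum>k<N. \<bar>ent (val h) i k\<bar>) <= of_nat C"
  "\<forall>es. length es = length hs & (\<forall>e\<in>set es. \<bar>e\<bar> <= int (bnd N d C (length hs))) & (\<exists>e\<in>set es. e ~= 0) -->
   ~ unip N (pe hs es)"
  using ic unfolding indep_cert_def by (elim exE conjE)
 have "\<exists>es. length es = length hs & (\<exists>e\<in>set es. e ~= 0) & (\<forall>e\<in>set es. \<bar>e\<bar> <= int (bnd N d C (length hs))) &
  (\<forall>j<N. ch j (val (pe hs es)) = 1)"
  by (rule relation_bound[OF N hs c(1), where C = C and ?es0.0 = es])
   (use es nz c in \<open>auto simp: kerch_def ints_def symm_def bnd_def\<close>)
 thus False using c(3) unip_iff[OF N pe_in[OF sg_TG hs]] by blast
qed

end

lemma triangD: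
 assumes N: "N >= 1" and GL: "H \<subseteq> GLN N" "set ls \<subseteq> GLN N" and c: "triang N H hs vs ls"
 shows "\<exists>ws. full_flag ws N & set ls \<union> set hs \<union> set vs \<subseteq> full_flag.TG ws N & set vs \<subseteq> full_flag.kerch ws N &
  full_flag.indep ws N ls"
proof -
 obtain Js where Js: "ideal_cert N (set ls \<union> set hs \<union> set vs) (set vs) Js" using c by (auto simp: triang_def)
 have "set ls \<union> set hs \<union> set vs \<subseteq> GLN N" using GL c by (auto simp: triang_def)
 from flag_of_ideal_cert[OF this Js] obtain ws where ws: "full_flag ws N"
  "set ls \<union> set hs \<union> set vs \<subseteq> full_flag.TG ws N" "\<forall>a\<in>set Js. a \<in> full_flag.sut ws N" by blast
 interpret full_flag ws N by fact
 have "fm.span (set Js) \<subseteq> sut" by (rule fm.span_minimal[OF _ subspace_sut]) (use ws in auto)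
 hence "\<forall>v\<in>set vs. val v - 1 \<in> sut" using Js unfolding ideal_cert_def by blast
 hence "set vs \<subseteq> kerch" using ws(2) ch_one_iff_sut unfolding kerch_def by blast
 moreover have "indep ls" by (rule indep_if_cert[OF N]) (use ws c in \<open>auto simp: triang_def\<close>)
 ultimately show ?thesis using ws by blast
qed

text \<open>Finite index would put some power g^k with k > 0 into the group generated by
  \<open>hs\<close> and \<open>vs\<close>. There it is a power product of \<open>hs\<close> modulo
  unipotents, against the independence of \<open>g # hs\<close>.\<close>

theorem cert_torus_sound:
 assumes N: "N >= 1" and G: "sg G" "G \<subseteq> GLN N" and H: "H \<subseteq> G" and cert: "cert_torus N G H"
 shows "~ fidx G H"
proof
 assume fin: "fidx G H"
 obtain g hs vs where c: "g \<in> G" "triang N H hs vs (g # hs)" using cert unfolding cert_torus_def by blast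
 have c': "set hs \<union> set vs \<subseteq> H" "fidx H (gen (set hs \<union> set vs))" using c(2) by (auto simp: triang_def)
 have "\<exists>ws. full_flag ws N & set (g # hs) \<union> set hs \<union> set vs \<subseteq> full_flag.TG ws N &
  set vs \<subseteq> full_flag.kerch ws N & full_flag.indep ws N (g # hs)"
  by (rule triangD[OF N _ _ c(2)]) (use c(1) c' G H in auto)
 then obtain ws where ws: "full_flag ws N" "set (g # hs) \<union> set hs \<union> set vs \<subseteq> full_flag.TG ws N"
  "set vs \<subseteq> full_flag.kerch ws N" "full_flag.indep ws N (g # hs)" by blast
 interpret full_flag ws N by fact
 have gTG: "g \<in> TG" and hsTG: "set hs \<subseteq> TG" and vsTG: "set vs \<subseteq> TG" using ws(2) by auto
 let ?H = "gen (set hs \<union> set vs)"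
 have HTG: "?H \<subseteq> TG" by (rule gen_least[OF sg_TG]) (use hsTG vsTG in auto)
 obtain k where k: "k >= 1" "g ^ k \<in> ?H"
  using fidx_power[OF G(1) sg_gen fidx_trans[OF fin c'(2)] c(1)] by auto
 have "\<exists>es. length es = length hs & g ^ k * iv (pe hs es) \<in> kerch"
  by (rule gen_pe_mod[OF sg_kerch nrm_mono[OF nrm_kerch HTG] ws(3) _ k(2)])
   (use hsTG in \<open>auto intro: cm_kerch\<close>)
 then obtain es where es: "length es = length hs" "g ^ k * iv (pe hs es) \<in> kerch" by auto
 define es' where "es' = int k # map uminus es"
 have "pe (g # hs) es' \<in> kerch"
 proof -
  have pTG: "pe hs es \<in> TG" "pe hs (map uminus es) \<in> TG" "g ^ k \<in> TG"
   using pe_in[OF sg_TG hsTG] sg_power[OF sg_TG gTG] by auto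
  have "ch j (val (pe hs (map uminus es))) = inverse (ch j (val (pe hs es)))" if "j < N" for j
   using ch_TG_pe[OF hsTG es(1) that] ch_TG_pe[OF hsTG _ that, of "map uminus es"] es(1)
   by (simp add: power_int_minus prod_inversef[unfolded o_def])
  moreover have "ch j (val (g ^ k)) = ch j (val (pe hs es))" if "j < N" for j
   using es(2) kerch_eq[OF pTG(3,1)] that by blast
  ultimately show ?thesis
   using pTG by (auto simp: kerch_def es'_def sg_mult[OF sg_TG] ch_TG_mult ch_TG_nz simp del: val_mult val_power)
 qed
 moreover have "length es' = length (g # hs)" using es by (simp add: es'_def)
 ultimately have "\<forall>e\<in>set es'. e = 0" using ws(4) by (auto simp: indep_def)
 thus False using k(1) by (simp add: es'_def)
qed

text \<open>u^k - 1 is a product of u - 1 with an element commuting with it.\<close>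

lemma unip_power: "unip N u ==> unip N (u ^ k)"
proof -
 assume u: "unip N u"
 define x where "x = val u - 1"
 have "\<exists>q. val u ^ k - 1 = x * q & x * q = q * x"
 proof (induction k)
  case 0
  show ?case by (rule exI[of _ 0]) simp
 next
  case (Suc k)
  then obtain q where q: "val u ^ k - 1 = x * q" "x * q = q * x" by auto
  have vu: "val u = 1 + x" by (simp add: x_def)
  have "val u ^ Suc k - 1 = x * (1 + q + q * x)"
  proof -
   have "val u ^ Suc k - 1 = (val u ^ k - 1) * val u + x" by (simp only: power_Suc2) (simp add: x_def algebra_simps)
   also have "\<dots> = x * (1 + q + q * x)" unfolding q(1) unfolding vu by (simp add: algebra_simps)
   finally show ?thesis .
  qed
  moreover have "x * (1 + q + q * x) = (1 + q + q * x) * x"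
   using q(2) mult.assoc[of x q x] mult.assoc[of q x x] by (simp add: algebra_simps)
  ultimately show ?case by blast
 qed
 then obtain q where q: "val u ^ k - 1 = x * q" "x * q = q * x" by auto
 have "(x * q) ^ n = x ^ n * q ^ n" for n
 proof (induction n)
  case (Suc n)
  have c: "q * x ^ n = x ^ n * q" by (induction n) (simp_all, metis mult.assoc q(2))
  have "(x * q) ^ Suc n = x * (q * x ^ n) * q ^ n" by (simp add: Suc mult.assoc)
  thus ?case by (simp add: c mult.assoc)
 qed simp
 thus ?thesis using u q(1) by (simp add: unip_def x_def)
qed

text \<open>The certificate exhibits finitely many \<open>ys\<close> whose polynomials of degree at most \<open>D\<close> control the normal
 closure of \<open>vs\<close>: a polynomial that vanishes on \<open>ys\<close> vanishes there, hence on all powers of \<open>u\<close> that lie in it,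
 hence at \<open>u\<close>.\<close>

definition van :: "nat => nat => fmat un list => fmat un => bool" where
 "van N D ys x \<longleftrightarrow> x \<in> GLN N & (\<forall>f. pd N D f & (\<forall>y\<in>set ys. f (val y) = 0) --> f (val x) = 0)"

lemma van_if_sp: "x \<in> GLN N ==> sp N D ys x ==> van N D ys x"
proof -
 assume x: "x \<in> GLN N" and "sp N D ys x"
 then obtain c where c: "!!l. l \<in> mons N D ==> mnm l (val x) = (\<Sum>i<length ys. c ! i * mnm l (val (ys ! i)))"
  by (auto simp: sp_def)
 have eq: "f (val x) = (\<Sum>i<length ys. c ! i * f (val (ys ! i)))" if "pd N D f" for f
  using that
 proof induction
  case (pd_add f g)
  thus ?case by (simp add: distrib_left sum.distrib)
 next
  case (pd_scale f c)
  thus ?case by (simp add: sum_distrib_left mult.left_commute)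
 qed (rule c)
 have "f (val x) = 0" if "pd N D f" "\<forall>y\<in>set ys. f (val y) = 0" for f
  unfolding eq[OF that(1)] using that(2) by simp
 thus ?thesis using x by (simp add: van_def)
qed

lemma van_translate:
 assumes ab: "a \<in> GLN N" "b \<in> GLN N" and x: "van N D ys x" and ys: "set ys \<subseteq> GLN N"
  and tr: "!!y. y \<in> set ys ==> van N D ys (a * y * b)"
 shows "van N D ys (a * x * b)"
 unfolding van_def
proof (intro conjI allI impI)
 have xG: "x \<in> GLN N" using x by (simp add: van_def)
 show "a * x * b \<in> GLN N" using ab xG by (simp add: sg_mult[OF sg_GLN] del: val_mult)
 fix f assume f: "pd N D f & (\<forall>y\<in>set ys. f (val y) = 0)"
 obtain g where g: "pd N D g" "!!z. z - 1 \<in> MN N ==> f (val a * z * val b) = g z"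
  using pd_translate[of "val a" N "val b" D f] f ab by (auto simp: GLN_def)
 have ga: "g (val y) = f (val (a * y * b))" if "y \<in> GLN N" for y using g(2)[of "val y"] that by (simp add: GLN_def)
 have "\<forall>y\<in>set ys. g (val y) = 0" using ga tr f ys unfolding van_def by (metis subsetD)
 thus "f (val (a * x * b)) = 0" using x g(1) ga[OF xG] by (auto simp: van_def)
qed

theorem cert_unip_sound:
 assumes N: "N >= 1" and G: "sg G" "G \<subseteq> GLN N" and H: "H \<subseteq> G" and cert: "cert_unip N G H"
 shows "~ fidx G H"
proof
 assume fin: "fidx G H"
 obtain u hs vs D ys where c: "u \<in> G" "unip N u" "triang N H hs vs hs" "\<forall>a\<in>set hs. \<forall>b\<in>set hs. cm a b \<in> set vs"
  "poly_cert N D (set hs \<union> set vs) (set vs) ys u"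
  using cert unfolding cert_unip_def by blast
 have c': "set hs \<union> set vs \<subseteq> H" "fidx H (gen (set hs \<union> set vs))" using c(3) by (auto simp: triang_def)
 hence SG: "set hs \<union> set vs \<subseteq> GLN N" using G H by auto
 obtain ws where ws: "full_flag ws N" "set hs \<union> set hs \<union> set vs \<subseteq> full_flag.TG ws N"
  "set vs \<subseteq> full_flag.kerch ws N" "full_flag.indep ws N hs"
  using triangD[OF N _ _ c(3)] G H SG by blast
 interpret full_flag ws N by fact
 have hsTG: "set hs \<subseteq> TG" using ws(2) by auto
 let ?H = "gen (set hs \<union> set vs)"
 have HTG: "?H \<subseteq> TG" by (rule gen_least[OF sg_TG]) (use ws(2) in auto)
 have HGL: "?H \<subseteq> GLN N" by (rule gen_least[OF sg_GLN SG])
 obtain k where k: "k >= 1" "u ^ k \<in> ?H"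
  using fidx_power[OF G(1) sg_gen fidx_trans[OF fin c'(2)] c(1)] by auto
 \<comment> \<open>The conjugates of \<open>vs\<close> and of their inverses, so that
   \<open>gen X\<close> is the normal closure of \<open>vs\<close> in the group generated by
   \<open>hs\<close> and \<open>vs\<close>.\<close>
 define X where "X = {x * v * iv x |x v. x \<in> ?H & v \<in> symm (set vs)}"
 have sv: "symm (set vs) \<subseteq> kerch" by (rule symm_subset[OF sg_kerch ws(3)])
 have vGL: "symm (set vs) \<subseteq> GLN N" by (rule symm_subset[OF sg_GLN]) (use SG in auto)
 have SGL: "symm (set hs \<union> set vs) \<subseteq> GLN N" by (rule symm_subset[OF sg_GLN SG])
 have Xconj: "g * y * iv g \<in> X" if gy: "g \<in> ?H" "y \<in> X" for g y
 proof -
  obtain x v where xv: "y = x * v * iv x" "x \<in> ?H" "v \<in> symm (set vs)" using gy(2) by (auto simp: X_def)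
  have "g * y * iv g = (g * x) * v * iv (g * x)" by (simp add: xv mult.assoc)
  moreover have "g * x \<in> ?H" by (rule sg_mult[OF sg_gen gy(1) xv(2)])
  ultimately show ?thesis unfolding X_def using xv(3) by blast
 qed
 have nX: "nrm ?H (gen X)"
  unfolding nrm_def using gen_conj Xconj by blast
 have vX: "set vs \<subseteq> gen X"
 proof
  fix v assume "v \<in> set vs"
  hence "v \<in> symm (set vs)" by (simp add: symm_def)
  hence "1 * v * iv 1 \<in> X" unfolding X_def using gen.one[of "set hs \<union> set vs"] by blast
  thus "v \<in> gen X" using gen_incl by fastforce
 qed
 have Xk: "gen X \<subseteq> kerch"
  by (rule gen_least[OF sg_kerch]) (use HTG sv nrmD[OF nrm_kerch] in \<open>auto simp: X_def\<close>)
 have "\<exists>es. length es = length hs & u ^ k * iv (pe hs es) \<in> gen X"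
  by (rule gen_pe_mod[OF sg_gen nX vX _ k(2)]) (use c(4) vX in auto)
 then obtain es where es: "length es = length hs" "u ^ k * iv (pe hs es) \<in> gen X" by auto
 have uTG: "u ^ k \<in> TG" using k HTG by auto
 have "u ^ k \<in> kerch" using unip_iff[OF N uTG] unip_power[OF c(2)] uTG by (simp add: kerch_def)
 moreover have "u ^ k * iv (pe hs es) \<in> kerch" using es Xk by auto
 ultimately have "pe hs es \<in> kerch" using sg_mult_left_iff[OF sg_kerch] sg_iv_iff[OF sg_kerch] by blast
 \<comment> \<open>The power product is unipotent together with u^k, and independence of
   \<open>hs\<close> leaves only zero exponents.\<close>
 hence "pe hs es = 1" using ws(4) es(1) by (intro pe_zero) (auto simp: indep_def)
 hence ukX: "u ^ k \<in> gen X" using es by simp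
 have ysG: "set ys \<subseteq> GLN N" using c(5) by (simp add: poly_cert_def)
 have v1: "van N D ys 1" by (rule van_if_sp[OF sg_one[OF sg_GLN]]) (use c(5) in \<open>simp add: poly_cert_def\<close>)
 have vv: "van N D ys (y * v)" if y: "van N D ys y" and v: "v \<in> symm (set vs)" for y v
 proof -
  have "van N D ys (1 * z * v)" if "z \<in> set ys" for z
   using c(5) that v vGL ysG by (intro van_if_sp) (auto simp: poly_cert_def intro: sg_mult[OF sg_GLN])
  thus ?thesis using van_translate[OF sg_one[OF sg_GLN] _ y ysG, of v] v vGL by auto
 qed
 have vc: "\<forall>y. van N D ys y --> van N D ys (g * y * iv g)" if "g \<in> ?H" for g
  using that
 proof (induction rule: symm_induct)
  case (mult x s)
  have s: "s \<in> GLN N" "iv s \<in> GLN N" using mult(2) SGL sg_iv[OF sg_GLN] by auto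
  have t: "van N D ys (s * z * iv s)" if "z \<in> set ys" for z
   using c(5) that mult(2) s ysG by (intro van_if_sp) (auto simp: poly_cert_def intro: sg_mult[OF sg_GLN])
  show ?case
  proof (intro allI impI)
   fix y assume "van N D ys y"
   hence "van N D ys (x * (s * y * iv s) * iv x)" using mult(3) van_translate[OF s _ ysG t] by blast
   thus "van N D ys (x * s * y * iv (x * s))" by (simp add: mult.assoc)
  qed
 qed auto
 \<comment> \<open>Use z x v x^-1 = x (x^-1 z x v) x^-1: conjugate, multiply by v, conjugate
   back.\<close>
 have vX: "van N D ys (z * s)" if z: "van N D ys z" and s: "s \<in> X" for z s
 proof -
  obtain x v where xv: "s = x * v * iv x" "x \<in> ?H" "v \<in> symm (set vs)" using s by (auto simp: X_def)
  have "van N D ys (x * (iv x * z * iv (iv x) * v) * iv x)"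
   using vc[OF xv(2)] vv[OF _ xv(3)] vc[OF sg_iv[OF sg_gen xv(2)]] z by blast
  thus ?thesis by (simp add: xv mult.assoc)
 qed
 have "van N D ys z" if "z \<in> gen X" for z
  using that
 proof (induction rule: symm_induct)
  case (mult z s)
  have "iv s \<in> X" if s: "s \<in> X" for s
  proof -
   obtain x v where xv: "s = x * v * iv x" "x \<in> ?H" "v \<in> symm (set vs)" using s by (auto simp: X_def)
   have "iv s = x * iv v * iv x" by (simp add: xv mult.assoc)
   moreover have "iv v \<in> symm (set vs)" using xv(3) by (auto simp: symm_def)
   ultimately show ?thesis unfolding X_def using xv(2) by blast
  qed
  hence "s \<in> X" using mult(2) by (auto simp: symm_def)
  thus ?case by (rule vX[OF mult(3)])
 qed (rule v1)
 hence vz: "van N D ys z" if "z \<in> gen X" for z using that by blast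
 obtain a where a: "\<forall>y\<in>set ys. (\<Sum>l\<in>mons N D. a l * mnm l (val y)) = 0" "(\<Sum>l\<in>mons N D. a l * mnm l (val u)) ~= 0"
  using c(5) unfolding poly_cert_def by blast
 define f where "f x = (\<Sum>l\<in>mons N D. a l * mnm l x)" for x
 have f: "pd N D f" unfolding f_def by (intro pd_sum finite_mons pd_scale pd_mnm)
 have "f (val u) = 0"
 proof (rule pol_vanish_power[OF pd_pol[OF f] _ k(1)])
  show "(val u - 1) ^ N = 0" using c(2) by (simp add: unip_def)
  have "\<forall>y\<in>set ys. f (val y) = 0" using a(1) by (simp add: f_def)
  thus "f (val (u ^ (k * j))) = 0" for j
   using vz[OF sg_power[OF sg_gen ukX, of j]] f unfolding van_def power_mult by blast
 qed
 thus False using a(2) by (simp add: f_def)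
qed

subsection \<open>Completeness\<close>

lemma (in vspace) finite_spanning_list:
 assumes "finite F" "X \<subseteq> span F"
 shows "\<exists>xs. set xs \<subseteq> X & distinct xs & X \<subseteq> span (set xs)"
proof -
 obtain B where B: "B \<subseteq> X" "independent B" "X \<subseteq> span B" "card B = dim X" by (rule basis_exists)
 have "finite B" using independent_span_bound[OF assms(1) B(2)] B(1) assms(2) by blast
 then obtain xs where "set xs = B" "distinct xs" using finite_distinct_list by blast
 thus ?thesis using B by auto
qed

lemma (in vspace) span_image_list:
 assumes "x \<in> span (f ` set ys)"
 shows "\<exists>c. length c = length ys & x = (\<Sum>i<length ys. scale (c ! i) (f (ys ! i)))"
 using assms
proof (induction rule: span_induct_alt)
 case base
 show ?case by (intro exI[of _ "replicate (length ys) 0"]) simp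
next
 case (step a y z)
 then obtain c where c: "length c = length ys" "z = (\<Sum>i<length ys. scale (c ! i) (f (ys ! i)))" by auto
 from step obtain k where k: "k < length ys" "y = f (ys ! k)" by (auto simp: in_set_conv_nth)
 have "scale a y + z = (\<Sum>i<length ys. scale ((c[k := c ! k + a]) ! i) (f (ys ! i)))"
 proof -
  have "(\<Sum>i<length ys. scale ((c[k := c ! k + a]) ! i) (f (ys ! i))) =
   (\<Sum>i<length ys. scale (c ! i) (f (ys ! i)) + (if i = k then scale a (f (ys ! i)) else 0))"
   using c(1) by (intro sum.cong refl) (auto simp: nth_list_update scale_left_distrib)
  also have "\<dots> = z + scale a y" using k by (simp add: sum.distrib c(2))
  finally show ?thesis by (simp add: add.commute)
 qed
 thus ?case using c(1) by (intro exI[of _ "c[k := c ! k + a]"]) simp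
qed

interpretation fs: vspace "%(c::rat) (f :: 'i => rat) l. c * f l"
 by unfold_locales (auto simp: fun_eq_iff algebra_simps)

lemma fs_sum: "(\<Sum>a\<in>A. f a) l = (\<Sum>a\<in>A. (f a l :: rat))"
 by (induction A rule: infinite_finite_induct) auto

text \<open>Evaluations lie in the dual of the polynomials of degree at most \<open>D\<close>, a
  space of finite dimension; so finitely many points suffice however large \<open>V\<close>
  is.\<close>

lemma spanning_evaluations:
 "\<exists>ys. set ys \<subseteq> V & (\<forall>x\<in>V. sp N D ys x)"
proof -
 define m where "m x = (%l. if l \<in> mons N D then mnm l (val x) else 0)" for x
 define dl where "dl l = (%k. if k = l then 1 else 0 :: rat)" for l :: "(nat \<times> nat) list"
 have "m x \<in> fs.span (dl ` mons N D)" for x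
 proof -
  have "m x = (\<Sum>l\<in>mons N D. (%k. m x l * dl l k))"
   by (rule ext) (auto simp: fs_sum dl_def m_def finite_mons if_distrib[of "(*) _"] cong: if_cong)
  also have "\<dots> \<in> fs.span (dl ` mons N D)"
   by (intro fs.span_sum fs.span_scale fs.span_base) auto
  finally show ?thesis .
 qed
 hence "m ` V \<subseteq> fs.span (dl ` mons N D)" by auto
 from fs.finite_spanning_list[OF _ this] finite_mons
 obtain xs where xs: "set xs \<subseteq> m ` V" "m ` V \<subseteq> fs.span (set xs)" by blast
 hence "\<forall>x\<in>set xs. \<exists>y\<in>V. m y = x" by auto
 then obtain g where g: "!!x. x \<in> set xs ==> g x \<in> V & m (g x) = x" by metis
 define ys where "ys = map g xs"
 have "m ` set ys = set xs" using g by (force simp: ys_def)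
 have "sp N D ys x" if "x \<in> V" for x
 proof -
  have "m x \<in> fs.span (m ` set ys)" using xs(2) that \<open>m ` set ys = set xs\<close> by auto
  from fs.span_image_list[OF this] obtain c where
   c: "length c = length ys" "m x = (\<Sum>i<length ys. (%l. c ! i * m (ys ! i) l))" by auto
  show ?thesis unfolding sp_def
  proof (intro exI[of _ c] conjI ballI c(1))
   fix l assume "l \<in> mons N D"
   thus "mnm l (val x) = (\<Sum>i<length ys. c ! i * mnm l (val (ys ! i)))"
    using fun_cong[OF c(2), of l] by (simp add: fs_sum m_def)
  qed
 qed
 thus ?thesis using g by (intro exI[of _ ys]) (auto simp: ys_def)
qed

context nilalg
begin

text \<open>The power J^k of the algebra.\<close>

definition jp :: "nat => fmat set" where
 "jp k = fm.span {prod_list js |js. length js = k & set js \<subseteq> J}"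

lemma jp_mult: "x \<in> jp i ==> y \<in> jp j ==> x * y \<in> jp (i + j)"
proof -
 assume x: "x \<in> jp i" and y: "y \<in> jp j"
 have 1: "prod_list js * y \<in> jp (i + j)" if js: "length js = i" "set js \<subseteq> J" for js
  using y unfolding jp_def[of j]
 proof (induction rule: fm.span_induct_alt)
  case base
  show ?case by (simp add: jp_def fm.span_zero)
 next
  case (step c a b)
  then obtain ks where ks: "a = prod_list ks" "length ks = j" "set ks \<subseteq> J" by auto
  have "prod_list js * a \<in> jp (i + j)" unfolding jp_def
   by (rule fm.span_base) (use js ks in \<open>auto intro!: exI[of _ "js @ ks"]\<close>)
  thus ?case using step(2) by (simp add: distrib_left jp_def fm.span_add fm.span_scale)
 qed
 show ?thesis
  using x unfolding jp_def[of i]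
 proof (induction rule: fm.span_induct_alt)
  case base
  show ?case by (simp add: jp_def fm.span_zero)
 next
  case (step c a b)
  hence "a * y \<in> jp (i + j)" using 1 by auto
  thus ?case using step(2) by (simp add: distrib_right jp_def fm.span_add fm.span_scale)
 qed
qed

lemma jp_1: "J \<subseteq> jp 1"
 unfolding jp_def by (rule subsetI, rule fm.span_base) (auto intro!: exI[of _ "[_]"])

lemma jp_Suc: "k >= 1 ==> jp (Suc k) \<subseteq> jp k"
 unfolding jp_def
proof (rule fm.span_minimal)
 assume k: "k >= 1"
 show "{prod_list js |js. length js = Suc k & set js \<subseteq> J} \<subseteq> fm.span {prod_list js |js. length js = k & set js \<subseteq> J}"
 proof
  fix x assume "x \<in> {prod_list js |js. length js = Suc k & set js \<subseteq> J}"
  then obtain js where js: "x = prod_list js" "length js = Suc k" "set js \<subseteq> J" by auto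
  then obtain a b cs where "js = a # b # cs" using k by (cases js; cases "tl js") auto
  hence "x = prod_list ((a * b) # cs)" "length ((a * b) # cs) = k" "set ((a * b) # cs) \<subseteq> J"
   using js J_mult by (auto simp: mult.assoc)
  thus "x \<in> fm.span {prod_list js |js. length js = k & set js \<subseteq> J}"
   by (intro fm.span_base) blast
 qed
qed simp

text \<open>With x = a - 1 and y = b - 1 one has [a, b] - 1 = (x y - y x) a^-1 b^-1, so weights add
  up as powers of J do. Nilpotency of J then ends the filtration.\<close>

lemma Gam_jp:
 assumes U: "ug J U"
 shows "Gam U i x ==> val x - 1 \<in> jp i"
proof (induction rule: Gam.induct)
 have sU: "sg U" using U by (simp add: ug_def)
 have j1: "val x - 1 \<in> jp 1" if "x \<in> U" for x using U that jp_1 by (auto simp: ug_def)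
 have plus: "a + b \<in> jp i" "a - b \<in> jp i" if "a \<in> jp i" "b \<in> jp i" for a b i
  using that by (auto simp: jp_def fm.span_add fm.span_diff)
 have right: "a * val x \<in> jp i" if "a \<in> jp i" "x \<in> U" "i >= 1" for a x i
 proof -
  have "a * (val x - 1) \<in> jp i" using jp_mult[OF that(1) j1[OF that(2)]] jp_Suc[OF that(3)] by auto
  from plus(1)[OF that(1) this] show ?thesis by (simp add: algebra_simps)
 qed
 {
  case (Gam_base u)
  thus ?case by (rule j1)
 next
  case (Gam_cm i a j b)
  have ab: "a \<in> U" "b \<in> U" "i >= 1" using Gam_cm Gam_sub[OF sU] Gam_pos by blast+
  have "(val a - 1) * (val b - 1) - (val b - 1) * (val a - 1) \<in> jp (i + j)"
   using jp_mult[OF Gam_cm.IH] jp_mult[OF Gam_cm.IH(2,1)] by (intro plus) (simp_all add: add.commute)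
  hence "((val a - 1) * (val b - 1) - (val b - 1) * (val a - 1)) * val (iv a * iv b) \<in> jp (i + j)"
   by (rule right) (use ab sU in \<open>auto intro: sg_mult sg_iv\<close>)
  moreover have "((val a - 1) * (val b - 1) - (val b - 1) * (val a - 1)) = val a * val b - val b * val a"
   by (simp add: algebra_simps)
  moreover have "(val a * val b - val b * val a) * val (iv a * iv b) = val (cm a b) - 1"
  proof -
   have "val (b * a * (iv a * iv b)) = 1" by (simp add: mult.assoc del: val_mult)
   thus ?thesis by (simp add: cm_def left_diff_distrib mult.assoc)
  qed
  ultimately show ?case by simp
 next
  case (Gam_one i)
  thus ?case by (simp add: jp_def fm.span_zero)
 next
  case (Gam_mult i a b)
  have b: "b \<in> U" "i >= 1" using Gam_mult Gam_sub[OF sU] Gam_pos by blast+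
  have "(val a - 1) * val b + (val b - 1) \<in> jp i" by (intro plus right b Gam_mult.IH)
  thus ?case by (simp add: algebra_simps)
 next
  case (Gam_iv i a)
  have a: "iv a \<in> U" "i >= 1" using Gam_iv Gam_sub[OF sU] Gam_pos sg_iv[OF sU] by blast+
  have "0 - (val a - 1) * val (iv a) \<in> jp i"
   by (intro plus right a Gam_iv.IH) (simp add: jp_def fm.span_zero)
  thus ?case by (simp add: algebra_simps)
 next
  case (Gam_weaken i a)
  thus ?case using jp_Suc by auto
 }
qed

lemma Gam_trivial:
 assumes "ug J U" "Gam U n x"
 shows "x = 1"
proof -
 have "jp n \<subseteq> {0}" unfolding jp_def
  by (rule fm.span_minimal) (use nil in \<open>auto simp: fm.subspace_single_0\<close>)
 hence "val x - 1 = 0" using Gam_jp[OF assms] by auto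
 thus ?thesis using val_inj[of x 1] by simp
qed

end

lemma Gam_conj:
 assumes "!!u. u \<in> U ==> g * u * iv g \<in> U"
 shows "Gam U i x ==> Gam U i (g * x * iv (g::'a::grp))"
proof (induction rule: Gam.induct)
 case (Gam_base u)
 thus ?case using assms Gam.Gam_base by blast
next
 case (Gam_cm i a j b)
 thus ?case using Gam.Gam_cm[OF Gam_cm.IH] by (simp add: cm_conj)
next
 case (Gam_one i)
 thus ?case using Gam.Gam_one by simp
next
 case (Gam_mult i a b)
 thus ?case using Gam.Gam_mult[OF Gam_mult.IH] by (simp add: mult.assoc)
next
 case (Gam_iv i a)
 thus ?case using Gam.Gam_iv[OF Gam_iv.IH] by (simp add: mult.assoc)
next
 case (Gam_weaken i a)
 thus ?case using Gam.Gam_weaken by blast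
qed

lemma common_denominator:
 "finite S ==> \<exists>d\<ge>1. \<forall>q\<in>S. of_nat d * q \<in> (\<int> :: rat set)"
proof (induction rule: finite_induct)
 case empty
 thus ?case by auto
next
 case (insert q S)
 then obtain d where d: "d >= 1" "\<forall>q\<in>S. of_nat d * q \<in> \<int>" by auto
 obtain a b where ab: "q = Rat.Fract a b" "b > 0" by (rule Rat_cases) auto
 have "of_nat (d * nat b) * q = of_nat d * of_int a"
  using ab by (simp add: Fract_of_int_quotient)
 also have "\<dots> \<in> \<int>" by simp
 finally have "of_nat (d * nat b) * q \<in> \<int>" .
 moreover have "of_nat (d * nat b) * r \<in> \<int>" if "r \<in> S" for r
 proof -
  have "of_nat (nat b) * (of_nat d * r) \<in> \<int>" by (rule Ints_mult) (use d that in auto)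
  thus ?thesis by (simp add: mult_ac)
 qed
 ultimately show ?case using d ab by (intro exI[of _ "d * nat b"]) auto
qed

lemma entry_bounds: "\<exists>d C. d >= 1 & (\<forall>h\<in>symm (set hs). \<forall>i<N. (\<forall>j<N. of_nat d * ent (val h) i j \<in> \<int>) &
 (\<Sum>k<N. \<bar>ent (val h) i k\<bar>) <= of_nat C)"
proof -
 have fin: "finite (symm (set hs))" by (simp add: symm_def)
 have "finite ((%(h, i, j). ent (val h) i j) ` (symm (set hs) \<times> {..<N} \<times> {..<N}))" using fin by auto
 from common_denominator[OF this] obtain d where
  d: "d >= 1" "\<forall>h\<in>symm (set hs). \<forall>i<N. \<forall>j<N. of_nat d * ent (val h) i j \<in> \<int>" by fastforce
 define M where "M = (\<Sum>h\<in>symm (set hs). \<Sum>i<N. \<Sum>k<N. \<bar>ent (val h) i k\<bar>)"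
 obtain C where C: "M <= of_nat C" using reals_Archimedean2[of M] less_imp_le by blast
 have "(\<Sum>k<N. \<bar>ent (val h) i k\<bar>) <= of_nat C" if "h \<in> symm (set hs)" "i < N" for h i
 proof -
  have "(\<Sum>k<N. \<bar>ent (val h) i k\<bar>) <= (\<Sum>i<N. \<Sum>k<N. \<bar>ent (val h) i k\<bar>)"
   by (rule member_le_sum[of i "{..<N}" "%i. \<Sum>k<N. \<bar>ent (val h) i k\<bar>"]) (use that in \<open>auto intro: sum_nonneg\<close>)
  also have "\<dots> <= M" unfolding M_def
   by (rule member_le_sum[of h _ "%h. \<Sum>i<N. \<Sum>k<N. \<bar>ent (val h) i k\<bar>"]) (use that fin in \<open>auto intro: sum_nonneg\<close>)
  finally show ?thesis using C by simp
 qed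
 thus ?thesis using d by blast
qed

context full_flag
begin

text \<open>A spanning list of all strictly triangular rational matrices of the block serves as
  certificate.\<close>

lemma ideal_cert_exists:
 assumes N: "N >= 1" and S: "S \<subseteq> TG" and vs: "vs \<subseteq> kerch"
 shows "\<exists>Js. ideal_cert N S vs Js"
proof -
 have sS: "symm S \<subseteq> TG" by (rule symm_subset[OF sg_TG S])
 define J where "J = sut \<inter> MN N"
 interpret nilalg J N N unfolding J_def by (rule nilalg_sut[OF N])
 obtain Js where Js: "set Js \<subseteq> J" "J \<subseteq> fm.span (set Js)"
  using fm.finite_spanning_list[OF finite_EN J_span] by blast
 have "ideal_cert N S vs Js" unfolding ideal_cert_def
 proof (intro conjI allI impI ballI)
  show "set Js \<subseteq> MN N" using Js J by auto
  show "prod_list js = 0" if "length js = N & set js \<subseteq> set Js" for js using nil that Js by blast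
  show "a * val g \<in> fm.span (set Js)" if a: "a \<in> set Js" and g: "g \<in> symm S" for a g
  proof -
   have "a \<in> sut" "a \<in> MN N" using a Js by (auto simp: J_def)
   moreover have "g \<in> TG" using g sS by auto
   ultimately have "a * val g \<in> J"
    unfolding J_def using sut_mult(1)[of a "val g"] TG_ut[of g] GLN_MN(2)[of g N a] TG_def by blast
   thus ?thesis using Js by auto
  qed
  show "val g * val h - val h * val g \<in> fm.span (set Js)" if gh: "g \<in> symm S" "h \<in> symm S" for g h
  proof -
   have g: "g \<in> TG" and h: "h \<in> TG" using gh sS by auto
   have "val g * val h - val h * val g \<in> sut"
    using g h by (auto simp: sut_iff ut_diff ut_mult TG_ut ch_diff ch_mult_eq)
   moreover have "val g * val h - val h * val g = (val g - 1) * (val h - 1) - (val h - 1) * (val g - 1)"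
    by (simp add: algebra_simps)
   moreover have "(val g - 1) * (val h - 1) - (val h - 1) * (val g - 1) \<in> MN N"
   proof -
    have "val g - 1 \<in> MN N" "val h - 1 \<in> MN N" using g h by (auto simp: TG_def GLN_def)
    thus ?thesis using fm.subspace_diff[OF MN_subspace] MN_mult by blast
   qed
   ultimately have "val g * val h - val h * val g \<in> J" by (simp add: J_def)
   thus ?thesis using Js by auto
  qed
  show "val v - 1 \<in> fm.span (set Js)" if "v \<in> vs" for v
  proof -
   have "v \<in> TG" "\<forall>j<N. ch j (val v) = 1" using that vs by (auto simp: kerch_def)
   hence "val v - 1 \<in> J" using ch_one_iff_sut by (auto simp: J_def TG_def GLN_def)
   thus ?thesis using Js by auto
  qed
 qed
 thus ?thesis by blast
qed

lemma indep_cert_if: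
 assumes N: "N >= 1" and hs: "set hs \<subseteq> TG" and ind: "indep hs"
 shows "indep_cert N hs"
proof -
 have *: "~ unip N (pe hs es)" if es: "length es = length hs" "\<exists>e\<in>set es. e ~= 0" for es
 proof
  assume u: "unip N (pe hs es)"
  have "pe hs es \<in> TG" by (rule pe_in[OF sg_TG hs])
  hence "pe hs es \<in> kerch" using u unip_iff[OF N] by (auto simp: kerch_def)
  thus False using ind es by (auto simp: indep_def)
 qed
 obtain d C where "d >= 1 & (\<forall>h\<in>symm (set hs). \<forall>i<N. (\<forall>j<N. of_nat d * ent (val h) i j \<in> \<int>) &
  (\<Sum>k<N. \<bar>ent (val h) i k\<bar>) <= of_nat C)" using entry_bounds[of hs N] by (elim exE)
 thus ?thesis unfolding indep_cert_def by (intro exI[of _ d] exI[of _ C]) (simp add: *)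
qed

lemma prod_powi: "(\<Prod>i\<in>A. f i) powi n = (\<Prod>i\<in>A. f i powi n :: complex)"
 by (induction A rule: infinite_finite_induct) (auto simp: power_int_mult_distrib)

lemma maximal_independent:
 "finite T ==> T \<subseteq> TG ==> \<exists>hs. set hs \<subseteq> T & indep hs & (\<forall>t\<in>T. ~ indep (t # hs))"
proof (induction rule: finite_induct)
 case empty
 thus ?case by (intro exI[of _ "[]"]) (auto simp: indep_def)
next
 case (insert t T)
 then obtain hs where hs: "set hs \<subseteq> T" "indep hs" "\<forall>t\<in>T. ~ indep (t # hs)" by auto
 show ?case
 proof (cases "indep (t # hs)")
  case False
  thus ?thesis using hs by (intro exI[of _ hs]) auto
 next
  case True
  have "~ indep (s # t # hs)" if "s \<in> T" for s
  proof -
   have "~ indep (s # hs)" using hs(3) that by blast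
   then obtain es where es: "length es = length (s # hs)" "pe (s # hs) es \<in> kerch" "\<exists>e\<in>set es. e ~= 0"
    unfolding indep_def by blast
   then obtain e es' where e: "es = e # es'" by (cases es) auto
   thus ?thesis unfolding indep_def using es by (auto intro!: exI[of _ "e # 0 # es'"])
  qed
  moreover have "~ indep (t # t # hs)"
  proof -
   have "pe (t # t # hs) (1 # - 1 # replicate (length hs) 0) = 1"
    by (simp add: pe_zero)
   hence "pe (t # t # hs) (1 # - 1 # replicate (length hs) 0) \<in> kerch"
    using sg_one[OF sg_kerch] by metis
   thus ?thesis unfolding indep_def by (auto intro!: exI[of _ "1 # - 1 # replicate (length hs) 0"])
  qed
  ultimately show ?thesis using True hs by (intro exI[of _ "t # hs"]) auto
 qed
qed

text \<open>In a relation for \<open>t # hs\<close> the exponent e of \<open>t\<close> is nonzero,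
  because \<open>hs\<close> is independent. Solving for t^|e| changes the signs of the other
  exponents exactly when e is positive.\<close>

lemma dependent_power:
 assumes hs: "set hs \<subseteq> TG" "indep hs" and t: "t \<in> TG" "~ indep (t # hs)"
 shows "\<exists>m\<ge>1. \<exists>es. length es = length hs & t ^ m * iv (pe hs es) \<in> kerch"
proof -
 obtain es where es: "length es = length (t # hs)" "pe (t # hs) es \<in> kerch" "\<exists>e\<in>set es. e ~= 0"
  using t(2) by (auto simp: indep_def)
 then obtain e es' where e: "es = e # es'" "length es' = length hs" by (cases es) auto
 have "e ~= 0"
 proof
  assume "e = 0"
  hence "pe hs es' \<in> kerch" "\<exists>e\<in>set es'. e ~= 0" using es e by auto
  thus False using hs(2) e(2) by (auto simp: indep_def)
 qed
 define fs where "fs = map (%x. - sgn e * x) es'"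
 have pTG: "pe hs fs \<in> TG" "pe hs es' \<in> TG" "t ^ nat \<bar>e\<bar> \<in> TG" "zp t e \<in> TG"
  using pe_in[OF sg_TG hs(1)] sg_power[OF sg_TG t(1)] sg_zp[OF sg_TG t(1)] by auto
 have "ch j (val (t ^ nat \<bar>e\<bar>)) = ch j (val (pe hs fs))" if j: "j < N" for j
 proof -
  define x where "x = ch j (val t)"
  define y where "y = ch j (val (pe hs es'))"
  have nz: "x ~= 0" "y ~= 0" using ch_TG_nz t(1) pTG(2) j by (auto simp: x_def y_def)
  have "ch j (val (zp t e * pe hs es')) = 1" using es(2) e(1) j by (simp add: kerch_def del: val_mult)
  hence rel: "x powi e * y = 1"
   using pTG j t(1) by (simp add: ch_TG_mult ch_TG_zp x_def y_def del: val_mult)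
  have "ch j (val (t ^ nat \<bar>e\<bar>)) = x powi \<bar>e\<bar>"
   using ch_power[OF TG_ut[OF t(1)] j] by (simp add: x_def power_int_def)
  moreover have "ch j (val (pe hs fs)) = y powi (- sgn e)"
   using ch_TG_pe[OF hs(1) _ j, of fs] ch_TG_pe[OF hs(1) e(2) j] e(2)
   by (simp add: y_def fs_def prod_powi power_int_mult[symmetric] mult.commute)
  moreover have "x powi \<bar>e\<bar> = y powi (- sgn e)"
   using rel nz \<open>e ~= 0\<close> by (cases "e > 0") (auto simp: sgn_if abs_if power_int_minus field_simps)
  ultimately show ?thesis by simp
 qed
 hence "t ^ nat \<bar>e\<bar> * iv (pe hs fs) \<in> kerch" using kerch_eq[OF pTG(3,1)] by blast
 thus ?thesis using \<open>e ~= 0\<close> e(2) by (intro exI[of _ "nat \<bar>e\<bar>"] exI[of _ fs] conjI) (auto simp: fs_def)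
qed

text \<open>Every generator of \<open>P\<close> has a power in the group Q generated by
  \<open>hs\<close> and the unipotents of \<open>P\<close>, so Q has finite index. By Schreier's
  lemma Q is finitely generated, even if its unipotent part is not; dividing each generator by a
  power product of \<open>hs\<close> makes it unipotent.\<close>

lemma independent_part:
 assumes T: "finite T" "P = gen T" and P: "P \<subseteq> TG" and hs: "set hs \<subseteq> P" "indep hs"
  and dep: "!!t. t \<in> T ==> ~ indep (t # hs)"
 shows "\<exists>us. fidx P (gen (set hs \<union> set us)) & set us \<subseteq> P \<inter> kerch &
  gen (set hs \<union> set us) = gen (set hs \<union> (P \<inter> kerch)) & (\<forall>a\<in>set hs. \<forall>b\<in>set hs. cm a b \<in> set us)"
proof -
 have sP: "sg P" using T sg_gen by auto
 define V where "V = P \<inter> kerch"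
 define Q where "Q = gen (set hs \<union> V)"
 have sV: "sg V" unfolding V_def by (rule sg_Int[OF sP sg_kerch])
 have sQ: "sg Q" by (simp add: Q_def sg_gen)
 have QP: "Q \<subseteq> P" unfolding Q_def by (rule gen_least[OF sP]) (use hs in \<open>auto simp: V_def\<close>)
 have cmV: "cm x y \<in> V" if "x \<in> P" "y \<in> P" for x y
  unfolding V_def using that P cm_kerch by (auto simp: cm_def intro!: sg_mult[OF sP] sg_iv[OF sP])
 have VQ: "V \<subseteq> Q" unfolding Q_def using gen_incl by blast
 have hsQ: "set hs \<subseteq> Q" unfolding Q_def using gen_incl by blast
 have TP: "T \<subseteq> P" using T gen_incl by auto
 have fPQ: "fidx P Q"
 proof -
  have "fidx (gen (T \<union> Q)) Q"
  proof (rule fidx_abelian_torsion[OF T(1) TP sP sQ QP])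
   show "cm x y \<in> Q" if "x \<in> P" "y \<in> P" for x y using cmV that VQ by blast
   show "\<exists>m\<ge>1. t ^ m \<in> Q" if t: "t \<in> T" for t
   proof -
    obtain m es where m: "m >= 1" "t ^ m * iv (pe hs es) \<in> kerch"
     using dependent_power[OF _ hs(2) _ dep[OF t]] hs(1) TP P t by blast
    have p: "pe hs es \<in> Q" by (rule pe_in[OF sQ hsQ])
    hence "t ^ m * iv (pe hs es) \<in> V"
     unfolding V_def using m t TP QP by (auto intro!: sg_mult[OF sP] sg_iv[OF sP] sg_power[OF sP])
    hence "t ^ m * iv (pe hs es) \<in> Q" using VQ by auto
    hence "t ^ m \<in> Q" using sg_mult_right_iff[OF sQ sg_iv[OF sQ p]] by blast
    thus ?thesis using m by blast
   qed
  qed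
  moreover have "P \<subseteq> gen (T \<union> Q)" unfolding T(2) by (rule gen_mono) auto
  ultimately show ?thesis using fidx_mono by blast
 qed
 obtain T2 where T2: "finite T2" "T2 \<subseteq> Q" "Q = gen T2"
  using schreier[OF T(1) sQ] QP fPQ T(2) by metis
 have "nrm P V" by (rule nrm_if_cm[OF sV _ cmV]) (auto simp: V_def)
 hence nV: "nrm Q V" using nrm_mono QP by blast
 have "\<exists>es. length es = length hs & t * iv (pe hs es) \<in> V" if t: "t \<in> T2" for t
 proof (rule gen_pe_mod[OF sV])
  show "nrm (gen (set hs \<union> V)) V" using nV by (simp add: Q_def)
  show "t \<in> gen (set hs \<union> V)" using T2(2) t by (auto simp: Q_def)
 qed (use cmV hs(1) in auto)
 then obtain es where es: "!!t. t \<in> T2 ==> t * iv (pe hs (es t)) \<in> V" by metis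
 \<comment> \<open>The commutators of \<open>hs\<close> are included because
   \<open>cert_unip\<close> asks for them among the unipotent generators.\<close>
 define X where "X = (%t. t * iv (pe hs (es t))) ` T2 \<union> (%(a, b). cm a b) ` (set hs \<times> set hs)"
 have "finite X" using T2 by (simp add: X_def)
 then obtain us where us: "set us = X" using finite_list by blast
 have XV: "X \<subseteq> V" using es cmV hs(1) by (auto simp: X_def)
 have "gen (set hs \<union> X) = Q"
 proof
  show "gen (set hs \<union> X) \<subseteq> Q" unfolding Q_def by (rule gen_mono) (use XV in auto)
  have "t \<in> gen (set hs \<union> X)" if "t \<in> T2" for t
  proof -
   have "t * iv (pe hs (es t)) \<in> gen (set hs \<union> X)"
    by (rule gen_incl) (use that in \<open>auto simp: X_def\<close>)
   moreover have "pe hs (es t) \<in> gen (set hs \<union> X)" by (rule pe_in[OF sg_gen]) (auto intro: gen_incl)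
   ultimately show ?thesis using sg_mult_right_iff[OF sg_gen sg_iv[OF sg_gen]] by blast
  qed
  thus "Q \<subseteq> gen (set hs \<union> X)" unfolding T2(3) by (intro gen_least[OF sg_gen]) auto
 qed
 thus ?thesis using fPQ us XV by (intro exI[of _ us]) (auto simp: V_def Q_def X_def)
qed

end

text \<open>If the torsion-free rank of \<open>G\<close> modulo unipotents is larger than that of \<open>H\<close>, then some \<open>g \<in> G\<close> has
 eigenvalue characters independent of those of a maximal independent family \<open>hs\<close> in \<open>H\<close>; otherwise the unipotent parts \<open>U\<close>, \<open>V\<close> satisfy \<open>|U : V| = \<infinity>\<close>, and some generator of \<open>U\<close> has
 infinite order modulo \<open>V [U, U]\<close>, so that a polynomial separates \<open>V\<close> from \<open>U\<close>.\<close>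

theorem certificates_complete:
 fixes A B :: "fmat un set"
 assumes N: "N >= 1" and A: "finite A" "A \<subseteq> GLN N" and B: "finite B" "gen B \<subseteq> gen A"
  and M: "sg M" "M \<subseteq> gen A" "nrm (gen A) M" "fidx (gen A) M" "(der ^^ k) M = {1}"
  and inf: "~ fidx (gen A) (gen B)"
 shows "cert_torus N (gen A) (gen B) | cert_unip N (gen A) (gen B)"
proof -
 let ?G = "gen A" and ?H = "gen B"
 have GL: "?G \<subseteq> GLN N" by (rule gen_least[OF sg_GLN A(2)])
 obtain G1 ws where G1: "sg G1" "G1 \<subseteq> ?G" "fidx ?G G1" "cv.flag (%g. Act (val g)) G1 ws"
  "cv.span (set ws) = cv.span (FN N)"
  using cr.malcev[OF finite_FN sg_gen _ M] GL Act_GLN_in by blast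
 interpret full_flag ws N
  by unfold_locales (use G1(4,5) in \<open>auto simp: cv.flag_def\<close>)
 have utG: "val g \<in> ut" if "g \<in> G1" for g
  using G1(4) that length_ws unfolding cv.flag_def ut_def by blast
 have G1T: "G1 \<subseteq> TG"
  unfolding TG_def using utG sg_iv[OF G1(1)] G1(2) GL by auto
 obtain T1 where T1: "finite T1" "T1 \<subseteq> G1" "G1 = gen T1" using schreier[OF A(1) G1(1-3)] by blast
 define H1 where "H1 = ?H \<inter> G1"
 have sH1: "sg H1" unfolding H1_def by (rule sg_Int[OF sg_gen G1(1)])
 have fHH1: "fidx ?H H1" unfolding H1_def by (rule fidx_Int'[OF sg_gen G1(1) G1(3) B(2)])
 have "H1 \<subseteq> gen B" by (auto simp: H1_def)
 then obtain T where T: "finite T" "T \<subseteq> H1" "H1 = gen T" using schreier[OF B(1) sH1 _ fHH1] by blast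
 have H1G1: "H1 \<subseteq> G1" by (auto simp: H1_def)
 hence TT: "T \<subseteq> TG" using T(2) G1T by auto
 obtain hs where hs: "set hs \<subseteq> T" "indep hs" "\<forall>t\<in>T. ~ indep (t # hs)"
  using maximal_independent[OF T(1) TT] by auto
 have hsH1: "set hs \<subseteq> H1" and hsG1: "set hs \<subseteq> G1" and hsT: "set hs \<subseteq> TG"
  using hs(1) T(2) H1G1 TT by auto
 have H1T: "H1 \<subseteq> TG" using H1G1 G1T by auto
 obtain vs where vs: "fidx H1 (gen (set hs \<union> set vs))" "set vs \<subseteq> H1 \<inter> kerch"
  "\<forall>a\<in>set hs. \<forall>b\<in>set hs. cm a b \<in> set vs"
  using independent_part[OF T(1,3) H1T hsH1 hs(2)] hs(3) by blast
 define K where "K = gen (set hs \<union> set vs)"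
 have sK: "sg K" by (simp add: K_def sg_gen)
 have KH1: "K \<subseteq> H1" unfolding K_def by (rule gen_least[OF sH1]) (use hsH1 vs(2) in auto)
 have hvH: "set hs \<union> set vs \<subseteq> ?H" using hsH1 vs(2) by (auto simp: H1_def)
 have fHK: "fidx ?H (gen (set hs \<union> set vs))" by (rule fidx_trans[OF fHH1 vs(1)])
 have vsk: "set vs \<subseteq> kerch" using vs(2) by auto
 have vsT: "set vs \<subseteq> TG" using vsk by (auto simp: kerch_def)
 show ?thesis
 proof (cases "\<exists>g\<in>T1. indep (g # hs)")
  case True
  then obtain g where g: "g \<in> T1" "indep (g # hs)" by auto
  have gT: "g \<in> TG" using g T1(2) G1T by auto
  have "\<exists>Js. ideal_cert N (set (g # hs) \<union> set hs \<union> set vs) (set vs) Js"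
   by (rule ideal_cert_exists[OF N _ vsk]) (use gT hsT vsT in auto)
  moreover have "indep_cert N (g # hs)" by (rule indep_cert_if[OF N _ g(2)]) (use gT hsT in auto)
  moreover have "g \<in> ?G" using g T1(2) G1(2) by auto
  ultimately have "cert_torus N ?G ?H" unfolding cert_torus_def triang_def using hvH fHK by blast
  thus ?thesis ..
 next
  case False
  then obtain us where us: "fidx G1 (gen (set hs \<union> set us))" "set us \<subseteq> G1 \<inter> kerch"
   "gen (set hs \<union> set us) = gen (set hs \<union> (G1 \<inter> kerch))"
   using independent_part[OF T1(1,3) G1T hsG1 hs(2)] by blast
  define G2 where "G2 = gen (set hs \<union> set us)"
  define U where "U = G1 \<inter> kerch"
  define V where "V = K \<inter> kerch"
  have sU: "sg U" unfolding U_def by (rule sg_Int[OF G1(1) sg_kerch])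
  have sV: "sg V" unfolding V_def by (rule sg_Int[OF sK sg_kerch])
  have VU: "V \<subseteq> U" using KH1 H1G1 by (auto simp: U_def V_def)
  have G2G1: "G2 \<subseteq> G1" unfolding G2_def by (rule gen_least[OF G1(1)]) (use hsG1 us(2) in auto)
  have G2eq: "G2 = gen (set hs \<union> U)" using us(3) by (simp add: G2_def U_def)
  have cmU: "cm x y \<in> U" if "x \<in> G1" "y \<in> G1" for x y
   unfolding U_def using that G1T cm_kerch by (auto simp: cm_def intro!: sg_mult[OF G1(1)] sg_iv[OF G1(1)])
  have nU: "nrm G1 U" by (rule nrm_if_cm[OF sU _ cmU]) (auto simp: U_def)
  have KG1: "K \<subseteq> G1" using KH1 H1G1 by auto
  have hsK: "set hs \<subseteq> K" and vsK: "set vs \<subseteq> K" unfolding K_def using gen_incl by blast+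
  have nV: "nrm K V"
   unfolding nrm_def
  proof (intro ballI)
   fix g v assume gv: "g \<in> K" "v \<in> V"
   have "g * v * iv g \<in> kerch" using nrmD[OF nrm_kerch, of g v] gv KG1 G1T by (auto simp: V_def)
   moreover have "g * v * iv g \<in> K" using gv by (auto simp: V_def intro!: sg_mult[OF sK] sg_iv[OF sK])
   ultimately show "g * v * iv g \<in> V" by (simp add: V_def)
  qed
  have pe_mod: "\<exists>es. length es = length hs & x * iv (pe hs es) \<in> U" if x: "x \<in> G2" for x
  proof (rule gen_pe_mod[OF sU])
   show "nrm (gen (set hs \<union> U)) U" using nrm_mono[OF nU G2G1] by (simp add: G2eq)
   show "x \<in> gen (set hs \<union> U)" using x by (simp add: G2eq)
  qed (use cmU hsG1 in auto)
  \<comment> \<open>Each element of \<open>G2\<close> is a power product of \<open>hs\<close>, which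
    lies in \<open>K\<close>, times an element of \<open>U\<close>. So finite index of V in U would
    pass to K in G2 and finally to H in G.\<close>
  have notUV: "~ fidx U V"
  proof
   assume "fidx U V"
   then obtain R where R: "finite R" "\<forall>u\<in>U. \<exists>r\<in>R. u * iv r \<in> V" by (auto simp: fidx_def)
   have "fidx G2 K"
   proof (rule fidxI[OF R(1)])
    fix x assume x: "x \<in> G2"
    obtain es where es: "x * iv (pe hs es) \<in> U" using pe_mod[OF x] by blast
    define p where "p = pe hs es"
    have p: "p \<in> K" unfolding p_def by (rule pe_in[OF sK hsK])
    have "iv p * (x * iv p) * p \<in> U"
     by (rule nrmD'[OF nU G1(1)]) (use p KG1 es in \<open>auto simp: p_def\<close>)
    hence "iv p * x \<in> U" by (simp add: mult.assoc)
    then obtain r where r: "r \<in> R" "iv p * x * iv r \<in> V" using R by blast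
    hence "p * (iv p * x * iv r) \<in> K" using p sg_mult[OF sK] by (simp add: V_def)
    thus "\<exists>r\<in>R. x * iv r \<in> K" using r(1) by (auto simp: mult.assoc)
   qed
   hence "fidx ?G K" using fidx_trans[OF G1(3) fidx_trans[OF us(1)]] by (simp add: G2_def)
   hence "fidx ?G ?H" by (rule fidx_mono) (use KH1 in \<open>auto simp: H1_def\<close>)
   thus False using inf by simp
  qed
  interpret nilalg "sut \<inter> MN N" N N by (rule nilalg_sut[OF N])
  have ugU: "ug (sut \<inter> MN N) U" unfolding ug_def
  proof (intro conjI ballI sU)
   fix x assume x: "x \<in> U"
   hence "x \<in> TG" "\<forall>j<N. ch j (val x) = 1" by (auto simp: U_def kerch_def)
   thus "val x - 1 \<in> sut \<inter> MN N" using ch_one_iff_sut by (auto simp: TG_def GLN_def)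
  qed
  \<comment> \<open>This is V [U, U]; by \<open>fidx_nilpotent\<close> some generator in
    \<open>us\<close> must have infinite order modulo it.\<close>
  define W where "W = GamV U V 1"
  have sW: "sg W" unfolding W_def by (rule sg_GamV[OF sU sV VU]) simp
  have WU: "W \<subseteq> U" unfolding W_def using GamV_Gam Gam_sub[OF sU] by blast
  have cmW: "cm x y \<in> W" if "x \<in> U" "y \<in> U" for x y
   unfolding W_def by (rule cm_GamV[OF sU sV VU]) (use that Gam_base in auto)
  have VW: "V \<subseteq> W"
  proof
   fix v assume "v \<in> V"
   moreover have "Gam U 1 v" using VU calculation by (intro Gam_base) auto
   moreover have "Gam U (Suc 1) 1" by (rule Gam_one) simp
   ultimately have "v * 1 \<in> W" unfolding W_def GamV_def by blast
   thus "v \<in> W" by simp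
  qed
  have "\<exists>u\<in>set us. \<forall>m\<ge>1. u ^ m \<notin> W"
  proof (rule ccontr)
   assume "~ ?thesis"
   hence "\<forall>u\<in>set us. \<exists>m\<ge>1. u ^ m \<in> W" by auto
   then obtain m where m: "!!u. u \<in> set us ==> m u >= (1::nat) & u ^ m u \<in> W" by metis
   define M1 where "M1 = (\<Prod>u\<in>set us. m u)"
   have M1: "M1 >= 1" unfolding M1_def by (rule prod_ge_1) (use m in blast)
   \<comment> \<open>The aim is \<open>E = U\<close>. As \<open>E\<close> contains \<open>us\<close>
     and the commutators of \<open>hs\<close> and is normalized by the group they generate, each
     element of U is a power product of \<open>hs\<close> modulo \<open>E\<close>, and being
     unipotent it is the trivial one.\<close>
   define E where "E = {x \<in> U. x ^ M1 \<in> W}"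
   have sE: "sg E" unfolding E_def by (rule sg_exponent_mod[OF sU sW WU cmW])
   have usE: "set us \<subseteq> E"
   proof
    fix u assume u: "u \<in> set us"
    have "m u dvd M1" unfolding M1_def by (rule dvd_prodI) (use u in auto)
    then obtain q where "M1 = m u * q" by auto
    hence "u ^ M1 \<in> W" using sg_power[OF sW, of "u ^ m u" q] m[OF u] by (simp add: power_mult)
    thus "u \<in> E" using u us(2) by (auto simp: E_def U_def)
   qed
   have VE: "V \<subseteq> E" using VU VW sg_power[OF sV] by (auto simp: E_def)
   \<comment> \<open>Conjugation by an element of \<open>K\<close> preserves V and the filtration;
     by an element of \<open>U\<close> it changes w only by a commutator, which lies in
     \<open>W\<close>.\<close>
   have conjE: "g * x * iv g \<in> E" if g: "g \<in> K | g \<in> U" and x: "x \<in> E" for g x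
   proof -
    have gG: "g \<in> G1" using g KG1 by (auto simp: U_def)
    have gU: "g * u * iv g \<in> U" if "u \<in> U" for u by (rule nrmD[OF nU gG that])
    have "g * w * iv g \<in> W" if w: "w \<in> W" for w
    proof (cases "g \<in> U")
     case True
     have "cm g w * w \<in> W" using cmW[OF True] w WU by (auto intro!: sg_mult[OF sW])
     thus ?thesis by (simp add: cm_def mult.assoc)
    next
     case False
     hence gK: "g \<in> K" using g by simp
     obtain v y where vy: "w = v * y" "v \<in> V" "Gam U 1 v" "Gam U (Suc 1) y"
      using w by (auto simp: W_def GamV_def)
     have "g * v * iv g \<in> V" by (rule nrmD[OF nV gK vy(2)])
     moreover have "Gam U 1 (g * v * iv g)" "Gam U (Suc 1) (g * y * iv g)"
      using Gam_conj[OF gU] vy by blast+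
     moreover have "g * w * iv g = (g * v * iv g) * (g * y * iv g)" by (simp add: vy mult.assoc)
     ultimately show ?thesis unfolding W_def GamV_def by blast
    qed
    moreover have "(g * x * iv g) ^ j = g * x ^ j * iv g" for j
     by (induction j) (auto simp: mult.assoc)
    ultimately show ?thesis using x gU by (simp add: E_def)
   qed
   have nE: "nrm (gen (set hs \<union> set us)) E"
   proof (rule nrm_gen[OF sE])
    fix s x assume s: "s \<in> set hs \<union> set us" and x: "x \<in> E"
    have sKU: "s \<in> K | s \<in> U" using s hsK us(2) by (auto simp: U_def)
    thus "s * x * iv s \<in> E" using x by (rule conjE)
    have "iv s \<in> K | iv s \<in> U" using sKU sg_iv[OF sK] sg_iv[OF sU] by blast
    from conjE[OF this x] show "iv s * x * s \<in> E" by simp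
   qed
   have "U \<subseteq> E"
   proof
    fix x assume x: "x \<in> U"
    have "x \<in> gen (set hs \<union> set us)" using x G2eq gen_incl[of x "set hs \<union> U"] by (simp add: G2_def)
    hence "\<exists>es. length es = length hs & x * iv (pe hs es) \<in> E"
     by (rule gen_pe_mod[OF sE nE usE, rotated]) (use vs(3) vsK vsk VE V_def in blast)
    then obtain es where es: "length es = length hs" "x * iv (pe hs es) \<in> E" by auto
    hence "x * iv (pe hs es) \<in> kerch" "x \<in> kerch" using x by (auto simp: E_def U_def)
    hence "iv (pe hs es) \<in> kerch" using sg_mult_left_iff[OF sg_kerch] by blast
    hence "pe hs es \<in> kerch" using sg_iv_iff[OF sg_kerch] by blast
    hence "pe hs es = 1" using hs(2) es(1) by (intro pe_zero) (auto simp: indep_def)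
    thus "x \<in> E" using es(2) by simp
   qed
   hence U: "!!u. u \<in> U ==> u ^ M1 \<in> GamV U V 1" by (auto simp: E_def W_def)
   have "fidx U V"
   proof (rule fidx_nilpotent[OF sU sV VU M1 U N Gam_trivial[OF ugU]])
    fix P X k assume "sg P" "sg X" "X \<subseteq> P" "P \<subseteq> U" "k >= (1::nat)" "!!u. u \<in> P ==> u ^ k \<in> X"
    moreover from this ugU have "ug (sut \<inter> MN N) P" by (auto simp: ug_def)
    ultimately show "fidx P X" by (intro fidx_unipotent[OF idl_J]) auto
   qed
   thus False using notUV by simp
  qed
  then obtain u where u: "u \<in> set us" "!!m. m >= 1 ==> u ^ m \<notin> W" by blast
  have uU: "u \<in> U" using u us(2) by (auto simp: U_def)
  obtain p x where p: "pol N p" "\<forall>w\<in>W. p (val w) = 0" "x \<in> U" "p (val x) ~= 0"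
   using separating_polynomial[OF idl_J ugU sW WU cmW uU u(2)] by blast
  obtain D where D: "pd N D p" using pol_pd[OF p(1)] by blast
  obtain a where a: "\<forall>x. p x = (\<Sum>l\<in>mons N D. a l * mnm l x)" using pd_sum_mnm[OF D] by blast
  obtain ys where ys: "set ys \<subseteq> V" "\<forall>x\<in>V. sp N D ys x" using spanning_evaluations by blast
  have symvs: "symm (set vs) \<subseteq> V" by (rule symm_subset[OF sV]) (use vsK vsk in \<open>auto simp: V_def\<close>)
  have symK: "symm (set hs \<union> set vs) \<subseteq> K" by (rule symm_subset[OF sK]) (use vsK hsK in auto)
  have pc: "poly_cert N D (set hs \<union> set vs) (set vs) ys x"
   unfolding poly_cert_def
  proof (intro conjI ballI exI[of _ a])
   show "set ys \<subseteq> GLN N" using ys(1) VU G1(2) GL by (auto simp: U_def)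
   show "sp N D ys 1" using ys(2) sg_one[OF sV] by blast
   show "sp N D ys (y * v)" if y: "y \<in> set ys" and v: "v \<in> symm (set vs)" for y v
   proof -
    have "y * v \<in> V" by (rule sg_mult[OF sV]) (use y v ys(1) symvs in auto)
    thus ?thesis using ys(2) by blast
   qed
   show "sp N D ys (g * y * iv g)" if y: "y \<in> set ys" and g: "g \<in> symm (set hs \<union> set vs)" for y g
   proof -
    have "g * y * iv g \<in> V" by (rule nrmD[OF nV]) (use y g ys(1) symK in auto)
    thus ?thesis using ys(2) by blast
   qed
   show "(\<Sum>l\<in>mons N D. a l * mnm l (val y)) = 0" if "y \<in> set ys" for y
    using that ys(1) VW p(2) a by auto
   show "(\<Sum>l\<in>mons N D. a l * mnm l (val x)) ~= 0" using p(4) a by auto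
  qed
  have uni: "unip N x" using unip_iff[OF N] p(3) by (auto simp: U_def kerch_def)
  have uG: "x \<in> ?G" using p(3) G1(2) by (auto simp: U_def)
  have "\<exists>Js. ideal_cert N (set hs \<union> set hs \<union> set vs) (set vs) Js"
   by (rule ideal_cert_exists[OF N _ vsk]) (use hsT vsT in auto)
  moreover have "indep_cert N hs" by (rule indep_cert_if[OF N hsT hs(2)])
  ultimately have "cert_unip N ?G ?H" unfolding cert_unip_def triang_def using uG uni hvH fHK vs(3) pc by blast
  thus ?thesis ..
 qed
qed

theorem infinite_index_iff:
 fixes A B :: "fmat un set"
 assumes N: "N >= 1" and A: "finite A" "A \<subseteq> GLN N" and B: "finite B" "gen B \<subseteq> gen A"
  and M: "sg M" "M \<subseteq> gen A" "nrm (gen A) M" "fidx (gen A) M" "(der ^^ k) M = {1}"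
 shows "~ fidx (gen A) (gen B) \<longleftrightarrow> cert_torus N (gen A) (gen B) | cert_unip N (gen A) (gen B)"
 using certificates_complete[OF assms] cert_torus_sound[OF N sg_gen _ B(2)]
  cert_unip_sound[OF N sg_gen _ B(2)] gen_least[OF sg_GLN A(2)] by blast

section \<open>Computability over coded types\<close>

lemma computes_comp1: "computes g xs y ==> computes f [y] z ==> computes (Comp f [g]) xs z"
 by (rule computes.comp[of "[y]"]) auto

lemma computes_comp2:
 "computes g xs y ==> computes g' xs y' ==> computes f [y, y'] z ==> computes (Comp f [g, g']) xs z"
 by (rule computes.comp[of "[y, y']"]) (auto simp: less_Suc_eq)

lemma computes_proj: "i < length xs ==> y = xs ! i ==> computes (Proj i) xs y"
 using computes.proj by simp

lemma computes_PrimRec: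
 assumes "computes p xs (f 0)" "!!k. computes q (k # f k # xs) (f (Suc k))"
 shows "computes (PrimRec p q) (n # xs) (f n)"
 by (induction n) (auto intro: computes.prim_0 computes.prim_Suc assms)

section \<open>Programs for arithmetic and pairing\<close>

definition "addP = PrimRec (Proj 0) (Comp Succ [Proj 1])"
definition "predP = PrimRec Zero (Proj 0)"
text \<open>The recursion runs over the first argument, so the result is the second argument minus
  the first.\<close>

definition "subP = PrimRec (Proj 0) (Comp predP [Proj 1])"
definition "triP = PrimRec Zero (Comp Succ [Comp addP [Proj 0, Proj 1]])"
definition "pairP = Comp addP [Comp triP [addP], Proj 0]"
text \<open>As \<open>prod_encode (m, k)\<close> is \<open>triangle (m + k) + m\<close>, the
  diagonal m + k is the least s with z < triangle (s + 1). This search inverts the pairing.\<close>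

definition "diagP = Mu (Comp subP [Comp triP [Comp Succ [Proj 0]], Comp Succ [Proj 1]])"
definition "fstP = Comp subP [Comp triP [diagP], Proj 0]"
definition "sndP = Comp subP [fstP, diagP]"

lemma computes_addP: "z = m + k ==> computes addP [k, m] z"
 unfolding addP_def
 by (erule ssubst, rule computes_PrimRec[where f = "%k. m + k"])
  (auto intro!: computes_proj computes_comp1 computes.succ)

lemma computes_predP: "computes predP [k] (k - 1)"
 unfolding predP_def
 by (rule computes_PrimRec[where f = "%k. k - 1"]) (auto intro!: computes_proj computes.zero)

lemma computes_subP: "z = m - k ==> computes subP [k, m] z"
 unfolding subP_def
 by (erule ssubst, rule computes_PrimRec[where f = "%k. m - k"])
  (auto intro!: computes_proj computes_comp1 computes_predP[THEN back_subst[of "computes _ _"]])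

lemma computes_triP: "computes triP [k] (triangle k)"
 unfolding triP_def
 by (rule computes_PrimRec[where f = triangle])
  (auto intro!: computes_proj computes_comp1 computes_comp2 computes.succ computes.zero computes_addP)

lemma computes_pairP: "computes pairP [m, k] (prod_encode (m, k))"
 unfolding pairP_def prod_encode_def
 by (auto intro!: computes_proj computes_comp1 computes_comp2 computes_triP computes_addP simp: add.commute)

lemma triangle_mono: "m <= k ==> triangle m <= triangle k"
 by (induction k) (auto simp: le_Suc_eq)

lemma computes_diagP: "computes diagP [prod_encode (m, k)] (m + k)"
 unfolding diagP_def
proof (rule computes.mu)
 let ?f = "Comp subP [Comp triP [Comp Succ [Proj 0]], Comp Succ [Proj 1]]"
 have f: "computes ?f [s, z] (Suc z - triangle (Suc s))" for s z
  by (auto intro!: computes_proj computes_comp1 computes_comp2 computes_triP computes_subP computes.succ)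
 show "computes ?f [m + k, prod_encode (m, k)] 0"
  using f[of "m + k" "prod_encode (m, k)"] by (simp add: prod_encode_def)
 show "\<forall>i<m + k. \<exists>y>0. computes ?f [i, prod_encode (m, k)] y"
 proof (intro allI impI)
  fix i assume "i < m + k"
  hence "triangle (Suc i) <= triangle (m + k)" by (intro triangle_mono) auto
  thus "\<exists>y>0. computes ?f [i, prod_encode (m, k)] y"
   using f[of i "prod_encode (m, k)"] by (intro exI[of _ "Suc (prod_encode (m, k)) - triangle (Suc i)"])
    (auto simp: prod_encode_def)
 qed
qed

lemma computes_fstP: "computes fstP [prod_encode (m, k)] m"
proof -
 have "m = prod_encode (m, k) - triangle (m + k)" by (simp add: prod_encode_def)
 from computes_subP[OF this] show ?thesis
  unfolding fstP_def by (auto intro!: computes_proj computes_comp1 computes_comp2 computes_triP computes_diagP)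
qed

lemma computes_sndP: "computes sndP [prod_encode (m, k)] k"
 unfolding sndP_def
 by (auto intro!: computes_comp2 computes_fstP computes_diagP computes_subP)

text \<open>Used in \<open>cmp_hdd\<close>: a primitive recursion that merely distinguishes cases
  still runs its step at every smaller number.\<close>

lemma total_fstP: "\<exists>y. computes fstP [k] y"
 using computes_fstP by (metis prod_decode_inverse surj_pair)

class coded =
 fixes enc :: "'a => nat"
 assumes enc_eq_iff: "enc x = enc y \<longleftrightarrow> x = y"

instantiation nat :: coded
begin
definition "enc (n::nat) = n"
instance by standard (simp add: enc_nat_def)
end

text \<open>Truth is coded by 0, since this is what unbounded search looks for.\<close>

instantiation bool :: coded
begin
definition "enc (b::bool) = (if b then 0 else 1 :: nat)"
instance by standard (auto simp: enc_bool_def)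
end

instantiation int :: coded
begin
definition "enc (i::int) = int_encode i"
instance by standard (simp add: enc_int_def inj_eq[OF inj_int_encode])
end

instantiation rat :: coded
begin
definition "enc (q::rat) = rat_code q"
instance
proof
 fix x y :: rat
 show "enc x = enc y \<longleftrightarrow> x = y"
  by (cases "quotient_of x"; cases "quotient_of y")
   (auto simp: enc_rat_def rat_code_def inj_eq[OF inj_int_encode] simp flip: quotient_of_inject_eq)
qed
end

instantiation prod :: (coded, coded) coded
begin
definition "enc p = prod_encode (enc (fst p), enc (snd p))"
instance by standard (auto simp: enc_prod_def enc_eq_iff prod_eq_iff)
end

instantiation list :: (coded) coded
begin
definition "enc xs = list_encode (map enc xs)"
instance
proof
 fix x y :: "'a list"
 have "inj (enc :: 'a => nat)" by (auto simp: inj_def enc_eq_iff)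
 thus "enc x = enc y \<longleftrightarrow> x = y" by (simp add: enc_list_def inj_map_eq_map list_encode_eq)
qed
end

definition cmp :: "('a::coded => 'b::coded) => bool" where
 "cmp f \<longleftrightarrow> (\<exists>p. \<forall>x. computes p [enc x] (enc (f x)))"

lemma cmp_id: "cmp (%x. x)"
 unfolding cmp_def by (rule exI[of _ "Proj 0"]) (auto intro: computes_proj)

lemma cmp_comp: "cmp f ==> cmp g ==> cmp (%x. f (g x))"
 unfolding cmp_def by (meson computes_comp1)

lemma cmp_const: "cmp (%x. c)"
proof -
 have "\<exists>p. \<forall>xs. computes p xs k" for k
 proof (induction k)
  case (Suc k)
  then obtain p where "\<forall>xs. computes p xs k" by auto
  hence "computes (Comp Succ [p]) xs (Suc k)" for xs by (auto intro: computes_comp1 computes.succ)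
  thus ?case by blast
 qed (auto intro: computes.zero)
 thus ?thesis unfolding cmp_def by blast
qed

text \<open>Computability depends only on codes, so functions into different types can share a
  program.\<close>

lemma cmp_raw: "(!!x. enc (g x) = enc (f x)) ==> cmp f ==> cmp (%x. g x)"
 by (simp add: cmp_def)

lemma cmp_unary:
 assumes "!!x. computes p [enc x] (enc (h x))" "cmp f"
 shows "cmp (%x. h (f x))"
 using assms computes_comp1 unfolding cmp_def by meson

lemma cmp_binary:
 assumes "!!x y. computes p [enc x, enc y] (enc (h x y))" "cmp f" "cmp g"
 shows "cmp (%x. h (f x) (g x))"
 using assms computes_comp2 unfolding cmp_def by meson

lemma cmp_Pair: "cmp f ==> cmp g ==> cmp (%x. (f x, g x))"
 by (rule cmp_binary[of pairP]) (simp_all add: enc_prod_def computes_pairP)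

lemma cmp_fst: "cmp f ==> cmp (%x. fst (f x))"
 by (rule cmp_unary[of fstP]) (auto simp: enc_prod_def computes_fstP)

lemma cmp_snd: "cmp f ==> cmp (%x. snd (f x))"
 by (rule cmp_unary[of sndP]) (auto simp: enc_prod_def computes_sndP)

lemma cmp_Suc: "cmp f ==> cmp (%x. Suc (f x))"
 by (rule cmp_unary[of Succ]) (auto simp: enc_nat_def computes.succ)

lemma cmp_enc: "cmp f ==> cmp (%x. enc (f x))"
 by (simp add: cmp_def enc_nat_def)

text \<open>Parameters, counter and intermediate value are packed into one code; the recursive
  constructions below are instances of this scheme.\<close>

lemma cmp_rec:
 assumes "cmp a" "cmp (%p. g (fst p) (fst (snd p)) (snd (snd p)))" "cmp n"
 shows "cmp (%x. rec_nat (a x) (%k r. g x k r) (n x))"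
proof -
 obtain pa pg pn where p: "!!x. computes pa [enc x] (enc (a x))"
  "!!x k r. computes pg [enc (x, k, r)] (enc (g x k r))" "!!x. computes pn [enc x] (n x)"
  using assms by (auto simp: cmp_def enc_nat_def)
 define R where "R = PrimRec pa (Comp pg [Comp pairP [Proj 2, Comp pairP [Proj 0, Proj 1]]])"
 have "computes R [k, enc x] (enc (rec_nat (a x) (g x) k))" for x k
  unfolding R_def
 proof (rule computes_PrimRec[where f = "%k. enc (rec_nat (a x) (g x) k)"])
  fix k let ?r = "rec_nat (a x) (g x) k"
  show "computes (Comp pg [Comp pairP [Proj 2, Comp pairP [Proj 0, Proj 1]]])
   (k # enc ?r # [enc x]) (enc (rec_nat (a x) (g x) (Suc k)))"
   using p(2)[of x k ?r] by (auto intro!: computes_comp1 computes_comp2 computes_pairP computes_proj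
     simp: enc_prod_def enc_nat_def)
 qed (simp add: p)
 hence "computes (Comp R [pn, Proj 0]) [enc x] (enc (rec_nat (a x) (g x) (n x)))" for x
  using p(3) by (auto intro!: computes_comp2 computes_proj)
 thus ?thesis unfolding cmp_def by blast
qed

lemma cmp_Least:
 assumes "cmp (%p. Q (fst p) (snd p))" "!!x. \<exists>w::nat. Q x w"
 shows "cmp (%x. LEAST w. Q x w)"
proof -
 obtain p where p: "!!x w. computes p [enc (x, w)] (enc (Q x w))"
  using assms(1) by (auto simp: cmp_def)
 let ?f = "Comp p [Comp pairP [Proj 1, Proj 0]]"
 have f: "computes ?f [w, enc x] (enc (Q x w))" for x w
  using p[of x w] by (auto intro!: computes_comp1 computes_comp2 computes_pairP computes_proj
    simp: enc_prod_def enc_nat_def)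
 have "computes (Mu ?f) [enc x] (LEAST w. Q x w)" for x
 proof (rule computes.mu)
  show "computes ?f [LEAST w. Q x w, enc x] 0"
   using f[of "LEAST w. Q x w" x] LeastI_ex[OF assms(2)[of x]] by (simp add: enc_bool_def)
  show "\<forall>i<LEAST w. Q x w. \<exists>y>0. computes ?f [i, enc x] y"
  proof (intro allI impI)
   fix i assume "i < (LEAST w. Q x w)"
   hence "~ Q x i" by (rule not_less_Least)
   thus "\<exists>y>0. computes ?f [i, enc x] y" using f[of i x] by (intro exI[of _ 1]) (simp add: enc_bool_def)
  qed
 qed
 thus ?thesis unfolding cmp_def by (auto simp: enc_nat_def)
qed

lemma cmp_plus: "cmp f ==> cmp g ==> cmp (%x. f x + g x :: nat)"
 by (rule cmp_binary[of addP]) (auto simp: enc_nat_def intro: computes_addP)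

lemma cmp_minus: "cmp f ==> cmp g ==> cmp (%x. f x - g x :: nat)"
 by (rule cmp_binary[of subP "%x y. y - x" g f]) (auto simp: enc_nat_def intro: computes_subP)

lemma cmp_times:
 assumes "cmp f" "cmp g" shows "cmp (%x. f x * g x :: nat)"
proof -
 have "rec_nat 0 (%k r. r + n) m = m * n" for m n :: nat by (induction m) auto
 moreover have "cmp (%x. rec_nat 0 (%k r. r + g x) (f x))"
  by (intro cmp_rec cmp_plus cmp_const cmp_comp[OF assms(2)] assms cmp_fst cmp_snd cmp_id)
 ultimately show ?thesis by simp
qed

text \<open>Branching is recursion over the code of the condition, which is 0 or 1.\<close>

lemma cmp_If:
 assumes "cmp b" "cmp f" "cmp g" shows "cmp (%x. if b x then f x else g x)"
proof -
 have "cmp (%x. rec_nat (f x) (%k r. g x) (enc (b x)))"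
  by (intro cmp_rec cmp_comp[OF assms(3)] assms cmp_fst cmp_id cmp_enc)
 moreover have "rec_nat (f x) (%k r. g x) (enc (b x)) = (if b x then f x else g x)" for x
  by (simp add: enc_bool_def)
 ultimately show ?thesis by simp
qed

lemma cmp_zero: assumes "cmp f" shows "cmp (%x. f x = (0::nat))"
proof -
 have "rec_nat True (%_ _. False) n = (n = 0)" for n by (cases n) auto
 moreover have "cmp (%x. rec_nat True (%_ _. False) (f x))" by (intro cmp_rec cmp_const assms)
 ultimately show ?thesis by simp
qed

lemma cmp_not: assumes "cmp b" shows "cmp (%x. ~ b x)"
 using cmp_If[OF assms cmp_const[of False] cmp_const[of True]] by (simp add: if_bool_eq_conj)

lemma cmp_conj: assumes "cmp b" "cmp c" shows "cmp (%x. b x & c x)"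
 by (rule cmp_raw[OF _ cmp_If[OF assms cmp_const[of False]]]) auto

lemma cmp_disj: assumes "cmp b" "cmp c" shows "cmp (%x. b x | c x)"
 using cmp_not[OF cmp_conj[OF cmp_not[OF assms(1)] cmp_not[OF assms(2)]]] by simp

lemma cmp_le: assumes "cmp f" "cmp g" shows "cmp (%x. f x <= (g x :: nat))"
 using cmp_zero[OF cmp_minus[OF assms]] by simp

lemma cmp_less: assumes "cmp f" "cmp g" shows "cmp (%x. f x < (g x :: nat))"
 using cmp_le[OF cmp_Suc[OF assms(1)] assms(2)] by (simp add: Suc_le_eq)

lemma cmp_eq: assumes "cmp f" "cmp g" shows "cmp (%x. f x = g x)"
proof -
 have "cmp (%x. enc (f x) <= enc (g x) & enc (g x) <= enc (f x))"
  by (intro cmp_conj cmp_le cmp_enc assms)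
 thus ?thesis by (simp add: enc_eq_iff flip: eq_iff)
qed

lemmas cmp_basic = cmp_id cmp_const cmp_Pair cmp_fst cmp_snd cmp_Suc cmp_enc cmp_rec cmp_plus cmp_minus
 cmp_times cmp_If cmp_not cmp_conj cmp_disj cmp_le cmp_less cmp_eq

subsection \<open>Lists\<close>

lemma enc_Nil [simp]: "enc [] = 0"
 by (simp add: enc_list_def)

lemma enc_Cons: "enc (x # xs) = Suc (prod_encode (enc x, enc xs))"
 by (simp add: enc_list_def)

lemma cmp_Cons: "cmp f ==> cmp g ==> cmp (%x. f x # g x)"
 by (rule cmp_binary[of "Comp Succ [pairP]"])
  (auto simp: enc_Cons intro: computes_comp1 computes_pairP computes.succ)

lemma cmp_tl:
 fixes f :: "'a::coded => 'b::coded list"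
 shows "cmp f ==> cmp (%x. tl (f x))"
proof (rule cmp_unary[of "Comp sndP [predP]" tl f])
 fix xs :: "'b list"
 \<comment> \<open>The empty list has code 0, whose predecessor is again 0 and decodes to (0, 0); so
   the program returns the code of \<open>tl []\<close> as well.\<close>
 have "prod_encode (0, 0) = 0" by (simp add: prod_encode_def)
 hence "computes sndP [0] 0" using computes_sndP[of 0 0] by simp
 hence "computes sndP [enc xs - 1] (enc (tl xs))"
  using computes_sndP by (cases xs) (auto simp: enc_Cons)
 thus "computes (Comp sndP [predP]) [enc xs] (enc (tl xs))"
  by (rule computes_comp1[OF computes_predP])
qed

definition hdd :: "'a => 'a list => 'a" where
 "hdd d xs = (case xs of [] => d | x # _ => x)"

lemma cmp_hdd:
 fixes d :: "'a::coded => 'b::coded"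
 shows "cmp d ==> cmp f ==> cmp (%x. hdd (d x) (f x))"
proof (rule cmp_binary[of "PrimRec (Proj 0) (Comp fstP [Proj 0])" "%xs d. hdd d xs" f d])
 fix xs :: "'b list" and d :: 'b
 obtain F where F: "!!k. computes fstP [k] (F k)" using total_fstP by metis
 have "computes (PrimRec (Proj 0) (Comp fstP [Proj 0])) [n, enc d] (case n of 0 => enc d | Suc k => F k)" for n
  by (rule computes_PrimRec[where f = "%n. case n of 0 => enc d | Suc k => F k"])
   (auto intro!: computes_comp1 computes_proj F)
 from this[of "enc xs"] show "computes (PrimRec (Proj 0) (Comp fstP [Proj 0])) [enc xs, enc d] (enc (hdd d xs))"
  using computes_deterministic[OF F computes_fstP]
  by (cases xs) (auto simp: hdd_def enc_Cons)
qed

lemma le_enc_list: "length xs <= enc xs"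
proof (induction xs)
 case (Cons x xs)
 thus ?case using le_prod_encode_2[of "enc xs" "enc x"] by (simp add: enc_Cons)
qed simp

text \<open>Iterated as often as the code of the list says, which by \<open>le_enc_list\<close> is
  at least its length; after the list is exhausted the state no longer changes.\<close>

definition fold_step :: "('s => 'a => 's) => 'a => 'a list \<times> 's => 'a list \<times> 's" where
 "fold_step f d p = (if fst p = [] then p else (tl (fst p), f (snd p) (hdd d (fst p))))"

lemma foldl_step: "length xs <= n ==> snd ((fold_step f d ^^ n) (xs, a)) = foldl f a xs"
proof (induction n arbitrary: xs a)
 case (Suc n)
 show ?case
 proof (cases xs)
  case Nil
  hence "(fold_step f d ^^ Suc n) (xs, a) = (fold_step f d ^^ n) (xs, a)"
   by (simp add: fold_step_def funpow_swap1)
  thus ?thesis using Suc.IH[of xs a] Nil by simp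
 next
  case (Cons y ys)
  hence "(fold_step f d ^^ Suc n) (xs, a) = (fold_step f d ^^ n) (ys, f a y)"
   by (simp add: fold_step_def funpow_swap1 hdd_def)
  thus ?thesis using Suc.IH[of ys "f a y"] Suc.prems Cons by simp
 qed
qed simp

lemma rec_nat_funpow: "rec_nat a (%_ r. f r) n = (f ^^ n) a"
 by (induction n) auto

lemma cmp_foldl:
 assumes f: "cmp (%p. f (fst p) (fst (snd p)) (snd (snd p)))" and "cmp a" "cmp xs"
 shows "cmp (%x. foldl (%s y. f x s y) (a x) (xs x))"
proof -
 have "cmp (%x. snd (rec_nat (xs x, a x) (%_ r. fold_step (f x) undefined r) (enc (xs x))))"
  unfolding fold_step_def
  by (intro cmp_basic cmp_tl cmp_hdd assms
    cmp_comp[OF f, of "%p. (fst p, snd (snd (snd p)), hdd undefined (fst (snd (snd p))))", unfolded fst_conv snd_conv])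
 thus ?thesis by (simp add: rec_nat_funpow foldl_step le_enc_list)
qed

lemma cmp_rev: assumes "cmp xs" shows "cmp (%x. rev (xs x))"
proof -
 have "foldl (%s y. y # s) a l = rev l @ a" for a l :: "'b list" by (induction l arbitrary: a) auto
 moreover have "cmp (%x. foldl (%s y. y # s) [] (xs x))"
  by (intro cmp_foldl cmp_Cons cmp_basic assms)
 ultimately show ?thesis by simp
qed

lemma cmp_foldr:
 assumes "cmp (%p. f (fst p) (fst (snd p)) (snd (snd p)))" "cmp a" "cmp xs"
 shows "cmp (%x. foldr (%y s. f x y s) (xs x) (a x))"
proof -
 have "cmp (%x. foldl (%s y. f x y s) (a x) (rev (xs x)))"
  by (intro cmp_foldl cmp_rev assms
    cmp_comp[OF assms(1), of "%p. (fst p, snd (snd p), fst (snd p))", unfolded fst_conv snd_conv] cmp_basic)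
 thus ?thesis by (simp add: foldr_conv_foldl)
qed

lemma cmp_map:
 assumes "cmp (%p. f (fst p) (snd p))" "cmp xs"
 shows "cmp (%x. map (%y. f x y) (xs x))"
proof -
 have "cmp (%x. foldr (%y s. f x y # s) (xs x) [])"
  by (intro cmp_foldr cmp_Cons cmp_basic assms
    cmp_comp[OF assms(1), of "%p. (fst p, fst (snd p))", unfolded fst_conv snd_conv])
 moreover have "foldr (%y s. f x y # s) l [] = map (f x) l" for x l by (induction l) auto
 ultimately show ?thesis by simp
qed

lemma cmp_append: assumes "cmp f" "cmp g" shows "cmp (%x. f x @ g x)"
proof -
 have "cmp (%x. foldr (%y s. y # s) (f x) (g x))" by (intro cmp_foldr cmp_Cons cmp_basic assms)
 moreover have "foldr (%y s. y # s) l m = l @ m" for l m :: "'b list" by (induction l) auto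
 ultimately show ?thesis by simp
qed

lemma cmp_concat: assumes "cmp f" shows "cmp (%x. concat (f x))"
proof -
 have "cmp (%x. foldr (%y s. y @ s) (f x) [])" by (intro cmp_foldr cmp_append cmp_basic assms)
 moreover have "foldr (%y s. y @ s) l [] = concat l" for l :: "'b list list" by (induction l) auto
 ultimately show ?thesis by simp
qed

lemma cmp_ball:
 assumes "cmp (%p. P (fst p) (snd p))" "cmp xs"
 shows "cmp (%x. \<forall>y\<in>set (xs x). P x y)"
proof -
 have "cmp (%x. foldr (%y s. P x y & s) (xs x) True)"
  by (intro cmp_foldr cmp_basic assms
    cmp_comp[OF assms(1), of "%p. (fst p, fst (snd p))", unfolded fst_conv snd_conv])
 moreover have "foldr (%y s. P x y & s) l True = (\<forall>y\<in>set l. P x y)" for x l by (induction l) auto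
 ultimately show ?thesis by simp
qed

lemma cmp_bex:
 assumes "cmp (%p. P (fst p) (snd p))" "cmp xs"
 shows "cmp (%x. \<exists>y\<in>set (xs x). P x y)"
 using cmp_not[OF cmp_ball[of "%x y. ~ P x y", OF cmp_not[OF assms(1)] assms(2)]] by simp

lemma cmp_length: assumes "cmp f" shows "cmp (%x. length (f x))"
proof -
 have "cmp (%x. foldr (%y s. Suc s) (f x) 0)" by (intro cmp_foldr cmp_basic assms)
 moreover have "foldr (%y s. Suc s) l 0 = length l" for l :: "'b list" by (induction l) auto
 ultimately show ?thesis by simp
qed

lemma cmp_upt: assumes "cmp n" shows "cmp (%x. [0..<n x])"
proof -
 have "cmp (%x. rec_nat [] (%k r. r @ [k]) (n x))" by (intro cmp_append cmp_Cons cmp_basic assms)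
 moreover have "rec_nat [] (%k r. r @ [k]) m = [0..<m]" for m by (induction m) auto
 ultimately show ?thesis by simp
qed

text \<open>Indexing with a default value, so that the result is specified at every index.\<close>

definition ix :: "'a => 'a list => nat => 'a" where
 "ix d xs i = (if i < length xs then xs ! i else d)"

lemma cmp_ix: assumes "cmp d" "cmp xs" "cmp i" shows "cmp (%x. ix (d x) (xs x) (i x))"
proof -
 have "cmp (%x. hdd (d x) (rec_nat (xs x) (%_ r. tl r) (i x)))"
  by (intro cmp_hdd cmp_tl cmp_basic assms)
 moreover have "hdd d ((tl ^^ i) xs) = ix d xs i" for d :: 'b and i xs
 proof (induction i arbitrary: xs)
  case 0
  thus ?case by (cases xs) (auto simp: hdd_def ix_def)
 next
  case (Suc i)
  have "hdd d ((tl ^^ Suc i) xs) = ix d (tl xs) i" by (simp only: funpow_Suc_right o_apply Suc)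
  thus ?case by (cases xs) (auto simp: ix_def)
 qed
 ultimately show ?thesis by (simp add: rec_nat_funpow)
qed

definition lists_len :: "nat => 'a list => 'a list list" where
 "lists_len n xs = rec_nat [[]] (%_ r. concat (map (%ys. map (%y. y # ys) xs) r)) n"

lemma set_lists_len: "set (lists_len n xs) = {ys. length ys = n & set ys \<subseteq> set xs}"
proof (induction n)
 case (Suc n)
 have "set (lists_len (Suc n) xs) = {y # ys |y ys. y \<in> set xs & ys \<in> set (lists_len n xs)}"
  by (auto simp: lists_len_def)
 also have "\<dots> = {ys. length ys = Suc n & set ys \<subseteq> set xs}"
  unfolding Suc by (auto simp: length_Suc_conv)
 finally show ?case .
qed (auto simp: lists_len_def)

lemma cmp_lists_len: assumes "cmp n" "cmp xs" shows "cmp (%x. lists_len (n x) (xs x))"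
 unfolding lists_len_def
 by (intro cmp_map cmp_concat cmp_Cons cmp_basic assms cmp_comp[OF assms(2)])

lemmas cmp_list = cmp_basic cmp_Cons cmp_tl cmp_hdd cmp_foldl cmp_foldr cmp_map cmp_append cmp_concat cmp_ball cmp_bex
 cmp_length cmp_upt cmp_ix cmp_lists_len cmp_rev

subsection \<open>Integers and rationals\<close>

lemma cmp_half_even: assumes "cmp f" shows "cmp (%x. f x div 2)" "cmp (%x. even (f x :: nat))"
proof -
 have c: "cmp (%x. rec_nat (0, True) (%_ r. if snd r then (fst r, False) else (Suc (fst r), True)) (f x))"
  by (intro cmp_basic assms)
 have r: "rec_nat (0, True) (%_ r. if snd r then (fst r, False) else (Suc (fst r), True)) n = (n div 2, even n)" for n
  by (induction n) auto
 show "cmp (%x. f x div 2)" using cmp_fst[OF c] by (simp only: r fst_conv)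
 show "cmp (%x. even (f x))" using cmp_snd[OF c] by (simp only: r snd_conv)
qed

lemma enc_int_nonneg: "enc (int n) = 2 * n"
 by (simp add: enc_int_def int_encode_def sum_encode_def)

lemma enc_int_neg: "enc (- int (Suc n)) = Suc (2 * n)"
 by (simp add: enc_int_def int_encode_def sum_encode_def)

lemma int_signs: obtains n where "i = int n" | n where "i = - int (Suc n)"
 by (cases i rule: int_cases) auto

lemma cmp_int: assumes "cmp f" shows "cmp (%x. int (f x))"
proof (rule cmp_raw)
 show "enc (int (f x)) = enc (2 * f x)" for x by (simp add: enc_int_nonneg enc_nat_def)
 show "cmp (%x. 2 * f x)" by (intro cmp_basic assms)
qed

lemma cmp_nat: assumes "cmp f" shows "cmp (%x. nat (f x))"
proof -
 have "cmp (%x. if even (enc (f x)) then enc (f x) div 2 else 0)"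
  by (intro cmp_If cmp_half_even cmp_basic assms)
 moreover have "(if even (enc i) then enc i div 2 else 0) = nat i" for i :: int
  by (cases i rule: int_signs) (auto simp only: enc_int_nonneg enc_int_neg; simp)+
 ultimately show ?thesis by simp
qed

lemma cmp_uminus: assumes "cmp f" shows "cmp (%x. - f x :: int)"
proof (rule cmp_raw)
 have "enc (- i) = (if even (enc i) then enc i - 1 else Suc (enc i))" for i :: int
 proof (cases i rule: int_signs)
  case (1 n)
  show ?thesis
  proof (cases n)
   case 0
   thus ?thesis using 1 enc_int_nonneg[of 0] by simp
  next
   case (Suc m)
   thus ?thesis unfolding 1 Suc enc_int_neg enc_int_nonneg by simp
  qed
 next
  case (2 n)
  hence "- i = int (Suc n)" by simp
  thus ?thesis by (simp only: 2 enc_int_nonneg enc_int_neg) simp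
 qed
 thus "enc (- f x) = enc (if even (enc (f x)) then enc (f x) - 1 else Suc (enc (f x)))" for x
  by (simp add: enc_nat_def)
 show "cmp (%x. if even (enc (f x)) then enc (f x) - 1 else Suc (enc (f x)))"
  by (intro cmp_If cmp_half_even cmp_basic assms)
qed

lemma cmp_int_diff:
 assumes "cmp f" "cmp g" shows "cmp (%x. int (f x) - int (g x))"
proof -
 have "cmp (%x. if g x <= f x then int (f x - g x) else - int (g x - f x))"
  by (intro cmp_int cmp_uminus cmp_basic assms)
 moreover have "(if g x <= f x then int (f x - g x) else - int (g x - f x)) = int (f x) - int (g x)" for x by auto
 ultimately show ?thesis by simp
qed

text \<open>Reduced to natural numbers by splitting into positive and negative parts, as for the
  product below.\<close>

lemma cmp_int_plus:
 assumes "cmp f" "cmp g" shows "cmp (%x. f x + g x :: int)"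
proof -
 have "cmp (%x. int (nat (f x) + nat (g x)) - int (nat (- f x) + nat (- g x)))"
  by (intro cmp_int_diff cmp_nat cmp_uminus cmp_basic assms)
 moreover have "int (nat i + nat j) - int (nat (- i) + nat (- j)) = i + j" for i j by simp
 ultimately show ?thesis by (simp only:)
qed

lemma cmp_int_minus: "cmp f ==> cmp g ==> cmp (%x. f x - g x :: int)"
 using cmp_int_plus[OF _ cmp_uminus] by fastforce

lemma cmp_int_times:
 assumes "cmp f" "cmp g" shows "cmp (%x. f x * g x :: int)"
proof -
 have "cmp (%x. int (nat (f x) * nat (g x) + nat (- f x) * nat (- g x)) -
  int (nat (f x) * nat (- g x) + nat (- f x) * nat (g x)))"
  by (intro cmp_int_diff cmp_nat cmp_uminus cmp_basic assms)
 moreover have "int (nat i * nat j + nat (- i) * nat (- j)) - int (nat i * nat (- j) + nat (- i) * nat j) = i * j" for i j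
  by (cases "i >= 0"; cases "j >= 0") auto
 ultimately show ?thesis by (simp only:)
qed

lemma cmp_int_le: assumes "cmp f" "cmp g" shows "cmp (%x. f x <= (g x :: int))"
proof -
 have "cmp (%x. nat (f x - g x) = 0)" by (intro cmp_nat cmp_int_minus cmp_basic assms)
 thus ?thesis by simp
qed

text \<open>Types over which unbounded search can run. Not every number is a code, for instance of a
  rational, so a computable surjection is required instead of an inverse of
  \<open>enc\<close>.\<close>

class enumb = coded +
 assumes ex_enum: "\<exists>d. surj d & (\<exists>p. \<forall>n. computes p [n] (enc (d n :: 'a)))"

lemma enum_cmp: "\<exists>d::nat => 'a::enumb. surj d & cmp d"
 using ex_enum[where 'a = 'a] by (simp add: cmp_def enc_nat_def)

lemma enumbI:
 fixes d :: "nat => 'a::coded"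
 shows "surj d ==> cmp d ==> \<exists>d. surj d & (\<exists>p. \<forall>n. computes p [n] (enc (d n :: 'a)))"
 by (intro exI[of _ d]) (simp add: cmp_def enc_nat_def)

instance nat :: enumb
 by standard (rule enumbI[OF _ cmp_id], simp)

instance int :: enumb
proof
 have "cmp int_decode" by (rule cmp_raw[OF _ cmp_id]) (simp add: enc_int_def enc_nat_def)
 thus "\<exists>d. surj d & (\<exists>p. \<forall>n. computes p [n] (enc (d n :: int)))" by (rule enumbI[OF surj_int_decode])
qed

lemma cmp_prod_decode: "cmp prod_decode"
 by (rule cmp_raw[OF _ cmp_id]) (simp add: enc_prod_def enc_nat_def)

lemma cmp_list_decode: "cmp list_decode"
proof (rule cmp_raw[OF _ cmp_id])
 have "(enc :: nat => nat) = id" by (simp add: enc_nat_def fun_eq_iff)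
 thus "enc (list_decode n) = enc n" for n by (simp add: enc_list_def)
qed

instance prod :: (enumb, enumb) enumb
proof
 obtain d :: "nat => 'a" where d: "surj d" "cmp d" using enum_cmp by blast
 obtain d' :: "nat => 'b" where d': "surj d'" "cmp d'" using enum_cmp by blast
 have "surj (%n. (d (fst (prod_decode n)), d' (snd (prod_decode n))))"
 proof (rule surjI)
  fix p show "(d (fst (prod_decode (prod_encode (inv_into UNIV d (fst p), inv_into UNIV d' (snd p))))),
   d' (snd (prod_decode (prod_encode (inv_into UNIV d (fst p), inv_into UNIV d' (snd p)))))) = p"
   by (simp add: surj_f_inv_f d d')
 qed
 thus "\<exists>d. surj d & (\<exists>p. \<forall>n. computes p [n] (enc (d n :: 'a \<times> 'b)))"
  by (rule enumbI) (intro cmp_Pair cmp_comp[OF d(2)] cmp_comp[OF d'(2)] cmp_fst cmp_snd cmp_prod_decode)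
qed

instance list :: (enumb) enumb
proof
 obtain d :: "nat => 'a" where d: "surj d" "cmp d" using enum_cmp by blast
 have "surj (%n. map d (list_decode n))"
 proof (rule surjI)
  fix xs show "map d (list_decode (list_encode (map (inv_into UNIV d) xs))) = xs"
   by (simp add: surj_f_inv_f d map_idI)
 qed
 thus "\<exists>d. surj d & (\<exists>p. \<forall>n. computes p [n] (enc (d n :: 'a list)))"
  by (rule enumbI) (intro cmp_map cmp_comp[OF d(2)] cmp_snd cmp_id cmp_list_decode)
qed

text \<open>Any solution of \<open>Q\<close> leads to the right value, so the first one found is as
  good as another.\<close>

lemma cmp_find:
 assumes "cmp (%p. Q (fst p) (snd p))" "cmp (%p. g (fst p) (snd p))"
  and "!!x. \<exists>y::'b::enumb. Q x y" "!!x y. Q x y ==> g x y = f x"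
 shows "cmp f"
proof -
 obtain d :: "nat => 'b" where d: "surj d" "cmp d" using enum_cmp by blast
 have ex: "\<exists>w. Q x (d w)" for x using assms(3)[of x] d(1) by (metis surjD)
 have "cmp (%p. Q (fst p) (d (snd p)))" "cmp (%x. g x (d (LEAST w. Q x (d w))))"
  by (intro cmp_comp[OF assms(1), of "%p. (fst p, d (snd p))", unfolded fst_conv snd_conv]
    cmp_comp[OF assms(2), of "%x. (x, d (LEAST w. Q x (d w)))", unfolded fst_conv snd_conv]
    cmp_comp[OF d(2)] cmp_Least cmp_Pair cmp_fst cmp_snd cmp_id ex)+
 moreover have "g x (d (LEAST w. Q x (d w))) = f x" for x by (rule assms(4)[OF LeastI_ex[OF ex]])
 ultimately show ?thesis by simp
qed

lemma enc_rat: "enc q = enc (quotient_of q)"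
 by (cases "quotient_of q") (simp add: enc_rat_def enc_prod_def rat_code_def enc_int_def)

lemma cmp_quotient_of: "cmp f ==> cmp (%x. quotient_of (f x))"
 by (erule cmp_raw[rotated]) (simp add: enc_rat)

lemma quotient_of_eqI:
 assumes "q > 0" "u * p + v * q = 1" "r = of_int p / of_int q"
 shows "quotient_of r = (p, q)"
proof -
 have "coprime p q"
  by (rule coprimeI) (metis assms(2) dvd_add dvd_mult)
 hence "Rat.normalize (p, q) = (p, q)" using assms(1) by (simp add: Rat.normalize_def Let_def)
 thus ?thesis using assms(3) quotient_of_Fract[of p q] by (simp add: Fract_of_int_quotient)
qed

text \<open>The reduced fraction is searched for instead of being computed with a gcd; Bezout
  coefficients witness that numerator and denominator are coprime. Division by zero has the value 0,
  which accounts for the case distinction in \<open>Q\<close>.\<close>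

lemma cmp_ratio:
 assumes "cmp f" "cmp g" shows "cmp (%x. of_int (f x) / of_int (g x) :: rat)"
proof -
 define Q where "Q s w \<longleftrightarrow> 1 <= snd (fst w) & fst (snd w) * fst (fst w) + snd (snd w) * snd (fst w) = (1::int) &
  (if snd s = 0 then fst (fst w) = 0 else fst (fst w) * snd s = fst s * snd (fst w))" for s :: "int \<times> int" and w
 have quot: "quotient_of (of_int (fst s) / of_int (snd s)) = fst w" if "Q s w" for s w
 proof -
  have "quotient_of (of_int (fst s) / of_int (snd s)) = (fst (fst w), snd (fst w))"
  proof (rule quotient_of_eqI[of _ "fst (snd w)" _ "snd (snd w)"])
   show "0 < snd (fst w)" "fst (snd w) * fst (fst w) + snd (snd w) * snd (fst w) = 1"
    using that by (auto simp: Q_def)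
   have nz: "snd (fst w) ~= 0" using that by (auto simp: Q_def)
   show "of_int (fst s) / of_int (snd s) = (of_int (fst (fst w)) / of_int (snd (fst w)) :: rat)"
   proof (cases "snd s = 0")
    case False
    hence "fst (fst w) * snd s = fst s * snd (fst w)" using that by (simp add: Q_def)
    hence "of_int (fst (fst w)) * of_int (snd s) = (of_int (fst s) * of_int (snd (fst w)) :: rat)"
     by (metis of_int_mult)
    thus ?thesis using False nz by (simp add: field_simps)
   qed (use that in \<open>simp add: Q_def\<close>)
  qed
  thus ?thesis by simp
 qed
 have ex: "\<exists>w. Q s w" for s
 proof -
  obtain p q where pq: "quotient_of (of_int (fst s) / of_int (snd s)) = (p, q)" by (cases "quotient_of (of_int (fst s) / of_int (snd s))")
  have q: "q > 0" "coprime p q" using quotient_of_denom_pos[OF pq] quotient_of_coprime[OF pq] by auto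
  obtain u v where uv: "u * p + v * q = gcd p q" using bezout_int by blast
  have eq: "of_int (fst s) / of_int (snd s) = (of_int p / of_int q :: rat)" by (rule quotient_of_div[OF pq])
  have "Q s ((p, q), (u, v))"
  proof (cases "snd s = 0")
   case True
   thus ?thesis using q uv eq by (simp add: Q_def)
  next
   case False
   hence "of_int (p * snd s) = (of_int (fst s * q) :: rat)"
    using eq q by (simp add: field_simps)
   hence "p * snd s = fst s * q" by (simp only: of_int_eq_iff)
   thus ?thesis using q uv False by (simp add: Q_def)
  qed
  thus ?thesis by blast
 qed
 have "cmp (%s::int \<times> int. quotient_of (of_int (fst s) / of_int (snd s)))"
 proof (rule cmp_find[of Q "%s w. fst w"])
  show "cmp (%p. Q (fst p) (snd p))" unfolding Q_def
   by (intro cmp_If cmp_int_le cmp_int_plus cmp_int_times cmp_conj cmp_eq cmp_fst cmp_snd cmp_id cmp_const)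
  show "cmp (%p. fst (snd p))" by (intro cmp_basic)
  show "\<exists>y. Q x y" for x by (rule ex)
  show "Q x y ==> fst y = quotient_of (of_int (fst x) / of_int (snd x))" for x y by (rule quot[symmetric])
 qed
 hence "cmp (%s::int \<times> int. of_int (fst s) / of_int (snd s) :: rat)"
  by (rule cmp_raw[rotated]) (simp add: enc_rat)
 from cmp_comp[OF this cmp_Pair[OF assms]] show ?thesis by simp
qed

lemma quotient_ratio: "of_int (fst (quotient_of q)) / of_int (snd (quotient_of q)) = q"
 using quotient_of_div[of q] by (cases "quotient_of q") auto

lemma snd_quotient_nz: "of_int (snd (quotient_of q)) ~= (0::rat)"
 using quotient_of_denom_pos'[of q] by simp

instance rat :: enumb
proof
 obtain d :: "nat => int \<times> int" where d: "surj d" "cmp d" using enum_cmp by blast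
 have "surj (%n. of_int (fst (d n)) / of_int (snd (d n)) :: rat)"
  by (rule surjI[of _ "%q. inv_into UNIV d (quotient_of q)"]) (simp add: surj_f_inv_f d quotient_ratio)
 thus "\<exists>d. surj d & (\<exists>p. \<forall>n. computes p [n] (enc (d n :: rat)))"
  by (rule enumbI) (intro cmp_ratio cmp_fst cmp_snd d)
qed

lemma cmp_rat_plus:
 assumes "cmp f" "cmp g" shows "cmp (%x. f x + g x :: rat)"
proof -
 let ?n = "%q. fst (quotient_of q)" and ?d = "%q. snd (quotient_of q)"
 have "cmp (%x. of_int (?n (f x) * ?d (g x) + ?n (g x) * ?d (f x)) / of_int (?d (f x) * ?d (g x)) :: rat)"
  by (intro cmp_ratio cmp_int_plus cmp_int_times cmp_fst cmp_snd cmp_quotient_of assms)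
 moreover have "of_int (?n a * ?d b + ?n b * ?d a) / of_int (?d a * ?d b) = a + b" for a b :: rat
 proof -
  have "a + b = of_int (?n a) / of_int (?d a) + of_int (?n b) / of_int (?d b)" by (simp only: quotient_ratio)
  thus ?thesis using snd_quotient_nz[of a] snd_quotient_nz[of b] by (simp add: field_simps)
 qed
 ultimately show ?thesis by (simp only:)
qed

lemma cmp_rat_times:
 assumes "cmp f" "cmp g" shows "cmp (%x. f x * g x :: rat)"
proof -
 let ?n = "%q. fst (quotient_of q)" and ?d = "%q. snd (quotient_of q)"
 have "cmp (%x. of_int (?n (f x) * ?n (g x)) / of_int (?d (f x) * ?d (g x)) :: rat)"
  by (intro cmp_ratio cmp_int_plus cmp_int_times cmp_fst cmp_snd cmp_quotient_of assms)
 moreover have "of_int (?n a * ?n b) / of_int (?d a * ?d b) = a * b" for a b :: rat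
  using quotient_ratio[of a] quotient_ratio[of b] by (metis of_int_mult times_divide_times_eq)
 ultimately show ?thesis by (simp only:)
qed

lemma cmp_of_int: assumes "cmp f" shows "cmp (%x. of_int (f x) :: rat)"
 using cmp_ratio[OF assms cmp_const[of 1]] by simp

lemma cmp_of_nat: assumes "cmp f" shows "cmp (%x. of_nat (f x) :: rat)"
 using cmp_of_int[OF cmp_int[OF assms]] by simp

lemma cmp_rat_minus: assumes "cmp f" "cmp g" shows "cmp (%x. f x - g x :: rat)"
proof -
 have "cmp (%x. f x + (- 1) * g x)" by (intro cmp_rat_plus cmp_rat_times assms cmp_const)
 thus ?thesis by simp
qed

lemma cmp_rat_le: assumes "cmp f" "cmp g" shows "cmp (%x. f x <= (g x :: rat))"
proof -
 have "0 <= q \<longleftrightarrow> 0 <= fst (quotient_of q)" for q :: rat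
  using quotient_ratio[of q] quotient_of_denom_pos'[of q]
  by (metis of_int_0_le_iff of_int_pos zero_le_divide_iff divide_nonneg_pos linorder_not_le divide_neg_pos of_int_0_less_iff of_int_less_0_iff)
 hence "f x <= g x \<longleftrightarrow> 0 <= fst (quotient_of (g x - f x))" for x by (metis diff_ge_0_iff_ge)
 moreover have "cmp (%x. 0 <= fst (quotient_of (g x - f x)))"
  by (intro cmp_int_le cmp_fst cmp_quotient_of cmp_rat_minus assms cmp_const)
 ultimately show ?thesis by simp
qed

lemma cmp_rat_abs: assumes "cmp f" shows "cmp (%x. \<bar>f x\<bar> :: rat)"
proof -
 have "cmp (%x. if 0 <= f x then f x else 0 - f x)"
  by (intro cmp_If cmp_rat_le cmp_rat_minus assms cmp_const)
 moreover have "(if 0 <= q then q else 0 - q) = \<bar>q\<bar>" for q :: rat by simp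
 ultimately show ?thesis by (simp only:)
qed

lemma cmp_rat_sum_list:
 assumes "cmp f" shows "cmp (%x. sum_list (f x) :: rat)"
 unfolding sum_list.eq_foldr o_def by (intro cmp_foldr cmp_rat_plus cmp_list assms)

lemma cmp_rat_prod_list:
 assumes "cmp f" shows "cmp (%x. prod_list (f x) :: rat)"
 unfolding prod_list.eq_foldr o_def by (intro cmp_foldr cmp_rat_times cmp_list assms)

lemma cmp_power:
 assumes "cmp f" "cmp n" shows "cmp (%x. f x ^ n x :: nat)"
proof -
 have "cmp (%x. rec_nat 1 (%_ r. f x * r) (n x))" by (intro cmp_list assms cmp_comp[OF assms(1)])
 moreover have "rec_nat 1 (%_ r. a * r) k = a ^ k" for a k :: nat by (induction k) auto
 ultimately show ?thesis by (simp only:)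
qed

lemma cmp_fact: assumes "cmp f" shows "cmp (%x. fact (f x) :: nat)"
proof -
 have "cmp (%x. rec_nat 1 (%k r. Suc k * r) (f x))" by (intro cmp_list assms)
 moreover have "rec_nat 1 (%k r. Suc k * r) n = fact n" for n by (induction n) auto
 ultimately show ?thesis by (simp only:)
qed

lemmas cmp_num = cmp_list cmp_int cmp_nat cmp_uminus cmp_int_plus cmp_int_minus cmp_int_times cmp_int_le
 cmp_rat_plus cmp_rat_times cmp_rat_minus cmp_rat_le cmp_rat_abs cmp_rat_sum_list cmp_rat_prod_list
 cmp_of_int cmp_of_nat cmp_power cmp_fact

subsection \<open>Recursively enumerable predicates\<close>

definition re :: "('a::coded => bool) => bool" where
 "re P \<longleftrightarrow> (\<exists>Q. cmp (%p. Q (fst p) (snd p)) & (\<forall>x. P x \<longleftrightarrow> (\<exists>w::nat. Q x w)))"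

lemma re_cmp: "cmp P ==> re (%x. P x)"
 unfolding re_def by (rule exI[of _ "%x w. P x"]) (auto intro: cmp_comp[OF _ cmp_fst[OF cmp_id]])

lemma re_ex:
 assumes "re (%p. P (fst p) (snd p))"
 shows "re (%x. \<exists>y::'b::enumb. P x y)"
proof -
 obtain Q where Q: "cmp (%p. Q (fst p) (snd p))" "\<forall>p. P (fst p) (snd p) \<longleftrightarrow> (\<exists>w::nat. Q p w)"
  using assms by (auto simp: re_def)
 obtain d :: "nat => 'b" where d: "surj d" "cmp d" using enum_cmp by blast
 let ?R = "%x w. Q (x, d (fst (prod_decode w))) (snd (prod_decode w))"
 have "cmp (%p. ?R (fst p) (snd p))"
  by (intro cmp_comp[OF Q(1), of "%p. ((fst p, d (fst (prod_decode (snd p)))), snd (prod_decode (snd p)))", unfolded fst_conv snd_conv]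
    cmp_basic cmp_comp[OF d(2)] cmp_comp[OF cmp_prod_decode])
 moreover have "(\<exists>y. P x y) \<longleftrightarrow> (\<exists>w. ?R x w)" for x
 proof
  assume "\<exists>y. P x y"
  then obtain y w where "Q (x, y) w" using Q(2) by fastforce
  thus "\<exists>w. ?R x w" using d(1)
   by (intro exI[of _ "prod_encode (inv_into UNIV d y, w)"]) (simp add: surj_f_inv_f)
 next
  assume "\<exists>w. ?R x w"
  thus "\<exists>y. P x y" using Q(2) by fastforce
 qed
 ultimately show ?thesis unfolding re_def by (intro exI[of _ ?R]) simp
qed

lemma re_conj: assumes "re P" "re Q" shows "re (%x. P x & Q x)"
proof -
 obtain P' where P: "cmp (%p. P' (fst p) (snd p))" "\<forall>x. P x \<longleftrightarrow> (\<exists>w::nat. P' x w)"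
  using assms by (auto simp: re_def)
 obtain Q' where Q: "cmp (%p. Q' (fst p) (snd p))" "\<forall>x. Q x \<longleftrightarrow> (\<exists>w::nat. Q' x w)"
  using assms by (auto simp: re_def)
 have "re (%x. \<exists>v. P' x (fst v) & Q' x (snd v))"
  by (intro re_ex re_cmp cmp_conj
    cmp_comp[OF P(1), of "%p. (fst p, fst (snd p))", unfolded fst_conv snd_conv]
    cmp_comp[OF Q(1), of "%p. (fst p, snd (snd p))", unfolded fst_conv snd_conv] cmp_basic)
 moreover have "P x & Q x \<longleftrightarrow> (\<exists>v. P' x (fst v) & Q' x (snd v))" for x using P Q by auto
 ultimately show ?thesis by simp
qed

lemma re_disj: assumes "re P" "re Q" shows "re (%x. P x | Q x)"
proof -
 obtain P' where P: "cmp (%p. P' (fst p) (snd p))" "\<forall>x. P x \<longleftrightarrow> (\<exists>w::nat. P' x w)"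
  using assms by (auto simp: re_def)
 obtain Q' where Q: "cmp (%p. Q' (fst p) (snd p))" "\<forall>x. Q x \<longleftrightarrow> (\<exists>w::nat. Q' x w)"
  using assms by (auto simp: re_def)
 show ?thesis unfolding re_def using P(2) Q(2) cmp_disj[OF P(1) Q(1)]
  by (intro exI[of _ "%x w. P' x w | Q' x w"]) auto
qed

text \<open>The witnesses for finitely many elements have a common bound, so the quantifier moves
  inside the search.\<close>

lemma re_ball:
 assumes "re (%p. P (fst p) (snd p))" "cmp xs"
 shows "re (%x. \<forall>y\<in>set (xs x). P x y)"
proof -
 obtain Q where Q: "cmp (%p. Q (fst p) (snd p))" "\<forall>p. P (fst p) (snd p) \<longleftrightarrow> (\<exists>w::nat. Q p w)"
  using assms by (auto simp: re_def)
 have "cmp (%p. \<forall>y\<in>set (xs (fst p)). \<exists>w\<in>set [0..<snd p]. Q (fst p, y) w)"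
  by (intro cmp_ball cmp_bex cmp_comp[OF assms(2)] cmp_list
    cmp_comp[OF Q(1), of "%p. ((fst (fst (fst p)), snd (fst p)), snd p)", unfolded fst_conv snd_conv])
 moreover have "(\<forall>y\<in>set l. P x y) \<longleftrightarrow> (\<exists>W. \<forall>y\<in>set l. \<exists>w\<in>set [0..<W]. Q (x, y) w)" for x l
 proof
  assume "\<forall>y\<in>set l. P x y"
  hence "\<forall>y\<in>set l. \<exists>w. Q (x, y) w" using Q(2) by fastforce
  then obtain w where w: "!!y. y \<in> set l ==> Q (x, y) (w y)" by metis
  have "w y < Suc (Max (w ` set l))" if "y \<in> set l" for y using that by (simp add: le_imp_less_Suc)
  thus "\<exists>W. \<forall>y\<in>set l. \<exists>w\<in>set [0..<W]. Q (x, y) w"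
   using w by (intro exI[of _ "Suc (Max (w ` set l))"] ballI) (auto intro!: bexI[of _ "w _"] simp del: upt_Suc)
 next
  assume "\<exists>W. \<forall>y\<in>set l. \<exists>w\<in>set [0..<W]. Q (x, y) w"
  thus "\<forall>y\<in>set l. P x y" using Q(2) by fastforce
 qed
 ultimately show ?thesis
  unfolding re_def by (intro exI[of _ "%x W. \<forall>y\<in>set (xs x). \<exists>w\<in>set [0..<W]. Q (x, y) w"]) auto
qed

lemma re_bex:
 assumes "re (%p. P (fst p) (snd p))" "cmp xs"
 shows "re (%x. \<exists>y\<in>set (xs x). P x y)"
proof -
 obtain Q where Q: "cmp (%p. Q (fst p) (snd p))" "\<forall>p. P (fst p) (snd p) \<longleftrightarrow> (\<exists>w::nat. Q p w)"
  using assms by (auto simp: re_def)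
 have "cmp (%p. \<exists>y\<in>set (xs (fst p)). Q (fst p, y) (snd p))"
  by (intro cmp_bex cmp_comp[OF assms(2)] cmp_list
    cmp_comp[OF Q(1), of "%p. ((fst (fst p), snd p), snd (fst p))", unfolded fst_conv snd_conv])
 moreover have "P x y \<longleftrightarrow> (\<exists>w. Q (x, y) w)" for x y using Q(2) by fastforce
 hence "(\<exists>y\<in>set l. P x y) \<longleftrightarrow> (\<exists>w. \<exists>y\<in>set l. Q (x, y) w)" for x l by blast
 ultimately show ?thesis
  unfolding re_def by (intro exI[of _ "%x w. \<exists>y\<in>set (xs x). Q (x, y) w"]) auto
qed

lemmas re_intros = re_ex re_conj re_disj re_ball re_bex

text \<open>Running both semi-decision procedures in parallel decides between two enumerable predicates of
 which exactly one holds.\<close>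

theorem re_decide:
 assumes "re P1" "re P0"
 shows "\<exists>p. \<forall>x. (P1 x & ~ P0 x --> computes p [enc x] 1) & (P0 x & ~ P1 x --> computes p [enc x] 0)"
proof -
 obtain Q1 where Q1: "cmp (%p. Q1 (fst p) (snd p))" "\<forall>x. P1 x \<longleftrightarrow> (\<exists>w::nat. Q1 x w)"
  using assms by (auto simp: re_def)
 obtain Q0 where Q0: "cmp (%p. Q0 (fst p) (snd p))" "\<forall>x. P0 x \<longleftrightarrow> (\<exists>w::nat. Q0 x w)"
  using assms by (auto simp: re_def)
 obtain q where q: "!!x w. computes q [enc (x, w)] (enc (Q1 x w | Q0 x w))"
  using cmp_disj[OF Q1(1) Q0(1)] by (auto simp: cmp_def)
 have "cmp (%p. if Q1 (fst p) (snd p) then 1 else 0 :: nat)" by (intro cmp_If Q1 cmp_const)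
 then obtain r where r: "!!x w. computes r [enc (x, w)] (if Q1 x w then 1 else 0)"
  by (auto simp: cmp_def enc_nat_def)
 let ?f = "Comp q [Comp pairP [Proj 1, Proj 0]]"
 have f: "computes ?f [w, enc x] (enc (Q1 x w | Q0 x w))" for x w
  using q[of x w] by (auto intro!: computes_comp1 computes_comp2 computes_pairP computes_proj
    simp: enc_prod_def enc_nat_def)
 define p where "p = Comp r [Comp pairP [Proj 0, Mu ?f]]"
 have p: "computes p [enc x] (if P1 x then 1 else 0)" if x: "P1 x | P0 x" "~ (P1 x & P0 x)" for x
 proof -
  let ?P = "%w. Q1 x w | Q0 x w"
  have ex: "\<exists>w. ?P w" using x Q1(2) Q0(2) by auto
  define w where "w = (LEAST w. ?P w)"
  have w: "?P w" unfolding w_def using ex by (rule LeastI_ex)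
  have "computes (Mu ?f) [enc x] w"
  proof (rule computes.mu)
   show "computes ?f [w, enc x] 0" using f[of w x] w by (simp add: enc_bool_def)
   show "\<forall>i<w. \<exists>y>0. computes ?f [i, enc x] y"
   proof (intro allI impI)
    fix i assume "i < w"
    hence "~ ?P i" unfolding w_def by (rule not_less_Least)
    thus "\<exists>y>0. computes ?f [i, enc x] y" using f[of i x] by (intro exI[of _ 1]) (simp add: enc_bool_def)
   qed
  qed
  hence "computes p [enc x] (if Q1 x w then 1 else 0)"
   unfolding p_def using r[of x w]
   by (auto intro!: computes_comp1 computes_comp2 computes_pairP computes_proj simp: enc_prod_def enc_nat_def)
  moreover have "Q1 x w \<longleftrightarrow> P1 x" using w x Q1(2) Q0(2) by auto
  ultimately show ?thesis by simp
 qed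
 show ?thesis
 proof (intro exI[of _ p] allI conjI impI)
  fix x
  show "computes p [enc x] 1" if "P1 x & ~ P0 x" using p[of x] that by simp
  show "computes p [enc x] 0" if "P0 x & ~ P1 x" using p[of x] that by simp
 qed
qed

section \<open>Enumerability of the certificates\<close>

lemma cmp_sum:
 fixes n :: "_ => nat"
 assumes "cmp (%p. f (fst p) (snd p))" "cmp n"
 shows "cmp (%x. \<Sum>k<n x. f x k :: rat)"
proof -
 have "cmp (%x. sum_list (map (%k. f x k) [0..<n x]))" by (intro cmp_num assms)
 thus ?thesis by (simp add: interv_sum_list_conv_sum_set_nat atLeast0LessThan)
qed

lemma cmp_all_less:
 fixes n :: "_ => nat"
 assumes "cmp (%p. P (fst p) (snd p))" "cmp n"
 shows "cmp (%x. \<forall>k<n x. P x k)"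
proof -
 have "cmp (%x. \<forall>k\<in>set [0..<n x]. P x k)" by (intro cmp_num assms)
 thus ?thesis by (simp add: Ball_def)
qed

lemma re_all_less:
 fixes n :: "_ => nat"
 assumes "re (%p. P (fst p) (snd p))" "cmp n"
 shows "re (%x. \<forall>k<n x. P x k)"
proof -
 have "re (%x. \<forall>k\<in>set [0..<n x]. P x k)" by (intro re_ball cmp_num assms)
 thus ?thesis by (simp add: Ball_def)
qed

lemma cmp_zip:
 assumes "cmp xs" "cmp ys" shows "cmp (%x. zip (xs x) (ys x))"
proof -
 have "cmp (%x. map (%i. (ix undefined (xs x) i, ix undefined (ys x) i))
  [0..<if length (xs x) <= length (ys x) then length (xs x) else length (ys x)])"
  by (intro cmp_num assms[THEN cmp_comp])
 moreover have "map (%i. (ix undefined us i, ix undefined vs i)) [0..<if length us <= length vs then length us else length vs]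
  = zip us vs" for us :: "'b list" and vs :: "'c list"
  by (rule nth_equalityI) (auto simp: ix_def split: if_splits)
 ultimately show ?thesis by simp
qed

lemmas cmp_all = cmp_num cmp_sum cmp_all_less cmp_zip
lemmas re_all = re_intros re_all_less

section \<open>Coding of matrices and units by rational data\<close>

type_synonym rmat = "rat list list"
type_synonym upair = "rmat \<times> rmat"

definition ef :: "rmat => nat => nat => rat" where "ef A i j = ix 0 (ix [] A i) j"
definition mk :: "nat => (nat => nat => rat) => rmat" where
 "mk N f = map (%i. map (%j. f i j) [0..<N]) [0..<N]"
definition Z :: "nat => rmat => fmat" where
 "Z N A = Fmat (%i j. if i < N & j < N then ef A i j else 0)"

lemma ef_mk: "i < N ==> j < N ==> ef (mk N f) i j = f i j"
 by (simp add: ef_def mk_def ix_def)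

lemma ent_Z: "ent (Z N A) i j = (if i < N & j < N then ef A i j else 0)"
 unfolding Z_def by (subst ent_Fmat) (auto intro: finite_subset[of _ "{..<N}"])

lemma MN_iff: "X \<in> MN N \<longleftrightarrow> (\<forall>i j. ~ (i < N & j < N) --> ent X i j = 0)"
 unfolding MN_def by blast

lemma Z_in: "Z N A \<in> MN N"
 by (simp add: MN_iff ent_Z)

lemma Z_eqI: "X \<in> MN N ==> (!!i j. i < N ==> j < N ==> ef A i j = ent X i j) ==> Z N A = X"
 by (rule fmat_eqI) (auto simp: ent_Z MN_iff)

lemma Z_surj: "X \<in> MN N ==> \<exists>A. Z N A = X"
 by (rule exI[of _ "mk N (ent X)"], rule Z_eqI) (auto simp: ef_mk)

lemma Z_list_surj: "set Xs \<subseteq> MN N ==> \<exists>As. map (Z N) As = Xs"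
proof (induction Xs)
 case (Cons X Xs)
 then obtain A As where "Z N A = X" "map (Z N) As = Xs" using Z_surj[of X N] by auto
 hence "map (Z N) (A # As) = X # Xs" by simp
 thus ?case by (rule exI)
qed simp

definition rep :: "nat => upair => fmat un => bool" where
 "rep N p x \<longleftrightarrow> x \<in> GLN N & (\<forall>i<N. \<forall>j<N. ent (val x) i j = ef (fst p) i j & ent (val (iv x)) i j = ef (snd p) i j)"

text \<open>A pair that does not consist of mutually inverse matrices decodes to 1. Decoding is thus
  total, and searches can range over all pairs.\<close>

definition un :: "nat => upair => fmat un" where
 "un N p = (if \<exists>x. rep N p x then SOME x. rep N p x else 1)"

lemma ent_GLN: "x \<in> GLN N ==> ~ (i < N & j < N) ==> ent (val x) i j = (if i = j then 1 else 0)"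
 by (auto simp: GLN_def MN_iff ent_simps)

lemma GLN_eqI:
 assumes "x \<in> GLN N" "y \<in> GLN N" "!!i j. i < N ==> j < N ==> ent (val x) i j = ent (val y) i j"
 shows "x = y"
 by (rule val_inj, rule fmat_eqI) (metis assms ent_GLN)

lemma rep_unique: "rep N p x ==> rep N p y ==> x = y"
 by (rule GLN_eqI[of _ N]) (auto simp: rep_def)

lemma un_eqI: "rep N p x ==> un N p = x"
 unfolding un_def using rep_unique by (metis someI)

lemma un_in: "un N p \<in> GLN N"
proof (cases "\<exists>x. rep N p x")
 case True
 then obtain x where x: "rep N p x" by blast
 thus ?thesis using un_eqI[OF x] by (simp add: rep_def)
next
 case False
 thus ?thesis using sg_one[OF sg_GLN] by (simp add: un_def)
qed

definition ok :: "nat => upair => bool" where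
 "ok N p \<longleftrightarrow> (\<forall>i<N. \<forall>j<N. (\<Sum>k<N. ef (fst p) i k * ef (snd p) k j) = (if i = j then 1 else 0) &
  (\<Sum>k<N. ef (snd p) i k * ef (fst p) k j) = (if i = j then 1 else 0))"

text \<open>Outside the block, and for a malformed pair, the entries are those of the identity; so
  \<open>E\<close> agrees with \<open>un\<close> at all indices (\<open>ent_un\<close>).\<close>

definition E :: "nat => upair => nat => nat => rat" where
 "E N p i j = (if i < N & j < N & ok N p then ef (fst p) i j else if i = j then 1 else 0)"

definition swap :: "upair => upair" where "swap p = (snd p, fst p)"

lemma ent_times_GLN': "x \<in> GLN N ==> i < N ==> ent (val x * B) i j = (\<Sum>k<N. ent (val x) i k * ent B k j)"
 by (rule ent_times_rb[OF rb_GLN])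

lemma ok_iff: "ok N p \<longleftrightarrow> (\<exists>x. rep N p x)"
proof
 assume ok: "ok N p"
 define e where "e A = Fmat (%i j. if i < N & j < N then ef A i j else if i = j then 1 else 0)" for A
 have ent_e: "ent (e A) i j = (if i < N & j < N then ef A i j else if i = j then 1 else 0)" for A i j
  unfolding e_def by (subst ent_Fmat) (auto intro: finite_subset[of _ "insert _ {..<N}"])
 have rbe: "e A \<in> rb N" for A by (auto simp: rb_def ent_e)
 have out: "ent (e A * e B) i j = (if i = j then 1 else 0)" if "i >= N" for A B i j
 proof -
  have "ent (e A * e B) i j = (\<Sum>k\<in>{i}. ent (e A) i k * ent (e B) k j)"
   by (rule ent_times) (use that in \<open>auto simp: ent_e split: if_splits\<close>)
  thus ?thesis using that by (simp add: ent_e)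
 qed
 have mult: "e (fst q) * e (snd q) = 1" if "ok N q" for q
 proof (rule fmat_eqI)
  fix i j
  show "ent (e (fst q) * e (snd q)) i j = ent 1 i j"
  proof (cases "i < N")
   case True
   show ?thesis unfolding ent_times_rb[OF rbe True] ent_e ent_simps
    using that True by (cases "j < N") (auto simp: ok_def intro!: sum.neutral)
  qed (simp add: out ent_simps)
 qed
 have "ok N (swap p)" using ok by (auto simp: ok_def swap_def)
 then obtain x where x: "val x = e (fst p)" "val (iv x) = e (snd p)"
  using mult[OF ok] mult[of "swap p"] ex_un[of "e (fst p)" "e (snd p)"] by (auto simp: swap_def)
 have "rep N p x" unfolding rep_def GLN_def x MN_iff by (auto simp: ent_e x ent_simps)
 thus "\<exists>x. rep N p x" by blast
next
 assume "\<exists>x. rep N p x"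
 then obtain x where x: "rep N p x" by blast
 have xG: "x \<in> GLN N" "iv x \<in> GLN N" using x sg_iv[OF sg_GLN] by (auto simp: rep_def)
 show "ok N p" unfolding ok_def
 proof (intro allI impI conjI)
  fix i j assume ij: "i < N" "j < N"
  have "(\<Sum>k<N. ef (fst p) i k * ef (snd p) k j) = ent (val x * val (iv x)) i j"
   unfolding ent_times_GLN'[OF xG(1) ij(1)] using x ij by (intro sum.cong refl) (auto simp: rep_def)
  thus "(\<Sum>k<N. ef (fst p) i k * ef (snd p) k j) = (if i = j then 1 else 0)" by (simp add: ent_simps)
  have "(\<Sum>k<N. ef (snd p) i k * ef (fst p) k j) = ent (val (iv x) * val x) i j"
   unfolding ent_times_GLN'[OF xG(2) ij(1)] using x ij by (intro sum.cong refl) (auto simp: rep_def)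
  thus "(\<Sum>k<N. ef (snd p) i k * ef (fst p) k j) = (if i = j then 1 else 0)" by (simp add: ent_simps)
 qed
qed

lemma ent_un: "ent (val (un N p)) i j = E N p i j"
proof (cases "ok N p")
 case True
 then obtain x where x: "rep N p x" by (auto simp: ok_iff)
 have xG: "x \<in> GLN N" using x by (simp add: rep_def)
 show ?thesis using x True ent_GLN[OF xG, of i j] by (auto simp: un_eqI[OF x] E_def rep_def)
next
 case False
 hence "un N p = 1" by (simp add: ok_iff un_def)
 thus ?thesis using False by (simp add: E_def ent_simps)
qed

lemma rep_swap: "rep N (swap p) y \<longleftrightarrow> rep N p (iv y)"
 using sg_iv_iff[OF sg_GLN, of y N] by (auto simp: rep_def swap_def)

lemma un_swap: "un N (swap p) = iv (un N p)"
proof (cases "ok N p")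
 case True
 then obtain x where x: "rep N p x" by (auto simp: ok_iff)
 hence "rep N (swap p) (iv x)" by (simp add: rep_swap)
 from un_eqI[OF this] un_eqI[OF x] show ?thesis by simp
next
 case False
 hence "\<nexists>x. rep N p x" "\<nexists>x. rep N (swap p) x" by (auto simp: ok_iff rep_swap)
 thus ?thesis by (simp add: un_def)
qed

lemma ent_iv_un: "ent (val (iv (un N p))) i j = E N (swap p) i j"
 by (simp add: ent_un flip: un_swap)

lemma un_surj: "x \<in> GLN N ==> \<exists>p. un N p = x"
 by (rule exI[of _ "(mk N (ent (val x)), mk N (ent (val (iv x))))"], rule un_eqI) (auto simp: rep_def ef_mk)

lemma un_list_surj: "set xs \<subseteq> GLN N ==> \<exists>ps. map (un N) ps = xs"
proof (induction xs)
 case (Cons x xs)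
 then obtain p ps where "un N p = x" "map (un N) ps = xs" using un_surj[of x N] by auto
 hence "map (un N) (p # ps) = x # xs" by simp
 thus ?case by (rule exI)
qed simp

lemma ent_times_un: "i < N ==> ent (val (un N p) * B) i j = (\<Sum>k<N. E N p i k * ent B k j)"
 by (simp add: ent_times_GLN'[OF un_in] ent_un)

lemma ent_times_iv_un: "i < N ==> ent (val (iv (un N p)) * B) i j = (\<Sum>k<N. E N (swap p) i k * ent B k j)"
 by (simp add: ent_times_un flip: un_swap)

definition onep :: "nat => upair" where
 "onep N = (mk N (%i j. if i = j then 1 else 0), mk N (%i j. if i = j then 1 else 0))"

lemma un_onep [simp]: "un N (onep N) = 1"
 by (rule un_eqI) (auto simp: rep_def onep_def ef_mk ent_simps sg_one[OF sg_GLN])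

definition mulp :: "nat => upair => upair => upair" where
 "mulp N p q = (mk N (%i j. \<Sum>k<N. E N p i k * E N q k j), mk N (%i j. \<Sum>k<N. E N (swap q) i k * E N (swap p) k j))"

lemma un_mulp [simp]: "un N (mulp N p q) = un N p * un N q"
proof (rule un_eqI)
 have "un N p * un N q \<in> GLN N" by (intro sg_mult[OF sg_GLN] un_in)
 moreover have "iv (un N q) \<in> GLN N" by (intro sg_iv[OF sg_GLN] un_in)
 ultimately show "rep N (mulp N p q) (un N p * un N q)"
  by (simp add: rep_def mulp_def ef_mk ent_times_un ent_times_iv_un ent_un ent_iv_un)
qed

lemma un_eq_iff: "un N p = un N q \<longleftrightarrow> (\<forall>i<N. \<forall>j<N. E N p i j = E N q i j)"
 unfolding ent_un[symmetric] using GLN_eqI[OF un_in un_in, of N p q] by auto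

lemma cmp_ef: "cmp A ==> cmp i ==> cmp j ==> cmp (%x. ef (A x) (i x) (j x))"
 unfolding ef_def by (intro cmp_all)

lemma cmp_mk:
 assumes "cmp (%p. f (fst (fst p)) (snd (fst p)) (snd p))" "cmp n"
 shows "cmp (%x. mk (n x) (%i j. f x i j))"
 unfolding mk_def
 by (intro cmp_all assms assms(2)[THEN cmp_comp])

lemma cmp_E:
 assumes "cmp n" "cmp p" "cmp i" "cmp j" shows "cmp (%x. E (n x) (p x) (i x) (j x))"
 unfolding E_def ok_def by (intro cmp_all cmp_ef assms[THEN cmp_comp])

lemma cmp_swap: "cmp p ==> cmp (%x. swap (p x))"
 unfolding swap_def by (intro cmp_all)

lemma cmp_onep: assumes "cmp n" shows "cmp (%x. onep (n x))"
 unfolding onep_def by (intro cmp_all cmp_mk assms)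

lemma cmp_mulp:
 assumes "cmp n" "cmp p" "cmp q" shows "cmp (%x. mulp (n x) (p x) (q x))"
 unfolding mulp_def by (intro cmp_all cmp_mk cmp_E cmp_swap assms[THEN cmp_comp])

lemma cmp_un_eq:
 assumes "cmp n" "cmp p" "cmp q" shows "cmp (%x. un (n x) (p x) = un (n x) (q x))"
 unfolding un_eq_iff by (intro cmp_all cmp_E assms[THEN cmp_comp])

lemmas cmp_mat = cmp_all cmp_ef cmp_mk cmp_E cmp_swap cmp_onep cmp_mulp cmp_un_eq

definition word :: "nat => upair list => upair" where
 "word N ws = foldl (%p q. mulp N p q) (onep N) ws"

definition sy :: "upair list => upair list" where "sy ps = ps @ map swap ps"

lemma un_sy: "un N ` set (sy ps) = symm (un N ` set ps)"
 by (simp add: sy_def symm_def un_swap image_image image_Un)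

text \<open>Membership in a finitely generated group as existence of a word, which makes it
  enumerable.\<close>

lemma gen_words: "x \<in> gen (un N ` set ps) \<longleftrightarrow> (\<exists>ws. (\<forall>w\<in>set ws. w \<in> set (sy ps)) & un N (word N ws) = x)"
proof
 assume "x \<in> gen (un N ` set ps)"
 thus "\<exists>ws. (\<forall>w\<in>set ws. w \<in> set (sy ps)) & un N (word N ws) = x"
 proof induction
  case one
  show ?case by (rule exI[of _ "[]"]) (simp add: word_def)
 next
  case (mult x s)
  then obtain ws p where "\<forall>w\<in>set ws. w \<in> set (sy ps)" "un N (word N ws) = x" "p \<in> set ps" "s = un N p" by auto
  thus ?case by (intro exI[of _ "ws @ [p]"]) (auto simp: word_def sy_def)
 next
  case (mult_iv x s)
  then obtain ws p where "\<forall>w\<in>set ws. w \<in> set (sy ps)" "un N (word N ws) = x" "p \<in> set ps" "s = un N p" by auto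
  thus ?case by (intro exI[of _ "ws @ [swap p]"]) (auto simp: word_def sy_def un_swap)
 qed
next
 have "(\<forall>w\<in>set ws. w \<in> set (sy ps)) ==> un N (word N ws) \<in> gen (un N ` set ps)" for ws
 proof (induction ws rule: rev_induct)
  case Nil
  show ?case by (simp add: word_def gen.one)
 next
  case (snoc w ws)
  have "un N w \<in> gen (un N ` set ps)" using snoc.prems by (auto simp: sy_def un_swap gen_incl gen_incl_iv)
  thus ?case using snoc by (auto simp: word_def intro: sg_mult[OF sg_gen])
 qed
 thus "\<exists>ws. (\<forall>w\<in>set ws. w \<in> set (sy ps)) & un N (word N ws) = x ==> x \<in> gen (un N ` set ps)" by blast
qed

lemma cmp_sy: "cmp p ==> cmp (%x. sy (p x))"
 unfolding sy_def by (intro cmp_mat)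

lemma cmp_word: assumes "cmp n" "cmp ws" shows "cmp (%x. word (n x) (ws x))"
 unfolding word_def by (intro cmp_mat assms[THEN cmp_comp])

lemma cmp_mem: assumes "cmp p" "cmp ps" shows "cmp (%x. p x \<in> set (ps x))"
proof -
 have "cmp (%x. \<exists>y\<in>set (ps x). p x = y)" by (intro cmp_mat assms[THEN cmp_comp])
 thus ?thesis by simp
qed

lemma re_gen:
 assumes "cmp n" "cmp p" "cmp ps" shows "re (%x. un (n x) (p x) \<in> gen (un (n x) ` set (ps x)))"
 unfolding gen_words
 by (intro re_all; intro re_cmp cmp_mat cmp_mem cmp_word cmp_sy assms[THEN cmp_comp])

text \<open>Finitely many memberships certify finite index: a list that contains 1 and is closed, up
  to a left factor in the subgroup, under the generators and their inverses represents all
  cosets.\<close>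

definition cosets :: "nat => upair list => upair list => bool" where
 "cosets N ps qs \<longleftrightarrow> (\<exists>rs. (\<exists>r\<in>set rs. un N r = un N (onep N)) &
  (\<forall>r\<in>set rs. \<forall>s\<in>set (sy ps). \<exists>t\<in>set rs. un N (mulp N (mulp N r s) (swap t)) \<in> gen (un N ` set qs)))"

lemma re_cosets:
 assumes "cmp n" "cmp ps" "cmp qs" shows "re (%x. cosets (n x) (ps x) (qs x))"
 unfolding cosets_def
 by (intro re_all re_gen; intro re_cmp cmp_mat cmp_sy assms[THEN cmp_comp])

lemma cosets_iff:
 assumes H: "gen (un N ` set qs) \<subseteq> gen (un N ` set ps)"
 shows "cosets N ps qs \<longleftrightarrow> fidx (gen (un N ` set ps)) (gen (un N ` set qs))"
proof
 let ?G = "gen (un N ` set ps)" and ?H = "gen (un N ` set qs)"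
 assume "cosets N ps qs"
 then obtain rs where rs: "\<exists>r\<in>set rs. un N r = 1"
  "!!r s. r \<in> set rs ==> s \<in> set (sy ps) ==> \<exists>t\<in>set rs. un N r * un N s * iv (un N t) \<in> ?H"
  by (auto simp: cosets_def un_swap)
 have step: "\<exists>r\<in>set rs. x * un N s * iv (un N r) \<in> ?H"
  if xs: "\<exists>r\<in>set rs. x * iv (un N r) \<in> ?H" "s \<in> set (sy ps)" for x s
 proof -
  obtain r where r: "r \<in> set rs" "x * iv (un N r) \<in> ?H" using xs by blast
  obtain t where t: "t \<in> set rs" "un N r * un N s * iv (un N t) \<in> ?H" using rs(2) r(1) xs(2) by blast
  have "(x * iv (un N r)) * (un N r * un N s * iv (un N t)) \<in> ?H" by (rule sg_mult[OF sg_gen r(2) t(2)])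
  thus ?thesis using t(1) by (auto simp: mult.assoc)
 qed
 have "\<exists>r\<in>set rs. x * iv (un N r) \<in> ?H" if "x \<in> ?G" for x
  using that
 proof induction
  case one
  obtain r where "r \<in> set rs" "un N r = 1" using rs(1) by blast
  thus ?case by (intro bexI[of _ r]) (simp_all add: gen.one)
 next
  case (mult x s)
  then obtain p where "p \<in> set (sy ps)" "s = un N p" by (auto simp: sy_def)
  thus ?case using step mult by blast
 next
  case (mult_iv x s)
  then obtain p where "swap p \<in> set (sy ps)" "iv s = un N (swap p)" by (auto simp: sy_def un_swap)
  thus ?case using step mult_iv by metis
 qed
 thus "fidx ?G ?H" by (intro fidxI[of "un N ` set rs"]) auto
next
 let ?G = "gen (un N ` set ps)" and ?H = "gen (un N ` set qs)"
 assume "fidx ?G ?H"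
 from fidx_Int[OF sg_gen sg_gen this subset_refl] H
 obtain R where R: "finite R" "R \<subseteq> ?G" "\<forall>g\<in>?G. \<exists>r\<in>R. g * iv r \<in> ?H" by (auto simp: Int_absorb1)
 obtain xs where xs: "set xs = insert 1 R" using finite_list[of "insert 1 R"] R(1) by auto
 have G: "?G \<subseteq> GLN N" by (rule gen_least[OF sg_GLN]) (use un_in in auto)
 hence xsG: "set xs \<subseteq> ?G" using xs R(2) gen.one by auto
 obtain rs where rs: "map (un N) rs = xs" using un_list_surj[of xs N] xsG G by auto
 have "set xs = un N ` set rs" using rs by (metis set_map)
 have "cosets N ps qs" unfolding cosets_def
 proof (intro exI[of _ rs] conjI ballI)
  have "1 \<in> un N ` set rs" using xs \<open>set xs = un N ` set rs\<close> by auto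
  thus "\<exists>r\<in>set rs. un N r = un N (onep N)" by force
  fix r s assume r: "r \<in> set rs" and s: "s \<in> set (sy ps)"
  have "un N r \<in> ?G" using r xsG \<open>set xs = un N ` set rs\<close> by auto
  moreover have "un N s \<in> ?G" using s by (auto simp: sy_def un_swap gen_incl gen_incl_iv)
  ultimately have "un N r * un N s \<in> ?G" by (rule sg_mult[OF sg_gen])
  then obtain t where t: "t \<in> R" "un N r * un N s * iv t \<in> ?H" using R(3) by blast
  hence "t \<in> un N ` set rs" using xs \<open>set xs = un N ` set rs\<close> by auto
  thus "\<exists>t\<in>set rs. un N (mulp N (mulp N r s) (swap t)) \<in> ?H" using t(2) by (auto simp: un_swap)
 qed
 thus "cosets N ps qs" .
qed

definition spn :: "nat => rmat list => rmat => bool" where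
 "spn N Js A \<longleftrightarrow> (\<exists>c. \<forall>i<N. \<forall>j<N. ef A i j = (\<Sum>k<length Js. ix 0 c k * ef (ix [] Js k) i j))"

lemma spn_iff: "spn N Js A \<longleftrightarrow> Z N A \<in> fm.span (Z N ` set Js)"
proof
 assume "spn N Js A"
 then obtain c where c: "!!i j. i < N ==> j < N ==> ef A i j = (\<Sum>k<length Js. ix 0 c k * ef (ix [] Js k) i j)"
  by (auto simp: spn_def)
 have "Z N A = (\<Sum>k<length Js. sm (ix 0 c k) (Z N (Js ! k)))"
  by (rule fmat_eqI) (auto simp: ent_sum sm.rep_eq ent_Z c ix_def intro!: sum.cong)
 also have "\<dots> \<in> fm.span (Z N ` set Js)"
  by (intro fm.span_sum fm.span_scale fm.span_base) auto
 finally show "Z N A \<in> fm.span (Z N ` set Js)" .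
next
 assume "Z N A \<in> fm.span (Z N ` set Js)"
 from fm.span_image_list[OF this] obtain c where
  c: "length c = length Js" "Z N A = (\<Sum>k<length Js. sm (c ! k) (Z N (Js ! k)))" by auto
 have "ef A i j = (\<Sum>k<length Js. ix 0 c k * ef (ix [] Js k) i j)" if "i < N" "j < N" for i j
 proof -
  have "ef A i j = ent (Z N A) i j" using that by (simp add: ent_Z)
  also have "\<dots> = (\<Sum>k<length Js. ix 0 c k * ef (ix [] Js k) i j)"
   unfolding c(2) using that c(1) by (auto simp: ent_sum sm.rep_eq ent_Z ix_def intro!: sum.cong)
  finally show ?thesis .
 qed
 thus "spn N Js A" unfolding spn_def by blast
qed

lemma re_spn:
 assumes "cmp n" "cmp js" "cmp a" shows "re (%x. spn (n x) (js x) (a x))"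
 unfolding spn_def by (intro re_ex re_cmp cmp_mat assms[THEN cmp_comp])

definition mulZ :: "nat => rmat => rmat => rmat" where
 "mulZ N A B = mk N (%i j. \<Sum>k<N. ef A i k * ef B k j)"

lemma Z_mulZ: "Z N (mulZ N A B) = Z N A * Z N B"
 by (rule Z_eqI) (auto simp: MN_mult Z_in mulZ_def ef_mk ent_times_MN[OF Z_in] ent_Z intro!: sum.cong)

text \<open>The identity of the block. Unlike 1 it lies in \<open>MN N\<close>, so it can end a
  nonempty product or power.\<close>

definition idm :: "nat => rmat" where "idm N = mk N (%i j. if i = j then 1 else 0)"

lemma Z_idm: "X \<in> MN N ==> X * Z N (idm N) = X"
proof (rule fmat_eqI)
 fix i j assume X: "X \<in> MN N"
 have "ent (X * Z N (idm N)) i j = (\<Sum>k<N. ent X i k * ent (Z N (idm N)) k j)" by (rule ent_times_MN[OF X])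
 also have "\<dots> = (\<Sum>k<N. if k = j then ent X i j else 0)"
  by (intro sum.cong refl) (auto simp: ent_Z idm_def ef_mk)
 also have "\<dots> = ent X i j" using X by (auto simp: MN_iff)
 finally show "ent (X * Z N (idm N)) i j = ent X i j" .
qed

lemma Z_prod: "L ~= [] ==> Z N (foldr (%A B. mulZ N A B) L (idm N)) = prod_list (map (Z N) L)"
proof (induction L)
 case (Cons A L)
 thus ?case by (cases "L = []") (auto simp: Z_mulZ Z_idm Z_in)
qed simp

lemma Z_power: "k >= 1 ==> Z N (rec_nat (idm N) (%_ B. mulZ N A B) k) = Z N A ^ k"
proof (induction k)
 case (Suc k)
 thus ?case by (cases k) (auto simp: Z_mulZ Z_idm Z_in)
qed simp

lemma Z_zero_iff: "Z N A = 0 \<longleftrightarrow> (\<forall>i<N. \<forall>j<N. ef A i j = 0)"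
proof
 assume "Z N A = 0"
 hence "ent (Z N A) i j = 0" for i j by (simp add: ent_simps)
 thus "\<forall>i<N. \<forall>j<N. ef A i j = 0" unfolding ent_Z by metis
qed (auto intro!: fmat_eqI simp: ent_Z ent_simps)

lemma cmp_mulZ: assumes "cmp n" "cmp a" "cmp b" shows "cmp (%x. mulZ (n x) (a x) (b x))"
 unfolding mulZ_def by (intro cmp_mat assms[THEN cmp_comp])

lemma cmp_idm: assumes "cmp n" shows "cmp (%x. idm (n x))"
 unfolding idm_def by (intro cmp_mat assms)

lemma Z_times_un: "Z N (mk N (%i j. \<Sum>k<N. ef A i k * E N p k j)) = Z N A * val (un N p)"
 by (rule Z_eqI) (auto simp: GLN_MN un_in Z_in ef_mk ent_times_MN[OF Z_in] ent_Z ent_un intro!: sum.cong)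

lemma Z_commutator: "Z N (mk N (%i j. \<Sum>k<N. E N p i k * E N q k j - E N q i k * E N p k j)) =
 val (un N p) * val (un N q) - val (un N q) * val (un N p)"
proof (rule Z_eqI)
 have *: "val (un N p) * val (un N q) - val (un N q) * val (un N p) =
  (val (un N p) - 1) * (val (un N q) - 1) - (val (un N q) - 1) * (val (un N p) - 1)" by (simp add: algebra_simps)
 show "val (un N p) * val (un N q) - val (un N q) * val (un N p) \<in> MN N"
  unfolding * using un_in[of N p] un_in[of N q] fm.subspace_diff[OF MN_subspace] MN_mult by (auto simp: GLN_def)
qed (simp add: ef_mk ent_simps ent_times_un ent_un sum_subtractf)

lemma Z_minus_one: "Z N (mk N (%i j. E N p i j - (if i = j then 1 else 0))) = val (un N p) - 1"
 by (rule Z_eqI) (use un_in[of N p] in \<open>auto simp: GLN_def ef_mk ent_simps ent_un\<close>)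

section \<open>Certificates on coded data\<close>

definition ideal_cert' :: "nat => upair list => upair list => rmat list => bool" where
 "ideal_cert' N ss vs Js \<longleftrightarrow>
  (\<forall>L\<in>set (lists_len N Js). \<forall>i<N. \<forall>j<N. ef (foldr (%A B. mulZ N A B) L (idm N)) i j = 0) &
  (\<forall>a\<in>set Js. \<forall>g\<in>set (sy ss). spn N Js (mk N (%i j. \<Sum>k<N. ef a i k * E N g k j))) &
  (\<forall>g\<in>set (sy ss). \<forall>h\<in>set (sy ss). spn N Js (mk N (%i j. \<Sum>k<N. E N g i k * E N h k j - E N h i k * E N g k j))) &
  (\<forall>v\<in>set vs. spn N Js (mk N (%i j. E N v i j - (if i = j then 1 else 0))))"

lemma re_ideal:
 assumes "cmp n" "cmp ss" "cmp vs" "cmp js"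
 shows "re (%x. ideal_cert' (n x) (ss x) (vs x) (js x))"
 unfolding ideal_cert'_def
 by (intro re_all re_spn; intro re_cmp cmp_mat cmp_mulZ cmp_idm cmp_sy assms[THEN cmp_comp])

lemma ideal_cert'_iff:
 assumes N: "N >= 1"
 shows "ideal_cert' N ss vs Js \<longleftrightarrow> ideal_cert N (un N ` set ss) (un N ` set vs) (map (Z N) Js)"
proof -
 have L: "(\<forall>L\<in>set (lists_len N Js). \<forall>i<N. \<forall>j<N. ef (foldr (%A B. mulZ N A B) L (idm N)) i j = 0) \<longleftrightarrow>
  (\<forall>js. length js = N & set js \<subseteq> Z N ` set Js --> prod_list js = 0)" (is "?l = ?r")
 proof
  assume l: ?l
  show ?r
  proof (intro allI impI)
   fix js assume js: "length js = N & set js \<subseteq> Z N ` set Js"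
   hence "\<forall>j\<in>set js. \<exists>A\<in>set Js. Z N A = j" by auto
   then obtain f where f: "!!j. j \<in> set js ==> f j \<in> set Js & Z N (f j) = j" by metis
   have "map f js \<in> set (lists_len N Js)" using js f by (auto simp: set_lists_len)
   hence "Z N (foldr (%A B. mulZ N A B) (map f js) (idm N)) = 0" using l by (auto simp: Z_zero_iff)
   moreover have "map f js ~= []" using js N by auto
   moreover have "map (Z N) (map f js) = js" using f by (simp add: map_idI)
   ultimately show "prod_list js = 0" using Z_prod by metis
  qed
 next
  assume r: ?r
  show ?l
  proof
   fix L assume "L \<in> set (lists_len N Js)"
   hence L: "length L = N" "set L \<subseteq> set Js" by (auto simp: set_lists_len)
   have "length (map (Z N) L) = N & set (map (Z N) L) \<subseteq> Z N ` set Js" using L by auto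
   hence "prod_list (map (Z N) L) = 0" using r by blast
   moreover have "L ~= []" using L N by auto
   ultimately show "\<forall>i<N. \<forall>j<N. ef (foldr (%A B. mulZ N A B) L (idm N)) i j = 0"
    using Z_prod Z_zero_iff by metis
  qed
 qed
 show ?thesis
  unfolding ideal_cert'_def ideal_cert_def L spn_iff Z_times_un Z_commutator Z_minus_one un_sy[symmetric] set_map
  by (simp add: Z_in image_subset_iff)
qed

definition powp :: "nat => upair => nat => upair" where
 "powp N p k = rec_nat (onep N) (%_ r. mulp N p r) k"

definition zpp :: "nat => upair => int => upair" where
 "zpp N p e = (if 0 <= e then powp N p (nat e) else powp N (swap p) (nat (- e)))"

definition pep :: "nat => upair list => int list => upair" where
 "pep N hs es = foldr (%t r. mulp N (zpp N (fst t) (snd t)) r) (zip hs es) (onep N)"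

lemma un_powp: "un N (powp N p k) = un N p ^ k"
 by (induction k) (auto simp: powp_def)

lemma un_zpp: "un N (zpp N p e) = zp (un N p) e"
 by (simp add: zpp_def zp_def un_powp un_swap)

lemma un_pep: "un N (pep N hs es) = pe (map (un N) hs) es"
proof (induction hs arbitrary: es)
 case (Cons h hs)
 thus ?case by (cases es) (auto simp: pep_def un_zpp)
qed (simp add: pep_def)

lemma cmp_pep: assumes "cmp n" "cmp hs" "cmp es" shows "cmp (%x. pep (n x) (hs x) (es x))"
 unfolding pep_def zpp_def powp_def by (intro cmp_mat assms[THEN cmp_comp])

definition unip' :: "nat => upair => bool" where
 "unip' N p \<longleftrightarrow> (\<forall>i<N. \<forall>j<N.
  ef (rec_nat (idm N) (%_ B. mulZ N (mk N (%i j. E N p i j - (if i = j then 1 else 0))) B) N) i j = 0)"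

lemma unip'_iff: "N >= 1 ==> unip' N p \<longleftrightarrow> unip N (un N p)"
 by (simp add: unip'_def unip_def flip: Z_zero_iff Z_minus_one Z_power)

lemma cmp_unip: assumes "cmp n" "cmp p" shows "cmp (%x. unip' (n x) (p x))"
 unfolding unip'_def by (intro cmp_mat cmp_mulZ cmp_idm assms[THEN cmp_comp])

text \<open>Listing the integers of absolute value at most B as k - B with k \<le> 2 B turns the
  quantifier over exponent vectors into a finite check.\<close>

definition indep_cert' :: "nat => upair list => bool" where
 "indep_cert' N hs \<longleftrightarrow> (\<exists>d C. 1 <= d &
  (\<forall>h\<in>set (sy hs). \<forall>i<N. (\<forall>j<N. \<exists>k. of_nat d * E N h i j = of_int k) & (\<Sum>k<N. \<bar>E N h i k\<bar>) <= of_nat C) &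
  (\<forall>es\<in>set (lists_len (length hs) (map (%k. int k - int (bnd N d C (length hs))) [0..<Suc (2 * bnd N d C (length hs))])).
   (\<forall>e\<in>set es. e = 0) | ~ unip' N (pep N hs es)))"

lemma indep_cert'_iff: "N >= 1 ==> indep_cert' N hs \<longleftrightarrow> indep_cert N (map (un N) hs)"
proof -
 assume N: "N >= 1"
 have "set (map (%k. int k - int B) [0..<Suc (2 * B)]) = {e. \<bar>e\<bar> <= int B}" for B
 proof (rule equalityI; rule subsetI)
  fix e assume "e \<in> {e. \<bar>e\<bar> <= int B}"
  hence eq: "int (nat (e + int B)) - int B = e" "nat (e + int B) \<in> set [0..<Suc (2 * B)]" by auto
  hence "(%k. int k - int B) (nat (e + int B)) \<in> set (map (%k. int k - int B) [0..<Suc (2 * B)])"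
   unfolding set_map by blast
  thus "e \<in> set (map (%k. int k - int B) [0..<Suc (2 * B)])" using eq(1) by simp
 qed auto
 hence "(\<forall>es\<in>set (lists_len (length hs) (map (%k. int k - int B) [0..<Suc (2 * B)])). Q es) \<longleftrightarrow>
  (\<forall>es. length es = length hs & (\<forall>e\<in>set es. \<bar>e\<bar> <= int B) --> Q es)" for B Q
  unfolding set_lists_len by auto
 note lists = this
 show ?thesis
  unfolding indep_cert'_def indep_cert_def lists set_map un_sy[symmetric] unip'_iff[OF N] un_pep
  by (simp add: ent_un Ints_def image_iff) blast
qed

lemma re_indep: assumes "cmp n" "cmp hs" shows "re (%x. indep_cert' (n x) (hs x))"
 unfolding indep_cert'_def bnd_def
 by (intro re_all; intro re_cmp cmp_mat cmp_sy cmp_unip cmp_pep assms[THEN cmp_comp])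

definition mn :: "nat => (nat \<times> nat) list => upair => rat" where
 "mn N l p = prod_list (map (%t. E N p (fst t) (snd t)) l)"

lemma mn_eq: "mn N l p = mnm l (val (un N p))"
 by (simp add: mn_def mnm_def ent_un case_prod_unfold)

definition monl :: "nat => nat => (nat \<times> nat) list list" where
 "monl N D = concat (map (%d. lists_len d (concat (map (%i. map (%j. (i, j)) [0..<N]) [0..<N]))) [0..<Suc D])"

lemma set_monl: "set (monl N D) = mons N D"
proof -
 have "set (concat (map (%i. map (%j. (i, j)) [0..<N]) [0..<N])) = {..<N} \<times> {..<N}" by auto
 moreover have "set (concat (map (%d. lists_len d P) [0..<Suc D])) = {l. length l <= D & set l \<subseteq> set P}"
  for P :: "(nat \<times> nat) list"
  unfolding set_concat set_map set_upt image_image set_lists_len by auto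
 ultimately show ?thesis unfolding monl_def mons_def by simp
qed

definition spp :: "nat => nat => upair list => upair => bool" where
 "spp N D ys p \<longleftrightarrow> (\<exists>c. \<forall>l\<in>set (monl N D). mn N l p = (\<Sum>i<length ys. ix 0 c i * mn N l (ix (onep N) ys i)))"

lemma spp_iff: "spp N D ys p \<longleftrightarrow> sp N D (map (un N) ys) (un N p)"
proof
 assume "spp N D ys p"
 then obtain c where c: "\<forall>l\<in>mons N D. mn N l p = (\<Sum>i<length ys. ix 0 c i * mn N l (ix (onep N) ys i))"
  by (auto simp: spp_def set_monl)
 show "sp N D (map (un N) ys) (un N p)" unfolding sp_def
  by (rule exI[of _ "map (ix 0 c) [0..<length ys]"])
   (use c in \<open>auto simp: mn_eq ix_def intro!: sum.cong\<close>)
next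
 assume "sp N D (map (un N) ys) (un N p)"
 then obtain c where c: "length c = length ys"
  "\<forall>l\<in>mons N D. mnm l (val (un N p)) = (\<Sum>i<length ys. c ! i * mnm l (val (map (un N) ys ! i)))"
  by (auto simp: sp_def)
 show "spp N D ys p" unfolding spp_def set_monl
  by (rule exI[of _ c]) (use c in \<open>auto simp: mn_eq ix_def intro!: sum.cong\<close>)
qed

lemma cmp_mn: assumes "cmp n" "cmp l" "cmp p" shows "cmp (%x. mn (n x) (l x) (p x))"
 unfolding mn_def by (intro cmp_mat assms[THEN cmp_comp])

lemma cmp_monl: assumes "cmp n" "cmp d" shows "cmp (%x. monl (n x) (d x))"
 unfolding monl_def by (intro cmp_mat assms[THEN cmp_comp])

lemma re_spp:
 assumes "cmp n" "cmp d" "cmp ys" "cmp p" shows "re (%x. spp (n x) (d x) (ys x) (p x))"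
 unfolding spp_def by (intro re_ex re_cmp cmp_mat cmp_mn cmp_monl assms[THEN cmp_comp])

text \<open>The separating polynomial is a finite list of monomials with coefficients, so that it
  can be searched for; repeated monomials add up.\<close>

definition poly_cert' :: "nat => nat => upair list => upair list => upair list => upair => bool" where
 "poly_cert' N D ss vs ys u \<longleftrightarrow> spp N D ys (onep N) &
  (\<forall>y\<in>set ys. \<forall>v\<in>set (sy vs). spp N D ys (mulp N y v)) &
  (\<forall>y\<in>set ys. \<forall>g\<in>set (sy ss). spp N D ys (mulp N (mulp N g y) (swap g))) &
  (\<exists>q. (\<forall>t\<in>set q. fst t \<in> set (monl N D)) &
   (\<forall>y\<in>set ys. sum_list (map (%t. snd t * mn N (fst t) y) q) = 0) &
   sum_list (map (%t. snd t * mn N (fst t) u) q) ~= 0)"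

lemma re_poly:
 assumes "cmp n" "cmp d" "cmp ss" "cmp vs" "cmp ys" "cmp u"
 shows "re (%x. poly_cert' (n x) (d x) (ss x) (vs x) (ys x) (u x))"
 unfolding poly_cert'_def
 by (intro re_all re_spp; intro re_cmp cmp_mat cmp_mn cmp_monl cmp_sy cmp_mem assms[THEN cmp_comp])

lemma list_polynomial:
 assumes "\<forall>t\<in>set q. fst t \<in> mons N D"
 shows "\<exists>a. \<forall>x. sum_list (map (%t. snd t * mnm (fst t) x) q) = (\<Sum>l\<in>mons N D. a l * mnm l x)"
proof -
 have "pd N D (%x. sum_list (map (%t. snd t * mnm (fst t) x) q))"
  using assms
 proof (induction q)
  case (Cons t q)
  thus ?case using pd_add[OF pd_scale[OF pd_mnm[of "fst t" N D]]] by simp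
 qed (simp add: pd_const)
 thus ?thesis by (rule pd_sum_mnm)
qed

lemma poly_cert'_iff:
 "poly_cert' N D ss vs ys u \<longleftrightarrow>
  poly_cert N D (un N ` set ss) (un N ` set vs) (map (un N) ys) (un N u)"
proof -
 have "(\<exists>q. (\<forall>t\<in>set q. fst t \<in> mons N D) &
   (\<forall>y\<in>set ys. sum_list (map (%t. snd t * mnm (fst t) (val (un N y))) q) = 0) &
   sum_list (map (%t. snd t * mnm (fst t) (val (un N u))) q) ~= 0) \<longleftrightarrow>
  (\<exists>a. (\<forall>y\<in>set ys. (\<Sum>l\<in>mons N D. a l * mnm l (val (un N y))) = 0) &
     (\<Sum>l\<in>mons N D. a l * mnm l (val (un N u))) ~= 0)" (is "?l = ?r")
 proof
  assume ?l
  then obtain q where q: "\<forall>t\<in>set q. fst t \<in> mons N D"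
   "\<forall>y\<in>set ys. sum_list (map (%t. snd t * mnm (fst t) (val (un N y))) q) = 0"
   "sum_list (map (%t. snd t * mnm (fst t) (val (un N u))) q) ~= 0" by blast
  obtain a where "\<forall>x. sum_list (map (%t. snd t * mnm (fst t) x) q) = (\<Sum>l\<in>mons N D. a l * mnm l x)"
   using list_polynomial[OF q(1)] by blast
  thus ?r using q by (intro exI[of _ a]) auto
 next
  assume ?r
  then obtain a where a: "\<forall>y\<in>set ys. (\<Sum>l\<in>mons N D. a l * mnm l (val (un N y))) = 0"
   "(\<Sum>l\<in>mons N D. a l * mnm l (val (un N u))) ~= 0" by blast
  obtain ls where ls: "set ls = mons N D" "distinct ls" using finite_distinct_list[OF finite_mons] by blast
  have "sum_list (map (%t. snd t * mnm (fst t) x) (map (%l. (l, a l)) ls)) = (\<Sum>l\<in>mons N D. a l * mnm l x)" for x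
   using ls by (simp add: o_def sum_list_distinct_conv_sum_set)
  thus ?l using a ls by (intro exI[of _ "map (%l. (l, a l)) ls"]) auto
 qed
 moreover have "un N ` set ys \<subseteq> GLN N" using un_in by blast
 ultimately show ?thesis
  unfolding poly_cert'_def poly_cert_def mn_eq set_monl spp_iff un_mulp un_swap un_onep un_sy[symmetric] set_map
  by simp
qed

definition triang' :: "nat => upair list => upair list => upair list => upair list => bool" where
 "triang' N bs hs vs ls \<longleftrightarrow> (\<forall>h\<in>set (hs @ vs). un N h \<in> gen (un N ` set bs)) & cosets N bs (hs @ vs) &
  (\<exists>Js. ideal_cert' N (ls @ hs @ vs) vs Js) & indep_cert' N ls"

lemma triang'_iff:
 assumes N: "N >= 1"
 shows "triang' N bs hs vs ls \<longleftrightarrow> triang N (gen (un N ` set bs)) (map (un N) hs) (map (un N) vs) (map (un N) ls)"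
proof (cases "\<forall>h\<in>set (hs @ vs). un N h \<in> gen (un N ` set bs)")
 case True
 have "gen (un N ` set (hs @ vs)) \<subseteq> gen (un N ` set bs)" by (rule gen_least[OF sg_gen]) (use True in auto)
 from cosets_iff[OF this] have c: "cosets N bs (hs @ vs) \<longleftrightarrow>
  fidx (gen (un N ` set bs)) (gen (set (map (un N) hs) \<union> set (map (un N) vs)))" by (simp add: image_Un)
 have i: "(\<exists>Js. ideal_cert' N (ls @ hs @ vs) vs Js) \<longleftrightarrow> (\<exists>Js. ideal_cert N (set (map (un N) ls) \<union>
  set (map (un N) hs) \<union> set (map (un N) vs)) (set (map (un N) vs)) Js)" (is "?l \<longleftrightarrow> (\<exists>Js. ?r Js)")
 proof
  show "?l ==> \<exists>Js. ?r Js" using N by (auto simp: ideal_cert'_iff image_Un Un_assoc)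
  assume "\<exists>Js. ?r Js"
  then obtain Js where Js: "?r Js" by blast
  moreover obtain Js' where "Js = map (Z N) Js'" using Z_list_surj[of Js N] Js by (auto simp: ideal_cert_def)
  ultimately have "ideal_cert' N (ls @ hs @ vs) vs Js'" using N by (simp add: ideal_cert'_iff image_Un Un_assoc)
  thus ?l ..
 qed
 have "set (map (un N) hs) \<union> set (map (un N) vs) \<subseteq> gen (un N ` set bs)" using True by auto
 thus ?thesis
  unfolding triang'_def triang_def c i indep_cert'_iff[OF N] using True by blast
next
 case False
 thus ?thesis by (auto simp: triang'_def triang_def)
qed

lemma re_triang:
 assumes "cmp n" "cmp bs" "cmp hs" "cmp vs" "cmp ls" shows "re (%x. triang' (n x) (bs x) (hs x) (vs x) (ls x))"
 unfolding triang'_def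
 by (intro re_all re_gen re_cosets re_ideal re_indep; intro re_cmp cmp_mat assms[THEN cmp_comp])

definition cert_torus' :: "nat => upair list => upair list => bool" where
 "cert_torus' N as bs \<longleftrightarrow> (\<exists>g hs vs. un N g \<in> gen (un N ` set as) & triang' N bs hs vs (g # hs))"

definition cert_unip' :: "nat => upair list => upair list => bool" where
 "cert_unip' N as bs \<longleftrightarrow> (\<exists>u hs vs D ys. un N u \<in> gen (un N ` set as) & unip' N u & triang' N bs hs vs hs &
  (\<forall>a\<in>set hs. \<forall>b\<in>set hs. \<exists>v\<in>set vs. un N (mulp N (mulp N (mulp N a b) (swap a)) (swap b)) = un N v) &
  poly_cert' N D (hs @ vs) vs ys u)"

lemma re_cert_torus:
 assumes "cmp n" "cmp as" "cmp bs" shows "re (%x. cert_torus' (n x) (as x) (bs x))"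
 unfolding cert_torus'_def
 by (intro re_all re_gen re_triang; intro re_cmp cmp_mat assms[THEN cmp_comp])

lemma re_cert_unip:
 assumes "cmp n" "cmp as" "cmp bs" shows "re (%x. cert_unip' (n x) (as x) (bs x))"
 unfolding cert_unip'_def
 by (intro re_all re_gen re_triang re_poly; intro re_cmp cmp_mat cmp_unip assms[THEN cmp_comp])

lemma gen_GLN: "gen (un N ` set ps) \<subseteq> GLN N"
 by (rule gen_least[OF sg_GLN]) (use un_in in auto)

lemma triang_GLN: "triang N (gen (un N ` set bs)) hs vs ls ==> set hs \<subseteq> GLN N & set vs \<subseteq> GLN N"
 using gen_GLN[of N bs] unfolding triang_def by blast

lemma cert_torus'_iff:
 assumes N: "N >= 1"
 shows "cert_torus' N as bs \<longleftrightarrow> cert_torus N (gen (un N ` set as)) (gen (un N ` set bs))"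
proof
 show "cert_torus' N as bs ==> cert_torus N (gen (un N ` set as)) (gen (un N ` set bs))"
  unfolding cert_torus'_def cert_torus_def triang'_iff[OF N] list.map by blast
 assume "cert_torus N (gen (un N ` set as)) (gen (un N ` set bs))"
 then obtain g hs vs where c: "g \<in> gen (un N ` set as)" "triang N (gen (un N ` set bs)) hs vs (g # hs)"
  unfolding cert_torus_def by blast
 obtain g' where g: "un N g' = g" using un_surj[of g N] c(1) gen_GLN by blast
 obtain hs' vs' where "map (un N) hs' = hs" "map (un N) vs' = vs"
  using triang_GLN[OF c(2)] un_list_surj[of hs N] un_list_surj[of vs N] by auto
 hence "triang' N bs hs' vs' (g' # hs')" using c(2) g by (simp add: triang'_iff[OF N])
 thus "cert_torus' N as bs" unfolding cert_torus'_def using c(1) g by blast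
qed

lemma cert_unip'_iff:
 assumes N: "N >= 1"
 shows "cert_unip' N as bs \<longleftrightarrow> cert_unip N (gen (un N ` set as)) (gen (un N ` set bs))"
proof -
 have cm: "(\<forall>a\<in>set hs. \<forall>b\<in>set hs. \<exists>v\<in>set vs. un N (mulp N (mulp N (mulp N a b) (swap a)) (swap b)) = un N v) \<longleftrightarrow>
  (\<forall>a\<in>set (map (un N) hs). \<forall>b\<in>set (map (un N) hs). cm a b \<in> set (map (un N) vs))" for hs vs
  by (auto simp: cm_def un_swap image_iff)
 have poly: "poly_cert' N D (hs @ vs) vs ys u \<longleftrightarrow> poly_cert N D (set (map (un N) hs) \<union> set (map (un N) vs))
  (set (map (un N) vs)) (map (un N) ys) (un N u)" for D hs vs ys u
  by (simp add: poly_cert'_iff image_Un)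
 show ?thesis
 proof
  show "cert_unip' N as bs ==> cert_unip N (gen (un N ` set as)) (gen (un N ` set bs))"
   unfolding cert_unip'_def cert_unip_def triang'_iff[OF N] unip'_iff[OF N] cm poly by blast
  assume "cert_unip N (gen (un N ` set as)) (gen (un N ` set bs))"
  then obtain u hs vs D ys where c: "u \<in> gen (un N ` set as)" "unip N u" "triang N (gen (un N ` set bs)) hs vs hs"
   "\<forall>a\<in>set hs. \<forall>b\<in>set hs. cm a b \<in> set vs" "poly_cert N D (set hs \<union> set vs) (set vs) ys u"
   unfolding cert_unip_def by blast
  obtain u' where u: "u = un N u'" using un_surj[of u N] c(1) gen_GLN by blast
  obtain hs' vs' ys' where l: "hs = map (un N) hs'" "vs = map (un N) vs'" "ys = map (un N) ys'"
   using triang_GLN[OF c(3)] un_list_surj[of hs N] un_list_surj[of vs N] un_list_surj[of ys N] c(5)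
   by (auto simp: poly_cert_def)
  show "cert_unip' N as bs" unfolding cert_unip'_def triang'_iff[OF N] unip'_iff[OF N] cm poly
   using c unfolding u l by blast
 qed
qed

section \<open>Restriction of scalars\<close>

lemma eval_at_add: "eval_at \<alpha> (g + h) = eval_at \<alpha> g + eval_at \<alpha> h"
proof -
 have "map_poly of_rat (g + h) = (map_poly of_rat g + map_poly of_rat h :: complex poly)"
  by (rule poly_eqI) (simp add: coeff_map_poly of_rat_add)
 thus ?thesis by (simp add: eval_at_def)
qed

lemma eval_at_smult: "eval_at \<alpha> (smult c g) = of_rat c * eval_at \<alpha> g"
proof -
 have "map_poly of_rat (smult c g) = (smult (of_rat c) (map_poly of_rat g) :: complex poly)"
  by (rule poly_eqI) (simp add: coeff_map_poly of_rat_mult)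
 thus ?thesis by (simp add: eval_at_def)
qed

lemma eval_at_0 [simp]: "eval_at \<alpha> 0 = 0"
 by (simp add: eval_at_def)

lemma eval_at_1 [simp]: "eval_at \<alpha> 1 = 1"
 by (simp add: eval_at_def)

lemma eval_at_pCons: "eval_at \<alpha> (pCons c g) = of_rat c + \<alpha> * eval_at \<alpha> g"
proof -
 have "map_poly of_rat (pCons c g) = (pCons (of_rat c) (map_poly of_rat g) :: complex poly)"
  by (rule poly_eqI) (simp add: coeff_map_poly coeff_pCons split: nat.split)
 thus ?thesis by (simp add: eval_at_def)
qed

lemma eval_at_mult: "eval_at \<alpha> (g * h) = eval_at \<alpha> g * eval_at \<alpha> h"
 by (induction g) (auto simp: eval_at_add eval_at_smult eval_at_pCons algebra_simps)

lemma eval_at_monom: "eval_at \<alpha> (monom c k) = of_rat c * \<alpha> ^ k"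
 by (induction k) (auto simp: monom_0 monom_Suc eval_at_pCons)

lemma eval_at_sum: "eval_at \<alpha> (\<Sum>i\<in>A. g i) = (\<Sum>i\<in>A. eval_at \<alpha> (g i))"
 by (induction A rule: infinite_finite_induct) (auto simp: eval_at_add)

lemma eval_at_coeffs: "eval_at \<alpha> g = (\<Sum>k<length (coeffs g). of_rat (coeffs g ! k) * \<alpha> ^ k)"
proof (induction g)
 case (pCons a g)
 have "coeffs (pCons a g) = a # coeffs g" using pCons.hyps by (auto simp: cCons_def)
 thus ?case
  by (simp add: eval_at_pCons pCons.IH sum.lessThan_Suc_shift sum_distrib_left mult_ac del: sum.lessThan_Suc)
qed simp

locale numfield =
 fixes \<alpha> :: complex and f :: "rat poly"
 assumes mp: "minimal_polynomial f \<alpha>"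
begin

abbreviation d :: nat where "d \<equiv> degree f"

lemma f_nz: "f ~= 0" and f_lead: "lead_coeff f = 1" and f_root: "eval_at \<alpha> f = 0"
 using mp by (auto simp: minimal_polynomial_def)

lemma f_min: "eval_at \<alpha> g = 0 ==> degree g < d ==> g = 0"
 using mp by (force simp: minimal_polynomial_def)

lemma d_pos: "d >= 1"
proof (rule ccontr)
 assume "~ d >= 1"
 hence "f = monom 1 0" using f_lead by (metis degree_0_id less_one linorder_not_le monom_0)
 thus False using f_root by (simp add: eval_at_monom)
qed

text \<open>\<open>S\<close> and its inverse \<open>cd\<close> pass between coordinates and elements
  for the basis 1, \<alpha>, ..., \<alpha>^(d-1).\<close>

definition S :: "(nat => rat) => complex" where "S u = (\<Sum>a<d. of_rat (u a) * \<alpha> ^ a)"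

text \<open>The ring Q[\<alpha>]; by \<open>K_inverse\<close> it is a field and therefore contains
  \<open>rat_adjoin \<alpha>\<close>.\<close>

definition K :: "complex set" where "K = range (eval_at \<alpha>)"

lemma S_inj: "S u = S v ==> a < d ==> u a = v a"
proof -
 assume S: "S u = S v" and a: "a < d"
 define g where "g = (\<Sum>a<d. monom (u a - v a) a)"
 have "eval_at \<alpha> g = S u - S v"
  by (simp add: g_def eval_at_sum eval_at_monom S_def of_rat_diff left_diff_distrib sum_subtractf)
 moreover have c: "poly.coeff g b = (if b < d then u b - v b else 0)" for b
  by (simp add: g_def coeff_sum)
 have "degree g < d"
  by (rule degree_lessI) (use d_pos c in auto)
 ultimately have "g = 0" using f_min S by simp
 thus "u a = v a" using c[of a] a by simp
qed

lemma K_S: "x \<in> K ==> \<exists>u. S u = x"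
proof -
 assume "x \<in> K"
 then obtain g where g: "x = eval_at \<alpha> g" by (auto simp: K_def)
 define r where "r = g mod f"
 have "g = (g div f) * f + r" by (simp add: r_def)
 hence "eval_at \<alpha> g = eval_at \<alpha> r" by (metis eval_at_add eval_at_mult f_root mult_zero_right add_0)
 have "degree r < d" using degree_mod_less[OF f_nz, of g] d_pos by (auto simp: r_def)
 hence "r = (\<Sum>a<d. monom (poly.coeff r a) a)"
  by (intro poly_eqI) (auto simp: coeff_sum coeff_eq_0)
 hence "eval_at \<alpha> r = (\<Sum>a<d. eval_at \<alpha> (monom (poly.coeff r a) a))" by (metis eval_at_sum)
 hence "S (poly.coeff r) = x" using g \<open>eval_at \<alpha> g = eval_at \<alpha> r\<close> by (simp add: S_def eval_at_monom)
 thus "\<exists>u. S u = x" by blast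
qed

lemma S_K: "S u \<in> K"
proof -
 have "S u = eval_at \<alpha> (\<Sum>a<d. monom (u a) a)" by (simp add: S_def eval_at_sum eval_at_monom)
 thus ?thesis by (simp add: K_def)
qed

lemma K_mult: "x \<in> K ==> y \<in> K ==> x * y \<in> K"
 and K_add: "x \<in> K ==> y \<in> K ==> x + y \<in> K"
 by (auto simp: K_def simp flip: eval_at_mult eval_at_add)

lemma K_rat: "of_rat q \<in> K"
 using eval_at_monom[of \<alpha> q 0] by (auto simp: K_def intro: range_eqI sym)

lemma K_0: "0 \<in> K" and K_1: "1 \<in> K"
 using K_rat[of 0] K_rat[of 1] by auto

lemma K_pow: "\<alpha> ^ k \<in> K"
 using eval_at_monom[of \<alpha> 1 k] by (auto simp: K_def intro: range_eqI sym)

text \<open>A nonzero element h of least degree in the ideal of g and f divides f = h k. As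
  h(\<alpha>) is nonzero, k(\<alpha>) = 0, so k has full degree and h is a constant; writing h in
  terms of g and f gives the inverse.\<close>

lemma K_inverse: "x \<in> K ==> x ~= 0 ==> inverse x \<in> K"
proof -
 assume "x \<in> K" and x0: "x ~= 0"
 then obtain g where g: "x = eval_at \<alpha> g" by (auto simp: K_def)
 define I where "I = {a * g + b * f |a b. True}"
 have Imod: "p - q * h \<in> I" if ph: "p \<in> I" "h \<in> I" for p q h
 proof -
  obtain a b a' b' where "p = a * g + b * f" "h = a' * g + b' * f" using ph unfolding I_def by blast
  hence "p - q * h = (a - q * a') * g + (b - q * b') * f" by (simp add: algebra_simps)
  thus ?thesis by (auto simp: I_def)
 qed
 have "0 * g + 1 * f \<in> I" "1 * g + 0 * f \<in> I" unfolding I_def by blast+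
 hence fI: "f \<in> I" and gI: "g \<in> I" by simp_all
 obtain h where h: "h \<in> I" "h ~= 0" "!!p. p \<in> I ==> p ~= 0 ==> degree h <= degree p"
  using ex_has_least_nat[of "%p. p \<in> I & p ~= 0" f degree] fI f_nz by blast
 have dvd: "h dvd p" if "p \<in> I" for p
 proof -
  have "p mod h \<in> I" using Imod[OF that h(1), of "p div h"] by (simp add: minus_div_mult_eq_mod)
  hence "p mod h = 0" using degree_mod_less[OF h(2), of p] h(3) by fastforce
  thus ?thesis by (simp add: mod_eq_0_iff_dvd)
 qed
 obtain k where k: "f = h * k" using dvd[OF fI] by auto
 obtain m where m: "g = h * m" using dvd[OF gI] by auto
 have "eval_at \<alpha> h ~= 0" using x0 g m by (auto simp: eval_at_mult)
 hence "eval_at \<alpha> k = 0" using f_root k by (simp add: eval_at_mult)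
 moreover have "k ~= 0" using k f_nz by auto
 ultimately have "d <= degree k" using f_min[of k] by fastforce
 hence "degree h = 0" using k h(2) \<open>k ~= 0\<close> by (simp add: degree_mult_eq)
 then obtain c where c: "h = [:c:]" by (rule degree_eq_zeroE)
 hence c0: "c ~= 0" using h(2) by simp
 obtain a b where ab: "h = a * g + b * f" using h(1) by (auto simp: I_def)
 have "eval_at \<alpha> h = eval_at \<alpha> a * x" unfolding ab eval_at_add eval_at_mult f_root g by simp
 moreover have "eval_at \<alpha> h = of_rat c" by (simp add: c eval_at_pCons)
 ultimately have "x * (of_rat (inverse c) * eval_at \<alpha> a) = of_rat (inverse c) * of_rat c" by (simp add: mult_ac)
 also have "\<dots> = 1" using c0 by (simp flip: of_rat_mult)
 finally have "inverse x = of_rat (inverse c) * eval_at \<alpha> a" by (rule inverse_unique)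
 thus ?thesis using K_mult[OF K_rat] by (simp add: K_def)
qed

lemma rat_adjoin_K: "rat_adjoin \<alpha> \<subseteq> K"
proof
 fix x assume "x \<in> rat_adjoin \<alpha>"
 thus "x \<in> K" unfolding rat_adjoin_def
 proof induction
  case one
  thus ?case by (simp add: K_1 class_ring_simps)
 next
  case (incl h)
  thus ?case using K_pow[of 1] by simp
 next
  case (a_inv h)
  have "of_rat (- 1) * h \<in> K" by (rule K_mult[OF K_rat a_inv.IH])
  hence "- h \<in> K" by simp
  moreover have "\<ominus>\<^bsub>class_ring\<^esub> h = - h" by (simp add: matrix_vs_simps)
  ultimately show ?case by simp
 next
  case (m_inv h)
  have "h ~= 0" using m_inv by (simp add: class_ring_simps)
  hence "inv\<^bsub>class_ring\<^esub> h = inverse h" by (simp add: matrix_vs_simps)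
  thus ?case using K_inverse[OF m_inv.IH \<open>h ~= 0\<close>] by simp
 next
  case (eng_add h1 h2)
  thus ?case using K_add by (simp add: class_ring_simps)
 next
  case (eng_mult h1 h2)
  thus ?case using K_mult by (simp add: class_ring_simps)
 qed
qed

definition cd :: "complex => nat => rat" where "cd x = (SOME u. S u = x)"

lemma S_cd: "x \<in> K ==> S (cd x) = x"
 unfolding cd_def using someI_ex[OF K_S] .

lemma cd_eqI: "S u = x ==> a < d ==> cd x a = u a"
 using S_inj S_cd S_K by metis

lemma cd_sum:
 assumes "!!i. i \<in> A ==> x i \<in> K" "a < d"
 shows "cd (\<Sum>i\<in>A. x i) a = (\<Sum>i\<in>A. cd (x i) a)"
proof (rule cd_eqI[OF _ assms(2)])
 have "S (%a. \<Sum>i\<in>A. cd (x i) a) = (\<Sum>i\<in>A. S (cd (x i)))"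
  unfolding S_def of_rat_sum sum_distrib_right by (rule sum.swap)
 thus "S (%a. \<Sum>i\<in>A. cd (x i) a) = (\<Sum>i\<in>A. x i)" using assms(1) by (simp add: S_cd)
qed

lemma cd_mult:
 assumes "x \<in> K" "y \<in> K" "a < d"
 shows "cd (x * y) a = (\<Sum>c<d. cd (x * \<alpha> ^ c) a * cd y c)"
proof (rule cd_eqI[OF _ assms(3)])
 have "S (%a. \<Sum>c<d. cd (x * \<alpha> ^ c) a * cd y c) =
  (\<Sum>a<d. \<Sum>c<d. of_rat (cd (x * \<alpha> ^ c) a) * of_rat (cd y c) * \<alpha> ^ a)"
  by (simp add: S_def of_rat_sum of_rat_mult sum_distrib_right)
 also have "\<dots> = (\<Sum>c<d. of_rat (cd y c) * S (cd (x * \<alpha> ^ c)))"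
  unfolding S_def sum_distrib_left by (subst sum.swap) (simp add: mult_ac)
 also have "\<dots> = x * S (cd y)"
  using assms(1) by (simp add: S_cd K_mult K_pow S_def[of "cd y"] sum_distrib_left mult_ac)
 finally show "S (%a. \<Sum>c<d. cd (x * \<alpha> ^ c) a * cd y c) = x * y" using assms(2) by (simp add: S_cd)
qed

text \<open>Each entry is replaced by the d x d matrix of multiplication by it, in the basis of
  powers of \<alpha>.\<close>

definition bl :: "complex mat => nat => nat => rat" where
 "bl A i j = cd (A $$ (i div d, j div d) * \<alpha> ^ (j mod d)) (i mod d)"

lemma sum_blocks: "(\<Sum>l<n * d. g (l div d) (l mod d)) = (\<Sum>k<n. \<Sum>c<d. g k c :: rat)"
proof -
 have "(\<Sum>l\<in>{k * d..<k * d + d}. g (l div d) (l mod d)) = (\<Sum>c<d. g k c)" for k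
 proof (rule sum.reindex_bij_witness[of _ "%c. k * d + c" "%l. l - k * d"])
  fix l assume "l \<in> {k * d..<k * d + d}"
  hence "l = (l - k * d) + k * d" "l - k * d < d" by auto
  hence "l div d = k" "l mod d = l - k * d"
   by (metis div_mult_self3 div_less add.commute add_0 gr_implies_not0 mult.commute, metis mod_less mod_mult_self3 add.commute)
  thus "g k (l - k * d) = g (l div d) (l mod d)" by simp
 qed auto
 thus ?thesis using sum.nat_group[of "%l. g (l div d) (l mod d)" d n] by simp
qed

lemma div_less: "i < n * d ==> i div d < n"
 by (simp add: less_mult_imp_div_less)

lemma bl_mult:
 assumes A: "A \<in> carrier_mat n n" "elements_mat A \<subseteq> K" and B: "B \<in> carrier_mat n n" "elements_mat B \<subseteq> K"
  and ij: "i < n * d" "j < n * d"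
 shows "(\<Sum>l<n * d. bl A i l * bl B l j) = bl (A * B) i j"
proof -
 define a b i' j' where defs: "a = i mod d" "b = j mod d" "i' = i div d" "j' = j div d"
 have lt: "a < d" "i' < n" "j' < n" using d_pos ij div_less by (auto simp: defs)
 have AK: "A $$ (i', k) \<in> K" if "k < n" for k using A that lt by blast
 have BK: "B $$ (k, j') \<in> K" if "k < n" for k using B that lt by blast
 have "(\<Sum>l<n * d. bl A i l * bl B l j) =
  (\<Sum>l<n * d. cd (A $$ (i', l div d) * \<alpha> ^ (l mod d)) a * cd (B $$ (l div d, j') * \<alpha> ^ b) (l mod d))"
  by (simp add: bl_def defs)
 also have "\<dots> = (\<Sum>k<n. \<Sum>c<d. cd (A $$ (i', k) * \<alpha> ^ c) a * cd (B $$ (k, j') * \<alpha> ^ b) c)"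
  by (rule sum_blocks)
 also have "\<dots> = (\<Sum>k<n. cd (A $$ (i', k) * (B $$ (k, j') * \<alpha> ^ b)) a)"
  using AK BK lt by (intro sum.cong refl cd_mult[symmetric] K_mult K_pow) auto
 also have "\<dots> = cd (\<Sum>k<n. A $$ (i', k) * (B $$ (k, j') * \<alpha> ^ b)) a"
  using AK BK lt by (intro cd_sum[symmetric] K_mult K_pow) auto
 also have "(\<Sum>k<n. A $$ (i', k) * (B $$ (k, j') * \<alpha> ^ b)) = (A * B) $$ (i', j') * \<alpha> ^ b"
  using A B lt by (simp add: scalar_prod_def sum_distrib_right mult.assoc atLeast0LessThan)
 finally show ?thesis by (simp add: bl_def defs)
qed

lemma bl_one:
 assumes "i < n * d" "j < n * d"
 shows "bl (1\<^sub>m n) i j = (if i = j then 1 else 0)"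
proof -
 have lt: "i mod d < d" "i div d < n" "j div d < n" "j mod d < d" using d_pos assms div_less by auto
 have "S (%a. if a = b then q else 0) = of_rat q * \<alpha> ^ b" if "b < d" for b q
 proof -
  have "S (%a. if a = b then q else 0) = (\<Sum>a<d. if a = b then of_rat q * \<alpha> ^ a else 0)"
   unfolding S_def by (intro sum.cong) auto
  thus ?thesis using that by simp
 qed
 from this[OF lt(4), of 1] this[OF lt(4), of 0]
 have "cd (\<alpha> ^ (j mod d)) (i mod d) = (if i mod d = j mod d then 1 else 0)" "cd 0 (i mod d) = 0"
  using cd_eqI[of "%a. if a = j mod d then 1 else 0" _ "i mod d"] cd_eqI[of "%a. if a = j mod d then 0 else 0" 0 "i mod d"] lt(1)
  by auto
 moreover have "i = j \<longleftrightarrow> i div d = j div d & i mod d = j mod d" by (metis div_mult_mod_eq)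
 ultimately show ?thesis using lt by (cases "i div d = j div d") (simp_all add: bl_def)
qed

section \<open>The embedding of GL(n, Q(\<alpha>)) into GL(n d, Q)\<close>

definition MM :: "nat => complex mat set" where
 "MM n = {A \<in> carrier_mat n n. elements_mat A \<subseteq> rat_adjoin \<alpha>}"

lemma MM: "A \<in> MM n ==> A \<in> carrier_mat n n" "A \<in> MM n ==> elements_mat A \<subseteq> K"
 using rat_adjoin_K by (auto simp: MM_def)

definition rho :: "nat => complex mat => fmat un" where
 "rho n A = un (n * d) (mk (n * d) (bl A), mk (n * d) (bl (SOME B. B \<in> MM n & A * B = 1\<^sub>m n & B * A = 1\<^sub>m n)))"

lemma carrier_GL: "A \<in> carrier (GL n (rat_adjoin \<alpha>)) \<longleftrightarrow> A \<in> MM n & (\<exists>B\<in>MM n. A * B = 1\<^sub>m n & B * A = 1\<^sub>m n)"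
 by (auto simp: GL_def units_of_def Units_def MM_def)

lemma ent_rho:
 assumes A: "A \<in> carrier (GL n (rat_adjoin \<alpha>))" and ij: "i < n * d" "j < n * d"
 shows "ent (val (rho n A)) i j = bl A i j"
proof -
 define B where "B = (SOME B. B \<in> MM n & A * B = 1\<^sub>m n & B * A = 1\<^sub>m n)"
 have B: "B \<in> MM n & A * B = 1\<^sub>m n & B * A = 1\<^sub>m n"
  unfolding B_def by (rule someI_ex) (use A in \<open>auto simp: carrier_GL\<close>)
 have "ok (n * d) (mk (n * d) (bl A), mk (n * d) (bl B))"
  unfolding ok_def
 proof (intro allI impI)
  fix i j assume ij: "i < n * d" "j < n * d"
  have "(\<Sum>l<n * d. bl A i l * bl B l j) = bl (1\<^sub>m n) i j" "(\<Sum>l<n * d. bl B i l * bl A l j) = bl (1\<^sub>m n) i j"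
   using bl_mult[of A n B i j] bl_mult[of B n A i j] MM[of _ n] A B ij by (auto simp: carrier_GL)
  thus "(\<Sum>k<n * d. ef (fst (mk (n * d) (bl A), mk (n * d) (bl B))) i k * ef (snd (mk (n * d) (bl A), mk (n * d) (bl B))) k j) =
    (if i = j then 1 else 0) &
   (\<Sum>k<n * d. ef (snd (mk (n * d) (bl A), mk (n * d) (bl B))) i k * ef (fst (mk (n * d) (bl A), mk (n * d) (bl B))) k j) =
    (if i = j then 1 else 0)"
   using ij by (simp add: ef_mk bl_one)
 qed
 thus ?thesis using ij by (simp add: rho_def B_def[symmetric] ent_un E_def ef_mk)
qed

lemma rho_in: "rho n A \<in> GLN (n * d)"
 by (simp add: rho_def un_in)

lemma rat_adjoin_one: "1 \<in> rat_adjoin \<alpha>"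
 using generate_field.one[of class_ring "{\<alpha>}"] by (simp add: rat_adjoin_def class_ring_simps)

lemma rat_adjoin_zero: "0 \<in> rat_adjoin \<alpha>"
 using generate_field.eng_add[OF generate_field.one generate_field.a_inv[OF generate_field.one], of class_ring "{\<alpha>}"]
 by (simp add: rat_adjoin_def class_ring_simps matrix_vs_simps)

lemma MM_mult: "A \<in> MM n ==> B \<in> MM n ==> A * B \<in> MM n"
proof -
 assume A: "A \<in> MM n" and B: "B \<in> MM n"
 have P: "(\<Sum>k\<in>X. x k * y k) \<in> rat_adjoin \<alpha>"
  if "!!k. k \<in> X ==> x k \<in> rat_adjoin \<alpha> & y k \<in> rat_adjoin \<alpha>" for X :: "nat set" and x y
  using that
 proof (induction X rule: infinite_finite_induct)
  case (insert k X)
  thus ?case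
   using generate_field.eng_add[of "x k * y k" class_ring "{\<alpha>}"] generate_field.eng_mult[of "x k" class_ring "{\<alpha>}" "y k"]
   by (simp add: rat_adjoin_def class_ring_simps)
 qed (use rat_adjoin_zero in auto)
 show "A * B \<in> MM n"
  unfolding MM_def
 proof (intro CollectI conjI subsetI)
  have c: "A \<in> carrier_mat n n" "B \<in> carrier_mat n n" using A B by (auto simp: MM_def)
  thus "A * B \<in> carrier_mat n n" by simp
  fix x assume "x \<in> elements_mat (A * B)"
  then obtain i j where ij: "i < n" "j < n" "x = (A * B) $$ (i, j)" using c by auto
  have "A $$ (i, k) \<in> rat_adjoin \<alpha> & B $$ (k, j) \<in> rat_adjoin \<alpha>" if "k < n" for k
   using A B elements_matI[OF c(1) ij(1) that refl] elements_matI[OF c(2) that ij(2) refl] by (auto simp: MM_def)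
  hence "(\<Sum>k<n. A $$ (i, k) * B $$ (k, j)) \<in> rat_adjoin \<alpha>" by (intro P) auto
  thus "x \<in> rat_adjoin \<alpha>" using c ij by (simp add: scalar_prod_def atLeast0LessThan)
 qed
qed

lemma rho_mult:
 assumes A: "A \<in> carrier (GL n (rat_adjoin \<alpha>))" and B: "B \<in> carrier (GL n (rat_adjoin \<alpha>))"
  and AB: "A * B \<in> carrier (GL n (rat_adjoin \<alpha>))"
 shows "rho n (A * B) = rho n A * rho n B"
proof (rule GLN_eqI[of _ "n * d"])
 show "rho n A * rho n B \<in> GLN (n * d)" by (intro sg_mult[OF sg_GLN] rho_in)
 fix i j assume ij: "i < n * d" "j < n * d"
 have "ent (val (rho n A * rho n B)) i j = (\<Sum>l<n * d. bl A i l * bl B l j)"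
  using ij A B by (simp add: ent_times_GLN'[OF rho_in] ent_rho)
 also have "\<dots> = bl (A * B) i j" using A B ij by (intro bl_mult MM) (auto simp: carrier_GL)
 finally show "ent (val (rho n (A * B))) i j = ent (val (rho n A * rho n B)) i j"
  using ij AB by (simp add: ent_rho)
qed (rule rho_in)

text \<open>The first column of each block holds the coordinates of the entry itself.\<close>

lemma rho_inj: "inj_on (rho n) (carrier (GL n (rat_adjoin \<alpha>)))"
proof (rule inj_onI)
 fix A B assume A: "A \<in> carrier (GL n (rat_adjoin \<alpha>))" and B: "B \<in> carrier (GL n (rat_adjoin \<alpha>))"
  and eq: "rho n A = rho n B"
 have "A \<in> MM n" "B \<in> MM n" using A B by (auto simp: carrier_GL)
 hence c: "A \<in> carrier_mat n n" "B \<in> carrier_mat n n" "elements_mat A \<subseteq> K" "elements_mat B \<subseteq> K"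
  using MM by blast+
 have "A $$ (i, j) = B $$ (i, j)" if ij: "i < n" "j < n" for i j
 proof -
  have "cd (A $$ (i, j)) a = cd (B $$ (i, j)) a" if a: "a < d" for a
  proof -
   have lt: "i * d + a < n * d" "j * d < n * d"
    using ij a d_pos by (auto simp: nat_mult_less_cancel_disj)
     (metis add.commute add_less_cancel_left less_le_trans mult_Suc mult_le_mono1 Suc_leI)
   have "bl A (i * d + a) (j * d) = bl B (i * d + a) (j * d)"
    using ent_rho[OF A lt] ent_rho[OF B lt] eq by simp
   thus ?thesis using a d_pos by (simp add: bl_def)
  qed
  hence "S (cd (A $$ (i, j))) = S (cd (B $$ (i, j)))" by (simp add: S_def)
  moreover have "A $$ (i, j) \<in> K" "B $$ (i, j) \<in> K" using c ij by blast+
  ultimately show ?thesis by (simp add: S_cd)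
 qed
 thus "A = B" using c by (intro eq_matI) auto
qed

lemma group_GL: "group (GL n (rat_adjoin \<alpha>))"
proof -
 have one: "1\<^sub>m n \<in> MM n"
  using rat_adjoin_one rat_adjoin_zero by (auto simp: MM_def)
 have "monoid \<lparr>carrier = MM n, monoid.mult = (*), monoid.one = 1\<^sub>m n\<rparr>"
 proof (rule monoidI)
  fix x y z
  assume "x \<in> carrier \<lparr>carrier = MM n, monoid.mult = (*), monoid.one = 1\<^sub>m n\<rparr>"
   "y \<in> carrier \<lparr>carrier = MM n, monoid.mult = (*), monoid.one = 1\<^sub>m n\<rparr>"
   "z \<in> carrier \<lparr>carrier = MM n, monoid.mult = (*), monoid.one = 1\<^sub>m n\<rparr>"
  thus "x \<otimes>\<^bsub>\<lparr>carrier = MM n, monoid.mult = (*), monoid.one = 1\<^sub>m n\<rparr>\<^esub> y \<otimes>\<^bsub>\<lparr>carrier = MM n, monoid.mult = (*), monoid.one = 1\<^sub>m n\<rparr>\<^esub> z =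
   x \<otimes>\<^bsub>\<lparr>carrier = MM n, monoid.mult = (*), monoid.one = 1\<^sub>m n\<rparr>\<^esub> (y \<otimes>\<^bsub>\<lparr>carrier = MM n, monoid.mult = (*), monoid.one = 1\<^sub>m n\<rparr>\<^esub> z)"
   using assoc_mult_mat[OF MM(1) MM(1) MM(1)] by simp
 qed (use one MM_mult left_mult_one_mat[OF MM(1)] right_mult_one_mat[OF MM(1)] in auto)
 thus ?thesis unfolding GL_def MM_def by (rule monoid.units_group)
qed

lemma mult_GL: "x \<otimes>\<^bsub>GL n (rat_adjoin \<alpha>)\<^esub> y = x * y"
 by (simp add: GL_def units_of_def)

text \<open>Multiplication by \<alpha> shifts the coordinates, and f(\<alpha>) = 0 with f monic
  reduces the overflow \<alpha>^d.\<close>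

lemma S_shift: "S v * \<alpha> = S (%a. (if a = 0 then 0 else v (a - 1)) - v (d - 1) * poly.coeff f a)"
proof -
 have top: "\<alpha> ^ d = - (\<Sum>a<d. of_rat (poly.coeff f a) * \<alpha> ^ a)"
 proof -
  have "f = (\<Sum>a\<le>d. monom (poly.coeff f a) a)" by (rule poly_as_sum_of_monoms[symmetric])
  hence "eval_at \<alpha> f = (\<Sum>a\<le>d. of_rat (poly.coeff f a) * \<alpha> ^ a)" by (metis (no_types, lifting) eval_at_sum eval_at_monom sum.cong)
  hence "0 = (\<Sum>a<d. of_rat (poly.coeff f a) * \<alpha> ^ a) + \<alpha> ^ d"
   using f_root f_lead by (simp add: lessThan_Suc_atMost[symmetric])
  thus ?thesis by (simp add: eq_neg_iff_add_eq_0 add.commute)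
 qed
 obtain e where e: "d = Suc e" using d_pos by (cases d) auto
 have "S v * \<alpha> = (\<Sum>a<Suc e. of_rat (v a) * \<alpha> ^ Suc a)"
  by (simp only: S_def e sum_distrib_right) (simp add: mult_ac)
 also have "\<dots> = (\<Sum>a<e. of_rat (v a) * \<alpha> ^ Suc a) + of_rat (v (d - 1)) * \<alpha> ^ d" by (simp add: e)
 also have "(\<Sum>a<e. of_rat (v a) * \<alpha> ^ Suc a) = (\<Sum>a<d. of_rat (if a = 0 then 0 else v (a - 1)) * \<alpha> ^ a)"
  unfolding e sum.lessThan_Suc_shift by simp
 finally show ?thesis
  unfolding top S_def of_rat_diff left_diff_distrib sum_subtractf
  by (simp add: of_rat_mult sum_distrib_left mult_ac)
qed

end

section \<open>Computing the embedding from coefficient lists\<close>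

lemma cmp_ok: assumes "cmp n" "cmp p" shows "cmp (%x. ok (n x) (p x))"
 unfolding ok_def by (intro cmp_mat assms[THEN cmp_comp])

text \<open>Coordinates of \<alpha>^m by repeated application of \<open>S_shift\<close>. The
  coefficient list \<open>fl\<close> of f has length d + 1, so \<open>length fl - 1\<close> is d and
  \<open>length fl - 2\<close> is the top index.\<close>

definition copow :: "rat list => nat => rat list" where
 "copow fl m = rec_nat (map (%a. if a = 0 then 1 else 0) [0..<length fl - 1])
  (%_ v. map (%a. (if a = 0 then 0 else ix 0 v (a - 1)) - ix 0 v (length fl - 2) * ix 0 fl a) [0..<length fl - 1]) m"

lemma ix_map_upt: "a < n ==> ix x (map g [0..<n]) a = g a"
 by (simp add: ix_def)

lemma copow_Suc: "a < length fl - 1 ==> ix 0 (copow fl (Suc m)) a =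
 (if a = 0 then 0 else ix 0 (copow fl m) (a - 1)) - ix 0 (copow fl m) (length fl - 2) * ix 0 fl a"
proof -
 have "copow fl (Suc m) = map (%a. (if a = 0 then 0 else ix 0 (copow fl m) (a - 1)) -
  ix 0 (copow fl m) (length fl - 2) * ix 0 fl a) [0..<length fl - 1]" by (simp add: copow_def)
 thus "a < length fl - 1 ==> ?thesis" by (simp add: ix_map_upt)
qed

text \<open>The matrix \<open>bl\<close> in terms of the input data; see
  \<open>ef_matL\<close>.\<close>

definition matL :: "rat list => nat => rat list list list => rmat" where
 "matL fl n M = mk (n * (length fl - 1)) (%i j.
  \<Sum>k<length (ix [] (ix [] M (i div (length fl - 1))) (j div (length fl - 1))).
   ix 0 (ix [] (ix [] M (i div (length fl - 1))) (j div (length fl - 1))) k *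
   ix 0 (copow fl (k + j mod (length fl - 1))) (i mod (length fl - 1)))"

lemma cmp_div: assumes "cmp f" "cmp g" shows "cmp (%x. f x div (g x :: nat))"
proof -
 have ex: "\<exists>q. g x = 0 | f x < Suc q * g x" for x
  by (rule exI[of _ "f x"], cases "g x") auto
 have "cmp (%x. LEAST q. g x = 0 | f x < Suc q * g x)"
  by (intro cmp_Least ex cmp_num assms[THEN cmp_comp])
 moreover have "(LEAST q. b = 0 | a < Suc q * b) = a div b" for a b :: nat
 proof (rule Least_equality)
  show "b = 0 | a < Suc (a div b) * b" using dividend_less_div_times[of b a] by (cases "b = 0") auto
  show "a div b <= q" if "b = 0 | a < Suc q * b" for q
   using that less_mult_imp_div_less[of a "Suc q" b] by (cases "b = 0") auto
 qed
 ultimately show ?thesis by simp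
qed

lemma cmp_mod: assumes "cmp f" "cmp g" shows "cmp (%x. f x mod (g x :: nat))"
proof -
 have "cmp (%x. f x - f x div g x * g x)" by (intro cmp_num cmp_div assms)
 thus ?thesis by (simp add: minus_div_mult_eq_mod)
qed

lemma cmp_copow: assumes "cmp fl" "cmp m" shows "cmp (%x. copow (fl x) (m x))"
 unfolding copow_def by (intro cmp_num assms[THEN cmp_comp])

lemma cmp_matL: assumes "cmp fl" "cmp n" "cmp M" shows "cmp (%x. matL (fl x) (n x) (M x))"
 unfolding matL_def by (intro cmp_mat cmp_copow cmp_div cmp_mod assms[THEN cmp_comp])

context numfield
begin

lemma length_coeffs_f: "length (coeffs f) = Suc d"
 using f_nz by (simp add: length_coeffs_degree)

lemma S_copow: "S (%a. ix 0 (copow (coeffs f) m) a) = \<alpha> ^ m"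
proof (induction m)
 case 0
 have "S (%a. ix 0 (copow (coeffs f) 0) a) = (\<Sum>a<d. if a = 0 then \<alpha> ^ a else 0)"
  unfolding S_def by (intro sum.cong refl) (auto simp: copow_def ix_def length_coeffs_f)
 also have "\<dots> = 1" using d_pos by simp
 finally show ?case by simp
next
 case (Suc m)
 let ?v = "%a. ix 0 (copow (coeffs f) m) a"
 have l2: "length (coeffs f) - 2 = d - 1" using length_coeffs_f by simp
 have "S (%a. ix 0 (copow (coeffs f) (Suc m)) a) =
  S (%a. (if a = 0 then 0 else ?v (a - 1)) - ?v (d - 1) * poly.coeff f a)"
  unfolding S_def
 proof (intro sum.cong refl)
  fix a assume a: "a \<in> {..<d}"
  hence "ix 0 (coeffs f) a = poly.coeff f a"
   using length_coeffs_f by (simp add: ix_def coeffs_nth f_nz)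
  thus "of_rat (ix 0 (copow (coeffs f) (Suc m)) a) * \<alpha> ^ a =
   of_rat ((if a = 0 then 0 else ?v (a - 1)) - ?v (d - 1) * poly.coeff f a) * \<alpha> ^ a"
   using a by (simp add: copow_Suc l2 length_coeffs_f)
 qed
 also have "\<dots> = \<alpha> ^ Suc m" using S_shift[of ?v] Suc by (simp add: mult.commute)
 finally show ?case .
qed

lemma cd_list:
 assumes "a < d"
 shows "cd (eval_at \<alpha> g * \<alpha> ^ b) a = (\<Sum>k<length (coeffs g). ix 0 (coeffs g) k * ix 0 (copow (coeffs f) (k + b)) a)"
proof (rule cd_eqI[OF _ assms])
 have "S (%a. \<Sum>k<length (coeffs g). ix 0 (coeffs g) k * ix 0 (copow (coeffs f) (k + b)) a) =
  (\<Sum>k<length (coeffs g). of_rat (ix 0 (coeffs g) k) * S (%a. ix 0 (copow (coeffs f) (k + b)) a))"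
  unfolding S_def of_rat_sum sum_distrib_right sum_distrib_left of_rat_mult
  by (subst sum.swap) (simp add: mult_ac)
 also have "\<dots> = eval_at \<alpha> g * \<alpha> ^ b"
  unfolding S_copow eval_at_coeffs sum_distrib_right
  by (intro sum.cong refl) (simp add: ix_def power_add mult_ac)
 finally show "S (%a. \<Sum>k<length (coeffs g). ix 0 (coeffs g) k * ix 0 (copow (coeffs f) (k + b)) a) =
  eval_at \<alpha> g * \<alpha> ^ b" .
qed

definition ml :: "rat poly mat => rat list list list" where
 "ml M = map (map coeffs) (mat_to_list M)"

lemma enc_coeffs: "enc (coeffs g) = poly_code g"
proof -
 have "(enc :: rat => nat) = rat_code" by (rule ext) (simp add: enc_rat_def)
 thus ?thesis by (simp add: enc_list_def poly_code_def)
qed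

lemma enc_ml: "enc (map ml L) = mats_code L"
proof -
 show ?thesis
  by (simp add: enc_list_def[of "map ml L"] enc_list_def[of "map (map coeffs) _"] enc_list_def[of "map coeffs _"]
    mats_code_def mat_code_def[abs_def] ml_def o_def enc_coeffs)
qed

lemma ef_matL:
 assumes M: "M \<in> carrier_mat n n" and ij: "i < n * d" "j < n * d"
 shows "ef (matL (coeffs f) n (ml M)) i j = bl (map_mat (eval_at \<alpha>) M) i j"
proof -
 have lt: "i div d < n" "j div d < n" "i mod d < d" using ij div_less d_pos by auto
 have "ix [] (ix [] (ml M) (i div d)) (j div d) = coeffs (M $$ (i div d, j div d))"
  using M lt by (simp add: ml_def mat_to_list_def ix_def)
 thus ?thesis
  using ij M lt by (simp add: matL_def length_coeffs_f ef_mk bl_def cd_list)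
qed

text \<open>The input supplies matrices without their inverses. Completions to valid pairs exist,
  and every valid completion decodes to the same units, because inverses are unique.\<close>

lemma presented:
 assumes S1: "S1 \<subseteq> carrier (GL n (rat_adjoin \<alpha>))" "presents \<alpha> f L S1"
 shows "\<exists>as. map fst as = map (matL (coeffs f) n) (map ml L) & (\<forall>p\<in>set as. ok (n * d) p)"
  and "map fst as = map (matL (coeffs f) n) (map ml L) ==> \<forall>p\<in>set as. ok (n * d) p ==>
   un (n * d) ` set as = rho n ` S1"
proof -
 have S1': "S1 = map_mat (eval_at \<alpha>) ` set L" using S1(2) by (simp add: presents_def)
 have c: "M \<in> carrier_mat n n" "map_mat (eval_at \<alpha>) M \<in> carrier (GL n (rat_adjoin \<alpha>))" if "M \<in> set L" for M
 proof -
  show g: "map_mat (eval_at \<alpha>) M \<in> carrier (GL n (rat_adjoin \<alpha>))"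
   using S1(1) imageI[OF that, of "map_mat (eval_at \<alpha>)"] unfolding S1' by (rule subsetD)
  hence "map_mat (eval_at \<alpha>) M \<in> MM n" by (simp add: carrier_GL)
  hence "map_mat (eval_at \<alpha>) M \<in> carrier_mat n n" by (rule MM(1))
  thus "M \<in> carrier_mat n n" by simp
 qed
 have un_rho: "un (n * d) p = rho n (map_mat (eval_at \<alpha>) M)"
  if M: "M \<in> set L" and p: "fst p = matL (coeffs f) n (ml M)" "ok (n * d) p" for M p
  by (rule GLN_eqI[OF un_in rho_in])
   (use c[OF M] p in \<open>simp add: ent_un E_def ent_rho ef_matL\<close>)
 have ex: "\<exists>p. fst p = matL (coeffs f) n (ml M) & ok (n * d) p" if M: "M \<in> set L" for M
 proof -
  let ?x = "rho n (map_mat (eval_at \<alpha>) M)"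
  have "rep (n * d) (matL (coeffs f) n (ml M), mk (n * d) (ent (val (iv ?x)))) ?x"
   using c[OF M] by (simp add: rep_def rho_in ef_mk ef_matL ent_rho)
  hence "ok (n * d) (matL (coeffs f) n (ml M), mk (n * d) (ent (val (iv ?x))))" using ok_iff by blast
  thus ?thesis by fastforce
 qed
 then obtain h where h: "!!M. M \<in> set L ==> fst (h M) = matL (coeffs f) n (ml M) & ok (n * d) (h M)" by metis
 thus "\<exists>as. map fst as = map (matL (coeffs f) n) (map ml L) & (\<forall>p\<in>set as. ok (n * d) p)"
  by (intro exI[of _ "map h L"]) auto
 assume as: "map fst as = map (matL (coeffs f) n) (map ml L)" "\<forall>p\<in>set as. ok (n * d) p"
 have len: "length as = length L" using arg_cong[OF as(1), of length] by simp
 have nth: "un (n * d) (as ! i) = rho n (map_mat (eval_at \<alpha>) (L ! i))" if i: "i < length L" for i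
 proof (rule un_rho)
  have "map fst as ! i = map (matL (coeffs f) n) (map ml L) ! i" by (simp only: as(1))
  thus "fst (as ! i) = matL (coeffs f) n (ml (L ! i))" using i len by simp
  show "ok (n * d) (as ! i)" using as(2) i len by simp
 qed (use i in simp)
 have "map (un (n * d)) as = map (%M. rho n (map_mat (eval_at \<alpha>) M)) L"
  by (rule nth_equalityI) (use nth len in auto)
 hence "set (map (un (n * d)) as) = set (map (%M. rho n (map_mat (eval_at \<alpha>) M)) L)" by (rule arg_cong)
 thus "un (n * d) ` set as = rho n ` S1" by (simp add: S1' image_image)
qed

end

section \<open>Transfer of group properties\<close>

text \<open>An injective homomorphism from a group with explicit carrier into a type of class
  \<open>grp\<close>; it carries generation, index and solvability from one setting to the
  other.\<close>

locale transfer = group \<Gamma> for \<Gamma> (structure) +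
 fixes r :: "'a => 'c::grp"
 assumes r_mult: "x \<in> carrier \<Gamma> ==> y \<in> carrier \<Gamma> ==> r (x \<otimes> y) = r x * r y"
  and r_inj: "inj_on r (carrier \<Gamma>)"
begin

lemma r_one: "r \<one> = 1"
proof -
 have "r (\<one> \<otimes> \<one>) = r \<one> * r \<one>" by (rule r_mult) auto
 hence "iv (r \<one>) * r \<one> = iv (r \<one>) * (r \<one> * r \<one>)" by simp
 thus ?thesis by simp
qed

lemma r_inv: "x \<in> carrier \<Gamma> ==> r (inv x) = iv (r x)"
proof -
 assume x: "x \<in> carrier \<Gamma>"
 have "r x * r (inv x) = 1" using r_mult[of x "inv x"] x by (simp add: r_one)
 thus ?thesis by (metis iv_unique)
qed

lemma r_generate: "X \<subseteq> carrier \<Gamma> ==> r ` generate \<Gamma> X = gen (r ` X)"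
proof (intro equalityI subsetI)
 assume X: "X \<subseteq> carrier \<Gamma>"
 fix y assume "y \<in> r ` generate \<Gamma> X"
 then obtain x where x: "x \<in> generate \<Gamma> X" "y = r x" by auto
 from x(1) have "r x \<in> gen (r ` X)"
 proof induction
  case one
  thus ?case by (simp add: r_one gen.one)
 next
  case (incl h)
  thus ?case by (auto intro: gen_incl)
 next
  case (inv h)
  hence "h \<in> carrier \<Gamma>" using X by blast
  thus ?case using inv by (simp add: r_inv gen_incl_iv)
 next
  case (eng h1 h2)
  hence "h1 \<in> carrier \<Gamma>" "h2 \<in> carrier \<Gamma>" using generate_in_carrier[OF X] by auto
  thus ?case using eng by (simp add: r_mult sg_mult[OF sg_gen])
 qed
 thus "y \<in> gen (r ` X)" using x by simp
next
 assume X: "X \<subseteq> carrier \<Gamma>"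
 fix y assume "y \<in> gen (r ` X)"
 thus "y \<in> r ` generate \<Gamma> X"
 proof induction
  case one
  show ?case using generate.one[of \<Gamma> X] r_one by (metis imageI)
 next
  case (mult y s)
  then obtain x z where xz: "x \<in> generate \<Gamma> X" "y = r x" "z \<in> X" "s = r z" by auto
  have "x \<otimes> z \<in> generate \<Gamma> X" by (rule generate.eng[OF xz(1) generate.incl[OF xz(3)]])
  moreover have "r (x \<otimes> z) = y * s" using xz X generate_in_carrier[OF X] by (auto simp: r_mult)
  ultimately show ?case by (metis imageI)
 next
  case (mult_iv y s)
  then obtain x z where xz: "x \<in> generate \<Gamma> X" "y = r x" "z \<in> X" "s = r z" by auto
  have "x \<otimes> inv z \<in> generate \<Gamma> X" by (rule generate.eng[OF xz(1) generate.inv[OF xz(3)]])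
  moreover have "r (x \<otimes> inv z) = y * iv s" using xz X generate_in_carrier[OF X] by (auto simp: r_mult r_inv)
  ultimately show ?case by (metis imageI)
 qed
qed

lemma sg_image: "subgroup H \<Gamma> ==> sg (r ` H)"
proof -
 assume H: "subgroup H \<Gamma>"
 have "generate \<Gamma> H = H" using generateI[OF H subset_refl] H by (metis generate.incl subgroup.subset generate_subgroup_incl[OF subset_refl H] subsetI subset_antisym)
 hence "r ` H = gen (r ` H)" using r_generate[OF subgroup.subset[OF H]] by simp
 thus ?thesis using sg_gen by metis
qed

lemma r_in_iff: "subgroup H \<Gamma> ==> x \<in> carrier \<Gamma> ==> r x \<in> r ` H \<longleftrightarrow> x \<in> H"
 using r_inj by (auto simp: inj_on_def dest: subgroup.mem_carrier)

lemma finite_index_iff: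
 assumes H: "subgroup H \<Gamma>"
 shows "finite_index \<Gamma> H \<longleftrightarrow> fidx (r ` carrier \<Gamma>) (r ` H)"
proof
 assume "finite_index \<Gamma> H"
 hence fin: "finite (rcosets H)" by (simp add: finite_index_def)
 define c where "c C = (SOME a. a \<in> carrier \<Gamma> & H #> a = C)" for C
 have c: "c C \<in> carrier \<Gamma> & H #> c C = C" if "C \<in> rcosets H" for C
  unfolding c_def by (rule someI_ex) (use that in \<open>auto simp: RCOSETS_def\<close>)
 show "fidx (r ` carrier \<Gamma>) (r ` H)"
 proof (rule fidxI[of "(%C. r (c C)) ` (rcosets H)"])
  fix y assume "y \<in> r ` carrier \<Gamma>"
  then obtain g where g: "g \<in> carrier \<Gamma>" "y = r g" by auto
  let ?C = "H #> g"
  have C: "?C \<in> rcosets H" using g by (auto simp: RCOSETS_def)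
  have "g \<in> H #> c ?C" using c[OF C] rcos_self[OF g(1) H] by simp
  then obtain h where h: "h \<in> H" "g = h \<otimes> c ?C" by (auto simp: r_coset_def)
  have "r (h \<otimes> c ?C) = r h * r (c ?C)" using c[OF C] subgroup.mem_carrier[OF H h(1)] by (intro r_mult) auto
  hence "y = r h * r (c ?C)" using g(2) h(2) by argo
  hence "y * iv (r (c ?C)) = r h" by (simp add: mult.assoc)
  thus "\<exists>z\<in>(%C. r (c C)) ` (rcosets H). y * iv z \<in> r ` H" using C h(1) by (intro bexI[of _ "r (c ?C)"]) auto
 qed (use fin in simp)
next
 assume "fidx (r ` carrier \<Gamma>) (r ` H)"
 from fidx_Int[OF sg_image[OF subgroup_self] sg_image[OF H] this subset_refl]
 obtain R where R: "finite R" "R \<subseteq> r ` carrier \<Gamma>" "\<forall>g\<in>r ` carrier \<Gamma>. \<exists>y\<in>R. g * iv y \<in> r ` carrier \<Gamma> \<inter> r ` H" by blast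
 obtain R' where R': "finite R'" "R' \<subseteq> carrier \<Gamma>" "R = r ` R'" using finite_subset_image[OF R(1,2)] by auto
 have "rcosets H \<subseteq> (%a. H #> a) ` R'"
 proof
  fix C assume "C \<in> rcosets H"
  then obtain g where g: "g \<in> carrier \<Gamma>" "C = H #> g" by (auto simp: RCOSETS_def)
  then obtain a where a: "a \<in> R'" "r g * iv (r a) \<in> r ` H" using R(3) R'(3) by blast
  have ac: "a \<in> carrier \<Gamma>" using a R' by auto
  hence "r (g \<otimes> inv a) \<in> r ` H" using a g by (simp add: r_mult r_inv)
  hence "g \<otimes> inv a \<in> H" using r_in_iff[OF H] g ac by simp
  hence "H #> g = H #> a"
   using coset_join2[of "g \<otimes> inv a" H] coset_mult_assoc[of H "g \<otimes> inv a" a] g ac H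
   by (simp add: m_assoc subgroup.subset)
  thus "C \<in> (%a. H #> a) ` R'" using a g by auto
 qed
 thus "finite_index \<Gamma> H" unfolding finite_index_def using R'(1) by (rule finite_subset[OF _ finite_imageI])
qed

lemma transfer_subgroup: "subgroup H \<Gamma> ==> transfer (\<Gamma>\<lparr>carrier := H\<rparr>) r"
 using r_inj subgroup.mem_carrier[of H \<Gamma>]
 by (intro transfer.intro subgroup_imp_group) (auto simp: transfer_axioms_def r_mult intro: inj_on_subset[OF r_inj subgroup.subset])

lemma r_derived: "X \<subseteq> carrier \<Gamma> ==> r ` derived \<Gamma> X = der (r ` X)"
proof -
 assume X: "X \<subseteq> carrier \<Gamma>"
 have "r (h1 \<otimes> h2 \<otimes> inv h1 \<otimes> inv h2) = cm (r h1) (r h2)" if h: "h1 \<in> X" "h2 \<in> X" for h1 h2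
 proof -
  have "h1 \<in> carrier \<Gamma>" "h2 \<in> carrier \<Gamma>" using h X by blast+
  thus ?thesis by (simp add: cm_def r_mult r_inv)
 qed
 hence "r ` derived_set \<Gamma> X = {cm a b |a b. a \<in> r ` X & b \<in> r ` X}" by (auto simp: image_iff) metis+
 thus ?thesis unfolding derived_def der_def using r_generate[OF derived_set_in_carrier[OF X]] by simp
qed

lemma r_derived_funpow: "r ` (derived \<Gamma> ^^ k) (carrier \<Gamma>) = (der ^^ k) (r ` carrier \<Gamma>)"
proof (induction k)
 case (Suc k)
 have "(derived \<Gamma> ^^ k) (carrier \<Gamma>) \<subseteq> carrier \<Gamma>" by (rule exp_of_derived_in_carrier) simp
 thus ?case using r_derived Suc by simp
qed simp

lemma solvable_by_finiteD:
 assumes "solvable_by_finite \<Gamma>"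
 shows "\<exists>M k. sg M & M \<subseteq> r ` carrier \<Gamma> & nrm (r ` carrier \<Gamma>) M & fidx (r ` carrier \<Gamma>) M & (der ^^ k) M = {1}"
proof -
 obtain N where N: "N \<lhd> \<Gamma>" "solvable (\<Gamma>\<lparr>carrier := N\<rparr>)" "finite_index \<Gamma> N"
  using assms by (auto simp: solvable_by_finite_def)
 have sN: "subgroup N \<Gamma>" using N(1) by (simp add: normal_imp_subgroup)
 interpret N: transfer "\<Gamma>\<lparr>carrier := N\<rparr>" r by (rule transfer_subgroup[OF sN])
 obtain k where "(derived (\<Gamma>\<lparr>carrier := N\<rparr>) ^^ k) N = {\<one>}"
  using N(2) N.solvable_iff_trivial_derived_seq by auto
 hence "(der ^^ k) (r ` N) = {1}" using N.r_derived_funpow[of k] r_one by simp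
 moreover have "nrm (r ` carrier \<Gamma>) (r ` N)"
  unfolding nrm_def
 proof (intro ballI)
  fix g n assume "g \<in> r ` carrier \<Gamma>" "n \<in> r ` N"
  then obtain x y where xy: "x \<in> carrier \<Gamma>" "g = r x" "y \<in> N" "n = r y" by auto
  have "x \<otimes> y \<otimes> inv x \<in> N" using normal.inv_op_closed2[OF N(1)] xy by blast
  moreover have "r (x \<otimes> y \<otimes> inv x) = g * n * iv g" using xy subgroup.mem_carrier[OF sN] by (simp add: r_mult r_inv)
  ultimately show "g * n * iv g \<in> r ` N" by (metis imageI)
 qed
 ultimately show ?thesis
  using sg_image[OF sN] finite_index_iff[OF sN] N(3) subgroup.subset[OF sN] by blast
qed

end

theorem mainTheorem7:
  shows "\<exists>IsOfFiniteIndex :: prog.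
    \<forall>(\<alpha> :: complex) (f :: rat poly) (n :: nat) (S1 :: complex mat set) (S2 :: complex mat set)
      (L1 :: rat poly mat list) (L2 :: rat poly mat list).
      let \<Gamma> = GL n (rat_adjoin \<alpha>);
          G = generate \<Gamma> S1;
          H = generate \<Gamma> S2
      in minimal_polynomial f \<alpha> \<and> n \<ge> 1 \<and>
         finite S1 \<and> S1 \<subseteq> carrier \<Gamma> \<and> presents \<alpha> f L1 S1 \<and>
         finite S2 \<and> S2 \<subseteq> carrier \<Gamma> \<and> presents \<alpha> f L2 S2 \<and>
         solvable_by_finite (\<Gamma>\<lparr>carrier := G\<rparr>) \<and> H \<subseteq> G \<longrightarrow>
         computes IsOfFiniteIndex [poly_code f, n, mats_code L1, mats_code L2]
           (if finite_index (\<Gamma>\<lparr>carrier := G\<rparr>) H then 1 else 0)"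
proof -
 \<comment> \<open>The inverses of the input matrices are left to the search over \<open>as\<close>,
   and \<open>ok\<close> verifies them.\<close>
 define good where "good fl n L as \<longleftrightarrow> map fst as = map (%M. matL fl n M) L & (\<forall>p\<in>set as. ok (n * (length fl - 1)) p)"
  for fl n L as
 define P1 where "P1 x \<longleftrightarrow> (\<exists>as bs. good (fst x) (fst (snd x)) (fst (snd (snd x))) as &
  good (fst x) (fst (snd x)) (snd (snd (snd x))) bs & cosets (fst (snd x) * (length (fst x) - 1)) as bs)"
  for x :: "rat list \<times> nat \<times> rat list list list list \<times> rat list list list list"
 define P0 where "P0 x \<longleftrightarrow> (\<exists>as bs. good (fst x) (fst (snd x)) (fst (snd (snd x))) as &
  good (fst x) (fst (snd x)) (snd (snd (snd x))) bs &
  (cert_torus' (fst (snd x) * (length (fst x) - 1)) as bs | cert_unip' (fst (snd x) * (length (fst x) - 1)) as bs))"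
  for x :: "rat list \<times> nat \<times> rat list list list list \<times> rat list list list list"
 have "re P1" unfolding P1_def good_def
  by (intro re_all re_cosets; intro re_cmp cmp_mat cmp_matL cmp_ok)
 moreover have "re P0" unfolding P0_def good_def
  by (intro re_all re_cert_torus re_cert_unip; intro re_cmp cmp_mat cmp_matL cmp_ok)
 ultimately obtain p where p: "!!x. P1 x & ~ P0 x ==> computes p [enc x] 1" "!!x. P0 x & ~ P1 x ==> computes p [enc x] 0"
  using re_decide by metis
 \<comment> \<open>Packs the four arguments into the single code expected by
   \<open>p\<close>.\<close>
 define q where "q = Comp p [Comp pairP [Proj 0, Comp pairP [Proj 1, Comp pairP [Proj 2, Proj 3]]]]"
 have q: "computes q [enc a, enc b, enc c, enc e] y" if "computes p [enc (a, b, c, e)] y"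
  for a :: "rat list" and b :: nat and c e :: "rat list list list list" and y
  unfolding q_def using that
  by (auto intro!: computes_comp1 computes_comp2 computes_pairP computes_proj simp: enc_prod_def)
 show ?thesis
  unfolding Let_def
 proof (rule exI[of _ q], intro allI impI)
  fix \<alpha> f n S1 S2 L1 L2
  let ?\<Gamma> = "GL n (rat_adjoin \<alpha>)"
  let ?G = "generate ?\<Gamma> S1" and ?H = "generate ?\<Gamma> S2"
  assume A: "minimal_polynomial f \<alpha> & n >= 1 & finite S1 & S1 \<subseteq> carrier ?\<Gamma> & presents \<alpha> f L1 S1 &
   finite S2 & S2 \<subseteq> carrier ?\<Gamma> & presents \<alpha> f L2 S2 & solvable_by_finite (?\<Gamma>\<lparr>carrier := ?G\<rparr>) & ?H \<subseteq> ?G"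
  interpret numfield \<alpha> f by unfold_locales (use A in simp)
  have sub: "S1 \<subseteq> carrier ?\<Gamma>" "S2 \<subseteq> carrier ?\<Gamma>" using A by auto
  interpret group ?\<Gamma> by (rule group_GL)
  interpret T: transfer ?\<Gamma> "rho n"
  proof unfold_locales
   fix x y assume "x \<in> carrier ?\<Gamma>" "y \<in> carrier ?\<Gamma>"
   thus "rho n (x \<otimes>\<^bsub>?\<Gamma>\<^esub> y) = rho n x * rho n y" using m_closed[of x y] by (simp add: mult_GL rho_mult)
  qed (rule rho_inj)
  have sG: "subgroup ?G ?\<Gamma>" and sH: "subgroup ?H ?\<Gamma>" using generate_is_subgroup sub by auto
  interpret TG: transfer "?\<Gamma>\<lparr>carrier := ?G\<rparr>" "rho n" by (rule T.transfer_subgroup[OF sG])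
  have sHG: "subgroup ?H (?\<Gamma>\<lparr>carrier := ?G\<rparr>)" by (rule subgroup_incl[OF sH sG]) (use A in simp)
  let ?N = "n * d"
  have N: "?N >= 1" using A d_pos by simp
  define x where "x = (coeffs f, n, map ml L1, map ml L2)"
  have good: "\<exists>as. good (coeffs f) n (map ml L) as" "good (coeffs f) n (map ml L) as ==> un ?N ` set as = rho n ` X"
   if "X \<subseteq> carrier ?\<Gamma>" "presents \<alpha> f L X" for L X as
   using presented[OF that] by (auto simp: good_def length_coeffs_f)
  have P1: "P1 x \<longleftrightarrow> (\<exists>as bs. good (coeffs f) n (map ml L1) as & good (coeffs f) n (map ml L2) bs & cosets ?N as bs)"
   by (simp add: P1_def x_def length_coeffs_f)
  have P0: "P0 x \<longleftrightarrow> (\<exists>as bs. good (coeffs f) n (map ml L1) as & good (coeffs f) n (map ml L2) bs &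
   (cert_torus' ?N as bs | cert_unip' ?N as bs))"
   by (simp add: P0_def x_def length_coeffs_f)
  have key: "cosets ?N as bs \<longleftrightarrow> finite_index (?\<Gamma>\<lparr>carrier := ?G\<rparr>) ?H"
   "cert_torus' ?N as bs | cert_unip' ?N as bs \<longleftrightarrow> ~ finite_index (?\<Gamma>\<lparr>carrier := ?G\<rparr>) ?H"
   if as: "good (coeffs f) n (map ml L1) as" "good (coeffs f) n (map ml L2) bs" for as bs
  proof -
   have un: "un ?N ` set as = rho n ` S1" "un ?N ` set bs = rho n ` S2"
    using good(2)[of S1 L1 as] good(2)[of S2 L2 bs] as A by auto
   have G: "gen (un ?N ` set as) = rho n ` ?G" and H: "gen (un ?N ` set bs) = rho n ` ?H"
    using T.r_generate[OF sub(1)] T.r_generate[OF sub(2)] un by auto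
   have HG: "gen (un ?N ` set bs) \<subseteq> gen (un ?N ` set as)" using A unfolding G H by blast
   have fi: "finite_index (?\<Gamma>\<lparr>carrier := ?G\<rparr>) ?H \<longleftrightarrow> fidx (gen (un ?N ` set as)) (gen (un ?N ` set bs))"
    using TG.finite_index_iff[OF sHG] G H by simp
   show "cosets ?N as bs \<longleftrightarrow> finite_index (?\<Gamma>\<lparr>carrier := ?G\<rparr>) ?H" using cosets_iff[OF HG] fi by simp
   obtain M k where M: "sg M" "M \<subseteq> gen (un ?N ` set as)" "nrm (gen (un ?N ` set as)) M"
    "fidx (gen (un ?N ` set as)) M" "(der ^^ k) M = {1}"
    using TG.solvable_by_finiteD A G by auto
   have GL: "un ?N ` set as \<subseteq> GLN ?N" using un_in by auto
   show "cert_torus' ?N as bs | cert_unip' ?N as bs \<longleftrightarrow> ~ finite_index (?\<Gamma>\<lparr>carrier := ?G\<rparr>) ?H"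
    using infinite_index_iff[OF N _ GL _ HG M] fi cert_torus'_iff[OF N] cert_unip'_iff[OF N] by simp
  qed
  \<comment> \<open>Valid completions exist, and by \<open>key\<close> the answer is the same for
    all of them; so exactly one of \<open>P1 x\<close> and \<open>P0 x\<close> holds.\<close>
  obtain as bs where ab: "good (coeffs f) n (map ml L1) as" "good (coeffs f) n (map ml L2) bs"
   using good(1)[of S1 L1] good(1)[of S2 L2] A by blast
  have P: "P1 x \<longleftrightarrow> finite_index (?\<Gamma>\<lparr>carrier := ?G\<rparr>) ?H" "P0 x \<longleftrightarrow> ~ finite_index (?\<Gamma>\<lparr>carrier := ?G\<rparr>) ?H"
   unfolding P1 P0 using key ab by blast+
  have "computes p [enc x] (if finite_index (?\<Gamma>\<lparr>carrier := ?G\<rparr>) ?H then 1 else 0)"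
   using p[of x] P by auto
  hence "computes q [enc (coeffs f), enc n, enc (map ml L1), enc (map ml L2)]
   (if finite_index (?\<Gamma>\<lparr>carrier := ?G\<rparr>) ?H then 1 else 0)" unfolding x_def by (rule q)
  thus "computes q [poly_code f, n, mats_code L1, mats_code L2]
   (if finite_index (?\<Gamma>\<lparr>carrier := ?G\<rparr>) ?H then 1 else 0)"
   by (simp add: enc_nat_def enc_coeffs enc_ml)
 qed
qed

end
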